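(* Let $n\geq 6$ be an even integer and let $m$ be a positive integer such that $m\notin\{2,4,6,10\}$ if $m$ is even, and $m\notin\{1,3,5\}$ if $m$ is odd. Let $H\in\mathrm{Mod}(\Sigma_{0,n})$ be a half-twist. Then the quotient of $\mathrm{Mod}(\Sigma_{0,n})$ by the normal closure of $H^m$ contains a free nonabelian subgroup.
   Context: $\Sigma_{0,n}$ is the sphere with $n$ marked points. $\mathrm{Mod}(\Sigma_{0,n})$ is the group of isotopy classes of orientation-preserving homeomorphisms of the sphere that preserve the set of marked points (possibly permuting them), isotopies being relative to the marked points. A half-twist is a mapping class interchanging two marked points by a rotation of angle $\pi$ supported in a disc containing exactly these two marked points. $\mathrm{Mod}(\Sigma_{0,n})$ is generated by half-twists $H_1,\dots,H_{n-1}$, where $H_i$ interchanges the $i$-th and $(i+1)$-st marked points, with defining relations $H_iH_{i+1}H_i=H_{i+1}H_iH_{i+1}$ for $1\le i\le n-2$; $H_kH_j=H_jH_k$ for $|k-j|>1$; $(H_1H_2\cdots H_{n-1})^n=1$; and $H_1H_2\cdots H_{n-2}H_{n-1}^2H_{n-2}\cdots H_2H_1=1$. Each $H_i$ is a half-twist. *)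

theory Defs
  imports "HOL-Homology.Homology"
begin

section \<open>Groups\<close>

definition normal_closure :: "('a, 'b) monoid_scheme \<Rightarrow> 'a set \<Rightarrow> 'a set" where
  "normal_closure G S = \<Inter> {N. N \<lhd> G \<and> S \<subseteq> N}"

text \<open>A word is a list of letters; \<open>(x, True)\<close> stands for \<open>x\<close> and \<open>(x, False)\<close> for its inverse.\<close>

definition reduced_word :: "('a \<times> bool) list \<Rightarrow> bool" where
  "reduced_word w \<longleftrightarrow> successively (\<lambda>(x, b) (y, c). \<not> (x = y \<and> b \<noteq> c)) w"

definition word_value :: "('a, 'b) monoid_scheme \<Rightarrow> ('a \<times> bool) list \<Rightarrow> 'a" where
  "word_value G w =
     foldr (\<lambda>(x, b) y. (if b then x else inv\<^bsub>G\<^esub> x) \<otimes>\<^bsub>G\<^esub> y) w \<one>\<^bsub>G\<^esub>"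

definition freely_generates :: "('a, 'b) monoid_scheme \<Rightarrow> 'a set \<Rightarrow> bool" where
  "freely_generates G X \<longleftrightarrow>
     X \<subseteq> carrier G \<and> generate G X = carrier G \<and>
     (\<forall>w. set w \<subseteq> X \<times> UNIV \<and> reduced_word w \<and> w \<noteq> [] \<longrightarrow> word_value G w \<noteq> \<one>\<^bsub>G\<^esub>)"

definition free_group :: "('a, 'b) monoid_scheme \<Rightarrow> bool" where
  "free_group G \<longleftrightarrow> group G \<and> (\<exists>X. freely_generates G X)"

definition contains_free_nonabelian_subgroup :: "('a, 'b) monoid_scheme \<Rightarrow> bool" where
  "contains_free_nonabelian_subgroup G \<longleftrightarrow>
     (\<exists>K. subgroup K G \<and> free_group (G\<lparr>carrier := K\<rparr>) \<and> \<not> comm_group (G\<lparr>carrier := K\<rparr>))"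


section \<open>Mapping class groups of the sphere with marked points\<close>

text \<open>
  Maps of the sphere are total functions on \<open>nat \<Rightarrow> real\<close> whose values off \<open>nsphere 2\<close> are
  irrelevant: isotopy does not depend on them, so maps that agree on the sphere are always in the
  same class. For a homeomorphism of the sphere, preserving orientation means having degree 1.
\<close>

type_synonym point = "nat \<Rightarrow> real"

abbreviation S2 :: "point topology" where
  "S2 \<equiv> nsphere 2"

definition marked_homeos :: "point set \<Rightarrow> (point \<Rightarrow> point) set" where
  "marked_homeos P = {f. homeomorphic_map S2 S2 f \<and> Brouwer_degree2 2 f = 1 \<and> f ` P = P}"

definition isotopic_rel :: "point set \<Rightarrow> (point \<Rightarrow> point) \<Rightarrow> (point \<Rightarrow> point) \<Rightarrow> bool" where
  "isotopic_rel P f g \<longleftrightarrow>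
     homotopic_with (\<lambda>h. homeomorphic_map S2 S2 h \<and> (\<forall>x\<in>P. h x = f x)) S2 S2 f g"

definition mapping_class :: "point set \<Rightarrow> (point \<Rightarrow> point) \<Rightarrow> (point \<Rightarrow> point) set" where
  "mapping_class P f = {g \<in> marked_homeos P. isotopic_rel P f g}"

definition mapping_class_group :: "point set \<Rightarrow> (point \<Rightarrow> point) set monoid" where
  "mapping_class_group P =
     \<lparr>carrier = mapping_class P ` marked_homeos P,
      mult = \<lambda>A B. \<Union>f\<in>A. \<Union>g\<in>B. mapping_class P (f \<circ> g),
      one = mapping_class P id\<rparr>"

text \<open>
  The model half-twist of the closed unit disc: the rotation by \<open>\<pi>\<close> on the disc of radius
  \<open>1/2\<close>, interpolated to the identity on the boundary circle. It interchanges \<open>1/2\<close> and \<open>-1/2\<close>.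
\<close>

definition disc_half_twist :: "complex \<Rightarrow> complex" where
  "disc_half_twist z = z * cis (pi * min 1 (2 - 2 * cmod z))"

lemma disc_half_twist_boundary: "cmod z = 1 \<Longrightarrow> disc_half_twist z = z"
  by (simp add: disc_half_twist_def)

lemma disc_half_twist_inner: "cmod z \<le> 1/2 \<Longrightarrow> disc_half_twist z = - z"
  by (simp add: disc_half_twist_def min_def)

text \<open>
  The embedding \<open>\<phi>\<close> may preserve or reverse orientation, so half-twists of both handedness
  are included.
\<close>

definition half_twist :: "point set \<Rightarrow> (point \<Rightarrow> point) set \<Rightarrow> bool" where
  "half_twist P H \<longleftrightarrow>
     H \<in> carrier (mapping_class_group P) \<and>
     (\<exists>\<phi>. embedding_map (top_of_set (cball (0::complex) 1)) S2 \<phi> \<and>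
          \<phi> ` cball 0 1 \<inter> P = {\<phi> (1/2), \<phi> (-1/2)} \<and>
          (\<exists>f\<in>H. (\<forall>z\<in>cball 0 1. f (\<phi> z) = \<phi> (disc_half_twist z)) \<and>
                 (\<forall>x\<in>topspace S2 - \<phi> ` cball 0 1. f x = x)))"


section \<open>The mapping class group is a group\<close>

lemma normal_closure_normal:
  assumes "group G" "S \<subseteq> carrier G"
  shows "normal_closure G S \<lhd> G"
proof -
  interpret group G by fact
  let ?F = "{N. N \<lhd> G \<and> S \<subseteq> N}"
  have "carrier G \<lhd> G"
    by (auto simp: normal_inv_iff subgroup_self)
  then have ne: "?F \<noteq> {}"
    using assms by blast
  have "subgroup (\<Inter>?F) G"
    by (rule subgroups_Inter) (use ne normal_imp_subgroup in blast)+
  then show ?thesis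
    unfolding normal_closure_def by (auto simp: normal_inv_iff)
qed

lemma marked_homeosD:
  assumes "f \<in> marked_homeos P"
  shows "homeomorphic_map S2 S2 f" "continuous_map S2 S2 f" "Brouwer_degree2 2 f = 1" "f ` P = P"
  using assms by (auto simp: marked_homeos_def homeomorphic_imp_continuous_map)

lemma id_marked_homeos [simp]: "id \<in> marked_homeos P"
  by (simp add: marked_homeos_def)

lemma comp_marked_homeos:
  assumes "f \<in> marked_homeos P" "g \<in> marked_homeos P"
  shows "f \<circ> g \<in> marked_homeos P"
proof -
  have "(f \<circ> g) ` P = P"
    using marked_homeosD(4) [OF assms(1)] marked_homeosD(4) [OF assms(2)] by (metis image_comp)
  moreover have "homeomorphic_map S2 S2 (f \<circ> g)"
    using marked_homeosD(1) [OF assms(1)] marked_homeosD(1) [OF assms(2)]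
    by (blast intro: homeomorphic_map_compose)
  ultimately show ?thesis
    using marked_homeosD(2,3) [OF assms(1)] marked_homeosD(2,3) [OF assms(2)]
    by (simp add: marked_homeos_def Brouwer_degree2_compose)
qed

lemma inverse_marked_homeos:
  assumes P: "P \<subseteq> topspace S2" and f: "f \<in> marked_homeos P"
  obtains g where "g \<in> marked_homeos P" "\<And>x. x \<in> topspace S2 \<Longrightarrow> g (f x) = x"
proof -
  obtain g where g: "homeomorphic_maps S2 S2 f g"
    using marked_homeosD(1) [OF f] homeomorphic_map_maps by blast
  then have gf: "\<And>x. x \<in> topspace S2 \<Longrightarrow> g (f x) = x"
    by (simp add: homeomorphic_maps_def)
  have "g ` P = g ` (f ` P)"
    using marked_homeosD(4) [OF f] by simp
  also have "\<dots> = P"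
    using P gf by (force simp: image_iff)
  finally have "g ` P = P" .
  moreover have "Brouwer_degree2 2 g = 1"
    using g marked_homeosD(3) [OF f] Brouwer_degree2_homeomorphic_maps by metis
  moreover have "homeomorphic_map S2 S2 g"
    using g homeomorphic_maps_map by blast
  ultimately show ?thesis
    using that gf by (simp add: marked_homeos_def)
qed

lemma isotopic_rel_eq_on:
  assumes "isotopic_rel P f g" "x \<in> P"
  shows "g x = f x"
  using assms homotopic_with_imp_property unfolding isotopic_rel_def by blast

lemma isotopic_rel_refl:
  assumes "f \<in> marked_homeos P"
  shows "isotopic_rel P f f"
  using marked_homeosD [OF assms] by (simp add: isotopic_rel_def)

lemma isotopic_rel_sym:
  assumes "isotopic_rel P f g"
  shows "isotopic_rel P g f"
  using homotopic_with_symD [OF assms [unfolded isotopic_rel_def]] isotopic_rel_eq_on [OF assms]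
  unfolding isotopic_rel_def by (force elim: homotopic_with_mono)

lemma isotopic_rel_trans:
  assumes "isotopic_rel P f g" "isotopic_rel P g h"
  shows "isotopic_rel P f h"
proof -
  have "homotopic_with (\<lambda>h. homeomorphic_map S2 S2 h \<and> (\<forall>x\<in>P. h x = f x)) S2 S2 g h"
    using assms(2) isotopic_rel_eq_on [OF assms(1)]
    unfolding isotopic_rel_def by (force elim: homotopic_with_mono)
  then show ?thesis
    using assms(1) homotopic_with_trans unfolding isotopic_rel_def by blast
qed

lemma isotopic_rel_cong:
  assumes "P \<subseteq> topspace S2" "f \<in> marked_homeos P" "\<And>x. x \<in> topspace S2 \<Longrightarrow> f x = g x"
  shows "isotopic_rel P f g"
  unfolding isotopic_rel_def
proof (rule homotopic_with_equal)
  have "homeomorphic_map S2 S2 g"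
    using marked_homeosD(1) [OF assms(2)] assms(3) by (rule homeomorphic_map_eq)
  then show "homeomorphic_map S2 S2 g \<and> (\<forall>x\<in>P. g x = f x)"
    using assms by auto
qed (use marked_homeosD [OF assms(2)] assms(3) in simp_all)

lemma isotopic_rel_comp:
  assumes f: "f \<in> marked_homeos P" "f' \<in> marked_homeos P"
    and g: "g \<in> marked_homeos P" "g' \<in> marked_homeos P"
    and fg: "isotopic_rel P f f'" "isotopic_rel P g g'"
  shows "isotopic_rel P (f \<circ> g) (f' \<circ> g')"
proof (rule isotopic_rel_trans)
  show "isotopic_rel P (f \<circ> g) (f' \<circ> g)"
    unfolding isotopic_rel_def
    by (rule homotopic_with_compose_continuous_map_right [OF fg(1) [unfolded isotopic_rel_def]])
       (use marked_homeosD [OF g(1)] in \<open>auto intro: homeomorphic_map_compose\<close>)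
  show "isotopic_rel P (f' \<circ> g) (f' \<circ> g')"
    unfolding isotopic_rel_def
    by (rule homotopic_with_compose_continuous_map_left [OF fg(2) [unfolded isotopic_rel_def]])
       (use marked_homeosD [OF f(2)] in \<open>auto intro: homeomorphic_map_compose\<close>)
qed

lemma mapping_class_self: "f \<in> marked_homeos P \<Longrightarrow> f \<in> mapping_class P f"
  by (simp add: mapping_class_def isotopic_rel_refl)

lemma mapping_class_eqI:
  assumes "isotopic_rel P f g"
  shows "mapping_class P f = mapping_class P g"
  using assms isotopic_rel_trans isotopic_rel_sym unfolding mapping_class_def by blast

lemma mapping_class_mult:
  assumes "f \<in> marked_homeos P" "g \<in> marked_homeos P"
  shows "mapping_class P f \<otimes>\<^bsub>mapping_class_group P\<^esub> mapping_class P g = mapping_class P (f \<circ> g)"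
proof -
  have "mapping_class P (f' \<circ> g') = mapping_class P (f \<circ> g)"
    if "f' \<in> mapping_class P f" "g' \<in> mapping_class P g" for f' g'
    using that assms mapping_class_eqI isotopic_rel_comp isotopic_rel_sym
    unfolding mapping_class_def by blast
  moreover have "f \<in> mapping_class P f" "g \<in> mapping_class P g"
    using assms by (auto intro: mapping_class_self)
  ultimately have "(\<Union>f'\<in>mapping_class P f. \<Union>g'\<in>mapping_class P g. mapping_class P (f' \<circ> g'))
      = mapping_class P (f \<circ> g)"
    by blast
  then show ?thesis
    by (simp add: mapping_class_group_def)
qed

lemma group_mapping_class_group:
  assumes P: "P \<subseteq> topspace S2"
  shows "group (mapping_class_group P)"
proof -
  let ?M = "mapping_class_group P"
  have car: "carrier ?M = mapping_class P ` marked_homeos P" "\<one>\<^bsub>?M\<^esub> = mapping_class P id"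
    by (auto simp: mapping_class_group_def)
  show ?thesis
  proof (rule groupI)
    fix A assume "A \<in> carrier ?M"
    then obtain f where f: "f \<in> marked_homeos P" "A = mapping_class P f"
      using car by blast
    obtain g where g: "g \<in> marked_homeos P" "\<And>x. x \<in> topspace S2 \<Longrightarrow> g (f x) = x"
      using inverse_marked_homeos [OF P f(1)] by blast
    have "isotopic_rel P (g \<circ> f) id"
      using g comp_marked_homeos [OF g(1) f(1)] by (intro isotopic_rel_cong [OF P]) auto
    then show "\<exists>B\<in>carrier ?M. B \<otimes>\<^bsub>?M\<^esub> A = \<one>\<^bsub>?M\<^esub>"
      using f g car mapping_class_mult mapping_class_eqI by (metis imageI)
  qed (auto simp: car mapping_class_mult comp_marked_homeos comp_assoc)
qed

end

theory Submission
  imports Defs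
begin

text \<open>
  Let \<open>N = n - 1\<close>. In a chart that sends one marked point to infinity and the others to
  \<open>0, \<dots>, N - 1\<close>, a homeomorphism acts on the free fundamental group of the punctured plane up to
  inner automorphisms. By Artin's theorem the action is that of a word in the standard braid
  generators, followed by complex conjugation if the orientation is reversed. In a suitable chart a
  half-twist acts by a power of the first generator.

  On chains of \<open>n\<close> spins the braid generators act through the Hecke algebra with eigenvalues \<open>1\<close> and
  \<open>- Q\<close>. For \<open>- Q = cis (2 * pi / m)\<close> the \<open>m\<close>-th powers of the generators act trivially. Two words
  that represent the same mapping class differ by a word that acts by an inner automorphism, and a
  Schur-type argument shows that such a word acts on the singlets of the quantum group that arise
  from a fixed one by the first two generators \<open>s\<^sub>0, s\<^sub>1\<close> as a scalar. So the normal closure of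
  \<open>H\<^sup>m\<close> acts on them by scalars. For \<open>m \<ge> 7\<close> the elements \<open>s\<^sub>0 - s\<^sub>1\<close> and \<open>- s\<^sub>1 + s\<^sub>0\<close> (the group
  is written additively) are hyperbolic on the plane spanned by these singlets, and by ping-pong no
  nontrivial reduced word in high powers of them is a scalar.
\<close>

section \<open>Free groups\<close>

text \<open>Braid words that give the same mapping class have to be compared through isotopic
  homeomorphisms. These permute all punctures and fix no base point, so their action on the
  fundamental group is defined up to inner automorphisms only, and the difficulty is to see what
  inner automorphisms become on the spin chain. The bridge are the point-pushing braids
  \<open>pure_word\<close>: braids of the other strands conjugate them exactly as they act on the
  generators of the free group, and their product is the full turn, the braid that is trivial on the
  sphere. On singlets the full turn is a scalar; this is the reason for working with singlets, and a
  chain of \<open>n\<close> spins has them only for even \<open>n\<close>. The bound 7 comes from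
  the trace \<open>1 + 2 * cos (2 * pi / m)\<close> of the two hyperbolic elements, which exceeds 2
  exactly for \<open>m > 6\<close>. Fundamental groups are handled without paths: cocycles defined
  for nearby points take the place of covering spaces, so that only open covers, connectedness and
  bisection of the unit interval enter.\<close>

lemmas grp_norm = diff_conv_add_uminus add.assoc minus_add minus_minus

fun flip :: "'a \<times> bool \<Rightarrow> 'a \<times> bool" where
  "flip (x, b) = (x, \<not> b)"

lemma flip_flip [simp]: "flip (flip a) = a"
  by (cases a) simp

lemma flip_eq_iff [simp]: "flip a = flip b \<longleftrightarrow> a = b"
  by (metis flip_flip)

lemma reduced_word_altdef: "reduced_word w \<longleftrightarrow> successively (\<lambda>a b. b \<noteq> flip a) w"
proof -
  have "(\<lambda>(x :: 'a, b) (y, c). \<not> (x = y \<and> b \<noteq> c)) = (\<lambda>a b. b \<noteq> flip a)"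
    by (auto simp: fun_eq_iff)
  then show ?thesis by (simp add: reduced_word_def)
qed

lemma reduced_word_Cons:
  "reduced_word (a # w) \<longleftrightarrow> reduced_word w \<and> (w = [] \<or> hd w \<noteq> flip a)"
  by (auto simp: reduced_word_altdef successively_Cons)

lemma reduced_word_append:
  "reduced_word (v @ w) \<longleftrightarrow> reduced_word v \<and> reduced_word w \<and> (v = [] \<or> w = [] \<or> hd w \<noteq> flip (last v))"
  by (auto simp: reduced_word_altdef successively_append_iff)

lemma reduced_word_Nil [simp]: "reduced_word []"
  by (simp add: reduced_word_altdef)

lemma reduced_word_single [simp]: "reduced_word [a]"
  by (simp add: reduced_word_altdef)

text \<open>Left multiplication of a reduced word by one letter. The letters act as permutations of
  the reduced words, opposite letters being inverse to each other, and associativity of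
  \<open>foldr push\<close> is read off from this action.\<close>

fun push :: "'a \<times> bool \<Rightarrow> ('a \<times> bool) list \<Rightarrow> ('a \<times> bool) list" where
  "push a [] = [a]"
| "push a (b # w) = (if b = flip a then w else a # b # w)"

lemma reduced_word_push: "reduced_word w \<Longrightarrow> reduced_word (push a w)"
  by (cases w) (auto simp: reduced_word_Cons)

lemma push_flip: "reduced_word w \<Longrightarrow> push a (push (flip a) w) = w"
  by (cases w rule: list.exhaust; cases "tl w") (auto simp: reduced_word_Cons)

lemma push_reduced: "reduced_word (a # w) \<Longrightarrow> push a w = a # w"
  by (cases w) (auto simp: reduced_word_Cons)

lemma reduced_word_foldr_push: "reduced_word v \<Longrightarrow> reduced_word (foldr push u v)"
  by (induction u) (auto intro: reduced_word_push)

lemma foldr_push_reduced: "reduced_word (u @ v) \<Longrightarrow> foldr push u v = u @ v"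
  by (induction u) (auto simp: push_reduced reduced_word_Cons)

lemma foldr_push_push:
  assumes "reduced_word v"
  shows "foldr push (push a u) v = push a (foldr push u v)"
  using assms by (cases u) (auto simp: push_flip reduced_word_foldr_push)

lemma foldr_push_assoc:
  assumes "reduced_word w"
  shows "foldr push (foldr push u v) w = foldr push u (foldr push v w)"
  using assms by (induction u) (auto simp: foldr_push_push)

definition inv_word :: "('a \<times> bool) list \<Rightarrow> ('a \<times> bool) list" where
  "inv_word w = rev (map flip w)"

lemma inv_word_simps [simp]:
  "inv_word [] = []" "inv_word (a # w) = inv_word w @ [flip a]"
  "inv_word (v @ w) = inv_word w @ inv_word v" "inv_word (inv_word w) = w"
  "length (inv_word w) = length w" "inv_word w = [] \<longleftrightarrow> w = []"
  by (auto simp: inv_word_def rev_map o_def)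

lemma hd_inv_word: "w \<noteq> [] \<Longrightarrow> hd (inv_word w) = flip (last w)"
  by (auto simp: inv_word_def hd_rev last_map)

lemma reduced_inv_word: "reduced_word w \<Longrightarrow> reduced_word (inv_word w)"
proof (induction w)
  case (Cons a w)
  then show ?case
    by (cases w) (auto simp: reduced_word_Cons reduced_word_append last_append)
qed simp

lemma foldr_push_inv_word:
  assumes "reduced_word v"
  shows "foldr push (inv_word w) (foldr push w v) = v"
  using assms
proof (induction w)
  case (Cons a w)
  have "push (flip a) (push a (foldr push w v)) = foldr push w v"
    using push_flip [of "foldr push w v" "flip a"] Cons.prems by (simp add: reduced_word_foldr_push)
  then show ?case using Cons by simp
qed simp

text \<open>One free group on all natural numbers serves every rank; rank \<open>N\<close> is the
  subgroup \<open>letters_below N\<close>. The additive notation is that of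
  \<open>group_add\<close>, whose instances need not be commutative.\<close>

typedef fgroup = "{w :: (nat \<times> bool) list. reduced_word w}"
  morphisms word_of Abs_fgroup
  by (rule exI [of _ "[]"]) simp

setup_lifting type_definition_fgroup

instantiation fgroup :: group_add
begin
lift_definition zero_fgroup :: fgroup is "[]" by simp
lift_definition plus_fgroup :: "fgroup \<Rightarrow> fgroup \<Rightarrow> fgroup" is "foldr push"
  by (rule reduced_word_foldr_push)
lift_definition uminus_fgroup :: "fgroup \<Rightarrow> fgroup" is inv_word
  by (rule reduced_inv_word)
definition minus_fgroup :: "fgroup \<Rightarrow> fgroup \<Rightarrow> fgroup" where
  "minus_fgroup a b = a + - b"
instance
proof
  fix a b c :: fgroup
  show "a + b + c = a + (b + c)"
    by transfer (rule foldr_push_assoc)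
  show "0 + a = a"
    by transfer simp
  show "a + 0 = a"
    by transfer (simp add: foldr_push_reduced)
  show "- a + a = 0"
    by transfer (metis append.right_neutral foldr_push_inv_word foldr_push_reduced reduced_word_Nil)
  show "a + - b = a - b"
    by (simp add: minus_fgroup_def)
qed
end

lift_definition gen :: "nat \<Rightarrow> fgroup" is "\<lambda>i. [(i, True)]" by simp

fun letter :: "(nat \<Rightarrow> 'g::group_add) \<Rightarrow> nat \<times> bool \<Rightarrow> 'g" where
  "letter f (i, b) = (if b then f i else - f i)"

lemma letter_flip: "letter f (flip a) = - letter f a"
  by (cases a) auto

definition wval :: "(nat \<Rightarrow> 'g::group_add) \<Rightarrow> (nat \<times> bool) list \<Rightarrow> 'g" where
  "wval f w = sum_list (map (letter f) w)"

lemma wval_simps [simp]: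
  "wval f [] = 0" "wval f (a # w) = letter f a + wval f w" "wval f (v @ w) = wval f v + wval f w"
  by (simp_all add: wval_def)

lemma wval_inv_word: "wval f (inv_word w) = - wval f w"
  by (induction w) (simp_all add: letter_flip minus_add)

lemma wval_push: "wval f (push a w) = letter f a + wval f w"
  by (cases w) (auto simp: letter_flip add.assoc [symmetric])

lemma wval_foldr_push: "wval f (foldr push u v) = wval f u + wval f v"
  by (induction u) (simp_all add: wval_push add.assoc)

text \<open>The universal property: \<open>ev f\<close> is the homomorphism that extends
  \<open>f\<close>.\<close>

definition ev :: "(nat \<Rightarrow> 'g::group_add) \<Rightarrow> fgroup \<Rightarrow> 'g" where
  "ev f z = wval f (word_of z)"

lemma ev_add: "ev f (a + b) = ev f a + ev f b"
  unfolding ev_def by transfer (rule wval_foldr_push)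

lemma ev_zero [simp]: "ev f 0 = 0"
  unfolding ev_def by transfer simp

lemma ev_uminus: "ev f (- a) = - ev f a"
  unfolding ev_def by transfer (rule wval_inv_word)

lemma ev_diff: "ev f (a - b) = ev f a - ev f b"
  by (metis add_uminus_conv_diff ev_add ev_uminus)

lemma ev_gen [simp]: "ev f (gen i) = f i"
  unfolding ev_def by transfer simp

lemmas ev_hom = ev_add ev_uminus ev_diff

lemma wval_gen_word_of: "wval gen (word_of z) = z"
proof -
  have "reduced_word w \<Longrightarrow> wval gen w = Abs_fgroup w" for w
  proof (induction w)
    case Nil
    then show ?case by (simp add: zero_fgroup.abs_eq)
  next
    case (Cons a w)
    have "letter gen a = Abs_fgroup [a]"
      by (cases a) (auto simp: gen.abs_eq uminus_fgroup.abs_eq eq_onp_same_args)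
    then show ?case using Cons
      by (simp add: plus_fgroup.abs_eq eq_onp_same_args reduced_word_Cons push_reduced)
  qed
  then show ?thesis using word_of [of z] by (simp add: word_of_inverse)
qed

lemma word_of_wval_gen: "word_of (wval gen w) = foldr push w []"
proof (induction w)
  case (Cons a w)
  have "word_of (letter gen a) = [a]"
    by (cases a) (auto simp: gen.rep_eq uminus_fgroup.rep_eq)
  then show ?case using Cons by (simp add: plus_fgroup.rep_eq)
qed (simp add: zero_fgroup.rep_eq)

lemma fgroup_induct [case_names zero gen minus_gen]:
  assumes "P 0" "\<And>i z. P z \<Longrightarrow> P (gen i + z)" "\<And>i z. P z \<Longrightarrow> P (- gen i + z)"
  shows "P z"
proof -
  have "P (wval gen w)" for w
  proof (induction w)
    case (Cons a w)
    then show ?case using assms by (cases a) auto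
  qed (use assms in simp)
  then show ?thesis by (metis wval_gen_word_of)
qed

definition additive_map :: "('a::group_add \<Rightarrow> 'b::group_add) \<Rightarrow> bool" where
  "additive_map h \<longleftrightarrow> (\<forall>a b. h (a + b) = h a + h b)"

lemma additive_mapD:
  assumes "additive_map h"
  shows "h (a + b) = h a + h b" "h 0 = 0" "h (- a) = - h a" "h (a - b) = h a - h b"
proof -
  show add: "h (a + b) = h a + h b" for a b
    using assms by (simp add: additive_map_def)
  show zero: "h 0 = 0"
    using add [of 0 0] by (metis add.right_neutral add_left_cancel)
  show minus: "h (- a) = - h a" for a
    using add [of "- a" a] zero by (simp add: eq_neg_iff_add_eq_0)
  show "h (a - b) = h a - h b"
    using add [of a "- b"] minus [of b] by simp
qed

lemma additive_map_ev [simp]: "additive_map (ev f)"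
  by (simp add: additive_map_def ev_add)

lemma additive_map_id [simp]: "additive_map id" "additive_map (\<lambda>x. x)"
  by (simp_all add: additive_map_def)

lemma additive_map_comp: "additive_map f \<Longrightarrow> additive_map g \<Longrightarrow> additive_map (f \<circ> g)"
  by (simp add: additive_map_def)

lemma additive_map_ext:
  assumes "additive_map f" "additive_map g" "\<And>i. f (gen i) = g (gen i)"
  shows "f z = g z"
  by (induction z rule: fgroup_induct) (simp_all add: additive_mapD [OF assms(1)] additive_mapD [OF assms(2)] assms(3))

lemma ev_gen_id [simp]: "ev gen z = z"
  by (rule additive_map_ext) auto

lemma length_push_le: "length (push a w) \<le> Suc (length w)"
  by (cases w) auto

lemma foldr_push_length_eq:
  "length (foldr push u v) = length u + length v \<Longrightarrow> foldr push u v = u @ v"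
proof (induction u)
  case (Cons a u)
  have "length (foldr push u v) \<le> length u + length v" for u :: "('a \<times> bool) list"
  proof (induction u)
    case (Cons b u)
    then show ?case using length_push_le [of b "foldr push u v"] by simp
  qed simp
  then have "length (foldr push u v) = length u + length v"
    using Cons.prems length_push_le [of a "foldr push u v"] by (simp add: le_antisym)
  then have "foldr push u v = u @ v" using Cons.IH by blast
  moreover from this have "length (push a (u @ v)) = Suc (length (u @ v))" using Cons.prems by simp
  then have "push a (u @ v) = a # u @ v"
    by (cases "u @ v") (auto split: if_splits)
  ultimately show ?case by simp
qed simp

section \<open>Cyclic subgroups and centralizers in free groups\<close>

inductive_set cyc :: "'g::group_add \<Rightarrow> 'g set" for x where
  cyc_zero: "0 \<in> cyc x"
| cyc_add: "a \<in> cyc x \<Longrightarrow> a + x \<in> cyc x"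
| cyc_diff: "a \<in> cyc x \<Longrightarrow> a - x \<in> cyc x"

lemma cyc_image:
  assumes "additive_map h" "a \<in> cyc x"
  shows "h a \<in> cyc (h x)"
  using assms(2) by induction (auto simp: additive_mapD [OF assms(1)] intro: cyc.intros)

lemma cyc_add_left:
  assumes "a \<in> cyc x"
  shows "x + a \<in> cyc x" "- x + a \<in> cyc x"
  using assms
proof (induction)
  case cyc_zero
  {
    case 1
    show ?case using cyc.intros(2) [OF cyc.intros(1)] by fastforce
  next
    case 2
    show ?case using cyc.intros(3) [OF cyc.intros(1)] by fastforce
  }
next
  case (cyc_add a)
  then show "x + (a + x) \<in> cyc x" "- x + (a + x) \<in> cyc x"
    using cyc.intros(2) by (metis add.assoc)+
next
  case (cyc_diff a)
  then show "x + (a - x) \<in> cyc x" "- x + (a - x) \<in> cyc x"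
    using cyc.intros(3) by (metis add.assoc diff_conv_add_uminus)+
qed

text \<open>Induction on the length. If the reduced word of \<open>z\<close> starts with
  \<open>gen l\<close> or its inverse, that letter commutes with \<open>gen l\<close> and can be
  removed. Otherwise nothing cancels in \<open>gen l + z\<close>, hence, the lengths being equal,
  nothing cancels in \<open>z + gen l\<close>, and the two words differ in their first
  letters.\<close>

lemma commutes_gen_imp_cyc:
  assumes "z + gen l = gen l + z"
  shows "z \<in> cyc (gen l)"
  using assms
proof (induction "length (word_of z)" arbitrary: z rule: less_induct)
  case less
  define w where "w = word_of z"
  have red: "reduced_word w"
    using word_of [of z] by (simp add: w_def)
  have eq: "foldr push w [(l, True)] = push (l, True) w"
    using arg_cong [OF less.prems, of word_of] by (simp add: plus_fgroup.rep_eq gen.rep_eq w_def)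
  show ?case
  proof (cases w)
    case Nil
    then have "z = 0" by (metis w_def word_of_inject zero_fgroup.rep_eq)
    then show ?thesis by (simp add: cyc_zero)
  next
    case (Cons a w')
    have z: "z = letter gen a + wval gen w'"
      using wval_gen_word_of [of z] Cons w_def by simp
    have red': "reduced_word w'" using red Cons by (simp add: reduced_word_Cons)
    have len: "length (word_of (wval gen w')) < length (word_of z)"
      using red' Cons foldr_push_reduced [of w' "[]"] by (simp add: word_of_wval_gen flip: w_def)
    show ?thesis
    proof (cases "fst a = l")
      case True
      let ?y = "letter gen a"
      have comm: "?y + gen l = gen l + ?y" "?y = gen l \<or> ?y = - gen l"
        using True by (cases a; auto)+
      have "?y + (wval gen w' + gen l) = ?y + (gen l + wval gen w')"
        using less.prems comm unfolding z by (metis add.assoc)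
      then have "wval gen w' \<in> cyc (gen l)"
        using less.hyps [OF len] by simp
      then show ?thesis
        using z comm(2) cyc_add_left by metis
    next
      case False
      then have "push (l, True) w = (l, True) # w"
        using Cons by (cases a) auto
      then have "foldr push w [(l, True)] = w @ [(l, True)]" "foldr push w [(l, True)] = (l, True) # w"
        using eq foldr_push_length_eq [of w "[(l, True)]"] by auto
      then show ?thesis using Cons False by auto
    qed
  qed
qed

section \<open>Braid automorphisms of free groups\<close>

declare add_uminus_conv_diff [simp del]

text \<open>Permutations as an instance of \<open>group_add\<close>, so that \<open>ev\<close> turns
  an assignment of permutations to generators into an action of \<open>fgroup\<close>.\<close>

typedef 'a sym = "{f :: 'a \<Rightarrow> 'a. bij f}" morphisms app Abs_sym
  by (rule exI [of _ id]) simp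

setup_lifting type_definition_sym

instantiation sym :: (type) group_add
begin
lift_definition zero_sym :: "'a sym" is id by simp
lift_definition plus_sym :: "'a sym \<Rightarrow> 'a sym \<Rightarrow> 'a sym" is "(\<circ>)" by (rule bij_comp)
lift_definition uminus_sym :: "'a sym \<Rightarrow> 'a sym" is "inv_into UNIV" by (rule bij_imp_bij_inv)
definition minus_sym :: "'a sym \<Rightarrow> 'a sym \<Rightarrow> 'a sym" where
  "minus_sym a b = a + - b"
instance
proof
  fix a b c :: "'a sym"
  show "a + b + c = a + (b + c)" by transfer (simp add: comp_assoc)
  show "0 + a = a" "a + 0 = a" by (transfer, simp)+
  show "- a + a = 0" by transfer (simp add: bij_def)
  show "a + - b = a - b" by (simp add: minus_sym_def)
qed
end

lemma app_simps [simp]: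
  "app 0 x = x" "app (a + b) x = app a (app b x)"
  "app (- a) (app a x) = x" "app a (app (- a) x) = x"
  "app (a - b) x = app a (app (- b) x)"
  unfolding minus_sym_def by (transfer; simp add: bij_is_inj surj_f_inv_f bij_is_surj)+

lemma sym_eqI: "(\<And>x. app a x = app b x) \<Longrightarrow> a = b"
  by (simp add: app_inject [symmetric] fun_eq_iff)

lemma app_Abs_sym:
  assumes "\<And>x. f (g x) = x" "\<And>x. g (f x) = x"
  shows "app (Abs_sym f) = f" "app (- Abs_sym f) = g"
proof -
  have "bij f" using assms by (intro o_bij [of g]) (auto simp: fun_eq_iff)
  then show *: "app (Abs_sym f) = f" by (simp add: Abs_sym_inverse)
  show "app (- Abs_sym f) = g"
    by (metis "*" app_simps(3) assms(1) ext)
qed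

text \<open>The loop around the punctures \<open>0, ..., k - 1\<close> together.\<close>

fun ul :: "nat \<Rightarrow> fgroup" where
  "ul 0 = 0"
| "ul (Suc k) = ul k + gen k"

lemma gen_eq_u: "gen k = - ul k + ul (Suc k)"
  by (simp add: add.assoc [symmetric])

text \<open>The value 0 for \<open>k > N\<close> says that a loop around all \<open>N + 1\<close>
  punctures of the sphere is trivial. With this convention the braid generator that involves the
  puncture at infinity obeys the same formula as the others.\<close>

definition el :: "nat \<Rightarrow> nat \<Rightarrow> fgroup" where
  "el N k = (if k \<le> N then ul k else 0)"

lemma el_0 [simp]: "el N 0 = 0" by (simp add: el_def)

lemma additive_map_u_cong:
  assumes "additive_map f" "additive_map g" "\<And>j. j < k \<Longrightarrow> f (gen j) = g (gen j)"
  shows "f (ul k) = g (ul k)"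
  using assms(3) by (induction k) (simp_all add: additive_mapD [OF assms(1)] additive_mapD [OF assms(2)])

lemma gen_eq_e: "j < N \<Longrightarrow> gen j = - el N j + el N (Suc j)"
  by (auto simp: el_def gen_eq_u simp del: ul.simps)

lemma additive_map_gen_cong:
  assumes "additive_map f" "additive_map g" "\<And>k. k \<le> N \<Longrightarrow> f (el N k) = g (el N k)" "j < N"
  shows "f (gen j) = g (gen j)"
  using assms(3) [of j] assms(3) [of "Suc j"] assms(4)
  by (simp add: gen_eq_e [of j N] additive_mapD [OF assms(1)] additive_mapD [OF assms(2)] del: ul.simps)

lemma additive_map_ext_e:
  assumes "additive_map f" "additive_map g" "\<And>k. f (el N k) = g (el N k)" "\<And>j. N \<le> j \<Longrightarrow> f (gen j) = g (gen j)"
  shows "f z = g z"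
proof (rule additive_map_ext [OF assms(1,2)])
  fix j show "f (gen j) = g (gen j)"
    using additive_map_gen_cong [OF assms(1,2), of N j] assms(3,4) by (cases "j < N") auto
qed

text \<open>
  The generators of the braid group of the sphere with \<open>N + 1\<close> punctures, acting on its free
  fundamental group of rank \<open>N\<close>. The loop around the last puncture is \<open>- ul N\<close>.
\<close>

definition braid_gen :: "nat \<Rightarrow> nat \<Rightarrow> nat \<Rightarrow> fgroup" where
  "braid_gen N i j =
    (if Suc i < N then if j = i then gen (Suc i)
       else if j = Suc i then - gen (Suc i) + gen i + gen (Suc i) else gen j
     else if Suc i = N \<and> j = i then - ul N else gen j)"

definition braid_gen_inv :: "nat \<Rightarrow> nat \<Rightarrow> nat \<Rightarrow> fgroup" where
  "braid_gen_inv N i j =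
    (if Suc i < N then if j = i then gen i + gen (Suc i) - gen i
       else if j = Suc i then gen i else gen j
     else if Suc i = N \<and> j = i then - ul i - ul N + ul i else gen j)"

lemma ev_u_fixed: "(\<And>j. j < k \<Longrightarrow> f j = gen j) \<Longrightarrow> ev f (ul k) = ul k"
  by (induction k) (simp_all add: ev_add)

text \<open>In the coordinates \<open>el\<close> a braid generator moves a single element, also for
  \<open>i = N - 1\<close>. Identities between braid automorphisms are checked on
  \<open>el N k\<close>, where they become short computations.\<close>

lemma ev_braid_gen_e:
  assumes "i < N"
  shows "ev (braid_gen N i) (el N k) =
    (if k = Suc i then el N i - el N (Suc i) + el N (Suc (Suc i)) else el N k)"
proof -
  have low: "ev (braid_gen N i) (ul k) = ul k" if "k \<le> i" for k
    using that by (intro ev_u_fixed) (auto simp: braid_gen_def)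
  have mid: "ev (braid_gen N i) (ul (Suc i)) = ul i - ul (Suc i) + el N (Suc (Suc i))"
    using assms low [of i] by (cases "Suc i = N")
      (auto simp: ev_add el_def braid_gen_def grp_norm)
  have "ev (braid_gen N i) (ul k) = ul k" if "Suc (Suc i) \<le> k" "k \<le> N" for k
    using that
  proof (induction k rule: dec_induct)
    case base
    then have "braid_gen N i i = gen (Suc i)" "braid_gen N i (Suc i) = - gen (Suc i) + gen i + gen (Suc i)"
      by (auto simp: braid_gen_def)
    then show ?case using base by (simp add: ev_add low el_def grp_norm)
  next
    case (step k)
    then show ?case by (simp add: ev_add braid_gen_def)
  qed
  then show ?thesis
    using assms low mid by (cases "k \<le> i"; cases "k = Suc i"; auto simp: el_def)
qed

lemma ev_braid_gen_inv_e:
  assumes "i < N"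
  shows "ev (braid_gen_inv N i) (el N k) =
    (if k = Suc i then el N (Suc (Suc i)) - el N (Suc i) + el N i else el N k)"
proof -
  have low: "ev (braid_gen_inv N i) (ul k) = ul k" if "k \<le> i" for k
    using that by (intro ev_u_fixed) (auto simp: braid_gen_inv_def)
  have mid: "ev (braid_gen_inv N i) (ul (Suc i)) = el N (Suc (Suc i)) - ul (Suc i) + ul i"
    using assms low [of i] by (cases "Suc i = N")
      (auto simp: ev_add el_def braid_gen_inv_def grp_norm)
  have "ev (braid_gen_inv N i) (ul k) = ul k" if "Suc (Suc i) \<le> k" "k \<le> N" for k
    using that
  proof (induction k rule: dec_induct)
    case base
    then have "braid_gen_inv N i i = gen i + gen (Suc i) - gen i" "braid_gen_inv N i (Suc i) = gen i"
      by (auto simp: braid_gen_inv_def)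
    then show ?case using base by (simp add: ev_add low el_def grp_norm)
  next
    case (step k)
    then show ?case by (simp add: ev_add braid_gen_inv_def)
  qed
  then show ?thesis
    using assms low mid by (cases "k \<le> i"; cases "k = Suc i"; auto simp: el_def)
qed

lemma ev_braid_gen_ge: "N \<le> j \<Longrightarrow> braid_gen N i j = gen j" "N \<le> j \<Longrightarrow> braid_gen_inv N i j = gen j"
  by (auto simp: braid_gen_def braid_gen_inv_def)

lemma braid_gen_trivial: "N \<le> i \<Longrightarrow> braid_gen N i = gen" "N \<le> i \<Longrightarrow> braid_gen_inv N i = gen"
  by (auto simp: braid_gen_def braid_gen_inv_def)

lemma braid_gen_inverse:
  "ev (braid_gen N i) (ev (braid_gen_inv N i) z) = z" (is ?A)
  "ev (braid_gen_inv N i) (ev (braid_gen N i) z) = z" (is ?B)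
proof -
  have hom: "additive_map (\<lambda>z. ev (braid_gen N i) (ev (braid_gen_inv N i) z))"
    "additive_map (\<lambda>z. ev (braid_gen_inv N i) (ev (braid_gen N i) z))"
    by (simp_all add: additive_map_def ev_add)
  have "?A \<and> ?B"
  proof (cases "i < N")
    case True
    have "ev (braid_gen N i) (ev (braid_gen_inv N i) (el N k)) = el N k"
      "ev (braid_gen_inv N i) (ev (braid_gen N i) (el N k)) = el N k" for k
      using True by (simp_all add: ev_braid_gen_e ev_braid_gen_inv_e ev_add ev_uminus ev_diff grp_norm)
    then show ?thesis
      using additive_map_ext_e [OF hom(1) additive_map_id(2), of N z]
        additive_map_ext_e [OF hom(2) additive_map_id(2), of N z] by (simp add: ev_braid_gen_ge)
  qed (simp add: braid_gen_trivial)
  then show ?A ?B by auto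
qed

definition braid_sym :: "nat \<Rightarrow> nat \<Rightarrow> fgroup sym" where
  "braid_sym N i = Abs_sym (ev (braid_gen N i))"

lemma app_braid_sym [simp]:
  "app (braid_sym N i) = ev (braid_gen N i)" "app (- braid_sym N i) = ev (braid_gen_inv N i)"
  unfolding braid_sym_def
  using app_Abs_sym [of "ev (braid_gen N i)" "ev (braid_gen_inv N i)"] braid_gen_inverse by auto

text \<open>Elements of \<^typ>\<open>fgroup\<close> also serve as braid words.\<close>

definition act :: "nat \<Rightarrow> fgroup \<Rightarrow> fgroup \<Rightarrow> fgroup" where
  "act N z = app (ev (braid_sym N) z)"

lemma act_simps [simp]:
  "act N 0 x = x" "act N (a + b) x = act N a (act N b x)"
  "act N (- a) (act N a x) = x" "act N a (act N (- a) x) = x"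
  "act N (a - b) x = act N a (act N (- b) x)"
  "act N (gen i) = ev (braid_gen N i)" "act N (- gen i) = ev (braid_gen_inv N i)"
  by (simp_all add: act_def ev_hom)

lemma additive_map_act [simp]: "additive_map (act N z)"
proof (induction z rule: fgroup_induct)
  case zero
  then show ?case by (simp add: additive_map_def)
next
  case (gen i z)
  then show ?case unfolding additive_map_def by (simp add: ev_hom)
next
  case (minus_gen i z)
  then show ?case unfolding additive_map_def by (simp add: ev_hom)
qed

lemmas act_hom = additive_mapD [OF additive_map_act]

text \<open>The subgroup generated by the first \<open>k\<close> generators, as the fixed points of
  the retraction that kills the other letters. Its closure properties follow from \<open>ev\<close>
  being a homomorphism, and its induction rule from applying the retraction to an arbitrary
  element.\<close>

definition letters_below :: "nat \<Rightarrow> fgroup set" where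
  "letters_below k = {z. ev (\<lambda>i. if i < k then gen i else 0) z = z}"

lemma letters_below_intros:
  "0 \<in> letters_below k" "i < k \<Longrightarrow> gen i \<in> letters_below k"
  "a \<in> letters_below k \<Longrightarrow> b \<in> letters_below k \<Longrightarrow> a + b \<in> letters_below k"
  "a \<in> letters_below k \<Longrightarrow> - a \<in> letters_below k"
  "a \<in> letters_below k \<Longrightarrow> b \<in> letters_below k \<Longrightarrow> a - b \<in> letters_below k"
  by (simp_all add: letters_below_def ev_hom)

lemma letters_below_induct [consumes 1, case_names zero gen minus_gen]:
  assumes "z \<in> letters_below k" "P 0"
    "\<And>i z. i < k \<Longrightarrow> z \<in> letters_below k \<Longrightarrow> P z \<Longrightarrow> P (gen i + z)"
    "\<And>i z. i < k \<Longrightarrow> z \<in> letters_below k \<Longrightarrow> P z \<Longrightarrow> P (- gen i + z)"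
  shows "P z"
proof -
  define f where "f = (\<lambda>i. if i < k then gen i else 0)"
  have "ev f z \<in> letters_below k \<and> P (ev f z)" for z
  proof (induction z rule: fgroup_induct)
    case zero
    show ?case using assms(2) by (simp add: letters_below_intros)
  next
    case (gen i z)
    have "ev f (gen i + z) = (if i < k then gen i + ev f z else ev f z)"
      by (simp add: ev_add) (simp add: f_def)
    then show ?case using gen assms(3) letters_below_intros by auto
  next
    case (minus_gen i z)
    have "ev f (- gen i + z) = (if i < k then - gen i + ev f z else ev f z)"
      by (simp add: ev_add ev_uminus) (simp add: f_def)
    then show ?case using minus_gen assms(4) letters_below_intros by auto
  qed
  moreover have "ev f z = z"
    using assms(1) by (simp add: letters_below_def f_def)
  ultimately show ?thesis by metis
qed

lemma letters_below_mono: "z \<in> letters_below k \<Longrightarrow> k \<le> l \<Longrightarrow> z \<in> letters_below l"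
  by (induction rule: letters_below_induct) (simp_all add: letters_below_intros)

text \<open>Without the letter \<open>gen (N - 1)\<close> the puncture at infinity is not moved, and
  its loop is \<open>- ul N\<close>.\<close>

lemma act_e_last:
  assumes "z \<in> letters_below (N - 1)"
  shows "act N z (ul N) = ul N"
  using assms
proof (induction rule: letters_below_induct)
  case zero
  then show ?case by simp
next
  case (gen i z)
  then show ?case using ev_braid_gen_e [of i N N] by (auto simp: el_def simp del: ul.simps)
next
  case (minus_gen i z)
  then show ?case using ev_braid_gen_inv_e [of i N N] by (auto simp: el_def simp del: ul.simps)
qed

section \<open>Artin's description of the braid group\<close>

lemma reduced_word_eqI:
  assumes "reduced_word v" "reduced_word w" "wval gen v = wval gen w"
  shows "v = w"
  using assms by (metis append_Nil2 foldr_push_reduced word_of_wval_gen)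

lemma reduce_shorter:
  assumes "\<not> reduced_word w"
  obtains v where "wval gen v = wval gen w" "length v < length w"
proof -
  define v where "v = foldr push w []"
  have v: "wval gen v = wval gen w" by (simp add: v_def wval_foldr_push)
  have "length (foldr push w []) \<le> length w" for w :: "(nat \<times> bool) list"
  proof (induction w)
    case (Cons a w)
    then show ?case using length_push_le [of a "foldr push w []"] by simp
  qed simp
  moreover have "length v \<noteq> length w"
    using assms foldr_push_length_eq [of w "[]"] reduced_word_foldr_push [of "[]" w] by (auto simp: v_def)
  ultimately show ?thesis using that v v_def by (simp add: le_neq_implies_less)
qed

abbreviation conj_gen :: "(nat \<times> bool) list \<Rightarrow> nat \<Rightarrow> fgroup" where
  "conj_gen w p \<equiv> - wval gen w + gen p + wval gen w"

lemma common_suffix: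
  obtains h h' s where "v = h @ s" "w = h' @ s" "h = [] \<or> h' = [] \<or> last h \<noteq> last h'"
proof (induction v arbitrary: w thesis rule: rev_induct)
  case Nil
  then show ?case by (metis append_Nil2 append_Nil append.right_neutral)
next
  case (snoc x v)
  show ?case
  proof (cases w rule: rev_exhaust)
    case Nil
    then show ?thesis by (intro snoc.prems [of "v @ [x]" "[]" "[]"]) auto
  next
    case (snoc w' y)
    show ?thesis
    proof (cases "x = y")
      case True
      obtain h h' s where "v = h @ s" "w' = h' @ s" "h = [] \<or> h' = [] \<or> last h \<noteq> last h'"
        using snoc.IH by blast
      then show ?thesis using snoc True by (intro snoc.prems [of h "s @ [x]" h']) auto
    next
      case False
      then show ?thesis using snoc by (intro snoc.prems [of "v @ [x]" "[]" w]) auto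
    qed
  qed
qed

text \<open>Where two consecutive factors of the product meet, \<open>w i\<close> cancels against
  the inverse of \<open>w (Suc i)\<close>. The hypotheses \<open>left\<close> and
  \<open>right\<close> keep this cancellation from reaching the middle letter of either factor, so
  all \<open>N\<close> middle letters survive. The product is the word \<open>0, ..., N - 1\<close>
  of length \<open>N\<close>, hence nothing else survives.\<close>

lemma no_descent_trivial:
  assumes red: "\<And>i. i < N \<Longrightarrow> reduced_word (inv_word (w i) @ (p i, True) # w i)"
    and left: "\<And>i h. Suc i < N \<Longrightarrow> w (Suc i) \<noteq> h @ (p i, True) # w i"
    and right: "\<And>i h. Suc i < N \<Longrightarrow> w i \<noteq> h @ (p (Suc i), False) # w (Suc i)"
    and sum: "ev (\<lambda>i. conj_gen (w i) (p i)) (ul N) = ul N"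
    and "i < N"
  shows "w i = []" "p i = i"
proof -
  define a where "a = (\<lambda>i. conj_gen (w i) (p i))"
  \<comment> \<open>\<open>R\<close> is what precedes the last middle letter in the reduced form of
    the first \<open>k + 1\<close> factors. It contains the \<open>k\<close> earlier middle letters;
    if it contains no more, all conjugators so far are empty.\<close>
  have "\<exists>R. reduced_word (R @ (p k, True) # w k) \<and> ev a (ul (Suc k)) = wval gen (R @ (p k, True) # w k)
      \<and> k \<le> length R \<and> (length R = k \<longrightarrow> (\<forall>i\<le>k. w i = []) \<and> R = map (\<lambda>i. (p i, True)) [0..<k])"
    if "k < N" for k
    using that
  proof (induction k)
    case 0
    then show ?case using red [of 0]
      by (intro exI [of _ "inv_word (w 0)"]) (auto simp: ev_add a_def wval_inv_word grp_norm)
  next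
    case (Suc k)
    let ?x = "(p k, True)" and ?x' = "(p (Suc k), True)"
    obtain R where R: "reduced_word (R @ ?x # w k)" "ev a (ul (Suc k)) = wval gen (R @ ?x # w k)"
      "k \<le> length R" "length R = k \<Longrightarrow> (\<forall>i\<le>k. w i = []) \<and> R = map (\<lambda>i. (p i, True)) [0..<k]"
      using Suc by auto
    obtain h h' s where s: "w k = h @ s" "w (Suc k) = h' @ s" "h = [] \<or> h' = [] \<or> last h \<noteq> last h'"
      using common_suffix by blast
    define R' where "R' = (R @ ?x # h) @ inv_word h'"
    have r1: "reduced_word (R @ ?x # h)"
      using R(1) reduced_word_append [of "R @ ?x # h" s] by (simp add: s)
    have r2: "reduced_word (inv_word h' @ ?x' # w (Suc k))"
      using red [OF Suc.prems] reduced_word_append [of "inv_word s"] by (simp add: s)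
    \<comment> \<open>After the common suffix \<open>s\<close> has cancelled, the letters that now
      meet must not be inverse. If \<open>h\<close> and \<open>h'\<close> are both nonempty this is
      the maximality of \<open>s\<close>; if exactly one is empty, a further cancellation is the
      pattern excluded by \<open>left\<close> or \<open>right\<close>.\<close>
    have "hd (inv_word h' @ ?x' # w (Suc k)) \<noteq> flip (last (R @ ?x # h))"
    proof (cases "h = []")
      case True
      show ?thesis
      proof (cases "h' = []")
        case False
        have "last h' \<noteq> ?x"
        proof
          assume "last h' = ?x"
          then have "w (Suc k) = butlast h' @ ?x # w k"
            using False True s by (metis append_Cons append_Nil append_assoc append_butlast_last_id)
          then show False using left Suc.prems by blast
        qed
        then have "flip (last h') \<noteq> flip ?x" by (simp only: flip_eq_iff not_False_eq_True)
        then show ?thesis using False True by (simp add: hd_inv_word hd_append)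
      qed (use True in simp)
    next
      case False
      show ?thesis
      proof (cases "h' = []")
        case True
        have "last h \<noteq> (p (Suc k), False)"
        proof
          assume "last h = (p (Suc k), False)"
          then have "w k = butlast h @ (p (Suc k), False) # w (Suc k)"
            using False True s by (metis append_Cons append_Nil append_assoc append_butlast_last_id)
          then show False using right Suc.prems by blast
        qed
        then have "?x' \<noteq> flip (last h)" by (metis flip.simps flip_flip)
        then show ?thesis using False True by simp
      qed (use False s(3) in \<open>auto simp: hd_inv_word hd_append\<close>)
    qed
    then have "reduced_word ((R @ ?x # h) @ (inv_word h' @ ?x' # w (Suc k)))"
      using r1 r2 by (subst reduced_word_append) auto
    moreover have "ev a (ul (Suc (Suc k))) = wval gen (R' @ ?x' # w (Suc k))"
    proof -
      have "ev a (ul (Suc (Suc k))) = wval gen (R @ ?x # w k) + conj_gen (w (Suc k)) (p (Suc k))"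
        using R(2) by (simp add: ev_add a_def)
      then show ?thesis by (simp add: s R'_def wval_inv_word grp_norm)
    qed
    moreover have "Suc k \<le> length R'" using R(3) by (simp add: R'_def)
    moreover have "(\<forall>i\<le>Suc k. w i = []) \<and> R' = map (\<lambda>i. (p i, True)) [0..<Suc k]" if "length R' = Suc k"
    proof -
      have *: "length R = k" "h = []" "h' = []" using that R(3) by (auto simp: R'_def)
      then show ?thesis using R(4) [OF *(1)] s by (auto simp: R'_def le_Suc_eq)
    qed
    ultimately show ?case by (intro exI [of _ R']) (auto simp: R'_def)
  qed
  from this [of "N - 1"] \<open>i < N\<close> obtain R where
    R: "reduced_word (R @ (p (N - 1), True) # w (N - 1))" "ev a (ul N) = wval gen (R @ (p (N - 1), True) # w (N - 1))"
      "N - 1 \<le> length R"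
      "length R = N - 1 \<Longrightarrow> (\<forall>i\<le>N - 1. w i = []) \<and> R = map (\<lambda>i. (p i, True)) [0..<N - 1]"
    by auto
  have uN: "ul k = wval gen (map (\<lambda>i. (i, True)) [0..<k])" for k by (induction k) auto
  have "reduced_word (map (\<lambda>i. (i, True)) [0..<k])" for k
    by (induction k) (auto simp: reduced_word_append last_map)
  then have eq: "R @ (p (N - 1), True) # w (N - 1) = map (\<lambda>i. (i, True)) [0..<N]"
    using R(1,2) sum uN by (intro reduced_word_eqI) (auto simp: a_def)
  then have "length R + 1 + length (w (N - 1)) = N"
    using length_map [of "\<lambda>i. (i, True)" "[0..<N]"] unfolding eq [symmetric] by simp
  then have "length R = N - 1" using R(3) by linarith
  then have *: "\<forall>i\<le>N - 1. w i = []" "R = map (\<lambda>i. (p i, True)) [0..<N - 1]" using R(4) by auto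
  show "w i = []" using * \<open>i < N\<close> by auto
  obtain M where M: "N = Suc M" using \<open>i < N\<close> by (cases N) auto
  have "map (\<lambda>i. (p i, True)) [0..<N] = map (\<lambda>i. (i, True)) [0..<N]"
    using eq * by (simp add: M)
  then show "p i = i" using \<open>i < N\<close> by (auto simp: map_eq_conv)
qed

text \<open>Descent on the total length of the conjugators: an unreduced word, an absorbed letter
  and either of the overlaps excluded in \<open>no_descent_trivial\<close> permit a shortening, and
  in their absence the tuple is the identity. The rank \<open>M\<close> of the braid action is kept
  apart from the number \<open>N\<close> of loops, so that the theorem also applies to the first two
  of many punctures.\<close>

theorem artin:
  assumes "N \<le> M" "\<And>i. i < N \<Longrightarrow> a i = conj_gen (w i) (p i)" "ev a (ul N) = ul N"
  shows "\<exists>z\<in>letters_below (N - 1). \<forall>i<N. a i = act M z (gen i)"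
  using assms(2,3)
proof (induction "\<Sum>i<N. length (w i)" arbitrary: a w p rule: less_induct)
  case less
  have shorter: "(\<Sum>j<N. length ((w(i := v)) j)) < (\<Sum>j<N. length (w j))"
    if "i < N" "length v < length (w i)" for i v
    using that by (intro sum_strict_mono_ex1) auto
  have cong: "ev f (ul N) = ev g (ul N)" if "\<And>i. i < N \<Longrightarrow> f i = g i" for f g :: "nat \<Rightarrow> fgroup"
    by (rule additive_map_u_cong) (use that in auto)
  consider
      (unreduced) i where "i < N" "\<not> reduced_word (w i)"
    | (absorb) i b v where "i < N" "w i = (p i, b) # v"
    | (left) i h where "Suc i < N" "w (Suc i) = h @ (p i, True) # w i"
    | (right) i h where "Suc i < N" "w i = h @ (p (Suc i), False) # w (Suc i)"
    | (stuck) "\<And>i. i < N \<Longrightarrow> reduced_word (w i)" "\<And>i b v. i < N \<Longrightarrow> w i \<noteq> (p i, b) # v"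
      "\<And>i h. Suc i < N \<Longrightarrow> w (Suc i) \<noteq> h @ (p i, True) # w i"
      "\<And>i h. Suc i < N \<Longrightarrow> w i \<noteq> h @ (p (Suc i), False) # w (Suc i)"
    by metis
  then show ?case
  proof cases
    case unreduced
    obtain v where v: "wval gen v = wval gen (w i)" "length v < length (w i)"
      using reduce_shorter [OF unreduced(2)] by blast
    show ?thesis
      by (rule less.hyps [OF shorter [OF unreduced(1) v(2)]]) (use less.prems v in auto)
  next
    case absorb
    have "conj_gen v (p i) = conj_gen (w i) (p i)"
      using absorb by (cases b) (simp_all add: grp_norm)
    then show ?thesis
      by (intro less.hyps [OF shorter [OF absorb(1), of v]]) (use less.prems absorb in auto)
  next
    case left
    \<comment> \<open>Composition with an inverse braid generator. If \<open>x\<close> is the middle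
      letter of \<open>a i\<close>, the conjugator of \<open>a (Suc i)\<close> is \<open>h\<close>
      followed by \<open>x\<close> and \<open>w i\<close>; conjugation by \<open>a i\<close> turns
      it into \<open>h\<close> followed by \<open>w i\<close>, which saves one letter.\<close>
    define a' where "a' = a(i := a i + a (Suc i) - a i, Suc i := a i)"
    let ?w = "w(i := h @ w i, Suc i := w i)" and ?p = "p(i := p (Suc i), Suc i := p i)"
    have a'_eq: "a' j = ev a (braid_gen_inv M i j)" if "j < N" for j
      using that left assms(1) by (auto simp: a'_def braid_gen_inv_def ev_hom)
    have split: "(\<Sum>j<N. f j) = f i + f (Suc i) + (\<Sum>j\<in>{..<N} - {i, Suc i}. f j)" for f :: "nat \<Rightarrow> nat"
      using left by (subst sum.subset_diff [of "{i, Suc i}"]) auto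
    have "(\<Sum>j<N. length (?w j)) < (\<Sum>j<N. length (w j))"
      using left by (simp add: split)
    moreover have "a' j = conj_gen (?w j) (?p j)" if "j < N" for j
      using that left less.prems(1) [of i] less.prems(1) [of "Suc i"] less.prems(1) [of j]
      by (auto simp: a'_def grp_norm)
    moreover have "ev a' (ul N) = ul N"
    proof -
      have "ev a' (ul N) = (ev a \<circ> ev (braid_gen_inv M i)) (ul N)"
        by (rule additive_map_u_cong [OF additive_map_ev additive_map_comp [OF additive_map_ev additive_map_ev]])
          (simp add: a'_eq)
      moreover have "ev (braid_gen_inv M i) (ul N) = ul N"
        using ev_braid_gen_inv_e [of i M N] left assms(1) by (simp add: el_def)
      ultimately show ?thesis using less.prems by simp
    qed
    ultimately obtain z where z: "z \<in> letters_below (N - 1)" "\<And>j. j < N \<Longrightarrow> a' j = act M z (gen j)"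
      using less.hyps [of ?w a' ?p] by blast
    have a_eq: "a j = ev a' (braid_gen M i j)" if "j < N" for j
      using that left assms(1) by (auto simp: a'_def braid_gen_def ev_hom grp_norm)
    have "a j = act M (z + gen i) (gen j)" if "j < N" for j
      using that left assms(1)
      by (auto simp: a_eq braid_gen_def ev_hom z(2) act_hom)
    moreover have "z + gen i \<in> letters_below (N - 1)"
      using z(1) left by (intro letters_below_intros) auto
    ultimately show ?thesis by blast
  next
    case right
    define a' where "a' = a(i := a (Suc i), Suc i := - a (Suc i) + a i + a (Suc i))"
    let ?w = "w(i := w (Suc i), Suc i := h @ w (Suc i))" and ?p = "p(i := p (Suc i), Suc i := p i)"
    have a'_eq: "a' j = ev a (braid_gen M i j)" if "j < N" for j
      using that right assms(1) by (auto simp: a'_def braid_gen_def ev_hom)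
    have split: "(\<Sum>j<N. f j) = f i + f (Suc i) + (\<Sum>j\<in>{..<N} - {i, Suc i}. f j)" for f :: "nat \<Rightarrow> nat"
      using right by (subst sum.subset_diff [of "{i, Suc i}"]) auto
    have "(\<Sum>j<N. length (?w j)) < (\<Sum>j<N. length (w j))"
      using right by (simp add: split)
    moreover have "a' j = conj_gen (?w j) (?p j)" if "j < N" for j
      using that right less.prems(1) [of i] less.prems(1) [of "Suc i"] less.prems(1) [of j]
      by (auto simp: a'_def grp_norm)
    moreover have "ev a' (ul N) = ul N"
    proof -
      have *: "ev (braid_gen M i) (ul N) = ul N"
        using ev_braid_gen_e [of i M N] right assms(1) by (simp add: el_def)
      have "ev a' (ul N) = (ev a \<circ> ev (braid_gen M i)) (ul N)"
        by (rule additive_map_u_cong [OF additive_map_ev additive_map_comp [OF additive_map_ev additive_map_ev]])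
          (simp add: a'_eq)
      then show ?thesis using less.prems * by simp
    qed
    ultimately obtain z where z: "z \<in> letters_below (N - 1)" "\<And>j. j < N \<Longrightarrow> a' j = act M z (gen j)"
      using less.hyps [of ?w a' ?p] by blast
    have a_eq: "a j = ev a' (braid_gen_inv M i j)" if "j < N" for j
      using that right assms(1) by (auto simp: a'_def braid_gen_inv_def ev_hom grp_norm)
    have "a j = act M (z - gen i) (gen j)" if "j < N" for j
      using that right assms(1)
      by (auto simp: a_eq braid_gen_inv_def ev_hom z(2) act_hom)
    moreover have "z - gen i \<in> letters_below (N - 1)"
      using z(1) right by (intro letters_below_intros) auto
    ultimately show ?thesis by blast
  next
    case stuck
    have red: "reduced_word (inv_word (w i) @ (p i, True) # w i)" if "i < N" for i
    proof (cases "w i")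
      case (Cons b v)
      then have "fst b \<noteq> p i" using stuck(2) [OF that, of "snd b" v] by (metis prod.collapse)
      then have "b \<noteq> flip (p i, True)" "(p i, True) \<noteq> b" by auto
      then show ?thesis
        using stuck(1) [OF that] Cons reduced_inv_word [of "w i"]
        by (auto simp: reduced_word_append reduced_word_Cons)
    qed simp
    have "ev (\<lambda>i. conj_gen (w i) (p i)) (ul N) = ev a (ul N)"
      by (rule cong) (simp add: less.prems(1))
    then have sum: "ev (\<lambda>i. conj_gen (w i) (p i)) (ul N) = ul N"
      using less.prems(2) by simp
    have "w i = []" "p i = i" if "i < N" for i
      using no_descent_trivial [of N w p i, OF red stuck(3) stuck(4) sum that] by simp_all
    then have "a i = act M 0 (gen i)" if "i < N" for i
      using less.prems(1) that by simp
    then show ?thesis using letters_below_intros(1) by blast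
  qed
qed

declare add_uminus_conv_diff [simp]

section \<open>The spin chain representation\<close>

type_synonym spin = "(nat \<Rightarrow> bool) \<Rightarrow> complex"

text \<open>The exclusions: \<open>Q \<noteq> 0\<close> makes \<open>S\<close> invertible,
  \<open>Q \<noteq> - 1\<close> makes its eigenvalues distinct, and \<open>Q \<noteq> 1\<close>
  allows \<open>S\<close> to be recovered from its square.\<close>

locale spin_chain =
  fixes Q :: complex
  assumes Q0: "Q \<noteq> 0" and Q1: "Q \<noteq> 1" and Qm1: "Q \<noteq> - 1"
begin

text \<open>The generator of the Hecke algebra, with eigenvalues \<open>1\<close> and \<open>- Q\<close>, on the sites \<open>i\<close> and \<open>i + 1\<close>.\<close>

definition S :: "nat \<Rightarrow> spin \<Rightarrow> spin" where
  "S i f a =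
    (if a i = a (Suc i) then f a
     else if a i then f (a(i := False, Suc i := True))
     else (1 - Q) * f a + Q * f (a(i := True, Suc i := False)))"

lemma S_lincomb: "S i (\<lambda>a. x * f a + y * g a) = (\<lambda>a. x * S i f a + y * S i g a)"
  by (rule ext) (simp add: S_def algebra_simps)

lemma S_zero [simp]: "S i (\<lambda>a. 0) = (\<lambda>a. 0)"
  by (rule ext) (simp add: S_def)

lemma S_square: "S i (S i f) = (\<lambda>a. (1 - Q) * S i f a + Q * f a)"
proof
  fix a :: "nat \<Rightarrow> bool"
  have [simp]: "\<not> a i \<Longrightarrow> a (Suc i) \<Longrightarrow> a(i := False, Suc i := True) = a"
    "a i \<Longrightarrow> \<not> a (Suc i) \<Longrightarrow> a(i := True, Suc i := False) = a"
    by (auto simp: fun_eq_iff)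
  show "S i (S i f) a = (1 - Q) * S i f a + Q * f a"
    by (cases "a i"; cases "a (Suc i)"; simp add: S_def algebra_simps)
qed

lemma upd3: "a = a(i := a i, Suc i := a (Suc i), Suc (Suc i) := a (Suc (Suc i)))"
  by auto

lemma S_upd3:
  "S i f (a(i := x, Suc i := y, Suc (Suc i) := z)) =
    (if x = y then f (a(i := x, Suc i := y, Suc (Suc i) := z))
     else if x then f (a(i := False, Suc i := True, Suc (Suc i) := z))
     else (1 - Q) * f (a(i := x, Suc i := y, Suc (Suc i) := z)) + Q * f (a(i := True, Suc i := False, Suc (Suc i) := z)))"
  "S (Suc i) f (a(i := x, Suc i := y, Suc (Suc i) := z)) =
    (if y = z then f (a(i := x, Suc i := y, Suc (Suc i) := z))
     else if y then f (a(i := x, Suc i := False, Suc (Suc i) := True))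
     else (1 - Q) * f (a(i := x, Suc i := y, Suc (Suc i) := z)) + Q * f (a(i := x, Suc i := True, Suc (Suc i) := False)))"
  by (auto simp: S_def fun_upd_def intro!: arg_cong [where f = f])

lemma S_braid: "S i (S (Suc i) (S i f)) = S (Suc i) (S i (S (Suc i) f))"
proof
  fix a :: "nat \<Rightarrow> bool"
  define x y z where "x = a i" and "y = a (Suc i)" and "z = a (Suc (Suc i))"
  have "S i (S (Suc i) (S i f)) (a(i := x, Suc i := y, Suc (Suc i) := z)) =
      S (Suc i) (S i (S (Suc i) f)) (a(i := x, Suc i := y, Suc (Suc i) := z))"
    by (cases x; cases y; cases z; simp only: S_upd3 simp_thms if_True if_False; simp add: algebra_simps)
  then show "S i (S (Suc i) (S i f)) a = S (Suc i) (S i (S (Suc i) f)) a"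
    using upd3 [of a i] by (simp only: x_def y_def z_def)
qed

text \<open>The left-hand side is the antisymmetrizer of the Hecke algebra on three sites. It
  vanishes because a site has only two states; thus the action factors through the Temperley-Lieb
  algebra.\<close>

lemma S_temperley_lieb:
  "f a - S i f a - S (Suc i) f a + S i (S (Suc i) f) a + S (Suc i) (S i f) a - S i (S (Suc i) (S i f)) a = 0"
proof -
  define x y z where "x = a i" and "y = a (Suc i)" and "z = a (Suc (Suc i))"
  define b where "b = a(i := x, Suc i := y, Suc (Suc i) := z)"
  have "f b - S i f b - S (Suc i) f b + S i (S (Suc i) f) b + S (Suc i) (S i f) b - S i (S (Suc i) (S i f)) b = 0"
    unfolding b_def
    by (cases x; cases y; cases z; simp only: S_upd3 simp_thms if_True if_False; simp add: algebra_simps)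
  moreover have "b = a" using upd3 [of a i] by (simp only: b_def x_def y_def z_def)
  ultimately show ?thesis by simp
qed

lemma S_commute:
  assumes "Suc i < j"
  shows "S i (S j f) = S j (S i f)"
proof
  fix a :: "nat \<Rightarrow> bool"
  have tw: "a(j := p, Suc j := q, i := r, Suc i := s) = a(i := r, Suc i := s, j := p, Suc j := q)" for p q r s
    using assms by (auto simp: fun_eq_iff)
  show "S i (S j f) a = S j (S i f) a"
    using assms by (cases "a i"; cases "a (Suc i)"; cases "a j"; cases "a (Suc j)"; simp add: S_def tw algebra_simps)
qed

definition S_inv :: "nat \<Rightarrow> spin \<Rightarrow> spin" where
  "S_inv i f a = (S i f a - (1 - Q) * f a) / Q"

lemma S_inverse: "S i (S_inv i f) = f" "S_inv i (S i f) = f"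
proof -
  have "S_inv i f = (\<lambda>a. (1 / Q) * S i f a + (- (1 - Q) / Q) * f a)" for f
    using Q0 by (rule_tac ext) (simp add: S_inv_def field_simps)
  then have "S i (S_inv i f) = (\<lambda>a. (1 / Q) * S i (S i f) a + (- (1 - Q) / Q) * S i f a)"
    by (simp only: S_lincomb)
  also have "\<dots> = f" using Q0 by (auto simp: S_square fun_eq_iff field_simps)
  finally show "S i (S_inv i f) = f" .
  show "S_inv i (S i f) = f" using Q0 by (rule_tac ext) (simp add: S_inv_def S_square)
qed

section \<open>The commuting action of the quantum group\<close>

fun ones :: "nat \<Rightarrow> (nat \<Rightarrow> bool) \<Rightarrow> nat" where
  "ones 0 a = 0"
| "ones (Suc n) a = ones n a + (if a n then 1 else 0)"

lemma ones_upd [simp]: "n \<le> i \<Longrightarrow> ones n (a(i := x)) = ones n a"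
  by (induction n) auto

lemma ones_swap:
  assumes "Suc i < n" "a i = x" "a (Suc i) = y"
  shows "ones n (a(i := y, Suc i := x)) = ones n a"
proof -
  define b where "b = a(i := y, Suc i := x)"
  have b: "b i = y" "b (Suc i) = x" "ones i b = ones i a" "\<And>j. j \<noteq> i \<Longrightarrow> j \<noteq> Suc i \<Longrightarrow> b j = a j"
    using ones_upd [of i i] ones_upd [of i "Suc i"] by (simp_all add: b_def)
  have "Suc (Suc i) \<le> n" using assms by simp
  then have "ones n b = ones n a"
    by (induction n rule: dec_induct) (simp_all add: b assms)
  then show ?thesis by (simp only: b_def)
qed

text \<open>
  The raising and lowering operators of the quantum group of \<open>sl\<^sub>2\<close> on the first \<open>n\<close> sites.
\<close>

fun E :: "nat \<Rightarrow> spin \<Rightarrow> spin" where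
  "E 0 f a = 0"
| "E (Suc n) f a = E n f a + (if a n then Q ^ ones n a * f (a(n := False)) else 0)"

fun F :: "nat \<Rightarrow> spin \<Rightarrow> spin" where
  "F 0 f a = 0"
| "F (Suc n) f a = (if a n then F n f a else Q * F n f a + f (a(n := True)))"

lemma E_S_low: "k \<le> i \<Longrightarrow> E k (S i f) a = S i (E k f) a"
proof (induction k arbitrary: a)
  case (Suc k)
  have [simp]: "a(k := p, i := r, Suc i := s) = a(i := r, Suc i := s, k := p)" for a :: "nat \<Rightarrow> bool" and p r s
    using Suc.prems by (auto simp: fun_eq_iff)
  show ?case
    using Suc by (cases "a i"; cases "a (Suc i)"; cases "a k"; simp add: S_def algebra_simps)
qed (simp add: S_def)

lemma F_S_low: "k \<le> i \<Longrightarrow> F k (S i f) a = S i (F k f) a"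
proof (induction k arbitrary: a)
  case (Suc k)
  have [simp]: "a(k := p, i := r, Suc i := s) = a(i := r, Suc i := s, k := p)" for a :: "nat \<Rightarrow> bool" and p r s
    using Suc.prems by (auto simp: fun_eq_iff)
  show ?case
    using Suc by (cases "a i"; cases "a (Suc i)"; cases "a k"; simp add: S_def algebra_simps)
qed (simp add: S_def)

text \<open>Quantum Schur-Weyl duality. The sites below \<open>i\<close> are covered by
  \<open>E_S_low\<close>, the two sites of \<open>S i\<close> are the base case, and a later site
  sees these two only through \<open>ones\<close>, which an exchange does not change.\<close>

lemma E_S:
  assumes "Suc i < n"
  shows "E n (S i f) a = S i (E n f) a"
proof -
  have "Suc (Suc i) \<le> n" using assms by simp
  then show ?thesis
  proof (induction n arbitrary: a rule: dec_induct)
    case base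
    have [simp]: "a(i := p, Suc i := q, i := r) = a(i := r, Suc i := q)" for a :: "nat \<Rightarrow> bool" and p q r
      by (auto simp: fun_eq_iff)
    have [simp]: "\<not> a i \<Longrightarrow> a(i := False) = a" "\<not> a (Suc i) \<Longrightarrow> a(Suc i := False) = a"
      "a i \<Longrightarrow> a(i := True) = a" "a (Suc i) \<Longrightarrow> a(Suc i := True) = a"
      "\<not> a i \<Longrightarrow> a(i := False, Suc i := q) = a(Suc i := q)" "a i \<Longrightarrow> a(i := True, Suc i := q) = a(Suc i := q)"
      "\<not> a (Suc i) \<Longrightarrow> a(i := q, Suc i := False) = a(i := q)" "a (Suc i) \<Longrightarrow> a(i := q, Suc i := True) = a(i := q)"
      for q by (auto simp: fun_eq_iff)
    show ?case
      by (cases "a i"; cases "a (Suc i)"; simp add: E_S_low; simp add: S_def algebra_simps)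
  next
    case (step n)
    have [simp]: "a(n := p, i := r, Suc i := s) = a(i := r, Suc i := s, n := p)" for a :: "nat \<Rightarrow> bool" and p r s
      using step.hyps by (auto simp: fun_eq_iff)
    have ones: "a i = x \<Longrightarrow> a (Suc i) = y \<Longrightarrow> ones n (a(i := y, Suc i := x)) = ones n a" for x y
      using ones_swap step.hyps by simp
    show ?case
      using step.hyps step.IH ones [of True False] ones [of False True]
      by (cases "a i"; cases "a (Suc i)"; cases "a n"; simp add: S_def algebra_simps)
  qed
qed

lemma F_S:
  assumes "Suc i < n"
  shows "F n (S i f) a = S i (F n f) a"
proof -
  have "Suc (Suc i) \<le> n" using assms by simp
  then show ?thesis
  proof (induction n arbitrary: a rule: dec_induct)
    case base
    have [simp]: "a(i := p, Suc i := q, i := r) = a(i := r, Suc i := q)" for a :: "nat \<Rightarrow> bool" and p q r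
      by (auto simp: fun_eq_iff)
    have [simp]: "\<not> a i \<Longrightarrow> a(i := False) = a" "\<not> a (Suc i) \<Longrightarrow> a(Suc i := False) = a"
      "a i \<Longrightarrow> a(i := True) = a" "a (Suc i) \<Longrightarrow> a(Suc i := True) = a"
      "\<not> a i \<Longrightarrow> a(i := False, Suc i := q) = a(Suc i := q)" "a i \<Longrightarrow> a(i := True, Suc i := q) = a(Suc i := q)"
      "\<not> a (Suc i) \<Longrightarrow> a(i := q, Suc i := False) = a(i := q)" "a (Suc i) \<Longrightarrow> a(i := q, Suc i := True) = a(i := q)"
      for q by (auto simp: fun_eq_iff)
    show ?case
      by (cases "a i"; cases "a (Suc i)"; simp add: F_S_low; simp add: S_def algebra_simps)
  next
    case (step n)
    have [simp]: "a(n := p, i := r, Suc i := s) = a(i := r, Suc i := s, n := p)" for a :: "nat \<Rightarrow> bool" and p r s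
      using step.hyps by (auto simp: fun_eq_iff)
    show ?case
      using step.hyps step.IH
      by (cases "a i"; cases "a (Suc i)"; cases "a n"; simp add: S_def algebra_simps)
  qed
qed

lemma F_diff: "F n (\<lambda>a. f a - c * g a) a = F n f a - c * F n g a"
proof (induction n arbitrary: a)
  case (Suc n)
  show ?case by (cases "a n") (simp_all add: Suc.IH, simp add: algebra_simps)
qed simp

lemma E_nonzero: "E n f a \<noteq> 0 \<Longrightarrow> \<exists>j<n. a j \<and> f (a(j := False)) \<noteq> 0"
proof (induction n)
  case (Suc n)
  show ?case
  proof (cases "E n f a = 0")
    case True
    then have "a n" "f (a(n := False)) \<noteq> 0" using Suc.prems by (simp_all split: if_splits)
    then show ?thesis by blast
  next
    case False
    then show ?thesis using Suc.IH less_SucI by blast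
  qed
qed simp

lemma F_nonzero: "F n f a \<noteq> 0 \<Longrightarrow> \<exists>j<n. \<not> a j \<and> f (a(j := True)) \<noteq> 0"
proof (induction n)
  case (Suc n)
  show ?case
  proof (cases "F n f a = 0")
    case True
    then have "\<not> a n" "f (a(n := True)) \<noteq> 0" using Suc.prems by (simp_all split: if_splits)
    then show ?thesis by blast
  next
    case False
    then show ?thesis using Suc.IH less_SucI by blast
  qed
qed simp

text \<open>Site \<open>k\<close> carried once around all sites below it. For \<open>k = N\<close>
  the corresponding braid is trivial on the sphere: it is the last relation of the presentation by
  half-twists, with the marked points numbered from the other end.\<close>

fun full_turn :: "nat \<Rightarrow> spin \<Rightarrow> spin" where
  "full_turn 0 f = f"
| "full_turn (Suc k) f = S k (full_turn k (S k f))"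

text \<open>Only entries with \<open>\<not> a k\<close> are computed. There the correction to a
  diagonal operator is \<open>E k\<close>, whose value on a singlet is known from
  \<open>E (Suc k) f = 0\<close>.\<close>

lemma full_turn_row:
  "\<not> a k \<Longrightarrow> full_turn k f a = Q ^ ones k a * f a + (1 - Q) * E k f (a(k := True))"
proof (induction k arbitrary: f a)
  case (Suc k)
  show ?case
  proof (cases "a k")
    case False
    have "full_turn (Suc k) f a = full_turn k (S k f) a"
      using False Suc.prems by (simp add: S_def)
    also have "\<dots> = Q ^ ones k a * f a + (1 - Q) * S k (E k f) (a(k := True))"
      using False Suc.prems by (subst Suc.IH) (simp_all add: E_S_low, simp add: S_def)
    also have "S k (E k f) (a(k := True)) = E k f (a(Suc k := True))"
    proof -
      have "a(k := False, Suc k := True) = a(Suc k := True)" using False by (auto simp: fun_eq_iff)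
      then show ?thesis using Suc.prems by (simp add: S_def)
    qed
    moreover have "E (Suc k) f (a(Suc k := True)) = E k f (a(Suc k := True))"
      by (subst E.simps(2)) (use False in simp)
    moreover have "ones (Suc k) a = ones k a" using False by simp
    ultimately show ?thesis by (simp only:)
  next
    case True
    have [simp]: "a(k := False, Suc k := True, k := True, Suc k := False) = a" "a(k := True, Suc k := False) = a" "a(Suc k := False) = a"
      "a(k := False, Suc k := True, k := True) = a(Suc k := True)" "a(Suc k := True, k := False) = a(k := False, Suc k := True)"
      using True Suc.prems by (auto simp: fun_eq_iff)
    have "full_turn (Suc k) f a = full_turn k (S k f) (a(k := False, Suc k := True))"
      using True Suc.prems by (simp add: S_def)
    also have "\<dots> = Q ^ ones k a * S k f (a(k := False, Suc k := True)) + (1 - Q) * S k (E k f) (a(Suc k := True))"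
      by (subst Suc.IH) (simp_all add: E_S_low)
    also have "S k (E k f) (a(Suc k := True)) = E k f (a(Suc k := True))"
      using True by (simp add: S_def)
    also have "S k f (a(k := False, Suc k := True)) = (1 - Q) * f (a(k := False, Suc k := True)) + Q * f a"
      by (simp add: S_def)
    moreover have "E (Suc k) f (a(Suc k := True))
        = E k f (a(Suc k := True)) + Q ^ ones k a * f (a(k := False, Suc k := True))"
      by (subst E.simps(2)) (use True in simp)
    moreover have "ones (Suc k) a = Suc (ones k a)" using True by simp
    ultimately show ?thesis
      by (simp only: power_Suc distrib_left distrib_right left_diff_distrib right_diff_distrib ac_simps)
  qed
qed simp

text \<open>The singlets of the quantum group.\<close>

definition W :: "nat \<Rightarrow> nat \<Rightarrow> spin set" where
  "W n h = {f. (\<forall>a. f a \<noteq> 0 \<longrightarrow> (\<forall>j\<ge>n. \<not> a j) \<and> ones n a = h) \<and>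
              E n f = (\<lambda>a. 0) \<and> F n f = (\<lambda>a. 0)}"

lemma S_W:
  assumes "Suc i < n" "f \<in> W n h"
  shows "S i f \<in> W n h"
proof -
  have sup: "f a \<noteq> 0 \<Longrightarrow> (\<forall>j\<ge>n. \<not> a j) \<and> ones n a = h" for a using assms(2) unfolding W_def by blast
  have "(\<forall>j\<ge>n. \<not> a j) \<and> ones n a = h" if ne: "S i f a \<noteq> 0" for a
  proof -
    define b where "b = a(i := a (Suc i), Suc i := a i)"
    have "S i f a = 0" if "f a = 0" "f b = 0"
      using that by (cases "a i"; cases "a (Suc i)") (simp_all add: S_def b_def)
    then consider "f a \<noteq> 0" | "f b \<noteq> 0" using ne by blast
    then show ?thesis
    proof cases
      case 2
      have "ones n b = ones n a" unfolding b_def by (rule ones_swap [OF assms(1) refl refl])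
      moreover have "b j = a j" if "j \<ge> n" for j
        using that assms(1) by (simp add: b_def)
      ultimately show ?thesis using sup [OF 2] by simp
    qed (use sup in blast)
  qed
  moreover have "E n (S i f) = (\<lambda>a. 0)" "F n (S i f) = (\<lambda>a. 0)"
  proof -
    have "E n f = (\<lambda>a. 0)" "F n f = (\<lambda>a. 0)" using assms(2) by (simp_all add: W_def)
    then show "E n (S i f) = (\<lambda>a. 0)" "F n (S i f) = (\<lambda>a. 0)"
      by (intro ext; simp add: E_S [OF assms(1)] F_S [OF assms(1)])+
  qed
  ultimately show ?thesis unfolding W_def by blast
qed

lemma W_lincomb: 
  assumes "f \<in> W n h" "g \<in> W n h"
  shows "(\<lambda>a. x * f a + y * g a) \<in> W n h"
proof -
  have E: "E n (\<lambda>a. x * f a + y * g a) a = x * E n f a + y * E n g a" for a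
    by (induction n arbitrary: a) (simp_all add: algebra_simps)
  have F: "F n (\<lambda>a. x * f a + y * g a) a = x * F n f a + y * F n g a" for a
    by (induction n arbitrary: a) (simp_all add: algebra_simps)
  have "(\<forall>j\<ge>n. \<not> a j) \<and> ones n a = h" if "x * f a + y * g a \<noteq> 0" for a
  proof -
    have "f a \<noteq> 0 \<or> g a \<noteq> 0" using that by auto
    then show ?thesis using assms unfolding W_def by blast
  qed
  moreover have "E n (\<lambda>a. x * f a + y * g a) = (\<lambda>a. 0)" "F n (\<lambda>a. x * f a + y * g a) = (\<lambda>a. 0)"
  proof -
    have "E n f = (\<lambda>a. 0)" "E n g = (\<lambda>a. 0)" "F n f = (\<lambda>a. 0)" "F n g = (\<lambda>a. 0)"
      using assms unfolding W_def by blast+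
    then show "E n (\<lambda>a. x * f a + y * g a) = (\<lambda>a. 0)" "F n (\<lambda>a. x * f a + y * g a) = (\<lambda>a. 0)"
      by (intro ext; simp add: E F)+
  qed
  ultimately show ?thesis unfolding W_def by blast
qed

text \<open>The entries with \<open>\<not> a N\<close> follow from \<open>full_turn_row\<close> and
  the vanishing of \<open>E\<close>. The difference \<open>d\<close> of the two sides is zero there
  and is still annihilated by \<open>F\<close>, which commutes with every \<open>S k\<close>. In
  \<open>F d\<close> at a configuration with site \<open>N\<close> false, all terms but one are such
  entries, so the remaining one, with site \<open>N\<close> true, vanishes as well.\<close>

lemma full_turn_W:
  assumes "f \<in> W (Suc N) h"
  shows "full_turn N f = (\<lambda>a. Q ^ Suc h * f a)"
proof -
  have wt: "f a \<noteq> 0 \<Longrightarrow> ones (Suc N) a = h" for a using assms by (simp add: W_def)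
  have E: "E (Suc N) f a = 0" and F: "F (Suc N) f a = 0" for a using assms by (simp_all add: W_def fun_eq_iff)
  define d where "d = (\<lambda>a. full_turn N f a - Q ^ Suc h * f a)"
  have d0: "d a = 0" if "\<not> a N" for a
  proof -
    have "E N f (a(N := True)) = - (Q ^ ones N a * f a)"
      using E [of "a(N := True)"] that by (simp add: eq_neg_iff_add_eq_0 fun_upd_idem)
    then have "full_turn N f a = Q ^ Suc (ones N a) * f a"
      using full_turn_row [of a N f, OF that] by (simp add: algebra_simps)
    then show ?thesis using wt [of a] that by (auto simp: d_def)
  qed
  have "F (Suc N) (full_turn k g) a = 0" if "k \<le> N" "\<And>a. F (Suc N) g a = 0" for k g a
    using that
  proof (induction k arbitrary: g a)
    case (Suc k)
    have "F (Suc N) (full_turn k (S k g)) = (\<lambda>a. 0)"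
      using Suc.prems by (intro ext Suc.IH) (simp_all only: F_S [of k "Suc N"], simp_all add: S_def del: F.simps)
    then show ?case using Suc.prems by (simp add: F_S del: F.simps)
  qed simp
  then have Fd: "F (Suc N) d a = 0" for a
    using F by (simp add: d_def F_diff del: F.simps)
  have "d a = 0" if "a N" for a
  proof -
    define b where "b = a(N := False)"
    have "F N d b = 0"
    proof (rule ccontr)
      assume "F N d b \<noteq> 0"
      then obtain j where "j < N" "d (b(j := True)) \<noteq> 0" using F_nonzero by blast
      then show False using d0 [of "b(j := True)"] by (simp add: b_def)
    qed
    then have "d (b(N := True)) = 0" using Fd [of b] by (simp add: b_def)
    moreover have "b(N := True) = a" using that by (simp add: b_def fun_upd_idem_iff)
    ultimately show ?thesis by simp
  qed
  then have "d a = 0" for a using d0 by blast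
  then show ?thesis by (auto simp: d_def)
qed

text \<open>The two-site eigenvector of \<open>S\<close> for the eigenvalue
  \<open>- Q\<close>.\<close>

definition singlet :: "bool \<Rightarrow> bool \<Rightarrow> complex" where
  "singlet x y = (if x = y then 0 else if x then 1 else - Q)"

text \<open>The cup diagram that pairs the sites \<open>2 * k\<close> and \<open>2 * k + 1\<close>.
  This is the fixed singlet from which the plane for the ping-pong is generated.\<close>

definition cup :: "nat \<Rightarrow> spin" where
  "cup h a = (if \<forall>j\<ge>2 * h. \<not> a j then \<Prod>k<h. singlet (a (2 * k)) (a (Suc (2 * k))) else 0)"

lemma cup_eigen:
  assumes "k < h"
  shows "S (2 * k) (cup h) = (\<lambda>a. - Q * cup h a)"
proof
  fix a
  have cup_split: "cup h b = (if \<forall>j\<ge>2 * h. \<not> b j then singlet (b (2 * k)) (b (Suc (2 * k))) *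
     (\<Prod>l\<in>{..<h} - {k}. singlet (b (2 * l)) (b (Suc (2 * l)))) else 0)" for b
    unfolding cup_def using assms by (subst prod.remove [of _ k]) auto
  have upd: "cup h (a(2 * k := x, Suc (2 * k) := y)) = (if \<forall>j\<ge>2 * h. \<not> a j then singlet x y *
     (\<Prod>l\<in>{..<h} - {k}. singlet (a (2 * l)) (a (Suc (2 * l)))) else 0)" for x y
  proof -
    have "(\<forall>j\<ge>2 * h. \<not> (a(2 * k := x, Suc (2 * k) := y)) j) \<longleftrightarrow> (\<forall>j\<ge>2 * h. \<not> a j)"
      using assms by (auto simp: fun_upd_def)
    moreover have "(\<Prod>l\<in>{..<h} - {k}. singlet ((a(2 * k := x, Suc (2 * k) := y)) (2 * l)) ((a(2 * k := x, Suc (2 * k) := y)) (Suc (2 * l))))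
      = (\<Prod>l\<in>{..<h} - {k}. singlet (a (2 * l)) (a (Suc (2 * l))))"
    proof (intro prod.cong refl)
      fix l assume "l \<in> {..<h} - {k}"
      then have "l \<noteq> k" by simp
      then have "2 * l \<noteq> 2 * k" "2 * l \<noteq> Suc (2 * k)" "Suc (2 * l) \<noteq> 2 * k" "Suc (2 * l) \<noteq> Suc (2 * k)"
        by presburger+
      then show "singlet ((a(2 * k := x, Suc (2 * k) := y)) (2 * l)) ((a(2 * k := x, Suc (2 * k) := y)) (Suc (2 * l)))
          = singlet (a (2 * l)) (a (Suc (2 * l)))" by simp
    qed
    ultimately show ?thesis by (subst cup_split) (auto simp del: fun_upd_apply, auto)
  qed
  have "a = a(2 * k := a (2 * k), Suc (2 * k) := a (Suc (2 * k)))" by auto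
  then have "cup h a = (if \<forall>j\<ge>2 * h. \<not> a j then singlet (a (2 * k)) (a (Suc (2 * k))) *
     (\<Prod>l\<in>{..<h} - {k}. singlet (a (2 * l)) (a (Suc (2 * l)))) else 0)"
    using cup_split by blast
  moreover define supp where "supp = (\<forall>j\<ge>2 * h. \<not> a j)"
  moreover define c where "c = (if \<forall>j\<ge>2 * h. \<not> a j
     then \<Prod>l\<in>{..<h} - {k}. singlet (a (2 * l)) (a (Suc (2 * l))) else 0)"
  ultimately have "cup h a = singlet (a (2 * k)) (a (Suc (2 * k))) * c"
    and upd: "\<And>x y. cup h (a(2 * k := x, Suc (2 * k) := y)) = singlet x y * c"
    using upd unfolding supp_def [symmetric] by simp_all
  then show "S (2 * k) (cup h) a = - Q * cup h a"
    by (cases "a (2 * k)"; cases "a (Suc (2 * k))"; simp add: S_def upd; simp add: singlet_def algebra_simps)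
qed

definition cup_top :: "nat \<Rightarrow> nat \<Rightarrow> bool" where
  "cup_top h = (\<lambda>j. j < 2 * h \<and> even j)"

lemma cup_top_value: "cup h (cup_top h) = 1"
  by (auto simp: cup_def cup_top_def singlet_def intro!: prod.neutral)

text \<open>The eigenvector equation for a pair of sites expresses every value by the one where the
  pair is (True, False). Pair by pair all values reduce to the one at \<open>cup_top\<close>, so the
  common eigenspace is a line. In the Schur-type argument this takes the part of
  irreducibility.\<close>

lemma cup_unique:
  assumes "\<And>k. k < h \<Longrightarrow> S (2 * k) f = (\<lambda>a. - Q * f a)" "\<And>a. f a \<noteq> 0 \<Longrightarrow> \<forall>j\<ge>2 * h. \<not> a j"
  shows "f = (\<lambda>a. f (cup_top h) * cup h a)"
proof
  fix a
  have step: "f b = singlet (b (2 * k)) (b (Suc (2 * k))) * f (b(2 * k := True, Suc (2 * k) := False))"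
    if "k < h" for k b
  proof -
    have eq: "S (2 * k) f b = - Q * f b" for b using assms(1) [OF that] by simp
    show ?thesis
    proof (cases "b (2 * k) = b (Suc (2 * k))")
      case True
      have "(1 + Q) * f b = 0" using True eq [of b] by (simp add: S_def ring_distribs eq_neg_iff_add_eq_0)
      moreover have "1 + Q \<noteq> 0" using Qm1 by (metis add_eq_0_iff)
      ultimately show ?thesis using True by (simp add: singlet_def)
    next
      case False
      show ?thesis
      proof (cases "b (2 * k)")
        case True
        then have "b(2 * k := True, Suc (2 * k) := False) = b" using False by (intro ext) auto
        then show ?thesis using True False by (simp add: singlet_def)
      next
        case F: False
        let ?b = "b(2 * k := True, Suc (2 * k) := False)"
        have "?b(2 * k := False, Suc (2 * k) := True) = b" using F False by (intro ext) auto
        then show ?thesis using eq [of ?b] F False by (simp add: S_def singlet_def)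
      qed
    qed
  qed
  have iter: "f a = (\<Prod>k<m. singlet (a (2 * k)) (a (Suc (2 * k)))) * f (\<lambda>j. if j < 2 * m then even j else a j)"
    if "m \<le> h" for m
    using that
  proof (induction m)
    case (Suc m)
    let ?b = "\<lambda>j. if j < 2 * m then even j else a j"
    have "?b(2 * m := True, Suc (2 * m) := False) = (\<lambda>j. if j < 2 * Suc m then even j else a j)"
      by (auto simp: fun_eq_iff less_Suc_eq)
    then have "f ?b = singlet (a (2 * m)) (a (Suc (2 * m))) * f (\<lambda>j. if j < 2 * Suc m then even j else a j)"
      using step [of m ?b] Suc.prems by simp
    then show ?case using Suc by (simp add: mult.assoc)
  qed simp
  show "f a = f (cup_top h) * cup h a"
  proof (cases "\<forall>j\<ge>2 * h. \<not> a j")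
    case True
    then have "(\<lambda>j. if j < 2 * h then even j else a j) = cup_top h"
      by (auto simp: fun_eq_iff cup_top_def not_less)
    then show ?thesis using iter [of h] True by (simp add: cup_def)
  next
    case False
    then show ?thesis using assms(2) [of a] by (auto simp: cup_def)
  qed
qed

lemma cup_nonzero:
  assumes "cup h a \<noteq> 0"
  shows "\<And>j. j \<ge> 2 * h \<Longrightarrow> \<not> a j" "\<And>k. k < h \<Longrightarrow> a (2 * k) \<noteq> a (Suc (2 * k))" "ones (2 * h) a = h"
proof -
  show *: "\<And>j. j \<ge> 2 * h \<Longrightarrow> \<not> a j" using assms by (auto simp: cup_def split: if_splits)
  then have "(\<Prod>k<h. singlet (a (2 * k)) (a (Suc (2 * k)))) \<noteq> 0" using assms by (simp add: cup_def)
  then have nz: "singlet (a (2 * k)) (a (Suc (2 * k))) \<noteq> 0" if "k < h" for k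
    using that by (metis (no_types, lifting) finite_lessThan lessThan_iff prod_zero_iff)
  show k: "\<And>k. k < h \<Longrightarrow> a (2 * k) \<noteq> a (Suc (2 * k))"
    using nz by (force simp: singlet_def)
  have "m \<le> h \<Longrightarrow> ones (2 * m) a = m" for m
    by (induction m) (use k in \<open>auto simp: less_eq_Suc_le\<close>)
  then show "ones (2 * h) a = h" by simp
qed

lemma cup_top_flip: "j < 2 * h \<Longrightarrow> cup h ((cup_top h)(j := \<not> cup_top h j)) = 0"
proof (rule ccontr)
  assume j: "j < 2 * h" and ne: "cup h ((cup_top h)(j := \<not> cup_top h j)) \<noteq> 0"
  have "j div 2 < h" using j by auto
  from cup_nonzero(2) [OF ne this] j show False
    by (cases "even j") (auto simp: cup_top_def elim!: evenE oddE split: if_splits)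
qed

text \<open>\<open>E (2 * h) (cup h)\<close> and \<open>F (2 * h) (cup h)\<close> are again common
  eigenvectors, hence multiples of \<open>cup h\<close> by \<open>cup_unique\<close>. The factor is
  the value at \<open>cup_top h\<close>, a combination of values of \<open>cup h\<close> at
  configurations with one site flipped, and these vanish.\<close>

lemma cup_W: "cup h \<in> W (2 * h) h"
proof -
  have "E (2 * h) (cup h) = (\<lambda>a. E (2 * h) (cup h) (cup_top h) * cup h a)"
  proof (rule cup_unique)
    fix k assume k: "k < h"
    have "S (2 * k) (E (2 * h) (cup h)) a = E (2 * h) (S (2 * k) (cup h)) a" for a
      using k by (subst E_S) auto
    moreover have "E n (\<lambda>a. - (Q * f a)) a = - (Q * E n f a)" for n f a
      by (induction n arbitrary: a) (simp_all add: algebra_simps)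
    ultimately show "S (2 * k) (E (2 * h) (cup h)) = (\<lambda>a. - Q * E (2 * h) (cup h) a)"
      using cup_eigen [OF k] by auto
  next
    fix a assume "E (2 * h) (cup h) a \<noteq> 0"
    then obtain j where j: "j < 2 * h" "cup h (a(j := False)) \<noteq> 0" using E_nonzero by blast
    then show "\<forall>i\<ge>2 * h. \<not> a i" using cup_nonzero(1) [OF j(2)] by (auto simp: fun_upd_def split: if_splits)
  qed
  moreover have "E (2 * h) (cup h) (cup_top h) = 0"
    using E_nonzero [of "2 * h" "cup h" "cup_top h"] cup_top_flip [of _ h] by fastforce
  moreover have "F (2 * h) (cup h) = (\<lambda>a. F (2 * h) (cup h) (cup_top h) * cup h a)"
  proof (rule cup_unique)
    fix k assume k: "k < h"
    have "S (2 * k) (F (2 * h) (cup h)) a = F (2 * h) (S (2 * k) (cup h)) a" for a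
      using k by (subst F_S) auto
    moreover have "F n (\<lambda>a. - (Q * f a)) a = - (Q * F n f a)" for n f a
      by (induction n arbitrary: a) (simp_all add: algebra_simps)
    ultimately show "S (2 * k) (F (2 * h) (cup h)) = (\<lambda>a. - Q * F (2 * h) (cup h) a)"
      using cup_eigen [OF k] by auto
  next
    fix a assume "F (2 * h) (cup h) a \<noteq> 0"
    then obtain j where j: "j < 2 * h" "cup h (a(j := True)) \<noteq> 0" using F_nonzero by blast
    then show "\<forall>i\<ge>2 * h. \<not> a i" using cup_nonzero(1) [OF j(2)] by (auto simp: fun_upd_def split: if_splits)
  qed
  moreover have "F (2 * h) (cup h) (cup_top h) = 0"
    using F_nonzero [of "2 * h" "cup h" "cup_top h"] cup_top_flip [of _ h] by fastforce
  ultimately show ?thesis using cup_nonzero by (auto simp: W_def)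
qed

text \<open>The Temperley-Lieb relation on the sites 0, 1, 2, divided by \<open>1 + Q\<close>.
  Together with the quadratic relation it makes the plane of \<open>cup h\<close> and
  \<open>S 1 (cup h)\<close> invariant under \<open>S 0\<close> and \<open>S 1\<close>.\<close>

lemma S0_S1_cup:
  assumes "0 < h"
  shows "S 0 (S 1 (cup h)) = (\<lambda>a. S 1 (cup h) a - cup h a)"
proof
  fix a
  have e: "S 0 (cup h) = (\<lambda>a. - (Q * cup h a))" using cup_eigen [OF assms] by simp
  have sc: "S i (\<lambda>a. - (Q * f a)) = (\<lambda>a. - (Q * S i f a))" for i f
    using S_lincomb [of i "- Q" f 0 f] by simp
  have "cup h a + Q * cup h a - S 1 (cup h) a + S 0 (S 1 (cup h)) a - Q * S 1 (cup h) a + Q * S 0 (S 1 (cup h)) a = 0"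
    using S_temperley_lieb [of "cup h" a 0] by (simp add: e sc)
  then have "(1 + Q) * (cup h a - S 1 (cup h) a + S 0 (S 1 (cup h)) a) = 0" by (simp add: algebra_simps)
  moreover have "1 + Q \<noteq> 0" using Qm1 by (metis add_eq_0_iff)
  ultimately have "cup h a - S 1 (cup h) a + S 0 (S 1 (cup h)) a = 0" by (metis mult_eq_0_iff)
  then show "S 0 (S 1 (cup h)) a = S 1 (cup h) a - cup h a" by (simp add: algebra_simps)
qed

lemma cup_independent:
  assumes "1 < h" "\<And>a. x * cup h a + y * S 1 (cup h) a = 0"
  shows "x = 0" "y = 0"
proof -
  \<comment> \<open>The top configuration with the sites 1 and 2 exchanged: \<open>cup h\<close>
    vanishes here since the sites 0 and 1 agree, while \<open>S 1 (cup h)\<close> has the value of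
    \<open>cup h\<close> at \<open>cup_top h\<close>.\<close>
  define a where "a = (cup_top h)(1 := True, 2 := False)"
  have "a 0" "a 1" using assms(1) by (auto simp: a_def cup_top_def)
  then have "cup h a = 0" using cup_nonzero(2) [of h a 0] assms(1) by auto
  moreover have "a(1 := False, Suc 1 := True) = cup_top h"
    using assms(1) by (auto simp: a_def cup_top_def fun_eq_iff numeral_2_eq_2)
  then have "S 1 (cup h) a = 1" using assms(1)
    by (simp add: S_def cup_top_value) (simp add: a_def cup_top_def)
  ultimately show y: "y = 0" using assms(2) [of a] by simp
  show "x = 0" using assms(2) [of "cup_top h"] y by (simp add: cup_top_value)
qed

end

section \<open>Braid relations\<close>

declare add_uminus_conv_diff [simp del]

definition comm :: "'g::group_add \<Rightarrow> 'g \<Rightarrow> bool" where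
  "comm a b \<longleftrightarrow> a + b = b + a"

lemma comm_refl [simp]: "comm a a" by (simp add: comm_def)

lemma comm_zero [simp]: "comm a 0" "comm 0 a" by (simp_all add: comm_def)

lemma comm_add: "comm a b \<Longrightarrow> comm a c \<Longrightarrow> comm a (b + c)"
  unfolding comm_def by (metis add.assoc)

lemma comm_uminus: "comm a b \<Longrightarrow> comm a (- b)"
  unfolding comm_def by (metis add.assoc add.right_neutral left_minus right_minus add_0)

lemma comm_diff: "comm a b \<Longrightarrow> comm a c \<Longrightarrow> comm a (b - c)"
  by (metis comm_add comm_uminus add_uminus_conv_diff)

lemma comm_iff_conj: "comm a b \<longleftrightarrow> a + b - a = b"
  unfolding comm_def by (metis add_diff_cancel diff_add_cancel)

text \<open>The word \<open>s\<^sub>N\<^sub>-\<^sub>1 \<dots> s\<^sub>l\<close>, which carries strand \<open>l\<close> to the last position.\<close>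

definition shift_word :: "nat \<Rightarrow> nat \<Rightarrow> fgroup" where
  "shift_word N l = rec_nat 0 (\<lambda>d w. w + gen (N - Suc d)) (N - l)"

lemma shift_word_simps:
  "shift_word N N = 0" "l < N \<Longrightarrow> shift_word N l = shift_word N (Suc l) + gen l"
proof -
  assume "l < N"
  then have "N - l = Suc (N - Suc l)" "N - Suc (N - Suc l) = l" by auto
  then show "shift_word N l = shift_word N (Suc l) + gen l" by (simp add: shift_word_def)
qed (simp add: shift_word_def)

text \<open>The pure braid in which the last strand runs once around strand \<open>j\<close>:
  point-pushing of the last puncture. The value 0 for \<open>j \<ge> N\<close> merely completes the
  assignment to all generators of \<open>fgroup\<close>.\<close>

definition pure_word :: "nat \<Rightarrow> nat \<Rightarrow> fgroup" where
  "pure_word N j = (if j < N then shift_word N (Suc j) + gen j + gen j - shift_word N (Suc j) else 0)"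

fun turn_word :: "nat \<Rightarrow> fgroup" where
  "turn_word 0 = 0"
| "turn_word (Suc k) = gen k + turn_word k + gen k"

text \<open>Interpreted twice, by automorphisms of the free group and by operators on the spin
  chain. An identity between braid words that is proved here is available on both sides at
  once.\<close>

locale braid_family =
  fixes N :: nat and g :: "nat \<Rightarrow> 'g::group_add"
  assumes braid: "\<And>i. Suc i < N \<Longrightarrow> g i + g (Suc i) + g i = g (Suc i) + g i + g (Suc i)"
    and far: "\<And>i j. Suc i < j \<Longrightarrow> j < N \<Longrightarrow> comm (g i) (g j)"
begin

abbreviation C :: "nat \<Rightarrow> 'g" where "C l \<equiv> ev g (shift_word N l)"
abbreviation A :: "nat \<Rightarrow> 'g" where "A j \<equiv> ev g (pure_word N j)"

lemma C_simps: "C N = 0" "l < N \<Longrightarrow> C l = C (Suc l) + g l"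
  by (simp_all add: shift_word_simps ev_hom)

lemma A_eq: "j < N \<Longrightarrow> A j = C (Suc j) + g j + g j - C (Suc j)"
  by (simp add: pure_word_def ev_hom)

lemma comm_C: "Suc i < l \<Longrightarrow> l \<le> N \<Longrightarrow> comm (g i) (C l)"
proof (induction "N - l" arbitrary: l)
  case (Suc d)
  then have "comm (g i) (C (Suc l))" "comm (g i) (g l)" by (auto intro: far)
  then show ?case using Suc by (simp add: C_simps comm_add)
qed (simp add: C_simps)

text \<open>Sliding a crossing through the strand that the shift word carries across it lowers its
  index by one.\<close>

lemma C_shift: "l \<le> i \<Longrightarrow> Suc i < N \<Longrightarrow> C l + g (Suc i) = g i + C l"
proof (induction "i - l" arbitrary: l)
  case 0
  then have [simp]: "l = i" by simp
  have "C i + g (Suc i) = C (Suc (Suc i)) + (g (Suc i) + g i + g (Suc i))"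
    using 0 by (simp add: C_simps add.assoc)
  also have "\<dots> = (C (Suc (Suc i)) + g i) + g (Suc i) + g i"
    using 0 braid [of i] by (simp add: add.assoc)
  also have "C (Suc (Suc i)) + g i = g i + C (Suc (Suc i))"
    using comm_C [of i "Suc (Suc i)"] 0 by (simp add: comm_def)
  finally show ?case using 0 by (simp add: C_simps add.assoc)
next
  case (Suc d)
  have "C (Suc l) + g (Suc i) = g i + C (Suc l)" using Suc by simp
  moreover have "g l + g (Suc i) = g (Suc i) + g l" using far [of l "Suc i"] Suc by (simp add: comm_def)
  moreover have "C l = C (Suc l) + g l" using Suc by (simp add: C_simps)
  ultimately show ?case by (metis add.assoc)
qed

lemma conj_A_same:
  assumes "Suc i < N"
  shows "g i + A i - g i = A (Suc i)"
proof -
  define D p q where "D = C (Suc (Suc i))" and "p = g i" and "q = g (Suc i)"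
  have pq: "p + (q + p) = q + (p + q)" using braid [OF assms] by (simp add: p_def q_def add.assoc)
  have pD: "p + D = D + p" "p - D = - D + p"
    using comm_C [of i "Suc (Suc i)"] comm_uminus [OF comm_C [of i "Suc (Suc i)"]] assms
    by (simp_all add: comm_def D_def p_def diff_conv_add_uminus)
  have A: "A i = D + q + p + p - (D + q)" "A (Suc i) = D + q + q - D"
    using assms by (simp_all add: A_eq C_simps D_def p_def q_def)
  have "p + A i = (p + D) + (q + (p + p)) - (D + q)"
    by (simp add: A grp_norm)
  also have "\<dots> = D + ((p + (q + p)) + p) - (D + q)" by (simp add: pD add.assoc)
  also have "\<dots> = D + (q + (p + (q + p))) - (D + q)" by (simp only: pq add.assoc)
  also have "\<dots> = D + q + q + p + q - (D + q)" by (simp only: pq add.assoc)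
  also have "\<dots> = D + q + q + (p - D)" by (simp add: grp_norm)
  also have "\<dots> = A (Suc i) + p" by (simp only: pD A, simp add: grp_norm)
  finally show ?thesis by (metis p_def add_diff_cancel)
qed

lemma conj_A_next:
  assumes "Suc i < N"
  shows "g i + A (Suc i) - g i = - A (Suc i) + A i + A (Suc i)"
proof -
  define D p q where "D = C (Suc (Suc i))" and "p = g i" and "q = g (Suc i)"
  have pq: "p + (q + p) = q + (p + q)" using braid [OF assms] by (simp add: p_def q_def add.assoc)
  have pD: "p + D = D + p" "p - D = - D + p"
    using comm_C [of i "Suc (Suc i)"] comm_uminus [OF comm_C [of i "Suc (Suc i)"]] assms
    by (simp_all add: comm_def D_def p_def diff_conv_add_uminus)
  have A: "A i = D + q + p + p - (D + q)" "A (Suc i) = D + q + q - D"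
    using assms by (simp_all add: A_eq C_simps D_def p_def q_def)
  have AA: "A i + A (Suc i) = D + (q + (p + (p + q))) - D" by (simp add: A grp_norm)
  have "p + (A i + A (Suc i)) = (p + D) + (q + (p + (p + q))) - D" by (simp add: AA grp_norm)
  also have "\<dots> = D + ((p + (q + p)) + (p + q)) - D" by (simp only: pD add.assoc)
  also have "\<dots> = D + (q + (p + (q + (p + q)))) - D" by (simp only: pq add.assoc)
  also have "\<dots> = D + (q + (p + (p + (q + p)))) - D" by (simp only: pq)
  also have "\<dots> = D + (q + (p + (p + q))) + (p - D)" by (simp add: grp_norm)
  also have "\<dots> = A i + A (Suc i) + p" by (simp only: pD AA, simp add: grp_norm)
  finally have 1: "p + (A i + A (Suc i)) = A i + A (Suc i) + p" .
  have 2: "p + A i = A (Suc i) + p" using conj_A_same [OF assms] by (metis diff_add_cancel p_def)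
  have "A (Suc i) + (p + A (Suc i)) = A i + A (Suc i) + p" using 1 2 by (metis add.assoc)
  then have "p + A (Suc i) = - A (Suc i) + (A i + A (Suc i) + p)" by (metis minus_add_cancel)
  then have "p + A (Suc i) = - A (Suc i) + A i + A (Suc i) + p" by (simp add: add.assoc)
  then show ?thesis by (metis p_def add_diff_cancel)
qed

lemma comm_A:
  assumes "Suc i < N" "j < N" "j \<noteq> i" "j \<noteq> Suc i"
  shows "comm (g i) (A j)"
proof (cases "j < i")
  case True
  let ?D = "C (Suc j)"
  have sh: "?D + g (Suc i) = g i + ?D" using C_shift [of "Suc j" i] True assms by simp
  have "g j + g (Suc i) = g (Suc i) + g j" using far [of j "Suc i"] True assms by (simp add: comm_def)
  then have "?D + (g j + g j) + g (Suc i) = ?D + g (Suc i) + (g j + g j)"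
    by (metis add.assoc)
  also have "\<dots> = g i + (?D + (g j + g j))" using sh by (metis add.assoc)
  finally have 1: "?D + (g j + g j) + g (Suc i) = g i + (?D + (g j + g j))" .
  have 2: "g (Suc i) + - ?D = - ?D + g i"
    using sh by (metis add.assoc add_diff_cancel diff_conv_add_uminus minus_add_cancel)
  have "g i + A j = g i + (?D + (g j + g j)) - ?D" using assms by (simp add: A_eq grp_norm)
  also have "\<dots> = ?D + (g j + g j) + (g (Suc i) - ?D)" by (simp only: 1 [symmetric] diff_conv_add_uminus add.assoc)
  also have "\<dots> = A j + g i" using assms by (simp only: A_eq diff_conv_add_uminus add.assoc 2)
  finally show ?thesis by (simp add: comm_def)
next
  case False
  then have "comm (g i) (C (Suc j))" "comm (g i) (g j)"
    using assms by (auto intro: comm_C far)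
  then show ?thesis using assms by (simp add: A_eq comm_add comm_diff)
qed

text \<open>By \<open>conj_A_same\<close>, \<open>conj_A_next\<close> and \<open>comm_A\<close>,
  conjugation by \<open>g i\<close> acts on the \<open>A j\<close> as \<open>braid_gen N i\<close>
  acts on the generators. Hence in every braid family the braids of the first \<open>N\<close>
  strands act on the point-pushing elements as they act on the fundamental group.\<close>

lemma conj_pure:
  assumes "z \<in> letters_below (N - 1)" "x \<in> letters_below N"
  shows "ev g z + ev A x - ev g z = ev A (act N z x)"
proof -
  have conj_hom: "additive_map (\<lambda>x. t + ev A x - t)" for t
    by (simp add: additive_map_def ev_add grp_norm)
  have act_pure: "ev A (act N (gen i) x) = g i + ev A x - g i" if "i < N - 1" for i x
  proof -
    have "ev A (braid_gen N i j) = g i + A j - g i" for j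
    proof (cases "j < N")
      case True
      then show ?thesis
        using that conj_A_same [of i] conj_A_next [of i] comm_A [of i j]
        by (auto simp: braid_gen_def ev_hom comm_iff_conj)
    qed (auto simp: braid_gen_def pure_word_def)
    moreover have "additive_map (\<lambda>x. ev A (act N (gen i) x))"
      by (simp add: additive_map_def ev_add)
    ultimately show ?thesis
      using additive_map_ext [OF _ conj_hom [of "g i"], of "\<lambda>x. ev A (act N (gen i) x)" x] by simp
  qed
  have act_pure': "ev A (act N (- gen i) x) = - g i + ev A x + g i" if "i < N - 1" for i x
    using act_pure [OF that, of "act N (- gen i) x"] by (simp only: act_simps(4)) (simp add: grp_norm)
  show ?thesis using assms(1)
  proof (induction arbitrary: x rule: letters_below_induct)
    case (gen i z)
    have "ev g (gen i + z) + ev A x - ev g (gen i + z) = g i + (ev g z + ev A x - ev g z) - g i"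
      by (simp add: ev_hom grp_norm)
    then show ?case using gen act_pure by (simp only: act_simps(2))
  next
    case (minus_gen i z)
    have "ev g (- gen i + z) + ev A x - ev g (- gen i + z) = - g i + (ev g z + ev A x - ev g z) + g i"
      by (simp add: ev_hom grp_norm)
    then show ?case using minus_gen act_pure' by (simp only: act_simps(2))
  qed simp
qed

lemma pure_product: "k \<le> N \<Longrightarrow> ev A (ul k) = C k + ev g (turn_word k) - C k"
proof (induction k)
  case (Suc k)
  then have "ev A (ul (Suc k)) = C (Suc k) + g k + ev g (turn_word k) - (C (Suc k) + g k) + A k"
    by (simp add: ev_add C_simps)
  then show ?case using Suc.prems by (simp add: A_eq ev_add grp_norm)
qed simp

lemma turn_eq_pure: "ev g (turn_word N) = ev A (ul N)"
  using pure_product [of N] by (simp add: C_simps)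

end

lemma turn_word_letters: "turn_word k \<in> letters_below k"
  by (induction k) (auto intro!: letters_below_intros elim: letters_below_mono)

lemma shift_word_letters: "l \<le> N \<Longrightarrow> shift_word N l \<in> letters_below N"
proof (induction "N - l" arbitrary: l)
  case (Suc d)
  then show ?case by (simp add: shift_word_simps letters_below_intros)
qed (simp add: shift_word_simps letters_below_intros)

lemma act_letters:
  assumes "x \<in> letters_below N"
  shows "act N z x \<in> letters_below N"
proof -
  have ul: "k \<le> N \<Longrightarrow> ul k \<in> letters_below N" for k
    by (induction k) (simp_all add: letters_below_intros)
  have bg: "j < N \<Longrightarrow> braid_gen N i j \<in> letters_below N"
    "j < N \<Longrightarrow> braid_gen_inv N i j \<in> letters_below N" for i j
    using ul [of i] ul [of N]
    by (auto simp: braid_gen_def braid_gen_inv_def intro!: letters_below_intros simp del: ul.simps)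
  have "act N (gen i) x \<in> letters_below N" "act N (- gen i) x \<in> letters_below N"
    if "x \<in> letters_below N" for i x
    using that by (induction rule: letters_below_induct)
      (auto simp: ev_hom intro!: letters_below_intros bg)
  then show ?thesis using assms by (induction z rule: fgroup_induct) auto
qed

interpretation braid_act: braid_family N "braid_sym N" for N
proof
  fix i assume i: "Suc i < N"
  show "braid_sym N i + braid_sym N (Suc i) + braid_sym N i = braid_sym N (Suc i) + braid_sym N i + braid_sym N (Suc i)"
  proof (rule sym_eqI)
    fix x
    have "act N (gen i + gen (Suc i) + gen i) x = act N (gen (Suc i) + gen i + gen (Suc i)) x"
    proof (rule additive_map_ext_e [where N = N and f = "act N (gen i + gen (Suc i) + gen i)"
          and g = "act N (gen (Suc i) + gen i + gen (Suc i))"])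
      fix k
      show "act N (gen i + gen (Suc i) + gen i) (el N k) = act N (gen (Suc i) + gen i + gen (Suc i)) (el N k)"
        using i by (simp add: ev_braid_gen_e ev_hom grp_norm)
    qed (simp_all add: ev_braid_gen_ge)
    then show "app (braid_sym N i + braid_sym N (Suc i) + braid_sym N i) x =
      app (braid_sym N (Suc i) + braid_sym N i + braid_sym N (Suc i)) x" by simp
  qed
next
  fix i j assume i: "Suc i < j" "j < N"
  have "braid_sym N i + braid_sym N j = braid_sym N j + braid_sym N i"
  proof (rule sym_eqI)
    fix x
    have "act N (gen i + gen j) x = act N (gen j + gen i) x"
    proof (rule additive_map_ext_e [where N = N and f = "act N (gen i + gen j)" and g = "act N (gen j + gen i)"])
      fix k
      show "act N (gen i + gen j) (el N k) = act N (gen j + gen i) (el N k)"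
        using i by (simp add: ev_braid_gen_e ev_hom grp_norm)
    qed (simp_all add: ev_braid_gen_ge)
    then show "app (braid_sym N i + braid_sym N j) x = app (braid_sym N j + braid_sym N i) x" by simp
  qed
  then show "comm (braid_sym N i) (braid_sym N j)" by (simp add: comm_def)
qed

text \<open>The turn of strand \<open>k\<close> conjugates each \<open>el N j\<close> with
  \<open>j \<le> k\<close> by the loop around puncture \<open>k\<close>. For \<open>k = N\<close>
  that loop is \<open>- ul N\<close>, so the full turn acts by an inner automorphism.\<close>

lemma act_turn_word:
  assumes "k \<le> N"
  shows "act N (turn_word k) (el N j) =
    (if j \<le> k then - (- el N k + el N (Suc k)) + el N j + (- el N k + el N (Suc k)) else el N j)"
  using assms
proof (induction k arbitrary: j)
  case (Suc k)
  have IH: "act N (turn_word k) (el N j) =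
    (if j \<le> k then - (- el N k + el N (Suc k)) + el N j + (- el N k + el N (Suc k)) else el N j)" for j
    using Suc by simp
  consider "j \<le> k" | "j = Suc k" | "Suc (Suc k) \<le> j" by linarith
  then show ?case
    using Suc.prems
    by cases (simp_all add: act_hom IH ev_braid_gen_e ev_hom grp_norm)
qed simp

text \<open>\<open>ul N\<close> can replace the last generator in a free basis. The automorphism
  \<open>f\<close> that does so reduces the claim to the centralizer of a generator.\<close>

lemma centralizer_ul:
  assumes "comm a (ul N)" "0 < N"
  shows "a \<in> cyc (ul N)"
proof -
  obtain M where M: "N = Suc M" using assms(2) by (cases N) auto
  define f where "f = ev (\<lambda>j. if j = M then ul N else gen j)"
  define f' where "f' = ev (\<lambda>j. if j = M then - ul M + gen M else gen j)"
  have hom: "additive_map f" "additive_map f'" by (simp_all add: f_def f'_def)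
  have low: "f (ul M) = ul M" "f' (ul M) = ul M"
    unfolding f_def f'_def by (rule ev_u_fixed; simp)+
  have gens: "f (gen M) = ul N" "f' (gen M) = - ul M + gen M" "\<And>j. j \<noteq> M \<Longrightarrow> f (gen j) = gen j"
    "\<And>j. j \<noteq> M \<Longrightarrow> f' (gen j) = gen j" by (simp_all add: f_def f'_def)
  have "(f \<circ> f') x = id x" for x
  proof (rule additive_map_ext [where f = "f \<circ> f'" and g = id])
    fix j show "(f \<circ> f') (gen j) = id (gen j)"
      by (cases "j = M") (simp_all add: gens additive_mapD [OF hom(1)] low, simp add: M grp_norm)
  qed (use hom additive_map_comp in auto)
  then have inv: "f (f' a) = a" by simp
  have "f' (ul N) = gen M" by (simp add: M additive_mapD [OF hom(2)] low gens grp_norm)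
  then have "f' a + gen M = gen M + f' a"
    using assms(1) additive_mapD(1) [OF hom(2)] unfolding comm_def by metis
  then have "f' a \<in> cyc (gen M)" by (rule commutes_gen_imp_cyc)
  from cyc_image [OF hom(1) this] show ?thesis by (simp add: inv gens)
qed

section \<open>Words acting by inner automorphisms\<close>

definition acts_inner :: "nat \<Rightarrow> fgroup \<Rightarrow> bool" where
  "acts_inner N z \<longleftrightarrow> (\<exists>a. \<forall>x\<in>letters_below N. act N z x = a + x - a)"

lemma inner_zero [simp]: "acts_inner N 0"
  unfolding acts_inner_def by (rule exI [of _ 0]) simp

lemma inner_add: assumes "acts_inner N z" "acts_inner N w" shows "acts_inner N (z + w)"
proof -
  obtain a b where ab: "\<And>x. x \<in> letters_below N \<Longrightarrow> act N z x = a + x - a"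
    "\<And>x. x \<in> letters_below N \<Longrightarrow> act N w x = b + x - b"
    using assms by (auto simp: acts_inner_def)
  have "act N (z + w) x = (a + b) + x - (a + b)" if "x \<in> letters_below N" for x
  proof -
    have "act N z (act N w x) = a + act N w x - a" using ab(1) act_letters [OF that] by blast
    then show ?thesis using ab(2) [OF that] by (simp add: grp_norm)
  qed
  then show ?thesis unfolding acts_inner_def by blast
qed

lemma inner_uminus: assumes "acts_inner N z" shows "acts_inner N (- z)"
proof -
  obtain a where a: "\<And>x. x \<in> letters_below N \<Longrightarrow> act N z x = a + x - a"
    using assms by (auto simp: acts_inner_def)
  have "act N (- z) x = - act N (- z) a + x - - act N (- z) a" if "x \<in> letters_below N" for x
  proof -
    have "act N z (act N (- z) x) = a + act N (- z) x - a" using a act_letters [OF that] by blast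
    then have x: "x = a + act N (- z) x - a" by simp
    have "act N (- z) (act N z x) = act N (- z) (a + x - a)" using a [OF that] by simp
    then have "x = act N (- z) a + act N (- z) x - act N (- z) a" by (simp add: act_hom)
    then show ?thesis by (metis (no_types, lifting) add.assoc add_diff_cancel diff_add_cancel diff_conv_add_uminus minus_add_cancel minus_minus)
  qed
  then show ?thesis unfolding acts_inner_def by blast
qed

lemma inner_conj: assumes "acts_inner N z" shows "acts_inner N (w + z - w)"
proof -
  obtain a where a: "\<And>x. x \<in> letters_below N \<Longrightarrow> act N z x = a + x - a"
    using assms by (auto simp: acts_inner_def)
  have "act N (w + z - w) x = act N w a + x - act N w a" if "x \<in> letters_below N" for x
  proof -
    have "act N z (act N (- w) x) = a + act N (- w) x - a" using a act_letters [OF that] by blast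
    then show ?thesis by (simp add: act_hom)
  qed
  then show ?thesis unfolding acts_inner_def by blast
qed

lemma inner_turn_word: "acts_inner N (turn_word N)"
proof -
  have "act N (turn_word N) x = ul N + x - ul N" if "x \<in> letters_below N" for x
  proof -
    have hom: "additive_map (\<lambda>x. ul N + x - ul N)" by (simp add: additive_map_def grp_norm)
    have gens: "act N (turn_word N) (gen j) = ul N + gen j - ul N" if "j < N" for j
      by (rule additive_map_gen_cong [OF additive_map_act hom _ that])
        (simp add: act_turn_word, simp add: el_def grp_norm)
    show ?thesis using that
      by (induction rule: letters_below_induct) (simp_all add: act_hom gens del: act_simps, simp_all add: grp_norm)
  qed
  then show ?thesis unfolding acts_inner_def by blast
qed

text \<open>Inner automorphisms preserve the exponent sum \<open>d\<close>, and so do words in the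
  first \<open>N - 1\<close> braid generators. But the shift word sends \<open>gen l\<close> to
  \<open>- ul N\<close>, the loop at infinity, whose exponent sum is \<open>- N\<close> and not
  1.\<close>

lemma inner_degree:
  assumes "b \<in> letters_below (N - 1)" "l < N" 
  shows "\<not> acts_inner N (b + shift_word N l)"
proof
  define d :: "fgroup \<Rightarrow> int" where "d = ev (\<lambda>_. 1)"
  have d: "additive_map d" "\<And>j. d (gen j) = 1" by (simp_all add: d_def)
  note dh = additive_mapD [OF d(1)]
  have gens: "d (act N (gen i) x) = d x" "d (act N (- gen i) x) = d x" if "i < N - 1" for i x
  proof -
    have "d (braid_gen N i j) = 1" "d (braid_gen_inv N i j) = 1" for j
      using that by (auto simp: braid_gen_def braid_gen_inv_def dh d)
    moreover have "additive_map (\<lambda>x. d (act N (gen i) x))" "additive_map (\<lambda>x. d (act N (- gen i) x))"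
      by (simp_all add: additive_map_def ev_add dh)
    ultimately show "d (act N (gen i) x) = d x" "d (act N (- gen i) x) = d x"
      using additive_map_ext [OF _ d(1), of "\<lambda>x. d (act N (gen i) x)" x]
        additive_map_ext [OF _ d(1), of "\<lambda>x. d (act N (- gen i) x)" x] d(2) by simp_all
  qed
  have db: "d (act N b x) = d x" for x
    using assms(1)
  proof (induction rule: letters_below_induct)
    case (gen i z)
    then show ?case using gens(1) [of i "act N z x"] by (simp del: act_simps add: act_simps(2))
  next
    case (minus_gen i z)
    then show ?case using gens(2) [of i "act N z x"] by (simp del: act_simps add: act_simps(2))
  qed simp
  have "act N (shift_word N l) (gen l) = - ul N" using assms(2)
  proof (induction "N - l" arbitrary: l)
    case (Suc e)
    show ?case
    proof (cases "Suc l = N")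
      case True
      then show ?thesis by (simp add: shift_word_simps braid_gen_def)
    next
      case False
      then have "act N (shift_word N (Suc l)) (gen (Suc l)) = - ul N" using Suc by simp
      then show ?thesis using Suc.prems False by (simp add: shift_word_simps braid_gen_def)
    qed
  qed simp
  moreover have "d (ul k) = int k" for k by (induction k) (simp_all add: dh d)
  ultimately have 1: "d (act N (b + shift_word N l) (gen l)) = - int N"
    by (simp add: db dh)
  assume "acts_inner N (b + shift_word N l)"
  then obtain a where "act N (b + shift_word N l) (gen l) = a + gen l - a"
    using assms(2) letters_below_intros(2) unfolding acts_inner_def by blast
  then have "d (act N (b + shift_word N l) (gen l)) = 1"
    by (simp only: dh d)
  with 1 show False by simp
qed

context spin_chain
begin

definition spin_sym :: "nat \<Rightarrow> spin sym" where
  "spin_sym i = Abs_sym (S i)"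

lemma app_spin_sym [simp]: "app (spin_sym i) = S i" "app (- spin_sym i) = S_inv i"
  unfolding spin_sym_def using app_Abs_sym [of "S i" "S_inv i"] S_inverse by auto

sublocale rep: braid_family N spin_sym for N
proof
  fix i show "spin_sym i + spin_sym (Suc i) + spin_sym i = spin_sym (Suc i) + spin_sym i + spin_sym (Suc i)"
    by (rule sym_eqI) (simp add: S_braid)
next
  fix i j :: nat assume "Suc i < j"
  then show "comm (spin_sym i) (spin_sym j)"
    unfolding comm_def by (intro sym_eqI) (simp, rule S_commute)
qed

abbreviation rep :: "fgroup \<Rightarrow> spin sym" where "rep \<equiv> ev spin_sym"

end

declare add_uminus_conv_diff [simp]

context spin_chain
begin

lemma S_inv_eq: "S_inv i f = (\<lambda>a. (1 / Q) * S i f a + ((Q - 1) / Q) * f a)"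
  using Q0 by (rule_tac ext) (simp add: S_inv_def field_simps)

lemma S_inv_lincomb: "S_inv i (\<lambda>a. x * f a + y * g a) = (\<lambda>a. x * S_inv i f a + y * S_inv i g a)"
  unfolding S_inv_eq S_lincomb by (rule ext) (simp add: algebra_simps)

end

declare add_uminus_conv_diff [simp del]

context spin_chain
begin

definition linear_sym :: "spin sym \<Rightarrow> bool" where
  "linear_sym X \<longleftrightarrow> (\<forall>x y f g. app X (\<lambda>a. x * f a + y * g a) = (\<lambda>a. x * app X f a + y * app X g a))"

lemma linear_symD:
  "linear_sym X \<Longrightarrow> app X (\<lambda>a. x * f a + y * g a) = (\<lambda>a. x * app X f a + y * app X g a)"
  by (simp add: linear_sym_def)

lemma linear_sym_scale: "linear_sym X \<Longrightarrow> app X (\<lambda>a. x * f a) = (\<lambda>a. x * app X f a)"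
  using linear_symD [of X x f 0 f] by simp

lemma linear_rep: "linear_sym (rep z)"
proof (induction z rule: fgroup_induct)
  case zero
  then show ?case by (simp add: linear_sym_def)
next
  case (gen i z)
  then show ?case unfolding linear_sym_def by (simp add: ev_hom S_lincomb)
next
  case (minus_gen i z)
  then show ?case unfolding linear_sym_def by (simp add: ev_hom S_inv_lincomb)
qed

lemma rep_W:
  assumes "z \<in> letters_below N" "f \<in> W (Suc N) h"
  shows "app (rep z) f \<in> W (Suc N) h"
  using assms(1)
proof (induction rule: letters_below_induct)
  case (gen i z)
  then show ?case by (simp add: ev_hom S_W)
next
  case (minus_gen i z)
  have "S_inv i g \<in> W (Suc N) h" if "g \<in> W (Suc N) h" for g
  proof -
    have "S i g \<in> W (Suc N) h" using S_W [of i "Suc N" g h] that minus_gen.hyps by simp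
    then show ?thesis unfolding S_inv_eq using that by (rule W_lincomb)
  qed
  then show ?case using minus_gen by (simp add: ev_hom)
qed (use assms in simp)

section \<open>Braid words modulo those that are trivial on the sphere\<close>

definition scalar_on :: "spin set \<Rightarrow> spin sym \<Rightarrow> bool" where
  "scalar_on V X \<longleftrightarrow> (\<exists>s. s \<noteq> 0 \<and> (\<forall>f\<in>V. app X f = (\<lambda>a. s * f a)))"

lemma W_scale: "f \<in> W n h \<Longrightarrow> (\<lambda>a. s * f a) \<in> W n h"
  using W_lincomb [of f n h f s 0] by simp

lemma scalar_on_zero [simp]: "scalar_on V 0"
  unfolding scalar_on_def by (rule exI [of _ 1]) simp

lemma scalar_on_add:
  assumes "scalar_on (W n h) X" "scalar_on (W n h) Y"
  shows "scalar_on (W n h) (X + Y)"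
proof -
  obtain s t where "s \<noteq> 0" "t \<noteq> 0" "\<And>f. f \<in> W n h \<Longrightarrow> app X f = (\<lambda>a. s * f a)"
    "\<And>f. f \<in> W n h \<Longrightarrow> app Y f = (\<lambda>a. t * f a)"
    using assms by (auto simp: scalar_on_def)
  then show ?thesis unfolding scalar_on_def
    by (intro exI [of _ "s * t"]) (auto simp: W_scale mult.assoc)
qed

lemma scalar_on_uminus:
  assumes "scalar_on (W n h) X"
  shows "scalar_on (W n h) (- X)"
proof -
  obtain s where s: "s \<noteq> 0" "\<And>f. f \<in> W n h \<Longrightarrow> app X f = (\<lambda>a. s * f a)"
    using assms by (auto simp: scalar_on_def)
  have "app (- X) f = (\<lambda>a. (1 / s) * f a)" if "f \<in> W n h" for f
  proof -
    have "app X (\<lambda>a. (1 / s) * f a) = f"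
      using s W_scale [OF that, of "1 / s"] by simp
    then show ?thesis by (metis app_simps(3))
  qed
  then show ?thesis unfolding scalar_on_def using s(1) by (intro exI [of _ "1 / s"]) auto
qed

lemma scalar_on_conj:
  assumes "scalar_on (W (Suc N) h) (rep z)" "w \<in> letters_below N"
  shows "scalar_on (W (Suc N) h) (rep (w + z - w))"
proof -
  obtain s where s: "s \<noteq> 0" "\<And>f. f \<in> W (Suc N) h \<Longrightarrow> app (rep z) f = (\<lambda>a. s * f a)"
    using assms by (auto simp: scalar_on_def)
  have "app (rep (w + z - w)) f = (\<lambda>a. s * f a)" if "f \<in> W (Suc N) h" for f
  proof -
    have "app (rep (- w)) f \<in> W (Suc N) h" using rep_W assms(2) that letters_below_intros(4) by blast
    then have "app (rep (w + z - w)) f = app (rep w) (\<lambda>a. s * app (rep (- w)) f a)"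
      using s(2) by (simp add: ev_hom)
    also have "\<dots> = (\<lambda>a. s * app (rep w) (app (rep (- w)) f) a)"
      by (rule linear_sym_scale [OF linear_rep])
    finally show ?thesis by (simp add: ev_hom)
  qed
  then show ?thesis using s(1) unfolding scalar_on_def by blast
qed

text \<open>Words that are trivial both on the sphere, up to inner automorphisms, and projectively on \<open>W\<close>.\<close>

definition ker :: "nat \<Rightarrow> nat \<Rightarrow> fgroup set" where
  "ker N h = {z. acts_inner N z \<and> scalar_on (W (Suc N) h) (rep z)}"

lemma ker_intros:
  "0 \<in> ker N h" "a \<in> ker N h \<Longrightarrow> b \<in> ker N h \<Longrightarrow> a + b \<in> ker N h" "a \<in> ker N h \<Longrightarrow> - a \<in> ker N h"
  "a \<in> ker N h \<Longrightarrow> w \<in> letters_below N \<Longrightarrow> w + a - w \<in> ker N h"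
proof -
  show "a \<in> ker N h \<Longrightarrow> w \<in> letters_below N \<Longrightarrow> w + a - w \<in> ker N h"
    unfolding ker_def by (simp add: inner_conj scalar_on_conj del: ev_diff)
qed (simp_all add: ker_def inner_add inner_uminus ev_add ev_uminus scalar_on_add scalar_on_uminus)

text \<open>The relation of the sphere. It is the only source of elements of \<open>ker\<close>
  below, apart from words that are trivial both as automorphisms and as operators.\<close>

lemma turn_word_ker: "turn_word N \<in> ker N h"
proof -
  have "app (rep (turn_word k)) f = full_turn k f" for k f
    by (induction k arbitrary: f) (simp_all add: ev_hom)
  then have "scalar_on (W (Suc N) h) (rep (turn_word N))"
    unfolding scalar_on_def using full_turn_W Q0 by (intro exI [of _ "Q ^ Suc h"]) auto
  then show ?thesis using inner_turn_word by (simp add: ker_def)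
qed

definition eqv :: "nat \<Rightarrow> nat \<Rightarrow> fgroup \<Rightarrow> fgroup \<Rightarrow> bool" where
  "eqv N h a b \<longleftrightarrow> a - b \<in> ker N h"

lemma eqv_refl [simp]: "eqv N h a a" by (simp add: eqv_def ker_intros)

lemma eqv_trans: "eqv N h a b \<Longrightarrow> eqv N h b c \<Longrightarrow> eqv N h a c"
  unfolding eqv_def using ker_intros(2) [of "a - b" N h "b - c"] by (simp add: grp_norm)

lemma eqv_add_right: "eqv N h a b \<Longrightarrow> eqv N h (a + c) (b + c)"
  by (simp add: eqv_def grp_norm)

lemma eqv_add_left: "eqv N h a b \<Longrightarrow> c \<in> letters_below N \<Longrightarrow> eqv N h (c + a) (c + b)"
  unfolding eqv_def using ker_intros(4) [of "a - b" N h c] by (simp add: grp_norm)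

lemma eqv_uminus: "eqv N h a b \<Longrightarrow> a \<in> letters_below N \<Longrightarrow> eqv N h (- a) (- b)"
  unfolding eqv_def
  using ker_intros(3) [OF ker_intros(4) [of "a - b" N h "- a"]] letters_below_intros(4) [of a N]
  by (simp add: grp_norm)

lemma eqv_I:
  assumes "ev (braid_sym N) a = ev (braid_sym N) b" "rep a = rep b"
  shows "eqv N h a b"
proof -
  have "ev (braid_sym N) (a - b) = 0" "rep (a - b) = 0" using assms by (simp_all add: ev_diff)
  then have "acts_inner N (a - b)" "scalar_on (W (Suc N) h) (rep (a - b))"
    unfolding acts_inner_def act_def by (auto intro: exI [of _ 0])
  then show ?thesis by (simp add: eqv_def ker_def)
qed

text \<open>On the sphere, strand \<open>N - 1\<close> going around the last strand undoes its going
  around all the others. So for \<open>l = N - 1\<close> the word is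
  \<open>- turn_word (N - 1)\<close> modulo the full turn; the smaller \<open>l\<close> follow
  downwards by conjugation with \<open>gen l\<close>.\<close>

lemma pure_word_eqv:
  assumes "l < N"
  shows "\<exists>b\<in>letters_below (N - 1). eqv N h (pure_word N l) b"
  using assms
proof (induction "N - Suc l" arbitrary: l)
  case 0
  then obtain M where M: "N = Suc M" "l = M" by (cases N) auto
  have "- gen M + turn_word N - - gen M \<in> ker N h"
    by (rule ker_intros(4) [OF turn_word_ker]) (simp add: M letters_below_intros)
  then have k: "turn_word M + (gen M + gen M) \<in> ker N h" by (simp add: M grp_norm)
  have "- turn_word M \<in> letters_below N"
    using letters_below_mono [OF turn_word_letters [of M], of N] M by (simp add: letters_below_intros)
  from ker_intros(4) [OF k this]
  have "eqv N h (pure_word N M) (- turn_word M)"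
    unfolding eqv_def pure_word_def using M shift_word_simps(1) [of N] by (simp add: grp_norm)
  then show ?case using M turn_word_letters [of M] letters_below_intros(4) by auto
next
  case (Suc d)
  have l: "Suc l < N" "d = N - Suc (Suc l)" using Suc.hyps(2) by simp_all
  then obtain b where b: "b \<in> letters_below (N - 1)" "eqv N h (pure_word N (Suc l)) b"
    using Suc.hyps(1) [of "Suc l"] by blast
  note l = l(1)
  have "eqv N h (pure_word N l) (- gen l + pure_word N (Suc l) + gen l)"
  proof (rule eqv_I)
    show "ev (braid_sym N) (pure_word N l) = ev (braid_sym N) (- gen l + pure_word N (Suc l) + gen l)"
      using braid_act.conj_A_same [OF l] by (simp add: ev_hom flip: braid_act.conj_A_same [OF l]) (simp add: grp_norm)
    show "rep (pure_word N l) = rep (- gen l + pure_word N (Suc l) + gen l)"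
      by (simp add: ev_hom flip: rep.conj_A_same [OF l]) (simp add: grp_norm)
  qed
  moreover have "eqv N h (- gen l + pure_word N (Suc l) + gen l) (- gen l + b + gen l)"
    using b l by (intro eqv_add_right eqv_add_left letters_below_intros) auto
  moreover have "- gen l + b + gen l \<in> letters_below (N - 1)"
    using b l by (intro letters_below_intros) auto
  ultimately show ?case using eqv_trans by blast
qed

text \<open>Coset representatives for the stabilizer of the last strand: \<open>b\<close> fixes it,
  and \<open>shift_word N l\<close> brings strand \<open>l\<close> to its place. The statement is
  about \<open>- z\<close> because the induction puts letters in front of \<open>z\<close>, hence
  behind \<open>- z\<close>, where the shift word stands.\<close>

lemma coset_eqv:
  assumes "z \<in> letters_below N"
  shows "\<exists>b\<in>letters_below (N - 1). \<exists>l\<le>N. eqv N h (- z) (b + shift_word N l)"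
  using assms
proof (induction rule: letters_below_induct)
  case zero
  then show ?case using letters_below_intros(1) shift_word_simps(1) [of N]
    by (intro bexI [of _ 0] exI [of _ N]) auto
next
  have up: "\<exists>b'\<in>letters_below (N - 1). \<exists>l'\<le>N. eqv N h (b + (shift_word N l + t)) (b' + shift_word N l')"
    if b: "b \<in> letters_below (N - 1)" and l: "l \<le> N" and i: "i < N" and t: "t = gen i \<or> t = - gen i" for b l i t
  proof -
    have bN: "b \<in> letters_below N" using b letters_below_mono by (metis diff_le_self)
    have commute: "eqv N h (c + gen i) (gen j + c) \<and> eqv N h (c - gen i) (- gen j + c)"
      if "ev (braid_sym N) c + braid_sym N i = braid_sym N j + ev (braid_sym N) c"
        "rep c + spin_sym i = spin_sym j + rep c" for c j
    proof -
      have *: "x - y = - y' + x" if "x + y = y' + x" for x y y' :: "'g::group_add"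
        using that by (metis add.assoc add_diff_cancel diff_conv_add_uminus minus_add_cancel)
      show ?thesis using that by (auto intro!: eqv_I simp: ev_hom *)
    qed
    have fin: "\<exists>b'\<in>letters_below (N - 1). \<exists>l'\<le>N. eqv N h (b + (shift_word N l + t)) (b' + shift_word N l')"
      if "eqv N h (shift_word N l + t) (b'' + shift_word N l')" "b'' \<in> letters_below (N - 1)" "l' \<le> N" for b'' l'
    proof -
      have "eqv N h (b + (shift_word N l + t)) (b + (b'' + shift_word N l'))"
        using that(1) bN by (rule eqv_add_left)
      then show ?thesis using that b
        by (intro bexI [of _ "b + b''"] exI [of _ l']) (auto simp: add.assoc intro: letters_below_intros)
    qed
    \<comment> \<open>A letter behind the shift word slides through it, with its index kept or
      lowered, or it lengthens or shortens it. In the two middle cases one sign of the letter leaves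
      a squared generator over, which is absorbed as a \<open>pure_word\<close>.\<close>
    consider "Suc i < l" | "Suc i = l" | "i = l" | "l < i" by linarith
    then show ?thesis
    proof cases
      case 1
      have "eqv N h (shift_word N l + gen i) (gen i + shift_word N l) \<and>
          eqv N h (shift_word N l - gen i) (- gen i + shift_word N l)"
        using braid_act.comm_C [OF 1 l] rep.comm_C [OF 1 l] by (intro commute) (simp_all add: comm_def)
      moreover have "t \<in> letters_below (N - 1)"
        using t 1 l by (auto simp: letters_below_intros)
      ultimately show ?thesis using t fin [of t l] l by (auto simp: diff_conv_add_uminus)
    next
      case 2
      then have c: "shift_word N i = shift_word N l + gen i" using i shift_word_simps(2) by blast
      show ?thesis
      proof (cases "t = gen i")
        case True
        then show ?thesis using fin [of 0 i] c i letters_below_intros(1) by auto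
      next
        case False
        obtain b' where b': "b' \<in> letters_below (N - 1)" "eqv N h (pure_word N i) b'"
          using pure_word_eqv i by blast
        have pw: "pure_word N i \<in> letters_below N"
          using i shift_word_letters [of l N] l 2 by (auto simp: pure_word_def intro!: letters_below_intros)
        have "shift_word N l + t = - pure_word N i + shift_word N i"
          using False t i 2 by (simp add: c pure_word_def grp_norm)
        moreover have "eqv N h (- pure_word N i + shift_word N i) (- b' + shift_word N i)"
          using b' pw by (intro eqv_add_right eqv_uminus)
        ultimately show ?thesis using fin [of "- b'" i] b' i letters_below_intros(4) by auto
      qed
    next
      case 3
      then have c: "shift_word N l = shift_word N (Suc l) + gen i" using i shift_word_simps(2) by blast
      show ?thesis
      proof (cases "t = gen i")
        case False
        then show ?thesis using fin [of 0 "Suc l"] c i t 3 letters_below_intros(1) by (auto simp: grp_norm)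
      next
        case True
        obtain b' where b': "b' \<in> letters_below (N - 1)" "eqv N h (pure_word N i) b'"
          using pure_word_eqv i by blast
        have "shift_word N l + t = pure_word N i + shift_word N (Suc l)"
          using True i 3 by (simp add: c pure_word_def grp_norm)
        then show ?thesis using fin [of b' "Suc l"] b' i 3 eqv_add_right by auto
      qed
    next
      case 4
      then obtain j where j: "i = Suc j" "l \<le> j" by (cases i) auto
      have "eqv N h (shift_word N l + gen i) (gen j + shift_word N l) \<and>
          eqv N h (shift_word N l - gen i) (- gen j + shift_word N l)"
        using braid_act.C_shift [OF j(2), of N] rep.C_shift [OF j(2), of N] i j by (intro commute) simp_all
      moreover have "gen j \<in> letters_below (N - 1)" "- gen j \<in> letters_below (N - 1)"
        using i j by (simp_all add: letters_below_intros)
      ultimately show ?thesis using t fin [of "gen j" l] fin [of "- gen j" l] l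
        by (auto simp: diff_conv_add_uminus)
    qed
  qed
  {
    case (gen i z)
    then obtain b l where bl: "b \<in> letters_below (N - 1)" "l \<le> N" "eqv N h (- z) (b + shift_word N l)" by blast
    have "eqv N h (- (gen i + z)) (b + (shift_word N l + - gen i))"
      using eqv_add_right [OF bl(3), of "- gen i"] by (simp add: minus_add add.assoc)
    then show ?case using up [OF bl(1,2) gen.hyps(1), of "- gen i"] eqv_trans by blast
  next
    case (minus_gen i z)
    then obtain b l where bl: "b \<in> letters_below (N - 1)" "l \<le> N" "eqv N h (- z) (b + shift_word N l)" by blast
    have "eqv N h (- (- gen i + z)) (b + (shift_word N l + gen i))"
      using eqv_add_right [OF bl(3), of "gen i"] by (simp add: minus_add add.assoc)
    then show ?case using up [OF bl(1,2) minus_gen.hyps(1), of "gen i"] eqv_trans by blast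
  }
qed

text \<open>The quadratic relation expresses the square of \<open>S j\<close> as
  \<open>(1 - Q)\<close> times \<open>S j\<close> plus a scalar, and
  \<open>Q \<noteq> 1\<close>.\<close>

lemma comm_square_imp_comm:
  assumes "linear_sym X" "comm X (spin_sym j + spin_sym j)"
  shows "comm X (spin_sym j)"
  unfolding comm_def
proof (rule sym_eqI, rule ext)
  fix f a
  have "app (X + (spin_sym j + spin_sym j)) f = app ((spin_sym j + spin_sym j) + X) f"
    using assms(2) by (simp add: comm_def)
  then have "app X (S j (S j f)) a = S j (S j (app X f)) a" by simp
  then have "(1 - Q) * app X (S j f) a + Q * app X f a = (1 - Q) * S j (app X f) a + Q * app X f a"
    by (simp add: S_square linear_symD [OF assms(1)])
  then show "app (X + spin_sym j) f a = app (spin_sym j + X) f a" using Q1 by auto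
qed

text \<open>Downward induction: an operator that commutes with the shift word from
  \<open>l + 1\<close> and with \<open>pure_word N l\<close> commutes with the square of
  \<open>spin_sym l\<close>, hence with \<open>spin_sym l\<close> itself and with the next shift
  word.\<close>

lemma comm_pure_imp_comm:
  assumes "linear_sym X" "\<And>j. j < N \<Longrightarrow> comm X (rep (pure_word N j))" "j < N"
  shows "comm X (spin_sym j)"
proof -
  have "comm X (rep (shift_word N l)) \<and> (l < N \<longrightarrow> comm X (spin_sym l))" if "l \<le> N" for l
    using that
  proof (induction "N - l" arbitrary: l)
    case (Suc d)
    let ?C = "rep (shift_word N (Suc l))"
    have l: "l < N" using Suc by simp
    have C: "comm X ?C" using Suc by simp
    have "comm X (- ?C + rep (pure_word N l) + ?C)"
      by (intro comm_add comm_uminus C assms(2) l)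
    then have "comm X (spin_sym l + spin_sym l)" using l by (simp add: rep.A_eq grp_norm)
    then have "comm X (spin_sym l)" by (rule comm_square_imp_comm [OF assms(1)])
    then show ?case using C l by (simp add: rep.C_simps comm_add)
  qed (simp add: rep.C_simps)
  then show ?thesis using assms(3) by simp
qed

text \<open>Modulo \<open>ker\<close> the word becomes some \<open>b\<close> in the first
  \<open>N - 1\<close> generators, which acts as conjugation by an \<open>a\<close> in the
  centralizer of \<open>ul N\<close>. By \<open>conj_pure\<close> the operator of \<open>b\<close>
  conjugates every \<open>pure_word\<close> in the same way as \<open>a\<close> does when it is read
  as a product of these words. The quotient \<open>X\<close> of the two therefore commutes with all
  \<open>spin_sym j\<close>, and \<open>a\<close> itself becomes a power of the full turn, which is
  a scalar.\<close>

theorem inner_imp_scalar: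
  assumes z: "z \<in> letters_below N" "acts_inner N z" and N: "Suc N = 2 * h" "2 \<le> h"
  shows "\<exists>s. app (rep z) (cup h) = (\<lambda>a. s * cup h a) \<and> app (rep z) (S 1 (cup h)) = (\<lambda>a. s * S 1 (cup h) a)"
proof -
  let ?W = "W (Suc N) h"
  have cupW: "cup h \<in> ?W" using cup_W [of h] N by simp
  have S1W: "S 1 (cup h) \<in> ?W" using S_W [OF _ cupW, of 1] N by simp
  have "- z \<in> letters_below N" using z(1) by (rule letters_below_intros)
  from coset_eqv [OF this, of h] obtain b l where b: "b \<in> letters_below (N - 1)" "l \<le> N"
    and bz: "eqv N h z (b + shift_word N l)" by auto
  from bz have k: "z - (b + shift_word N l) \<in> ker N h" by (simp add: eqv_def)
  then have "acts_inner N (- (z - (b + shift_word N l)) + z)"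
    using z(2) by (intro inner_add inner_uminus) (auto simp: ker_def)
  then have "acts_inner N (b + shift_word N l)" by (simp add: grp_norm)
  \<comment> \<open>An inner automorphism does not carry a finite puncture to infinity.\<close>
  then have "l = N" using inner_degree [OF b(1), of l] b(2) by fastforce
  then have k: "z - b \<in> ker N h" and inb: "acts_inner N b"
    using k \<open>acts_inner N (b + shift_word N l)\<close> by (simp_all add: shift_word_simps)
  obtain a where a: "\<And>x. x \<in> letters_below N \<Longrightarrow> act N b x = a + x - a"
    using inb by (auto simp: acts_inner_def)
  let ?A = "ev (\<lambda>j. rep (pure_word N j))"
  have ulN: "ul k \<in> letters_below N" if "k \<le> N" for k
    using that by (induction k) (simp_all add: letters_below_intros)
  have "a + ul N - a = ul N" using a [OF ulN] act_e_last [OF b(1)] by simp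
  then have "comm a (ul N)" by (simp add: comm_iff_conj)
  then have "a \<in> cyc (ul N)" using N by (intro centralizer_ul) auto
  then have "?A a \<in> cyc (?A (ul N))" by (rule cyc_image [OF additive_map_ev])
  moreover have "?A (ul N) = rep (turn_word N)" using rep.turn_eq_pure [of N] by simp
  moreover have turn: "scalar_on ?W (rep (turn_word N))" using turn_word_ker [of N h] by (simp add: ker_def)
  moreover have "scalar_on ?W X" if "X \<in> cyc (rep (turn_word N))" for X
    using that turn by induction (simp_all add: scalar_on_add scalar_on_uminus diff_conv_add_uminus)
  ultimately have scA: "scalar_on ?W (- ?A a)" by (simp add: scalar_on_uminus)
  define X where "X = - ?A a + rep b"
  have "comm X (rep (pure_word N j))" if "j < N" for j
  proof -
    have "gen j \<in> letters_below N" using that by (rule letters_below_intros)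
    from rep.conj_pure [OF b(1) this] a [OF this]
    have "rep b + rep (pure_word N j) - rep b = ?A a + rep (pure_word N j) - ?A a"
      by (simp add: ev_hom)
    then have "- ?A a + (rep b + rep (pure_word N j) - rep b) + ?A a = rep (pure_word N j)"
      by (simp add: grp_norm)
    then show ?thesis unfolding comm_iff_conj X_def by (simp add: grp_norm)
  qed
  moreover have "linear_sym X"
  proof -
    have "?A a = rep (ev (pure_word N) a)"
      using additive_map_ext [of ?A "rep \<circ> ev (pure_word N)" a]
        additive_map_comp [OF additive_map_ev additive_map_ev, of spin_sym "pure_word N"] by simp
    then have "X = rep (- ev (pure_word N) a + b)" by (simp add: X_def ev_hom)
    then show ?thesis using linear_rep by simp
  qed
  ultimately have commX: "comm X (spin_sym j)" if "j < N" for j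
    using comm_pure_imp_comm that by blast
  then have XS: "app X (S j f) = S j (app X f)" if "j < N" for j f
  proof -
    have "app (X + spin_sym j) f = app (spin_sym j + X) f" using commX [OF that] by (simp add: comm_def)
    then show ?thesis by simp
  qed
  obtain t where t: "t \<noteq> 0" "\<And>f. f \<in> ?W \<Longrightarrow> app (- ?A a) f = (\<lambda>x. t * f x)"
    using scA by (auto simp: scalar_on_def)
  have bW: "app (rep b) f \<in> ?W" if "f \<in> ?W" for f
    using rep_W [OF letters_below_mono [OF b(1)] that] by simp
  have Xb: "app X f = (\<lambda>x. t * app (rep b) f x)" if "f \<in> ?W" for f
    using t(2) [OF bW [OF that]] by (simp add: X_def)
  have XW: "app X (cup h) \<in> ?W" using Xb [OF cupW] W_scale [OF bW [OF cupW]] by simp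
  obtain s where s: "app X (cup h) = (\<lambda>a. s * cup h a)"
  proof -
    have "app X (cup h) = (\<lambda>a. app X (cup h) (cup_top h) * cup h a)"
    proof (rule cup_unique)
      fix k assume "k < h"
      then have "S (2 * k) (app X (cup h)) = app X (\<lambda>a. - Q * cup h a)"
        using XS [of "2 * k" "cup h"] cup_eigen [of k h] N by simp
      then show "S (2 * k) (app X (cup h)) = (\<lambda>a. - Q * app X (cup h) a)"
        using linear_sym_scale [OF \<open>linear_sym X\<close>, of "- Q" "cup h"] by simp
    next
      fix a assume "app X (cup h) a \<noteq> 0"
      then show "\<forall>j\<ge>2 * h. \<not> a j" using XW N unfolding W_def by force
    qed
    then show ?thesis using that by blast
  qed
  have s1: "app X (S 1 (cup h)) = (\<lambda>a. s * S 1 (cup h) a)"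
  proof -
    have "S 1 (\<lambda>a. s * cup h a) = (\<lambda>a. s * S 1 (cup h) a)" using S_lincomb [of 1 s "cup h" 0 "cup h"] by simp
    then show ?thesis using XS [of 1 "cup h"] s N by simp
  qed
  have sb: "app (rep b) f = (\<lambda>x. s / t * f x)" if "f \<in> ?W" "app X f = (\<lambda>a. s * f a)" for f
    using Xb [OF that(1)] that(2) t(1) by (simp add: fun_eq_iff field_simps)
  obtain r where r: "\<And>f. f \<in> ?W \<Longrightarrow> app (rep (z - b)) f = (\<lambda>x. r * f x)"
    using k by (auto simp: ker_def scalar_on_def)
  have "app (rep z) f = (\<lambda>x. r * (s / t) * f x)" if "f \<in> ?W" "app X f = (\<lambda>a. s * f a)" for f
  proof -
    have "app (rep z) f = app (rep (z - b + b)) f" by simp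
    also have "\<dots> = app (rep (z - b)) (app (rep b) f)" by (simp only: ev_add app_simps)
    also have "\<dots> = (\<lambda>x. r * (app (rep b) f) x)" by (rule r [OF bW [OF that(1)]])
    finally show ?thesis by (simp add: sb [OF that] mult.assoc)
  qed
  then show ?thesis using cupW S1W s s1 by blast
qed

end

section \<open>A free group acting on the spin chain\<close>

declare add_uminus_conv_diff [simp]

definition npow :: "nat \<Rightarrow> 'g::group_add \<Rightarrow> 'g" where
  "npow k a = ((+) a ^^ k) 0"

lemma npow_simps: "npow 0 a = 0" "npow (Suc k) a = a + npow k a"
  by (simp_all add: npow_def)

lemma npow_commute: "npow k a + a = a + npow k a"
  by (induction k) (simp_all add: npow_simps add.assoc)

lemma additive_map_npow: "additive_map h \<Longrightarrow> h (npow k a) = npow k (h a)"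
  by (induction k) (simp_all add: npow_simps additive_mapD)

lemma app_npow: "app (npow k a) x = (app a ^^ k) x"
  by (induction k) (simp_all add: npow_simps)

lemma uminus_npow: "- npow k a = npow k (- a)"
  by (induction k) (simp_all add: npow_simps minus_add npow_commute del: add_uminus_conv_diff)

text \<open>By Cramer's rule the functional with the coefficients \<open>p\<close> and
  \<open>q\<close> is a combination of the two independent ones.\<close>

lemma independent_functionals:
  fixes a b c d :: complex
  assumes "a * d - b * c \<noteq> 0"
  obtains M where "M > 0" "\<And>x y. cmod (p * x + q * y) \<le> M * (cmod (a * x + b * y) + cmod (c * x + d * y))"
proof -
  let ?D = "a * d - b * c"
  define r s where "r = (p * d - q * c) / ?D" and "s = (q * a - p * b) / ?D"
  have eq: "p * x + q * y = r * (a * x + b * y) + s * (c * x + d * y)" for x y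
  proof -
    have "r * (a * x + b * y) + s * (c * x + d * y) = ((p * x + q * y) * ?D) / ?D"
      by (simp add: r_def s_def add_divide_distrib [symmetric] diff_divide_distrib [symmetric] algebra_simps)
    then show ?thesis using assms by simp
  qed
  show ?thesis
  proof (rule that [of "cmod r + cmod s + 1"])
    fix x y
    have "cmod (p * x + q * y) \<le> cmod r * cmod (a * x + b * y) + cmod s * cmod (c * x + d * y)"
      unfolding eq by (metis norm_mult norm_triangle_ineq)
    also have "\<dots> \<le> (cmod r + cmod s + 1) * cmod (a * x + b * y) + (cmod r + cmod s + 1) * cmod (c * x + d * y)"
      by (intro add_mono mult_right_mono) auto
    finally show "cmod (p * x + q * y) \<le> (cmod r + cmod s + 1) * (cmod (a * x + b * y) + cmod (c * x + d * y))"
      by (simp add: distrib_left)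
  qed (smt (verit) norm_ge_zero)
qed

text \<open>\<open>- Q\<close> is a primitive \<open>m\<close>-th root of unity, so the
  \<open>m\<close>-th powers of the generators act trivially, and \<open>7 \<le> m\<close> gives
  \<open>\<theta> < pi / 3\<close>, which lifts the trace \<open>\<tau>\<close> above 2.\<close>

locale spin_chain_hyperbolic =
  fixes m :: nat and Q :: complex
  assumes m: "7 \<le> m" and Q: "Q = - cis (2 * pi / m)"
begin

definition \<theta> :: real where "\<theta> = 2 * pi / m"

lemma \<theta>: "0 < \<theta>" "\<theta> < pi / 3"
proof -
  show "0 < \<theta>" using m by (simp add: \<theta>_def)
  have "6 * \<theta> < m * \<theta>" using m \<open>0 < \<theta>\<close> by simp
  also have "m * \<theta> = 2 * pi" using m by (simp add: \<theta>_def)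
  finally show "\<theta> < pi / 3" by simp
qed

lemma cos_\<theta>: "1 / 2 < cos \<theta>" "cos \<theta> < 1"
  using \<theta> cos_monotone_0_pi [of \<theta> "pi / 3"] cos_monotone_0_pi [of 0 \<theta>] by (simp_all add: cos_60)

lemma sin_\<theta>: "0 < sin \<theta>" using \<theta> by (intro sin_gt_zero) auto

lemma Q_parts: "Re Q = - cos \<theta>" "Im Q = - sin \<theta>" by (simp_all add: Q \<theta>_def)

sublocale spin_chain Q
proof
  show "Q \<noteq> 0" "Q \<noteq> 1" "Q \<noteq> - 1"
    using sin_\<theta> Q_parts(2) by auto
qed

lemma S_power:
  "(S i ^^ k) f = (\<lambda>a. f a + (((- Q) ^ k - 1) / (- Q - 1)) * (S i f a - f a))"
proof (induction k)
  case (Suc k)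
  let ?c = "\<lambda>k. ((- Q) ^ k - 1) / (- Q - 1)"
  have nz: "- Q - 1 \<noteq> 0"
  proof
    assume "- Q - 1 = 0"
    then have "- (- Q) = - 1" by simp
    then show False using Qm1 by simp
  qed
  have c: "?c (Suc k) = 1 - Q * ?c k"
    using nz by (simp add: divide_simps) (simp add: algebra_simps)
  define d where "d = ?c k"
  have "(S i ^^ Suc k) f = S i (\<lambda>a. f a + d * (S i f a - f a))"
    using Suc by (simp only: funpow.simps o_apply d_def)
  also have "(\<lambda>a. f a + d * (S i f a - f a)) = (\<lambda>a. (1 - d) * f a + d * S i f a)"
    by (rule ext) (simp add: algebra_simps)
  also have "S i \<dots> = (\<lambda>a. (1 - d) * S i f a + d * ((1 - Q) * S i f a + Q * f a))"
    by (simp only: S_lincomb S_square)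
  also have "\<dots> = (\<lambda>a. f a + (1 - Q * d) * (S i f a - f a))"
    by (rule ext) (simp add: algebra_simps)
  finally show ?case by (simp only: c d_def)
qed simp

lemma rep_gen_power: "rep (npow m (gen i)) = 0"
proof (rule sym_eqI)
  fix f
  have "(- Q) ^ m = 1" using m by (simp add: Q DeMoivre)
  then show "app (rep (npow m (gen i))) f = app 0 f"
    by (simp add: additive_map_npow app_npow S_power)
qed

definition pt :: "nat \<Rightarrow> complex \<times> complex \<Rightarrow> spin" where
  "pt h u = (\<lambda>a. fst u * cup h a + snd u * S 1 (cup h) a)"

lemma pt_eq_iff:
  assumes "1 < h" shows "pt h u = pt h u' \<longleftrightarrow> u = u'"
proof
  assume eq: "pt h u = pt h u'"
  have "(fst u - fst u') * cup h a + (snd u - snd u') * S 1 (cup h) a = pt h u a - pt h u' a" for a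
    by (simp add: pt_def algebra_simps)
  then have "(fst u - fst u') * cup h a + (snd u - snd u') * S 1 (cup h) a = 0" for a
    by (simp add: eq)
  from cup_independent [OF assms this] show "u = u'" by (simp add: prod_eq_iff)
qed simp

text \<open>The matrices of \<open>S 0\<close>, \<open>S 1\<close> and their inverses in the basis
  \<open>cup h\<close>, \<open>S 1 (cup h)\<close>.\<close>

fun b0 b1 b0' b1' :: "complex \<times> complex \<Rightarrow> complex \<times> complex" where
  "b0 (x, y) = (- Q * x - y, y)"
| "b1 (x, y) = (Q * y, x + (1 - Q) * y)"
| "b0' (x, y) = (- (x + y) / Q, y)"
| "b1' (x, y) = (y - (1 - Q) * x / Q, x / Q)"

lemma b_inverse: "b0 (b0' u) = u" "b1 (b1' u) = u" "b0' (b0 u) = u" "b1' (b1 u) = u"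
  using Q0 by (cases u; simp add: field_simps)+

lemma app_pt:
  assumes "1 < h"
  shows "app (rep (gen 0)) (pt h u) = pt h (b0 u)" "app (rep (gen 1)) (pt h u) = pt h (b1 u)"
    "app (rep (- gen 0)) (pt h u) = pt h (b0' u)" "app (rep (- gen 1)) (pt h u) = pt h (b1' u)"
proof -
  have e: "S 0 (cup h) = (\<lambda>a. - Q * cup h a)" using cup_eigen [of 0 h] assms by simp
  have A: "S 0 (pt h u) = pt h (b0 u)" "S 1 (pt h u) = pt h (b1 u)" for u
  proof -
    obtain x y where u: "u = (x, y)" by (cases u)
    have "0 < h" using assms by simp
    have "S 0 (pt h u) = (\<lambda>a. x * S 0 (cup h) a + y * S 0 (S 1 (cup h)) a)"
      unfolding pt_def u fst_conv snd_conv by (rule S_lincomb)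
    also have "\<dots> = pt h (b0 u)"
      unfolding e S0_S1_cup [OF \<open>0 < h\<close>] pt_def u by (rule ext) (simp add: algebra_simps)
    finally show "S 0 (pt h u) = pt h (b0 u)" .
    have "S 1 (pt h u) = (\<lambda>a. x * S 1 (cup h) a + y * S 1 (S 1 (cup h)) a)"
      unfolding pt_def u fst_conv snd_conv by (rule S_lincomb)
    also have "\<dots> = pt h (b1 u)"
      unfolding S_square pt_def u by (rule ext) (simp add: algebra_simps)
    finally show "S 1 (pt h u) = pt h (b1 u)" .
  qed
  then show "app (rep (gen 0)) (pt h u) = pt h (b0 u)" "app (rep (gen 1)) (pt h u) = pt h (b1 u)"
    by (simp_all only: ev_gen app_spin_sym)
  have "app (rep (- gen 0)) (app (rep (gen 0)) (pt h (b0' u))) = pt h (b0' u)"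
    "app (rep (- gen 1)) (app (rep (gen 1)) (pt h (b1' u))) = pt h (b1' u)"
    by (simp_all add: ev_uminus del: ev_gen)
  then show "app (rep (- gen 0)) (pt h u) = pt h (b0' u)" "app (rep (- gen 1)) (pt h u) = pt h (b1' u)"
    by (simp_all add: A A(2) [unfolded One_nat_def] b_inverse)
qed

text \<open>The trace \<open>1 - Q - 1 / Q\<close> of the matrix of \<open>gen 0 - gen 1\<close>,
  whose determinant is 1. Being real and above 2, it gives two real eigenvalues, \<open>lam\<close>
  and its inverse.\<close>

definition \<tau> :: real where "\<tau> = 1 + 2 * cos \<theta>"

definition lam :: real where "lam = (\<tau> + sqrt (\<tau>\<^sup>2 - 4)) / 2"

lemma \<tau>_gt: "2 < \<tau>" using cos_\<theta> by (simp add: \<tau>_def)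

lemma lam: "1 < lam" "lam * lam = \<tau> * lam - 1"
proof -
  have "4 < \<tau>\<^sup>2" using \<tau>_gt power_strict_mono [of 2 \<tau> 2] by simp
  then have s: "0 < sqrt (\<tau>\<^sup>2 - 4)" "(sqrt (\<tau>\<^sup>2 - 4))\<^sup>2 = \<tau>\<^sup>2 - 4" by simp_all
  show "1 < lam" using add_strict_mono [OF \<tau>_gt s(1)] by (simp add: lam_def)
  show "lam * lam = \<tau> * lam - 1"
    using s(2) by (simp add: lam_def field_simps power2_eq_square)
qed

lemma Q_trace: "complex_of_real \<tau> * Q = Q - Q * Q - 1"
proof -
  have "sin \<theta> * sin \<theta> = 1 - cos \<theta> * cos \<theta>"
    using sin_squared_eq [of \<theta>] by (simp add: power2_eq_square)
  then show ?thesis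
    by (simp add: complex_eq_iff Q_parts \<tau>_def power2_eq_square algebra_simps)
qed

text \<open>The eigenvalues of the two hyperbolic elements.\<close>

definition eig :: "bool \<Rightarrow> real" where "eig b = (if b then lam else inverse lam)"

lemma eig: "0 < eig b" "eig b * eig b = \<tau> * eig b - 1" "eig b \<noteq> 1" "eig (\<not> b) = inverse (eig b)"
proof -
  show "0 < eig b" "eig b \<noteq> 1" "eig (\<not> b) = inverse (eig b)" using lam(1) by (simp_all add: eig_def)
  show "eig b * eig b = \<tau> * eig b - 1"
    using lam by (auto simp: eig_def field_simps)
qed

text \<open>Left eigenvectors of the two hyperbolic matrices: \<open>k\<close> selects the matrix
  and \<open>b\<close> the eigenvalue. Their kernels are the fixed points on the projective
  line.\<close>

fun functional :: "nat \<times> bool \<Rightarrow> complex \<times> complex \<Rightarrow> complex" where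
  "functional (k, b) (x, y) = (if k = 0 then complex_of_real (eig b) * x - Q * y else x + (1 - Q - eig b) * y)"

lemma eig_complex: "complex_of_real (eig b) * complex_of_real (eig b) * Q = (Q - Q * Q - 1) * eig b - Q"
proof -
  have "complex_of_real (eig b * eig b) * Q = complex_of_real (\<tau> * eig b - 1) * Q" by (simp only: eig(2))
  also have "\<dots> = (complex_of_real \<tau> * Q) * eig b - Q" by (simp add: algebra_simps)
  finally show ?thesis by (simp only: Q_trace of_real_mult)
qed

lemma functional_g: "functional (0, b) (b0 (b1' u)) = eig b * functional (0, b) u"
proof (cases u)
  case (Pair x y)
  define c where "c = complex_of_real (eig b)"
  have c: "c * c * Q = (Q - Q * Q - 1) * c - Q" using eig_complex by (simp add: c_def)
  have "Q * functional (0, b) (b0 (b1' u)) = x * ((Q - Q * Q - 1) * c - Q) - c * Q * Q * y"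
    using Q0 by (simp add: Pair field_simps flip: c_def)
  also have "\<dots> = x * (c * c * Q) - c * Q * Q * y" by (simp only: c)
  also have "\<dots> = Q * (c * functional (0, b) u)"
    by (simp add: Pair algebra_simps flip: c_def)
  finally show ?thesis using Q0 by (simp add: c_def)
qed

lemma functional_h: "functional (Suc k, b) (b1' (b0 u)) = eig b * functional (Suc k, b) u"
proof (cases u)
  case (Pair x y)
  define c where "c = complex_of_real (eig b)"
  have c: "Q + c = (Q - Q * Q) * c - c * c * Q" using eig_complex [of b] by (simp add: c_def algebra_simps)
  have "Q * functional (Suc k, b) (b1' (b0 u)) = Q * c * x + y * (Q + c)"
    using Q0 by (simp add: Pair field_simps flip: c_def)
  also have "\<dots> = Q * (c * functional (Suc k, b) u)"
    unfolding c by (simp add: Pair algebra_simps flip: c_def)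
  finally show ?thesis using Q0 by (simp add: c_def)
qed

fun hyp :: "nat \<times> bool \<Rightarrow> complex \<times> complex \<Rightarrow> complex \<times> complex" where
  "hyp (k, True) u = (if k = 0 then b0 (b1' u) else b1' (b0 u))"
| "hyp (k, False) u = (if k = 0 then b1 (b0' u) else b0' (b1 u))"

lemma functional_hyp: "functional (k, b) (hyp (k, c) u) = (if c then eig b else eig (\<not> b)) * functional (k, b) u"
proof -
  have T: "functional (k, b) (hyp (k, True) u) = eig b * functional (k, b) u" for u
    by (cases k) (simp_all add: functional_g functional_h)
  have inv: "hyp (k, True) (hyp (k, False) u) = u" by (simp add: b_inverse)
  have "functional (k, b) u = eig b * functional (k, b) (hyp (k, False) u)"
    using T [of "hyp (k, False) u"] by (simp only: inv)
  moreover have "eig (\<not> b) * eig b = 1" using eig(1) [of b] eig(4) [of b] by simp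
  then have "complex_of_real (eig (\<not> b)) * complex_of_real (eig b) = 1"
    by (metis of_real_1 of_real_mult)
  ultimately have "functional (k, b) (hyp (k, False) u) = eig (\<not> b) * functional (k, b) u"
    by (simp add: mult.assoc [symmetric])
  then show ?thesis using T by (cases c) auto
qed

lemma functional_hyp_pow:
  "functional (k, b) ((hyp (k, c) ^^ n) u) = (if c then eig b else eig (\<not> b)) ^ n * functional (k, b) u"
  by (induction n) (simp_all add: functional_hyp)

text \<open>The determinant of an eigenfunctional of the first matrix and one of the second; it is
  nonzero when the two matrices have no common fixed point. For equal eigenvalues the expression is
  multiplied by \<open>Q\<close>, and the imaginary part becomes
  \<open>sin \<theta> * (2 * cos \<theta> - 1)\<close>.\<close>

lemma det_nz: "complex_of_real (eig b) * (1 - Q - eig c) + Q \<noteq> 0"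
proof (cases "c = b")
  case True
  have "Q * (complex_of_real (eig b) * (1 - Q - eig b) + Q) = eig b + Q * (1 + Q)"
    using eig_complex [of b] by (simp add: algebra_simps)
  moreover have "Im (eig b + Q * (1 + Q)) = sin \<theta> * (2 * cos \<theta> - 1)"
    by (simp add: Q_parts algebra_simps)
  then have "eig b + Q * (1 + Q) \<noteq> 0" using sin_\<theta> cos_\<theta> by (metis mult_eq_0_iff zero_complex.sel(2) less_irrefl diff_eq_eq add_0 mult_2 field_sum_of_halves add_strict_mono)
  ultimately show ?thesis using True by auto
next
  case False
  then have "eig c = inverse (eig b)" using eig(4) [of b] by (cases b; cases c) auto
  then have "complex_of_real (eig b) * eig c = 1" using eig(1) [of b] by simp
  then have "complex_of_real (eig b) * (1 - Q - eig c) + Q = (eig b - 1) * (1 - Q)"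
    by (simp add: algebra_simps)
  then show ?thesis using eig(3) [of b] Q1 by simp
qed

text \<open>A constant that defines the ping-pong domains. The factor 2 makes the domains of
  different generators disjoint, \<open>1 \<le> C\<close> those of a generator and its inverse, and
  \<open>lam\<^sup>2 \<le> C\<close> keeps the starting vector out of all of them.\<close>

definition dom_const :: "real \<Rightarrow> bool" where
  "dom_const C \<longleftrightarrow> 1 \<le> C \<and> lam\<^sup>2 \<le> C \<and>
    (\<forall>b c l u. l = (0, \<not> b) \<or> l = (1, \<not> c) \<longrightarrow>
       2 * cmod (functional l u) \<le> C * (cmod (functional (0, b) u) + cmod (functional (1, c) u)))"

lemma dom_const_exists: "\<exists>C. dom_const C"
proof -
  have ex: "\<exists>M>0. \<forall>u. cmod (functional l u) \<le> M * (cmod (functional (0, b) u) + cmod (functional (1, c) u))" for b c l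
  proof -
    obtain k d where l: "l = (k, d)" by (cases l)
    define p q where "p = (if k = 0 then complex_of_real (eig d) else 1)" and "q = (if k = 0 then - Q else 1 - Q - eig d)"
    have nz: "complex_of_real (eig b) * (1 - Q - eig c) - - Q * 1 \<noteq> 0" using det_nz [of b c] by simp
    obtain M where M: "M > 0" "\<And>x y. cmod (p * x + q * y) \<le> M * (cmod (complex_of_real (eig b) * x + - Q * y)
          + cmod (1 * x + (1 - Q - eig c) * y))"
      using independent_functionals [OF nz] by blast
    have "cmod (functional l u) \<le> M * (cmod (functional (0, b) u) + cmod (functional (1, c) u))" for u
      using M(2) [of "fst u" "snd u"] by (cases u) (simp add: l p_def q_def split: if_splits)
    then show ?thesis using M(1) by blast
  qed
  define M where "M = (\<lambda>b c l. SOME M. 0 < M \<and>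
    (\<forall>u. cmod (functional l u) \<le> M * (cmod (functional (0, b) u) + cmod (functional (1, c) u))))"
  have "0 < M b c l \<and> (\<forall>u. cmod (functional l u) \<le> M b c l * (cmod (functional (0, b) u) + cmod (functional (1, c) u)))" for b c l
    unfolding M_def by (rule someI_ex [OF ex])
  then have M: "\<And>b c l u. cmod (functional l u) \<le> M b c l * (cmod (functional (0, b) u) + cmod (functional (1, c) u))"
    "\<And>b c l. 0 < M b c l" by blast+
  define C where "C = 1 + lam\<^sup>2 + (\<Sum>b\<in>UNIV. \<Sum>c\<in>UNIV. \<Sum>l\<in>{(0, \<not> b), (1, \<not> c)}. 2 * M b c l)"
  define G where "G = (\<lambda>b c. \<Sum>l\<in>{(0, \<not> b), (1, \<not> c)}. 2 * M b c l)"
  have G: "0 \<le> G b c" for b c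
    unfolding G_def by (intro sum_nonneg) (simp add: less_imp_le M(2))
  have "2 * M b c l \<le> C" if "l = (0, \<not> b) \<or> l = (1, \<not> c)" for b c l
  proof -
    have "2 * M b c l \<le> G b c"
      unfolding G_def using that by (intro member_le_sum) (auto intro: less_imp_le M(2))
    also have "\<dots> \<le> (\<Sum>c\<in>UNIV. G b c)"
      by (rule member_le_sum [of c UNIV "\<lambda>c. G b c"]) (simp_all add: G)
    also have "\<dots> \<le> (\<Sum>b\<in>UNIV. \<Sum>c\<in>UNIV. G b c)"
      by (rule member_le_sum [of b UNIV "\<lambda>b. \<Sum>c\<in>UNIV. G b c"]) (simp_all add: G sum_nonneg del: UNIV_bool)
    also have "\<dots> \<le> C" by (simp add: C_def G_def del: UNIV_bool)
    finally show ?thesis .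
  qed
  then have "2 * cmod (functional l u) \<le> C * (cmod (functional (0, b) u) + cmod (functional (1, c) u))"
    if "l = (0, \<not> b) \<or> l = (1, \<not> c)" for b c l u
  proof -
    have "2 * cmod (functional l u) \<le> 2 * M b c l * (cmod (functional (0, b) u) + cmod (functional (1, c) u))"
      using M(1) [of l u b c] by simp
    also have "\<dots> \<le> C * (cmod (functional (0, b) u) + cmod (functional (1, c) u))"
      using that \<open>\<And>l c b. l = (0, \<not> b) \<or> l = (1, \<not> c) \<Longrightarrow> 2 * M b c l \<le> C\<close> by (intro mult_right_mono) auto
    finally show ?thesis .
  qed
  moreover have "0 \<le> (\<Sum>b\<in>UNIV. \<Sum>c\<in>UNIV. \<Sum>l\<in>{(0, \<not> b), (1, \<not> c)}. 2 * M b c l)"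
    by (intro sum_nonneg) (auto intro: less_imp_le M(2))
  ultimately have "dom_const C" unfolding dom_const_def C_def by (simp del: UNIV_bool)
  then show ?thesis by blast
qed

lemma functional_nonzero: "functional (k, b) u = 0 \<Longrightarrow> functional (k, \<not> b) u = 0 \<Longrightarrow> u = (0, 0)"
proof -
  assume a: "functional (k, b) u = 0" "functional (k, \<not> b) u = 0"
  obtain x y where u: "u = (x, y)" by (cases u)
  have ne: "complex_of_real (eig b) \<noteq> complex_of_real (eig (\<not> b))"
  proof
    assume "complex_of_real (eig b) = complex_of_real (eig (\<not> b))"
    then have "eig b = inverse (eig b)" unfolding of_real_eq_iff using eig(4) [of b] by simp
    then have "eig b * eig b = 1" using eig(1) [of b] by (metis less_irrefl right_inverse)
    then have "eig b = 1" using eig(1) [of b] by (simp add: power2_eq_square [symmetric] power2_eq_1_iff)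
    then show False using eig(3) by simp
  qed
  show ?thesis
  proof (cases "k = 0")
    case True
    then have "(complex_of_real (eig b) - eig (\<not> b)) * x = 0" using a u by (simp add: algebra_simps)
    then have "x = 0" using ne by simp
    then show ?thesis using a(1) True u Q0 by simp
  next
    case False
    then have "(complex_of_real (eig b) - eig (\<not> b)) * y = 0" using a u by (simp add: algebra_simps)
    then have "y = 0" using ne by simp
    then show ?thesis using a(1) False u by simp
  qed
qed

definition free_gens :: "nat \<Rightarrow> nat \<Rightarrow> fgroup" where
  "free_gens K k = (if k = 0 then npow K (gen 0 - gen 1) else npow K (- gen 1 + gen 0))"

text \<open>Ping-pong on the nonzero vectors of the plane. In the domain \<open>D l\<close> the
  functional that the letter \<open>l\<close> expands exceeds \<open>C\<close> times the one that it
  contracts. A nonempty reduced word moves \<open>(1, 0)\<close>, which stands for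
  \<open>cup h\<close>, into a domain, and no multiple of \<open>(1, 0)\<close> lies in one.\<close>

theorem free_gens_not_scalar:
  assumes h: "1 < h"
  shows "\<exists>K. \<forall>w s. reduced_word w \<longrightarrow> w \<noteq> [] \<longrightarrow> set w \<subseteq> {0, 1} \<times> UNIV \<longrightarrow>
    app (rep (wval (free_gens K) w)) (cup h) \<noteq> (\<lambda>a. s * cup h a)"
proof -
  obtain C where "dom_const C" using dom_const_exists by blast
  then have C: "1 \<le> C" "lam\<^sup>2 \<le> C"
    "\<And>b c l u. l = (0, \<not> b) \<or> l = (1, \<not> c) \<Longrightarrow>
       2 * cmod (functional l u) \<le> C * (cmod (functional (0, b) u) + cmod (functional (1, c) u))"
    unfolding dom_const_def by blast+
  \<comment> \<open>Outside \<open>D (flip l)\<close> the contracted functional is at most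
    \<open>C\<close> times the expanded one. To arrive in \<open>D l\<close> this ratio has to be
    improved by the factor \<open>C\<^sup>2\<close>.\<close>
  obtain K where K: "C\<^sup>2 < lam ^ K" using real_arch_pow [OF lam(1)] by blast
  define D where "D = (\<lambda>l :: nat \<times> bool. {u. fst l \<in> {0, 1} \<and> C * cmod (functional (flip l) u) < cmod (functional l u)})"
  define P where "P = - {(0 :: complex, 0 :: complex)}"
  define f where "f = (\<lambda>l. hyp (min 1 (fst l), snd l) ^^ K)"
  have fstep: "f l q \<in> D l \<inter> P" if l: "fst l \<in> {0, 1}" and q: "q \<in> P" "q \<notin> D (flip l)" for l q
  proof -
    obtain k b where kb: "l = (k, b)" by (cases l)
    let ?p = "cmod (functional (k, b) q)" and ?r = "cmod (functional (k, \<not> b) q)"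
    have k: "min 1 k = k" using l kb by auto
    have eb: "(if b then eig b else eig (\<not> b)) = lam" "(if b then eig (\<not> b) else eig b) = inverse lam"
      by (cases b; simp add: eig_def)+
    have fp: "cmod (functional (k, b) (f l q)) = lam ^ K * ?p"
      using functional_hyp_pow [of k b K b q] lam(1) k eb(1)
      by (simp add: f_def kb norm_mult norm_power split: if_splits)
    have fr: "cmod (functional (k, \<not> b) (f l q)) = inverse lam ^ K * ?r"
      using functional_hyp_pow [of k "\<not> b" K b q] lam(1) k eb(2)
      by (simp add: f_def kb norm_mult norm_power norm_inverse split: if_splits)
    have rp: "?r \<le> C * ?p" using q(2) l kb by (auto simp: D_def not_less)
    have "?p \<noteq> 0"
    proof
      assume "?p = 0"
      then have "?r \<le> 0" using rp by simp
      then show False using functional_nonzero [of k b q] \<open>?p = 0\<close> q(1) by (simp add: P_def)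
    qed
    then have pp: "0 < ?p" by simp
    have lamK: "1 \<le> lam ^ K" using lam(1) by (simp add: one_le_power)
    have "C * (inverse lam ^ K * ?r) \<le> C * (1 * ?r)"
      using C(1) lamK lam(1) by (intro mult_left_mono mult_right_mono) (auto simp: power_le_one_iff inverse_le_1_iff power_inverse)
    also have "\<dots> \<le> C * (C * ?p)" using rp C(1) by simp
    also have "\<dots> = C\<^sup>2 * ?p" by (simp add: power2_eq_square)
    also have "\<dots> < lam ^ K * ?p" using K pp by simp
    finally have "C * (inverse lam ^ K * ?r) < lam ^ K * ?p" .
    then have "C * cmod (functional (k, \<not> b) (f l q)) < cmod (functional (k, b) (f l q))"
      by (simp only: fp fr)
    then have "f l q \<in> D l" using l by (simp add: D_def kb)
    moreover have "functional (k, b) (f l q) \<noteq> 0" using fp pp lam(1) by auto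
    then have "f l q \<noteq> (0, 0)" by (cases "k = 0") auto
    then have "f l q \<in> P" by (simp add: P_def)
    ultimately show ?thesis by blast
  qed
  have disj: "l = l'" if q: "q \<in> D l" "q \<in> D l'" for l l' q
  proof (rule ccontr)
    assume ne: "l \<noteq> l'"
    obtain k b k' b' where kb: "l = (k, b)" "l' = (k', b')" by (cases l; cases l')
    have k: "k \<in> {0, 1}" "k' \<in> {0, 1}"
      and lt: "C * cmod (functional (k, \<not> b) q) < cmod (functional (k, b) q)"
        "C * cmod (functional (k', \<not> b') q) < cmod (functional (k', b') q)"
      using q by (simp_all add: D_def kb)
    have no: False if "C * cmod (functional (0, \<not> b) q) < cmod (functional (0, b) q)"
      "C * cmod (functional (1, \<not> c) q) < cmod (functional (1, c) q)" for b c
    proof -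
      have "2 * cmod (functional (0, b) q) \<le> C * (cmod (functional (0, \<not> b) q) + cmod (functional (1, \<not> c) q))"
        "2 * cmod (functional (1, c) q) \<le> C * (cmod (functional (0, \<not> b) q) + cmod (functional (1, \<not> c) q))"
        by (rule C(3); simp)+
      then show False using that by (simp add: distrib_left)
    qed
    show False
    proof (cases "k = k'")
      case True
      then have b: "b' = (\<not> b)" using ne kb by auto
      have "cmod (functional (k, b) q) \<le> C * cmod (functional (k, b) q)"
        "cmod (functional (k, \<not> b) q) \<le> C * cmod (functional (k, \<not> b) q)"
        using C(1) by (simp_all add: mult_le_cancel_right1)
      then show False using lt True b by simp
    next
      case False
      then show False using k lt no by auto
    qed
  qed
  have start: "(s, 0) \<notin> D l" for l s
  proof -
    obtain k b where kb: "l = (k, b)" by (cases l)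
    have "1 \<le> C * 1" using C(1) by simp
    moreover have "eig b \<le> C * eig (\<not> b)"
    proof (cases b)
      case True
      show ?thesis using True C(2) lam(1) by (simp add: eig_def field_simps power2_eq_square)
    next
      case False
      have "inverse lam \<le> 1" "1 \<le> C * lam" using lam(1) C(1) by (auto simp: inverse_le_1_iff intro: mult_ge1_I)
      then show ?thesis using False by (simp add: eig_def)
    qed
    then have "cmod s * eig b \<le> cmod s * (C * eig (\<not> b))" by (intro mult_left_mono) auto
    moreover have "cmod s \<le> C * cmod s" using C(1) by (simp add: mult_le_cancel_right1)
    ultimately show ?thesis
      using eig(1) [of b] eig(1) [of "\<not> b"] by (auto simp: D_def kb norm_mult algebra_simps not_less)
  qed
  have app: "app (rep (wval (free_gens K) w)) (pt h u) = pt h (foldr f w u)" for w u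
  proof (induction w)
    case (Cons l w)
    obtain k b where kb: "l = (k, b)" by (cases l)
    have one: "app (rep (if b then gen 0 - gen 1 else gen 1 - gen 0)) (pt h u) = pt h (hyp (0, b) u)"
      "app (rep (if b then - gen 1 + gen 0 else - gen 0 + gen 1)) (pt h u) = pt h (hyp (Suc 0, b) u)" for u
      using app_pt [OF h] by (cases b; simp add: ev_hom del: ev_gen)+
    have pow: "app (rep (npow n z)) (pt h u) = pt h ((F ^^ n) u)"
      if "\<And>u. app (rep z) (pt h u) = pt h (F u)" for n z F u
      using that by (induction n) (simp_all add: npow_simps ev_add)
    have lf: "letter (free_gens K) l = npow K (if k = 0 then if b then gen 0 - gen 1 else gen 1 - gen 0
        else if b then - gen 1 + gen 0 else - gen 0 + gen 1)"
      by (simp add: kb free_gens_def uminus_npow minus_add)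
    have "app (rep (letter (free_gens K) l)) (pt h u) = pt h (f l u)" for u
    proof (cases "k = 0")
      case True
      then show ?thesis using pow [OF one(1)] unfolding lf by (simp add: f_def kb)
    next
      case False
      then have "min (Suc 0) k = Suc 0" by simp
      then show ?thesis using pow [OF one(2)] False unfolding lf by (simp add: f_def kb)
    qed
    then show ?case using Cons by (simp add: ev_add)
  qed simp
  have "app (rep (wval (free_gens K) w)) (cup h) \<noteq> (\<lambda>a. s * cup h a)"
    if w: "reduced_word w" "w \<noteq> []" "set w \<subseteq> {0, 1} \<times> UNIV" for w s
  proof
    assume "app (rep (wval (free_gens K) w)) (cup h) = (\<lambda>a. s * cup h a)"
    moreover have "cup h = pt h (1, 0)" "(\<lambda>a. s * cup h a) = pt h (s, 0)" by (simp_all add: pt_def)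
    ultimately have "pt h (foldr f w (1, 0)) = pt h (s, 0)" using app by metis
    then have "foldr f w (1, 0) = (s, 0)" using pt_eq_iff [OF h] by blast
    moreover have "foldr f w (1, 0) \<in> D (hd w) \<inter> P"
      using w
    proof (induction w)
      case (Cons l w)
      have l: "fst l \<in> {0, 1}" using Cons.prems(3) by auto
      show ?case
      proof (cases "w = []")
        case True
        then show ?thesis using fstep [OF l, of "(1, 0)"] start by (simp add: P_def)
      next
        case False
        then have "foldr f w (1, 0) \<in> D (hd w) \<inter> P" "hd w \<noteq> flip l"
          using Cons by (auto simp: reduced_word_Cons)
        then have "foldr f w (1, 0) \<notin> D (flip l)" using disj by blast
        then show ?thesis using fstep [OF l, of "foldr f w (1, 0)"] \<open>foldr f w (1, 0) \<in> D (hd w) \<inter> P\<close> by auto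
      qed
    qed simp
    ultimately show False using start by simp
  qed
  then show ?thesis by blast
qed

end

section \<open>Local cocycles\<close>

declare add_uminus_conv_diff [simp del]

text \<open>Each point of \<open>S\<close> has a neighbourhood all of whose triples satisfy
  \<open>R\<close>. The three places serve the cocycle identity; relations between two points ignore
  the third.\<close>

definition near :: "'a::topological_space set \<Rightarrow> ('a \<Rightarrow> 'a \<Rightarrow> 'a \<Rightarrow> bool) \<Rightarrow> bool" where
  "near S R \<longleftrightarrow> (\<forall>p\<in>S. \<exists>Ob. open Ob \<and> p \<in> Ob \<and> (\<forall>x\<in>Ob \<inter> S. \<forall>y\<in>Ob \<inter> S. \<forall>z\<in>Ob \<inter> S. R x y z))"

lemma nearI:
  assumes "\<And>p. p \<in> S \<Longrightarrow> \<exists>Ob. open Ob \<and> p \<in> Ob \<and> (\<forall>x\<in>Ob \<inter> S. \<forall>y\<in>Ob \<inter> S. \<forall>z\<in>Ob \<inter> S. R x y z)"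
  shows "near S R"
  using assms by (auto simp: near_def)

lemma nearE:
  assumes "near S R" "p \<in> S"
  obtains Ob where "open Ob" "p \<in> Ob" "\<And>x y z. x \<in> Ob \<Longrightarrow> x \<in> S \<Longrightarrow> y \<in> Ob \<Longrightarrow> y \<in> S \<Longrightarrow> z \<in> Ob \<Longrightarrow> z \<in> S \<Longrightarrow> R x y z"
  using assms unfolding near_def by (metis IntI)

lemma near_mono:
  assumes "near S R" "\<And>x y z. x \<in> S \<Longrightarrow> y \<in> S \<Longrightarrow> z \<in> S \<Longrightarrow> R x y z \<Longrightarrow> R' x y z"
  shows "near S R'"
  using assms unfolding near_def by (meson IntD2)

lemma near_conj:
  assumes "near S R" "near S R'"
  shows "near S (\<lambda>x y z. R x y z \<and> R' x y z)"
proof (rule nearI)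
  fix p assume p: "p \<in> S"
  obtain Ob O' where "open Ob" "p \<in> Ob" "\<forall>x\<in>Ob \<inter> S. \<forall>y\<in>Ob \<inter> S. \<forall>z\<in>Ob \<inter> S. R x y z"
    "open O'" "p \<in> O'" "\<forall>x\<in>O' \<inter> S. \<forall>y\<in>O' \<inter> S. \<forall>z\<in>O' \<inter> S. R' x y z"
    using assms p unfolding near_def by meson
  then show "\<exists>Ob. open Ob \<and> p \<in> Ob \<and> (\<forall>x\<in>Ob \<inter> S. \<forall>y\<in>Ob \<inter> S. \<forall>z\<in>Ob \<inter> S. R x y z \<and> R' x y z)"
    by (intro exI [of _ "Ob \<inter> O'"]) auto
qed

lemma near_pull:
  assumes "near S R" "continuous_on T f" "\<And>x. x \<in> T \<Longrightarrow> f x \<in> S"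
  shows "near T (\<lambda>x y z. R (f x) (f y) (f z))"
proof (rule nearI)
  fix p assume p: "p \<in> T"
  then obtain Ob where Ob: "open Ob" "f p \<in> Ob"
    "\<And>x y z. x \<in> Ob \<Longrightarrow> x \<in> S \<Longrightarrow> y \<in> Ob \<Longrightarrow> y \<in> S \<Longrightarrow> z \<in> Ob \<Longrightarrow> z \<in> S \<Longrightarrow> R x y z"
    using assms nearE [OF assms(1), of "f p"] by metis
  obtain O' where "open O'" "O' \<inter> T = f -` Ob \<inter> T"
    using assms(2) Ob(1) unfolding continuous_on_open_invariant by blast
  then show "\<exists>Ob. open Ob \<and> p \<in> Ob \<and> (\<forall>x\<in>Ob \<inter> T. \<forall>y\<in>Ob \<inter> T. \<forall>z\<in>Ob \<inter> T. R (f x) (f y) (f z))"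
    using Ob p assms(3) by (intro exI [of _ O']) blast
qed

lemma near_subset: "near S R \<Longrightarrow> T \<subseteq> S \<Longrightarrow> near T R"
  using near_pull [of S R T "\<lambda>x. x"] by auto

lemma near_diag: "near S R \<Longrightarrow> x \<in> S \<Longrightarrow> R x x x"
  by (erule nearE) auto

lemma near_pairs:
  "near S (\<lambda>x y z. R x y) \<Longrightarrow> p \<in> S \<Longrightarrow> \<exists>W. open W \<and> p \<in> W \<and> (\<forall>x\<in>W \<inter> S. \<forall>y\<in>W \<inter> S. R x y)"
  by (erule (1) nearE) (metis IntD1 IntD2)

lemma near_open_Un:
  assumes "near S R" "near T R" "open S" "open T"
  shows "near (S \<union> T) R"
proof (rule nearI)
  fix p assume p: "p \<in> S \<union> T"
  have *: "\<exists>Ob. open Ob \<and> p \<in> Ob \<and> Ob \<subseteq> S' \<and> (\<forall>x\<in>Ob. \<forall>y\<in>Ob. \<forall>z\<in>Ob. R x y z)"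
    if "near S' R" "open S'" "p \<in> S'" for S'
  proof -
    obtain Ob where "open Ob" "p \<in> Ob"
      "\<And>x y z. x \<in> Ob \<Longrightarrow> x \<in> S' \<Longrightarrow> y \<in> Ob \<Longrightarrow> y \<in> S' \<Longrightarrow> z \<in> Ob \<Longrightarrow> z \<in> S' \<Longrightarrow> R x y z"
      using nearE [OF \<open>near S' R\<close> \<open>p \<in> S'\<close>] by metis
    then show ?thesis using that by (intro exI [of _ "Ob \<inter> S'"]) auto
  qed
  from p assms * [of S] * [of T] obtain Ob where "open Ob" "p \<in> Ob" "\<forall>x\<in>Ob. \<forall>y\<in>Ob. \<forall>z\<in>Ob. R x y z" by blast
  then show "\<exists>Ob. open Ob \<and> p \<in> Ob \<and> (\<forall>x\<in>Ob \<inter> (S \<union> T). \<forall>y\<in>Ob \<inter> (S \<union> T). \<forall>z\<in>Ob \<inter> (S \<union> T). R x y z)"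
    by blast
qed

lemma near_connected_const:
  assumes "near S (\<lambda>x y z. f x = f y)" "connected S" "a \<in> S" "b \<in> S"
  shows "f a = f b"
proof (rule connected_local_const [OF assms(2-4)], intro ballI)
  fix p assume "p \<in> S"
  then obtain Ob where "open Ob" "p \<in> Ob" "\<And>x y z. x \<in> Ob \<Longrightarrow> x \<in> S \<Longrightarrow> y \<in> Ob \<Longrightarrow> y \<in> S \<Longrightarrow> z \<in> Ob \<Longrightarrow> z \<in> S \<Longrightarrow> f x = f y"
    using nearE [OF assms(1)] by metis
  then show "\<forall>\<^sub>F b in at p within S. f p = f b"
    using \<open>p \<in> S\<close> unfolding eventually_at_topological by blast
qed

text \<open>
  Cocycles replace paths: \<open>c x y\<close> is meaningful for nearby points only, as the value of the cocycle
  on a short path from \<open>x\<close> to \<open>y\<close>.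
\<close>

definition cocycle :: "'a::topological_space set \<Rightarrow> ('a \<Rightarrow> 'a \<Rightarrow> 'g::group_add) \<Rightarrow> bool" where
  "cocycle S c \<longleftrightarrow> near S (\<lambda>x y z. c x y + c y z = c x z)"

text \<open>A trivialisation of the cocycle, as a function is one of its differential;
  \<open>cobounds\<close> below is a change of gauge between two cocycles. The values do not
  commute, which fixes the order of the terms.\<close>

definition primitive :: "'a::topological_space set \<Rightarrow> ('a \<Rightarrow> 'a \<Rightarrow> 'g::group_add) \<Rightarrow> ('a \<Rightarrow> 'g) \<Rightarrow> bool" where
  "primitive S c A \<longleftrightarrow> near S (\<lambda>x y z. c x y = - A x + A y)"

definition cobounds :: "'a::topological_space set \<Rightarrow> ('a \<Rightarrow> 'g::group_add) \<Rightarrow> ('a \<Rightarrow> 'a \<Rightarrow> 'g) \<Rightarrow> ('a \<Rightarrow> 'a \<Rightarrow> 'g) \<Rightarrow> bool" where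
  "cobounds S A c c' \<longleftrightarrow> near S (\<lambda>x y z. c' x y = - A x + c x y + A y)"

lemma cocycle_pull:
  "cocycle S c \<Longrightarrow> continuous_on T f \<Longrightarrow> (\<And>x. x \<in> T \<Longrightarrow> f x \<in> S) \<Longrightarrow> cocycle T (\<lambda>x y. c (f x) (f y))"
  unfolding cocycle_def by (rule near_pull)

lemma primitive_pull:
  "primitive S c A \<Longrightarrow> continuous_on T f \<Longrightarrow> (\<And>x. x \<in> T \<Longrightarrow> f x \<in> S) \<Longrightarrow> primitive T (\<lambda>x y. c (f x) (f y)) (\<lambda>x. A (f x))"
  unfolding primitive_def by (rule near_pull)

lemma cobounds_pull:
  "cobounds S A c c' \<Longrightarrow> continuous_on T f \<Longrightarrow> (\<And>x. x \<in> T \<Longrightarrow> f x \<in> S) \<Longrightarrow>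
    cobounds T (\<lambda>x. A (f x)) (\<lambda>x y. c (f x) (f y)) (\<lambda>x y. c' (f x) (f y))"
  unfolding cobounds_def by (rule near_pull)

lemma primitive_subset: "primitive S c A \<Longrightarrow> T \<subseteq> S \<Longrightarrow> primitive T c A"
  unfolding primitive_def by (rule near_subset)

lemma cobounds_subset: "cobounds S A c c' \<Longrightarrow> T \<subseteq> S \<Longrightarrow> cobounds T A c c'"
  unfolding cobounds_def by (rule near_subset)

lemma cocycle_diag:
  assumes "cocycle S c" "x \<in> S" shows "c x x = 0"
  using near_diag [OF assms(1) [unfolded cocycle_def] assms(2)]
  by (metis add.right_neutral add_left_cancel)

text \<open>\<open>A x - B x\<close> is locally constant: two primitives on a connected set differ
  by a constant on the left.\<close>

lemma primitive_unique:
  assumes "primitive S c A" "primitive S c B" "connected S" "x \<in> S" "y \<in> S"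
  shows "A x - B x = A y - B y"
proof -
  have "near S (\<lambda>x y z. A x - B x = A y - B y)"
  proof (rule near_mono [OF near_conj [OF assms(1,2) [unfolded primitive_def]]])
    fix x y assume "c x y = - A x + A y \<and> c x y = - B x + B y"
    then have "- A x + A y = - B x + B y" by metis
    then have "A y = A x + (- B x + B y)" by (metis add_minus_cancel)
    then show "A x - B x = A y - B y" by (simp add: grp_norm)
  qed
  from near_connected_const [OF this assms(3-5)] show ?thesis .
qed

lemma cobounds_trans:
  assumes "cobounds S A c c'" "cobounds S B c' c''"
  shows "cobounds S (\<lambda>x. A x + B x) c c''"
  unfolding cobounds_def
  by (rule near_mono [OF near_conj [OF assms [unfolded cobounds_def]]]) (auto simp: grp_norm)

lemma cobounds_sym: "cobounds S A c c' \<Longrightarrow> cobounds S (\<lambda>x. - A x) c' c"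
  unfolding cobounds_def by (erule near_mono) (simp add: grp_norm)

lemma cobounds_hom:
  assumes "additive_map h" "cobounds S A c c'"
  shows "cobounds S (\<lambda>x. h (A x)) (\<lambda>x y. h (c x y)) (\<lambda>x y. h (c' x y))"
  using assms(2) unfolding cobounds_def
  by (rule near_mono) (simp add: additive_mapD [OF assms(1)])

section \<open>Cocycles on cylinders and homotopy invariance\<close>

lemma open_box:
  "open W \<Longrightarrow> (s, y) \<in> W \<Longrightarrow> \<exists>J K. open J \<and> s \<in> J \<and> open K \<and> y \<in> K \<and> J \<times> K \<subseteq> W"
  by (erule (1) open_prod_elim) blast

text \<open>Over a small neighbourhood of \<open>y0\<close> the cocycle is pulled back from the
  bottom of the cylinder, up to a gauge that vanishes at the bottom. The interval is treated by
  bisection: a short interval lies in a region where the cocycle identity holds, and solutions over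
  adjacent intervals are composed.\<close>

lemma cylinder_step:
  fixes c :: "real \<times> 'a::topological_space \<Rightarrow> real \<times> 'a \<Rightarrow> 'g::group_add"
  assumes c: "cocycle ({0..1} \<times> Y) c" and y0: "y0 \<in> Y" and "0 \<le> a" "a \<le> b" "b \<le> 1"
  shows "\<exists>Ob A. open Ob \<and> y0 \<in> Ob \<and> (\<forall>y\<in>Ob \<inter> Y. A (a, y) = 0) \<and>
     cobounds ({a..b} \<times> (Ob \<inter> Y)) A (\<lambda>p q. c (a, snd p) (a, snd q)) c"
proof -
  define P where "P = (\<lambda>a b. 0 \<le> a \<longrightarrow> b \<le> 1 \<longrightarrow> (\<exists>Ob A. open Ob \<and> y0 \<in> Ob \<and> (\<forall>y\<in>Ob \<inter> Y. A (a, y) = 0) \<and>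
     cobounds ({a..b} \<times> (Ob \<inter> Y)) A (\<lambda>p q. c (a, snd p) (a, snd q)) c))"
  have c0: "c p p = 0" if "p \<in> {0..1} \<times> Y" for p using cocycle_diag [OF c that] .
  have "P a b"
  proof (rule Bolzano [of a b P])
    fix a b d assume Pab: "P a b" and Pbd: "P b d" and ab: "a \<le> b" "b \<le> d"
    show "P a d" unfolding P_def
    proof (intro impI)
      assume a: "0 \<le> a" and d: "d \<le> 1"
      have b: "0 \<le> b" "b \<le> 1" using a d ab by simp_all
      obtain O1 A where A: "open O1" "y0 \<in> O1" "\<forall>y\<in>O1 \<inter> Y. A (a, y) = 0"
        "cobounds ({a..b} \<times> (O1 \<inter> Y)) A (\<lambda>p q. c (a, snd p) (a, snd q)) c"
        using Pab [unfolded P_def, rule_format, OF a b(2)] by (elim exE conjE) (rule that)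
      obtain O2 B where B: "open O2" "y0 \<in> O2" "\<forall>y\<in>O2 \<inter> Y. B (b, y) = 0"
        "cobounds ({b..d} \<times> (O2 \<inter> Y)) B (\<lambda>p q. c (b, snd p) (b, snd q)) c"
        using Pbd [unfolded P_def, rule_format, OF b(1) d] by (elim exE conjE) (rule that)
      \<comment> \<open>The upper solution starts at height \<open>b\<close> with the value 0, so
        the value of the lower solution at that height is put in front of it.\<close>
      define G where "G = (\<lambda>p. if fst p \<le> b then A p else A (b, snd p) + B p)"
      have "cobounds ({a..d} \<times> (O1 \<inter> O2 \<inter> Y)) G (\<lambda>p q. c (a, snd p) (a, snd q)) c"
        unfolding cobounds_def
      proof (rule nearI)
        fix p assume p: "p \<in> {a..d} \<times> (O1 \<inter> O2 \<inter> Y)"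
        then obtain s y where sy: "p = (s, y)" "a \<le> s" "s \<le> d" "y \<in> O1" "y \<in> O2" "y \<in> Y" by auto
        let ?T = "{a..d} \<times> (O1 \<inter> O2 \<inter> Y)"
        have Aat: "\<exists>W. open W \<and> q \<in> W \<and> (\<forall>x\<in>W \<inter> ({a..b} \<times> (O1 \<inter> Y)). \<forall>y\<in>W \<inter> ({a..b} \<times> (O1 \<inter> Y)).
            c x y = - A x + c (a, snd x) (a, snd y) + A y)" if "q \<in> {a..b} \<times> (O1 \<inter> Y)" for q
          by (rule near_pairs [OF A(4) [unfolded cobounds_def] that])
        have Bat: "\<exists>W. open W \<and> q \<in> W \<and> (\<forall>x\<in>W \<inter> ({b..d} \<times> (O2 \<inter> Y)). \<forall>y\<in>W \<inter> ({b..d} \<times> (O2 \<inter> Y)).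
            c x y = - B x + c (b, snd x) (b, snd y) + B y)" if "q \<in> {b..d} \<times> (O2 \<inter> Y)" for q
          by (rule near_pairs [OF B(4) [unfolded cobounds_def] that])
        note box = open_box [of _ _ y]
        have "\<exists>J K. open J \<and> s \<in> J \<and> open K \<and> y \<in> K \<and>
           (\<forall>x\<in>(J \<times> K) \<inter> ?T. \<forall>y\<in>(J \<times> K) \<inter> ?T. c x y = - G x + c (a, snd x) (a, snd y) + G y)"
        proof -
          consider "s < b" | "b < s" | "s = b" by linarith
          then show ?thesis
          proof cases
            case 1
            have "p \<in> {a..b} \<times> (O1 \<inter> Y)" using sy 1 by auto
            from Aat [OF this] obtain W where W: "open W" "p \<in> W" "\<forall>x\<in>W \<inter> ({a..b} \<times> (O1 \<inter> Y)). \<forall>y\<in>W \<inter> ({a..b} \<times> (O1 \<inter> Y)).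
               c x y = - A x + c (a, snd x) (a, snd y) + A y" by (elim exE conjE) (rule that)
            obtain J K where JK: "open J" "s \<in> J" "open K" "y \<in> K" "J \<times> K \<subseteq> W"
              using box [OF W(1) W(2) [unfolded sy(1)]] by (elim exE conjE) (rule that)
            have "c x y = - G x + c (a, snd x) (a, snd y) + G y"
              if "x \<in> ((J \<inter> {..<b}) \<times> K) \<inter> ?T" "y \<in> ((J \<inter> {..<b}) \<times> K) \<inter> ?T" for x y
            proof -
              have "x \<in> W \<inter> ({a..b} \<times> (O1 \<inter> Y))" "y \<in> W \<inter> ({a..b} \<times> (O1 \<inter> Y))" "G x = A x" "G y = A y"
                using that JK(5) by (auto simp: G_def)
              then show ?thesis using W(3) by simp
            qed
            then show ?thesis using JK 1 by (intro exI [of _ "J \<inter> {..<b}"] exI [of _ K]) auto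
          next
            case 2
            have pB: "p \<in> {b..d} \<times> (O2 \<inter> Y)" and pA: "(b, y) \<in> {a..b} \<times> (O1 \<inter> Y)" using sy 2 ab by auto
            from Bat [OF pB] obtain W where W: "open W" "p \<in> W" "\<forall>x\<in>W \<inter> ({b..d} \<times> (O2 \<inter> Y)). \<forall>y\<in>W \<inter> ({b..d} \<times> (O2 \<inter> Y)).
               c x y = - B x + c (b, snd x) (b, snd y) + B y" by (elim exE conjE) (rule that)
            from Aat [OF pA] obtain W' where W': "open W'" "(b, y) \<in> W'" "\<forall>x\<in>W' \<inter> ({a..b} \<times> (O1 \<inter> Y)). \<forall>y\<in>W' \<inter> ({a..b} \<times> (O1 \<inter> Y)).
               c x y = - A x + c (a, snd x) (a, snd y) + A y"  by (elim exE conjE) (rule that)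
            obtain J K where JK: "open J" "s \<in> J" "open K" "y \<in> K" "J \<times> K \<subseteq> W"
              using box [OF W(1) W(2) [unfolded sy(1)]] by (elim exE conjE) (rule that)
            obtain J' K' where JK': "open J'" "b \<in> J'" "open K'" "y \<in> K'" "J' \<times> K' \<subseteq> W'"
              using box [OF W'(1,2)] by (elim exE conjE) (rule that)
            have "c x y = - G x + c (a, snd x) (a, snd y) + G y"
              if "x \<in> ((J \<inter> {b<..}) \<times> (K \<inter> K')) \<inter> ?T" "y \<in> ((J \<inter> {b<..}) \<times> (K \<inter> K')) \<inter> ?T" for x y
            proof -
              have "x \<in> W \<inter> ({b..d} \<times> (O2 \<inter> Y))" "y \<in> W \<inter> ({b..d} \<times> (O2 \<inter> Y))"
                "(b, snd x) \<in> W' \<inter> ({a..b} \<times> (O1 \<inter> Y))" "(b, snd y) \<in> W' \<inter> ({a..b} \<times> (O1 \<inter> Y))"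
                "G x = A (b, snd x) + B x" "G y = A (b, snd y) + B y"
                using that JK(5) JK'(2,5) ab by (auto simp: G_def)
              then have "c x y = - B x + c (b, snd x) (b, snd y) + B y"
                "c (b, snd x) (b, snd y) = - A (b, snd x) + c (a, snd x) (a, snd y) + A (b, snd y)"
                using W(3) W'(3) by auto
              then show ?thesis using \<open>G x = _\<close> \<open>G y = _\<close> by (simp add: grp_norm)
            qed
            then show ?thesis using JK JK' 2 by (intro exI [of _ "J \<inter> {b<..}"] exI [of _ "K \<inter> K'"]) auto
          next
            case 3
            have pB: "(b, y) \<in> {b..d} \<times> (O2 \<inter> Y)" and pA: "(b, y) \<in> {a..b} \<times> (O1 \<inter> Y)" and b01: "(b, y) \<in> {0..1} \<times> Y"
              using sy 3 ab a d by auto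
            from Bat [OF pB] obtain W where W: "open W" "(b, y) \<in> W" "\<forall>x\<in>W \<inter> ({b..d} \<times> (O2 \<inter> Y)). \<forall>y\<in>W \<inter> ({b..d} \<times> (O2 \<inter> Y)).
               c x y = - B x + c (b, snd x) (b, snd y) + B y" by (elim exE conjE) (rule that)
            from Aat [OF pA] obtain W' where W': "open W'" "(b, y) \<in> W'" "\<forall>x\<in>W' \<inter> ({a..b} \<times> (O1 \<inter> Y)). \<forall>y\<in>W' \<inter> ({a..b} \<times> (O1 \<inter> Y)).
               c x y = - A x + c (a, snd x) (a, snd y) + A y"  by (elim exE conjE) (rule that)
            obtain W'' where W'': "open W''" "(b, y) \<in> W''"
              "\<forall>x\<in>W'' \<inter> ({0..1} \<times> Y). \<forall>y\<in>W'' \<inter> ({0..1} \<times> Y). \<forall>z\<in>W'' \<inter> ({0..1} \<times> Y). c x y + c y z = c x z"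
              using c [unfolded cocycle_def near_def, THEN bspec, OF b01] by (elim exE conjE) (rule that)
            have "open (W \<inter> W' \<inter> W'')" "(b, y) \<in> W \<inter> W' \<inter> W''" using W W' W'' by auto
            then obtain J K where JK: "open J" "b \<in> J" "open K" "y \<in> K" "J \<times> K \<subseteq> W \<inter> W' \<inter> W''"
              using box [OF \<open>open (W \<inter> W' \<inter> W'')\<close> \<open>(b, y) \<in> W \<inter> W' \<inter> W''\<close>] by (elim exE conjE) (rule that)
            \<comment> \<open>Near the seam a pair may have one point below and one above height
              \<open>b\<close>. Both points are compared with their projections to that height, a
              detour which the cocycle identity allows.\<close>
            have half: "c (b, snd x) x = - A (b, snd x) + G x" "snd x \<in> O1 \<inter> Y"
              "(b, snd x) \<in> W''" "(b, snd x) \<in> {0..1} \<times> Y" "x \<in> W''" "x \<in> {0..1} \<times> Y"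
              "(b, snd x) \<in> W' \<inter> ({a..b} \<times> (O1 \<inter> Y))"
              if x: "x \<in> (J \<times> K) \<inter> ?T" for x
            proof -
              have xb: "(b, snd x) \<in> W \<inter> ({b..d} \<times> (O2 \<inter> Y))" "(b, snd x) \<in> W' \<inter> ({a..b} \<times> (O1 \<inter> Y))"
                and "x \<in> W" "x \<in> W'" using x JK(2,5) ab by auto
              show "snd x \<in> O1 \<inter> Y" "(b, snd x) \<in> W''" "(b, snd x) \<in> {0..1} \<times> Y" "x \<in> W''" "x \<in> {0..1} \<times> Y"
                "(b, snd x) \<in> W' \<inter> ({a..b} \<times> (O1 \<inter> Y))"
                using x JK(2,5) ab a d by auto
              have aa: "c (a, snd x) (a, snd x) = 0" "c (b, snd x) (b, snd x) = 0"
                using x ab a d by (intro c0; auto)+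
              show "c (b, snd x) x = - A (b, snd x) + G x"
              proof (cases "fst x \<le> b")
                case True
                then have xW: "x \<in> W' \<inter> ({a..b} \<times> (O1 \<inter> Y))" using x \<open>x \<in> W'\<close> by auto
                show ?thesis using bspec [OF bspec [OF W'(3) xb(2)] xW] aa True by (simp add: G_def)
              next
                case False
                then have xW: "x \<in> W \<inter> ({b..d} \<times> (O2 \<inter> Y))" using x \<open>x \<in> W\<close> by auto
                have "c (b, snd x) x = - B (b, snd x) + c (b, snd x) (b, snd x) + B x"
                  using bspec [OF bspec [OF W(3) xb(1)] xW] by simp
                moreover have "B (b, snd x) = 0" using B(3) xb(1) by auto
                ultimately show ?thesis using False aa by (simp add: G_def)
              qed
            qed
            have "c x y = - G x + c (a, snd x) (a, snd y) + G y"
              if "x \<in> (J \<times> K) \<inter> ?T" "y \<in> (J \<times> K) \<inter> ?T" for x y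
            proof -
              note hx = half [OF that(1)] and hy = half [OF that(2)]
              have 1: "c (b, snd x) (b, snd y) = - A (b, snd x) + c (a, snd x) (a, snd y) + A (b, snd y)"
                using bspec [OF bspec [OF W'(3) hx(7)] hy(7)] by simp
              note W3 = bspec [OF bspec [OF bspec [OF W''(3)]], OF IntI IntI IntI]
              have 2: "c (b, snd x) x + c x y = c (b, snd x) y" by (rule W3) (fact hx hy)+
              have 3: "c (b, snd x) (b, snd y) + c (b, snd y) y = c (b, snd x) y" by (rule W3) (fact hx hy)+
              have "c x y = - c (b, snd x) x + (c (b, snd x) (b, snd y) + c (b, snd y) y)"
                unfolding 3 2 [symmetric] by simp
              then show ?thesis by (simp add: 1 hx(1) hy(1) grp_norm)
            qed
            then show ?thesis using JK 3 by (intro exI [of _ J] exI [of _ K]) auto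
          qed
        qed
        then obtain J K where "open J" "s \<in> J" "open K" "y \<in> K"
           "\<forall>x\<in>(J \<times> K) \<inter> ?T. \<forall>y\<in>(J \<times> K) \<inter> ?T. c x y = - G x + c (a, snd x) (a, snd y) + G y" by blast
        then show "\<exists>Ob. open Ob \<and> p \<in> Ob \<and> (\<forall>x\<in>Ob \<inter> ?T. \<forall>y\<in>Ob \<inter> ?T. \<forall>z\<in>Ob \<inter> ?T.
            c x y = - G x + c (a, snd x) (a, snd y) + G y)"
          using sy(1) by (intro exI [of _ "J \<times> K"]) (auto simp: open_Times)
      qed
      moreover have "\<forall>y\<in>O1 \<inter> O2 \<inter> Y. G (a, y) = 0" using A(3) ab by (simp add: G_def)
      ultimately show "\<exists>Ob A. open Ob \<and> y0 \<in> Ob \<and> (\<forall>y\<in>Ob \<inter> Y. A (a, y) = 0) \<and>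
          cobounds ({a..d} \<times> (Ob \<inter> Y)) A (\<lambda>p q. c (a, snd p) (a, snd q)) c"
        using A B by (intro exI [of _ "O1 \<inter> O2"] exI [of _ G]) auto
    qed
  next
    fix x assume "a \<le> x" "x \<le> b"
    then have x01: "(x, y0) \<in> {0..1} \<times> Y" using assms by auto
    obtain W where W: "open W" "(x, y0) \<in> W"
      "\<forall>x\<in>W \<inter> ({0..1} \<times> Y). \<forall>y\<in>W \<inter> ({0..1} \<times> Y). \<forall>z\<in>W \<inter> ({0..1} \<times> Y). c x y + c y z = c x z"
      using c [unfolded cocycle_def near_def, THEN bspec, OF x01] by (elim exE conjE) (rule that)
    obtain J K where JK: "open J" "x \<in> J" "open K" "y0 \<in> K" "J \<times> K \<subseteq> W"
      using open_box [OF W(1,2)] by (elim exE conjE) (rule that)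
    obtain d where d: "d > 0" "\<And>s. dist s x < d \<Longrightarrow> s \<in> J" using JK(1,2) open_dist by metis
    have "P a' b'" if "a' \<le> x" "x \<le> b'" "b' - a' < d" for a' b'
      unfolding P_def
    proof (intro impI)
      assume ab': "0 \<le> a'" "b' \<le> 1"
      define A where "A = (\<lambda>p. c (a', snd p) p)"
      have "c p q = - A p + c (a', snd p) (a', snd q) + A q"
        if "p \<in> {a'..b'} \<times> (K \<inter> Y)" "q \<in> {a'..b'} \<times> (K \<inter> Y)" for p q
      proof -
        have J: "s \<in> J" if "a' \<le> s" "s \<le> b'" for s
          using that \<open>a' \<le> x\<close> \<open>x \<le> b'\<close> \<open>b' - a' < d\<close> by (intro d(2)) (auto simp: dist_real_def)
        have *: "r \<in> W \<and> r \<in> {0..1} \<times> Y" if "r \<in> {a'..b'} \<times> (K \<inter> Y)" for r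
          using that J JK(5) ab' by (cases r) auto
        have mem: "p \<in> W" "p \<in> {0..1} \<times> Y" "q \<in> W" "q \<in> {0..1} \<times> Y" using * that by blast+
        have mem': "(a', snd p) \<in> W" "(a', snd p) \<in> {0..1} \<times> Y" "(a', snd q) \<in> W" "(a', snd q) \<in> {0..1} \<times> Y"
          using * [of "(a', snd p)"] * [of "(a', snd q)"] that \<open>a' \<le> x\<close> \<open>x \<le> b'\<close> by (cases p; cases q; auto)+
        note W3 = bspec [OF bspec [OF bspec [OF W(3)]], OF IntI IntI IntI]
        have "c (a', snd p) p + c p q = c (a', snd p) q" "c (a', snd p) (a', snd q) + c (a', snd q) q = c (a', snd p) q"
          by (rule W3; fact mem mem')+
        then have "A p + c p q = c (a', snd p) (a', snd q) + A q" by (simp add: A_def)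
        then have "- A p + (A p + c p q) = - A p + (c (a', snd p) (a', snd q) + A q)" by simp
        then show ?thesis by (simp add: add.assoc)
      qed
      then have "cobounds ({a'..b'} \<times> (K \<inter> Y)) A (\<lambda>p q. c (a', snd p) (a', snd q)) c"
        unfolding cobounds_def by (intro nearI exI [of _ UNIV]) auto
      moreover have "\<forall>y\<in>K \<inter> Y. A (a', y) = 0" using ab' that by (auto simp: A_def intro!: c0)
      ultimately show "\<exists>Ob A. open Ob \<and> y0 \<in> Ob \<and> (\<forall>y\<in>Ob \<inter> Y. A (a', y) = 0) \<and>
          cobounds ({a'..b'} \<times> (Ob \<inter> Y)) A (\<lambda>p q. c (a', snd p) (a', snd q)) c"
        using JK by blast
    qed
    then show "\<exists>d>0. \<forall>a b. a \<le> x \<and> x \<le> b \<and> b - a < d \<longrightarrow> P a b" using d(1) by blast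
  qed (use assms in auto)
  then show ?thesis using assms unfolding P_def by blast
qed

text \<open>The local solutions all vanish at the bottom, and two primitives on a vertical segment
  that agree at one point coincide. So the local solutions agree on overlaps and glue to
  \<open>G\<close>.\<close>

theorem cylinder:
  fixes c :: "real \<times> 'a::topological_space \<Rightarrow> real \<times> 'a \<Rightarrow> 'g::group_add"
  assumes c: "cocycle ({0..1} \<times> Y) c"
  shows "\<exists>A. (\<forall>y\<in>Y. A (0, y) = 0) \<and> cobounds ({0..1} \<times> Y) A (\<lambda>p q. c (0, snd p) (0, snd q)) c"
proof -
  have "\<forall>y0\<in>Y. \<exists>Ob (A :: real \<times> 'a \<Rightarrow> 'g). open Ob \<and> y0 \<in> Ob \<and> (\<forall>y\<in>Ob \<inter> Y. A (0, y) = 0) \<and>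
     cobounds ({0..1} \<times> (Ob \<inter> Y)) A (\<lambda>p q. c (0, snd p) (0, snd q)) c"
    using cylinder_step [OF c, of _ 0 1] by simp
  then obtain N and A :: "'a \<Rightarrow> real \<times> 'a \<Rightarrow> 'g" where NA: "\<And>y. y \<in> Y \<Longrightarrow> open (N y)" "\<And>y. y \<in> Y \<Longrightarrow> y \<in> N y"
    "\<And>y y'. y \<in> Y \<Longrightarrow> y' \<in> N y \<Longrightarrow> y' \<in> Y \<Longrightarrow> A y (0, y') = 0"
    "\<And>y. y \<in> Y \<Longrightarrow> cobounds ({0..1} \<times> (N y \<inter> Y)) (A y) (\<lambda>p q. c (0, snd p) (0, snd q)) c"
    unfolding bchoice_iff by auto
  define G where "G = (\<lambda>p. A (snd p) p)"
  have G: "G p = A y p" if y: "y \<in> Y" and p: "p \<in> {0..1} \<times> (N y \<inter> Y)" for p y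
  proof -
    obtain s z where sz: "p = (s, z)" "0 \<le> s" "s \<le> 1" "z \<in> N y" "z \<in> Y" using p by auto
    have "primitive {0..1} (\<lambda>s t. c (s, z) (t, z)) (\<lambda>s. A w (s, z))" if "w \<in> Y" "z \<in> N w" for w
    proof -
      have "cobounds {0..1} (\<lambda>s. A w (s, z)) (\<lambda>s t. c (0, z) (0, z)) (\<lambda>s t. c (s, z) (t, z))"
        using cobounds_pull [OF NA(4) [OF that(1)], of "{0..1}" "\<lambda>s. (s, z)"] that sz
        by (simp add: continuous_intros)
      then show ?thesis using cocycle_diag [OF c, of "(0, z)"] sz by (simp add: cobounds_def primitive_def)
    qed
    then have "A y (s, z) - A z (s, z) = A y (0, z) - A z (0, z)"
      using sz y NA(2) by (intro primitive_unique [of "{0..1}" _ "\<lambda>s. A y (s, z)" "\<lambda>s. A z (s, z)"]) auto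
    then show ?thesis using NA(3) [of y z] NA(3) [of z z] NA(2) [of z] sz y by (simp add: G_def)
  qed
  have "cobounds ({0..1} \<times> Y) G (\<lambda>p q. c (0, snd p) (0, snd q)) c"
    unfolding cobounds_def
  proof (rule nearI)
    fix p :: "real \<times> 'a" assume "p \<in> {0..1} \<times> Y"
    then obtain s y where sy: "p = (s, y)" "0 \<le> s" "s \<le> 1" "y \<in> Y" by auto
    then have "p \<in> {0..1} \<times> (N y \<inter> Y)" using NA(2) by auto
    from near_pairs [OF NA(4) [OF sy(4), unfolded cobounds_def] this]
    obtain W where W: "open W" "p \<in> W" "\<forall>x\<in>W \<inter> ({0..1} \<times> (N y \<inter> Y)). \<forall>z\<in>W \<inter> ({0..1} \<times> (N y \<inter> Y)).
        c x z = - A y x + c (0, snd x) (0, snd z) + A y z" by (elim exE conjE) (rule that)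
    have *: "c x z = - G x + c (0, snd x) (0, snd z) + G z"
      if "x \<in> W \<inter> (UNIV \<times> N y) \<inter> ({0..1} \<times> Y)" "z \<in> W \<inter> (UNIV \<times> N y) \<inter> ({0..1} \<times> Y)" for x z
    proof -
      have "x \<in> {0..1} \<times> (N y \<inter> Y)" "z \<in> {0..1} \<times> (N y \<inter> Y)" using that by auto
      then show ?thesis using W(3) that G [OF sy(4)] by simp
    qed
    moreover have "open (W \<inter> (UNIV \<times> N y))" using W(1) NA(1) [OF sy(4)] by (simp add: open_Int open_Times)
    moreover have "p \<in> W \<inter> (UNIV \<times> N y)" using W(2) NA(2) sy by simp
    ultimately show "\<exists>Ob. open Ob \<and> p \<in> Ob \<and> (\<forall>x\<in>Ob \<inter> ({0..1} \<times> Y). \<forall>y\<in>Ob \<inter> ({0..1} \<times> Y). \<forall>z\<in>Ob \<inter> ({0..1} \<times> Y).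
        c x y = - G x + c (0, snd x) (0, snd y) + G y)" by blast
  qed
  moreover have "\<forall>y\<in>Y. G (0, y) = 0" using NA(2,3) by (simp add: G_def)
  ultimately show ?thesis by blast
qed

lemma homotopic_cobounds:
  fixes F :: "real \<times> 'a::topological_space \<Rightarrow> 'b::topological_space"
  assumes "cocycle S c" "continuous_on ({0..1} \<times> Y) F" "\<And>s y. s \<in> {0..1} \<Longrightarrow> y \<in> Y \<Longrightarrow> F (s, y) \<in> S"
  shows "\<exists>A. cobounds Y A (\<lambda>x y. c (F (0, x)) (F (0, y))) (\<lambda>x y. c (F (1, x)) (F (1, y)))"
proof -
  have "cocycle ({0..1} \<times> Y) (\<lambda>p q. c (F p) (F q))"
    using assms by (intro cocycle_pull [OF assms(1)]) auto
  from cylinder [OF this] obtain A where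
    A: "cobounds ({0..1} \<times> Y) A (\<lambda>p q. c (F (0, snd p)) (F (0, snd q))) (\<lambda>p q. c (F p) (F q))" by blast
  have cont: "continuous_on Y (\<lambda>y. (1 :: real, y))" by (intro continuous_intros)
  show ?thesis using cobounds_pull [OF A cont] by (intro exI [of _ "\<lambda>x. A (1, x)"]) simp
qed

lemma convex_primitive:
  fixes S :: "'a::real_normed_vector set"
  assumes "cocycle S c" "convex S"
  shows "\<exists>A. primitive S c A"
proof (cases "S = {}")
  case True
  then show ?thesis by (simp add: primitive_def near_def)
next
  case False
  then obtain k where k: "k \<in> S" by blast
  have cont: "continuous_on ({0..1} \<times> S) (\<lambda>p. (1 - fst p) *\<^sub>R k + fst p *\<^sub>R snd p)"
    by (intro continuous_intros)
  have "\<exists>A. cobounds S A (\<lambda>x y. c ((1 - 0) *\<^sub>R k + 0 *\<^sub>R x) ((1 - 0) *\<^sub>R k + 0 *\<^sub>R y))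
      (\<lambda>x y. c ((1 - 1) *\<^sub>R k + 1 *\<^sub>R x) ((1 - 1) *\<^sub>R k + 1 *\<^sub>R y))"
    using homotopic_cobounds [OF assms(1), of S "\<lambda>p. (1 - fst p) *\<^sub>R k + fst p *\<^sub>R snd p"] assms(2) k
      cont by (auto simp: convex_alt)
  then show ?thesis using cocycle_diag [OF assms(1) k] by (auto simp: cobounds_def primitive_def)
qed

lemma subgroup_valued:
  assumes H: "0 \<in> H" "\<And>a b. a \<in> H \<Longrightarrow> b \<in> H \<Longrightarrow> a + b \<in> H" "\<And>a. a \<in> H \<Longrightarrow> - a \<in> H"
    and "near S (\<lambda>x y z. c x y \<in> H)" "primitive S c A" "connected S" "x \<in> S" "y \<in> S"
  shows "- A x + A y \<in> H"
proof -
  have "near S (\<lambda>y z w. (- A x + A y \<in> H) = (- A x + A z \<in> H))"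
  proof (rule near_mono [OF near_conj [OF assms(4) assms(5) [unfolded primitive_def]]])
    fix y z assume h: "c y z \<in> H \<and> c y z = - A y + A z"
    have "- A x + A z = (- A x + A y) + c y z" "- A x + A y = (- A x + A z) + - c y z"
      using h by (simp_all add: grp_norm)
    then show "(- A x + A y \<in> H) = (- A x + A z \<in> H)" using H h by metis
  qed
  from near_connected_const [OF this assms(6-8)] show ?thesis using H(1) by simp
qed

section \<open>The punctured plane\<close>

definition plane :: "nat \<Rightarrow> complex set" where
  "plane N = - (of_nat ` {..<N})"

definition strips :: "nat \<Rightarrow> complex set" where
  "strips N = {z. \<forall>j<N. Re z \<noteq> real j}"

text \<open>\<open>slit 1 N\<close> and \<open>slit (-1) N\<close> are the planes slit downwards and upwards along the punctures.\<close>

definition slit :: "real \<Rightarrow> nat \<Rightarrow> complex set" where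
  "slit \<sigma> N = {z. 0 < \<sigma> * Im z} \<union> strips N"

definition strip :: "nat \<Rightarrow> nat \<Rightarrow> complex set" where
  "strip N k = {z. \<forall>j<N. if j < k then real j < Re z else Re z < real j}"

text \<open>The loop around the punctures to the left of \<open>z\<close>. On the plane slit upwards
  it is a primitive of \<open>crossing\<close>.\<close>

definition strip_label :: "nat \<Rightarrow> complex \<Rightarrow> fgroup" where
  "strip_label N z = ul (card {j. j < N \<and> real j < Re z})"

text \<open>
  With base point in the upper half plane, the loop \<open>gen j\<close> goes down to the left of the puncture \<open>j\<close>
  and up to its right.
\<close>

definition crossing :: "nat \<Rightarrow> complex \<Rightarrow> complex \<Rightarrow> fgroup" where
  "crossing N x y = (if Im x < 0 then - strip_label N x + strip_label N y else 0)"

lemma open_strips: "open (strips N)"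
proof -
  have "strips N = (\<Inter>j\<in>{..<N}. {z. Re z \<noteq> real j})" by (auto simp: strips_def)
  then show ?thesis
    by (simp only:) (intro open_INT finite_lessThan ballI open_Collect_neq continuous_intros)
qed

lemma open_slit: "open (slit \<sigma> N)"
  unfolding slit_def
  by (intro open_Un open_strips open_Collect_less continuous_intros)

lemma slit_Un: "slit 1 N \<union> slit (-1) N = plane N"
proof -
  have 1: "z \<in> plane N \<longleftrightarrow> Im z \<noteq> 0 \<or> z \<in> strips N" for z
    by (auto simp: plane_def strips_def complex_eq_iff)
  have 2: "z \<in> slit 1 N \<union> slit (-1) N \<longleftrightarrow> Im z \<noteq> 0 \<or> z \<in> strips N" for z
    unfolding slit_def by (cases "Im z" "0 :: real" rule: linorder_cases) simp_all
  show ?thesis by (rule Set.set_eqI) (simp only: 1 2)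
qed

lemma open_strip: "open (strip N k)"
proof -
  have "strip N k = (\<Inter>j\<in>{..<N}. if j < k then {z. real j < Re z} else {z. Re z < real j})"
    by (auto simp: strip_def split: if_splits)
  moreover have "open (if j < k then {z. real j < Re z} else {z. Re z < real j})" for j
    by (auto intro!: open_Collect_less continuous_intros)
  ultimately show ?thesis by (simp only:) (intro open_INT finite_lessThan ballI)
qed

lemma convex_halfspaces [simp]:
  "convex {z. a < Re z}" "convex {z. Re z < a}" "convex {z. a < Im z}" "convex {z. Im z < a}"
  by (simp_all add: convex_halfspace_Re_gt convex_halfspace_Re_lt convex_halfspace_Im_gt convex_halfspace_Im_lt)

lemma open_halfspaces:
  "open {z. a < Re z}" "open {z. Re z < a}" "open {z. a < Im z}" "open {z. Im z < a}"
  by (intro open_Collect_less continuous_intros)+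

lemma convex_strip: "convex (strip N k)"
proof -
  have "strip N k = (\<Inter>j\<in>{..<N}. if j < k then {z. real j < Re z} else {z. Re z < real j})"
    by (auto simp: strip_def split: if_splits)
  then show ?thesis by (simp only:) (intro convex_INT, simp)
qed

lemma strip_subset: "strip N k \<subseteq> strips N"
  by (auto simp: strip_def strips_def split: if_splits)

lemma strip_label_strip:
  assumes "z \<in> strip N k" "k \<le> N"
  shows "strip_label N z = ul k"
proof -
  have "{j. j < N \<and> real j < Re z} = {..<k}"
    using assms by (force simp: strip_def split: if_splits)
  then show ?thesis by (simp add: strip_label_def)
qed

lemma down_closed_initial:
  fixes A :: "nat set"
  assumes "finite A" "\<And>i j. i \<in> A \<Longrightarrow> j < i \<Longrightarrow> j \<in> A"
  shows "A = {..<card A}"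
proof (cases "A = {}")
  case False
  have "A = {..<Suc (Max A)}"
    using assms(2) [of "Max A"] Max_in [OF assms(1) False] Max_ge [OF assms(1)]
    by (auto simp: less_Suc_eq_le le_less)
  then show ?thesis by (metis card_lessThan)
qed simp

lemma strips_cover:
  assumes "z \<in> strips N"
  obtains k where "k \<le> N" "z \<in> strip N k"
proof -
  let ?A = "{j. j < N \<and> real j < Re z}"
  have A: "?A = {..<card ?A}" by (rule down_closed_initial) auto
  have "card ?A \<le> card {..<N}" by (rule card_mono) auto
  then have "card ?A \<le> N" by simp
  moreover have "z \<in> strip N (card ?A)"
    unfolding strip_def
  proof (intro CollectI allI impI)
    fix j assume j: "j < N"
    then have "j < card ?A \<longleftrightarrow> real j < Re z" using A by blast
    moreover have "Re z \<noteq> real j" using assms j by (simp add: strips_def)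
    ultimately show "if j < card ?A then real j < Re z else Re z < real j" by auto
  qed
  ultimately show ?thesis by (rule that)
qed

section \<open>The crossing cocycle and its universality\<close>

lemma near_all: "(\<And>x y z. x \<in> S \<Longrightarrow> y \<in> S \<Longrightarrow> z \<in> S \<Longrightarrow> R x y z) \<Longrightarrow> near S R"
  unfolding near_def by (blast intro: open_UNIV)

lemma near_strip_label: "near (strips N) (\<lambda>x y z. strip_label N x = strip_label N y)"
proof (rule nearI)
  fix p assume "p \<in> strips N"
  then obtain k where "k \<le> N" "p \<in> strip N k" by (rule strips_cover)
  then show "\<exists>Ob. open Ob \<and> p \<in> Ob \<and> (\<forall>x\<in>Ob \<inter> strips N. \<forall>y\<in>Ob \<inter> strips N. \<forall>z\<in>Ob \<inter> strips N.
      strip_label N x = strip_label N y)"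
    using open_strip by (intro exI [of _ "strip N k"]) (auto simp: strip_label_strip)
qed

lemma primitive_crossing_up: "primitive (slit 1 N) (crossing N) (\<lambda>_. 0)"
  unfolding primitive_def slit_def
proof (rule near_open_Un)
  show "near {z. 0 < 1 * Im z} (\<lambda>x y z. crossing N x y = - 0 + 0)"
    by (rule near_all) (simp add: crossing_def)
  show "near (strips N) (\<lambda>x y z. crossing N x y = - 0 + 0)"
    by (rule near_mono [OF near_strip_label]) (simp add: crossing_def)
qed (auto intro: open_strips simp: open_halfspaces)

lemma primitive_crossing_down: "primitive (slit (-1) N) (crossing N) (strip_label N)"
  unfolding primitive_def slit_def
proof (rule near_open_Un)
  show "near {z. 0 < -1 * Im z} (\<lambda>x y z. crossing N x y = - strip_label N x + strip_label N y)"
    by (rule near_all) (simp add: crossing_def)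
  show "near (strips N) (\<lambda>x y z. crossing N x y = - strip_label N x + strip_label N y)"
    by (rule near_mono [OF near_strip_label]) (simp add: crossing_def)
qed (auto intro: open_strips simp: open_halfspaces)

lemma primitive_imp_cocycle:
  assumes "primitive S c A" shows "cocycle S c"
  unfolding cocycle_def
proof (rule nearI)
  fix p assume "p \<in> S"
  from near_pairs [OF assms [unfolded primitive_def] this] obtain W where
    W: "open W" "p \<in> W" "\<forall>x\<in>W \<inter> S. \<forall>y\<in>W \<inter> S. c x y = - A x + A y"
    by (elim exE conjE) (rule that)
  have "\<forall>x\<in>W \<inter> S. \<forall>y\<in>W \<inter> S. \<forall>z\<in>W \<inter> S. c x y + c y z = c x z"
    using W(3) by (simp add: grp_norm)
  then show "\<exists>Ob. open Ob \<and> p \<in> Ob \<and> (\<forall>x\<in>Ob \<inter> S. \<forall>y\<in>Ob \<inter> S. \<forall>z\<in>Ob \<inter> S. c x y + c y z = c x z)"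
    using W(1,2) by (intro exI [of _ W] conjI)
qed

lemma cocycle_crossing: "cocycle (plane N) (crossing N)"
  unfolding slit_Un [symmetric] cocycle_def
  by (rule near_open_Un [OF primitive_imp_cocycle [OF primitive_crossing_up, unfolded cocycle_def]
        primitive_imp_cocycle [OF primitive_crossing_down, unfolded cocycle_def] open_slit open_slit])

lemma primitive_cobounds:
  assumes "primitive S c A" "cobounds S B c c'"
  shows "primitive S c' (\<lambda>x. A x + B x)"
  unfolding primitive_def
  by (rule near_mono [OF near_conj [OF assms(1) [unfolded primitive_def] assms(2) [unfolded cobounds_def]]])
    (simp add: grp_norm)

lemma convex_half: "\<sigma> \<in> {1, -1} \<Longrightarrow> convex {z. 0 < \<sigma> * Im z}"
  using convex_halfspaces(3) [of 0] convex_halfspaces(4) [of 0] by auto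

text \<open>\<open>F\<close> pushes the slit plane vertically, parallel to the slits, into a
  half-plane, which is convex. As far as cocycles are concerned the slit plane is thus simply
  connected.\<close>

lemma slit_primitive:
  assumes c: "cocycle (slit \<sigma> N) c" and \<sigma>: "\<sigma> \<in> {1, -1}"
  shows "\<exists>A. primitive (slit \<sigma> N) c A"
proof -
  define F where "F = (\<lambda>p :: real \<times> complex. Complex (Re (snd p)) (Im (snd p) + \<sigma> * fst p * (\<bar>Im (snd p)\<bar> + 1)))"
  have F: "continuous_on A F" for A
    unfolding F_def Complex_eq by (intro continuous_intros)
  have F_in: "F (s, y) \<in> slit \<sigma> N" if "s \<in> {0..1}" "y \<in> slit \<sigma> N" for s y
  proof (cases "y \<in> strips N")
    case False
    then have "0 < \<sigma> * Im y" using that by (simp add: slit_def)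
    moreover have "\<sigma> * Im (F (s, y)) = \<sigma> * Im y + s * (\<bar>Im y\<bar> + 1)" using \<sigma> by (auto simp: F_def algebra_simps)
    moreover have "0 \<le> s * (\<bar>Im y\<bar> + 1)" using that by simp
    ultimately show ?thesis by (simp add: slit_def)
  qed (simp add: slit_def strips_def F_def)
  have F0: "F (0, y) = y" for y by (simp add: F_def)
  have F1: "F (1, y) \<in> {z. 0 < \<sigma> * Im z}" for y using \<sigma> by (auto simp: F_def)
  obtain A where A: "cobounds (slit \<sigma> N) A c (\<lambda>x y. c (F (1, x)) (F (1, y)))"
    using homotopic_cobounds [OF c F F_in] by (auto simp: F0)
  have "cocycle {z. 0 < \<sigma> * Im z} c"
    using c near_subset unfolding cocycle_def slit_def by blast
  then obtain B where B: "primitive {z. 0 < \<sigma> * Im z} c B"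
    using convex_primitive convex_half [OF \<sigma>] by blast
  have "continuous_on (slit \<sigma> N) (\<lambda>y. F (1, y))"
    unfolding F_def Complex_eq by (intro continuous_intros)
  from primitive_cobounds [OF primitive_pull [OF B this F1] cobounds_sym [OF A]] show ?thesis by blast
qed

lemma connected_slit:
  assumes \<sigma>: "\<sigma> \<in> {1, -1}"
  shows "connected (slit \<sigma> N)"
proof -
  let ?H = "{z. 0 < \<sigma> * Im z}"
  define ray where "ray = (\<lambda>z. {w. Re w = Re z \<and> \<sigma> * Im z \<le> \<sigma> * Im w})"
  have cr: "convex (ray z)" for z
    unfolding convex_def ray_def
  proof safe
    fix x y and u v :: real assume *: "Re x = Re z" "Re y = Re z" "\<sigma> * Im z \<le> \<sigma> * Im x" "\<sigma> * Im z \<le> \<sigma> * Im y"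
      and uv: "0 \<le> u" "0 \<le> v" "u + v = 1"
    show "Re (u *\<^sub>R x + v *\<^sub>R y) = Re z" using * uv by (simp add: distrib_right [symmetric])
    have "u * (\<sigma> * Im z) + v * (\<sigma> * Im z) \<le> u * (\<sigma> * Im x) + v * (\<sigma> * Im y)"
      by (rule add_mono; rule mult_left_mono; fact * uv)
    moreover have "u * (\<sigma> * Im z) + v * (\<sigma> * Im z) = \<sigma> * Im z" using uv by (simp add: distrib_right [symmetric])
    ultimately show "\<sigma> * Im z \<le> \<sigma> * Im (u *\<^sub>R x + v *\<^sub>R y)" by (simp add: algebra_simps)
  qed
  have "connected (?H \<union> ray z)" if "z \<in> slit \<sigma> N" for z
  proof (rule connected_Un)
    have "Complex (Re z) (\<sigma> * (\<bar>Im z\<bar> + 1)) \<in> ?H \<inter> ray z" using \<sigma> by (auto simp: ray_def)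
    then show "?H \<inter> ray z \<noteq> {}" by blast
  qed (use convex_connected cr convex_half [OF \<sigma>] in blast)+
  then have "connected (\<Union>z\<in>slit \<sigma> N. ?H \<union> ray z)"
  proof (intro connected_Union)
    have "Complex 0 \<sigma> \<in> ?H" using \<sigma> by auto
    then show "\<Inter> ((\<lambda>z. ?H \<union> ray z) ` slit \<sigma> N) \<noteq> {}" by blast
  qed auto
  moreover have "(\<Union>z\<in>slit \<sigma> N. ?H \<union> ray z) = slit \<sigma> N"
  proof -
    have "?H \<union> ray z \<subseteq> slit \<sigma> N" if "z \<in> slit \<sigma> N" for z
      using that by (auto simp: slit_def ray_def strips_def)
    moreover have "z \<in> ray z" for z by (simp add: ray_def)
    ultimately show ?thesis by blast
  qed
  ultimately show ?thesis by simp
qed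

definition strip_point :: "nat \<Rightarrow> complex" where
  "strip_point k = Complex (real k - 1 / 2) 0"

lemma strip_point: "strip_point k \<in> strip N k"
  by (auto simp: strip_def strip_point_def)

lemma strips_slit: "strips N \<subseteq> slit \<sigma> N" by (auto simp: slit_def)

text \<open>Van Kampen's theorem for the two slit planes, whose overlap consists of the strips. On
  strip \<open>k\<close> the primitives \<open>A\<close> and \<open>B\<close> differ by a constant
  \<open>D k\<close>, and \<open>h\<close> is defined by the quotients of consecutive constants. In
  this sense \<open>crossing N\<close> is universal among the cocycles on the punctured
  plane.\<close>

theorem cocycle_classification:
  assumes c: "cocycle (plane N) c"
  obtains h A where "additive_map h" "cobounds (plane N) A (\<lambda>x y. h (crossing N x y)) c"
proof -
  have "cocycle (slit \<sigma> N) c" if "\<sigma> \<in> {1, -1}" for \<sigma>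
    using c near_subset [of "plane N" _ "slit \<sigma> N"] slit_Un [of N] that unfolding cocycle_def by blast
  then obtain A B where A: "primitive (slit 1 N) c A" and B: "primitive (slit (-1) N) c B"
    using slit_primitive by (metis insertI1 insertI2)
  define D where "D = (\<lambda>k. A (strip_point k) - B (strip_point k))"
  define h where "h = ev (\<lambda>k. D k - D (Suc k))"
  have h: "additive_map h" by (simp add: h_def)
  have h_ul: "h (ul k) = D 0 - D k" for k
    by (induction k) (simp_all add: h_def ev_add grp_norm)
  \<comment> \<open>The two branches agree on strip \<open>k\<close>, since
    \<open>h (ul k) = D 0 - D k\<close> and \<open>A x = D k + B x\<close> there.\<close>
  define A' where "A' = (\<lambda>x. if x \<in> slit 1 N then A x else - h (strip_label N x) + D 0 + B x)"
  have A'_down: "A' x = - h (strip_label N x) + D 0 + B x" if "x \<in> slit (-1) N" for x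
  proof (cases "x \<in> slit 1 N")
    case True
    then have "x \<in> strips N" using that by (auto simp: slit_def)
    then obtain k where k: "k \<le> N" "x \<in> strip N k" by (rule strips_cover)
    have sub: "strip N k \<subseteq> slit \<sigma> N" for \<sigma> using strip_subset strips_slit by (rule subset_trans)
    have "A x - B x = D k"
      unfolding D_def by (rule primitive_unique [OF primitive_subset [OF A sub] primitive_subset [OF B sub]
        convex_connected [OF convex_strip] k(2) strip_point])
    then have "A x = D k + B x" by (metis diff_add_cancel)
    then show ?thesis using True by (simp add: A'_def strip_label_strip [OF k(2,1)] h_ul grp_norm)
  qed (simp add: A'_def)
  have "near (slit 1 N) (\<lambda>x y z. c x y = - A' x + h (crossing N x y) + A' y)"
    by (rule near_mono [OF near_conj [OF A [unfolded primitive_def] primitive_crossing_up [unfolded primitive_def]]])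
      (simp add: A'_def additive_mapD [OF h])
  moreover have "near (slit (-1) N) (\<lambda>x y z. c x y = - A' x + h (crossing N x y) + A' y)"
    by (rule near_mono [OF near_conj [OF B [unfolded primitive_def] primitive_crossing_down [unfolded primitive_def]]])
      (simp add: A'_down additive_mapD [OF h] grp_norm)
  ultimately have "near (plane N) (\<lambda>x y z. c x y = - A' x + h (crossing N x y) + A' y)"
    unfolding slit_Un [symmetric] by (rule near_open_Un) (rule open_slit)+
  then show ?thesis using that h unfolding cobounds_def by blast
qed

lemma cobounds_up:
  assumes "additive_map h" "cobounds (plane N) A (\<lambda>x y. h (crossing N x y)) c"
  shows "primitive (slit 1 N) c A"
proof -
  have "cobounds (slit 1 N) A (\<lambda>x y. h (crossing N x y)) c"
    using assms(2) by (rule cobounds_subset) (use slit_Un in blast)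
  then have n: "near (slit 1 N) (\<lambda>x y z. c x y = - A x + h (crossing N x y) + A y)"
    unfolding cobounds_def .
  show ?thesis unfolding primitive_def
    by (rule near_mono [OF near_conj [OF n primitive_crossing_up [unfolded primitive_def]]])
      (simp add: additive_mapD [OF assms(1)])
qed

lemma cobounds_down:
  assumes "additive_map h" "cobounds (plane N) A (\<lambda>x y. h (crossing N x y)) c"
  shows "primitive (slit (-1) N) c (\<lambda>x. h (strip_label N x) + A x)"
proof -
  have "cobounds (slit (-1) N) A (\<lambda>x y. h (crossing N x y)) c"
    using assms(2) by (rule cobounds_subset) (use slit_Un in blast)
  then have n: "near (slit (-1) N) (\<lambda>x y z. c x y = - A x + h (crossing N x y) + A y)"
    unfolding cobounds_def .
  show ?thesis unfolding primitive_def
    by (rule near_mono [OF near_conj [OF n primitive_crossing_down [unfolded primitive_def]]])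
      (simp add: additive_mapD [OF assms(1)] grp_norm)
qed

text \<open>On \<open>slit 1 N\<close> the two gauges differ by one constant \<open>d\<close>. The
  comparison on \<open>slit (-1) N\<close> then relates \<open>h\<close> and \<open>g\<close> on
  every strip label, and the relation is conjugation by \<open>d\<close>.\<close>

lemma cobounds_unique:
  assumes h: "additive_map h" "cobounds (plane N) A (\<lambda>x y. h (crossing N x y)) c"
    and g: "additive_map g" "cobounds (plane N) B (\<lambda>x y. g (crossing N x y)) c"
  obtains a where "\<And>k. k \<le> N \<Longrightarrow> g (ul k) = a + h (ul k) - a"
proof -
  define d where "d = A (strip_point 0) - B (strip_point 0)"
  have sp: "strip_point k \<in> slit \<sigma> N" for k \<sigma> using strip_point strip_subset strips_slit by blast
  have lab: "strip_label N (strip_point k) = ul k" if "k \<le> N" for k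
    using strip_label_strip [OF strip_point that] .
  have "g (ul k) = - d + h (ul k) - - d" if k: "k \<le> N" for k
  proof -
    have 1: "A (strip_point k) - B (strip_point k) = d"
      unfolding d_def by (rule primitive_unique [OF cobounds_up [OF h] cobounds_up [OF g] connected_slit sp sp]) simp
    have "(h (ul k) + A (strip_point k)) - (g (ul k) + B (strip_point k)) =
        (h (ul 0) + A (strip_point 0)) - (g (ul 0) + B (strip_point 0))"
      using primitive_unique [OF cobounds_down [OF h] cobounds_down [OF g] connected_slit sp sp, of k 0]
        lab [OF k] lab [of 0] by simp
    then have "h (ul k) + (A (strip_point k) - B (strip_point k)) - g (ul k) = d"
      using additive_mapD(2) [OF h(1)] additive_mapD(2) [OF g(1)] by (simp add: d_def grp_norm)
    then have "h (ul k) + d - g (ul k) = d" by (simp only: 1)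
    then have "h (ul k) + d = d + g (ul k)" by (metis diff_add_cancel)
    then have "- d + (h (ul k) + d) = - d + (d + g (ul k))" by simp
    then show ?thesis by (simp add: grp_norm)
  qed
  then show ?thesis by (rule that)
qed

section \<open>The action of maps on the fundamental group\<close>

text \<open>\<open>f\<close> induces \<open>h\<close> on the fundamental group, up to inner automorphisms.\<close>

definition acts :: "nat \<Rightarrow> (complex \<Rightarrow> complex) \<Rightarrow> (fgroup \<Rightarrow> fgroup) \<Rightarrow> bool" where
  "acts N f h \<longleftrightarrow> additive_map h \<and>
     (\<exists>A. cobounds (plane N) A (\<lambda>x y. h (crossing N x y)) (\<lambda>x y. crossing N (f x) (f y)))"

definition plane_map :: "nat \<Rightarrow> (complex \<Rightarrow> complex) \<Rightarrow> bool" where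
  "plane_map N f \<longleftrightarrow> continuous_on (plane N) f \<and> f ` plane N \<subseteq> plane N"

lemma acts_exists:
  assumes "plane_map N f" obtains h where "acts N f h"
proof -
  have "cocycle (plane N) (\<lambda>x y. crossing N (f x) (f y))"
    using assms by (intro cocycle_pull [OF cocycle_crossing]) (auto simp: plane_map_def)
  then obtain h A where "additive_map h" "cobounds (plane N) A (\<lambda>x y. h (crossing N x y)) (\<lambda>x y. crossing N (f x) (f y))"
    by (rule cocycle_classification)
  then have "acts N f h" unfolding acts_def by blast
  then show ?thesis by (rule that)
qed

lemma acts_id: "acts N id id"
  unfolding acts_def cobounds_def
  by (intro conjI exI [of _ "\<lambda>_. 0"] near_all) simp_all

lemma acts_comp:
  assumes "acts N f h" "acts N g k" "plane_map N g"
  shows "acts N (f \<circ> g) (h \<circ> k)"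
proof -
  obtain A B where A: "cobounds (plane N) A (\<lambda>x y. h (crossing N x y)) (\<lambda>x y. crossing N (f x) (f y))"
    and B: "cobounds (plane N) B (\<lambda>x y. k (crossing N x y)) (\<lambda>x y. crossing N (g x) (g y))"
    and hk: "additive_map h" "additive_map k" using assms by (auto simp: acts_def)
  have "cobounds (plane N) (\<lambda>x. A (g x)) (\<lambda>x y. h (crossing N (g x) (g y))) (\<lambda>x y. crossing N (f (g x)) (f (g y)))"
    using assms(3) by (intro cobounds_pull [OF A]) (auto simp: plane_map_def)
  from cobounds_trans [OF cobounds_hom [OF hk(1) B] this] show ?thesis
    unfolding acts_def o_def using additive_map_comp [OF hk, unfolded o_def] by blast
qed

text \<open>The values of \<open>crossing N\<close> are built from \<open>ul 0, ..., ul N\<close>,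
  so agreement up to conjugation on these suffices; the generators beyond the rank are not
  seen.\<close>

lemma acts_conj:
  assumes "acts N f h" "additive_map g" "\<And>k. k \<le> N \<Longrightarrow> g (ul k) = a + h (ul k) - a"
  shows "acts N f g"
proof -
  obtain A where A: "cobounds (plane N) A (\<lambda>x y. h (crossing N x y)) (\<lambda>x y. crossing N (f x) (f y))"
    and h: "additive_map h" using assms by (auto simp: acts_def)
  have card: "card {j. j < N \<and> real j < Re x} \<le> N" for x
    using card_mono [of "{..<N}" "{j. j < N \<and> real j < Re x}"] by auto
  have "cobounds (plane N) (\<lambda>_. a) (\<lambda>x y. g (crossing N x y)) (\<lambda>x y. h (crossing N x y))"
    unfolding cobounds_def
  proof (rule near_all)
    fix x y
    show "h (crossing N x y) = - a + g (crossing N x y) + a"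
      using assms(3) [OF card [of x]] assms(3) [OF card [of y]]
      by (simp add: crossing_def strip_label_def additive_mapD [OF h] additive_mapD [OF assms(2)] grp_norm)
  qed
  from cobounds_trans [OF this A] show ?thesis using assms(2) unfolding acts_def by blast
qed

lemma acts_unique:
  assumes "acts N f h" "acts N f g"
  obtains a where "\<And>k. k \<le> N \<Longrightarrow> g (ul k) = a + h (ul k) - a"
proof -
  obtain A B where "additive_map h" "cobounds (plane N) A (\<lambda>x y. h (crossing N x y)) (\<lambda>x y. crossing N (f x) (f y))"
    "additive_map g" "cobounds (plane N) B (\<lambda>x y. g (crossing N x y)) (\<lambda>x y. crossing N (f x) (f y))"
    using assms unfolding acts_def by blast
  then show ?thesis by (rule cobounds_unique) (rule that)
qed

lemma acts_homotopic:
  fixes F :: "real \<times> complex \<Rightarrow> complex"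
  assumes "acts N f h" "continuous_on ({0..1} \<times> plane N) F"
    "\<And>s y. s \<in> {0..1} \<Longrightarrow> y \<in> plane N \<Longrightarrow> F (s, y) \<in> plane N"
    "\<And>y. y \<in> plane N \<Longrightarrow> F (0, y) = f y" "\<And>y. y \<in> plane N \<Longrightarrow> F (1, y) = g y"
  shows "acts N g h"
proof -
  obtain A B where "cobounds (plane N) A (\<lambda>x y. crossing N (F (0, x)) (F (0, y))) (\<lambda>x y. crossing N (F (1, x)) (F (1, y)))"
    and B: "cobounds (plane N) B (\<lambda>x y. h (crossing N x y)) (\<lambda>x y. crossing N (f x) (f y))"
    using homotopic_cobounds [OF cocycle_crossing assms(2,3)] assms(1) by (auto simp: acts_def)
  then have "cobounds (plane N) A (\<lambda>x y. crossing N (f x) (f y)) (\<lambda>x y. crossing N (g x) (g y))"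
    unfolding cobounds_def by (elim near_mono) (simp add: assms(4,5))
  from cobounds_trans [OF B this] show ?thesis using assms(1) unfolding acts_def by blast
qed

text \<open>By the convention for \<open>el\<close> the case \<open>i = N\<close> is the loop
  \<open>- ul N\<close> around infinity.\<close>

definition puncture :: "nat \<Rightarrow> nat \<Rightarrow> fgroup" where
  "puncture N i = - el N i + el N (Suc i)"

text \<open>The index \<open>N\<close> stands for the puncture at infinity.\<close>

definition end_nbhd :: "nat \<Rightarrow> nat \<Rightarrow> real \<Rightarrow> complex set" where
  "end_nbhd N i r = (if i < N then ball (of_nat i) r - {of_nat i} else {z. real N + 1 / r < cmod z})"

lemma cyc_closed:
  "0 \<in> cyc x" "a \<in> cyc x \<Longrightarrow> b \<in> cyc x \<Longrightarrow> a + b \<in> cyc x" "a \<in> cyc x \<Longrightarrow> - a \<in> cyc x"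
proof -
  show add: "b \<in> cyc x \<Longrightarrow> a \<in> cyc x \<Longrightarrow> a + b \<in> cyc x" for a b
    by (induction b rule: cyc.induct) (simp_all add: add.assoc [symmetric] add_diff_eq cyc.intros)
  have x: "x \<in> cyc x" "- x \<in> cyc x" using cyc.intros(2) [OF cyc.intros(1), of x] cyc.intros(3) [OF cyc.intros(1), of x] by simp_all
  show "a \<in> cyc x \<Longrightarrow> - a \<in> cyc x"
    by (induction rule: cyc.induct) (simp_all add: cyc.intros(1) minus_add add x minus_diff_eq diff_conv_add_uminus)
qed (rule cyc.intros)

text \<open>Near a finite puncture only two strip labels occur, and \<open>A = 0\<close> will do.
  Near infinity all labels occur in the lower half-plane; there \<open>A\<close> removes the labels
  of the points to the left of \<open>N\<close>, and only powers of \<open>ul N\<close>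
  remain.\<close>

lemma crossing_end:
  assumes "i \<le> N"
  obtains A r where "0 < r" "near (end_nbhd N i r) (\<lambda>x y z. - A x + crossing N x y + A y \<in> cyc (puncture N i))"
proof (cases "i < N")
  case True
  have lab: "strip_label N z \<in> {ul i, ul (Suc i)}" if "z \<in> end_nbhd N i 1" for z
  proof -
    have "cmod (of_nat i - z) < 1" using that True by (simp add: end_nbhd_def dist_norm)
    then have "\<bar>real i - Re z\<bar> < 1" using abs_Re_le_cmod [of "of_nat i - z"] by simp
    then have "{j. j < N \<and> real j < Re z} = (if real i < Re z then {..<Suc i} else {..<i})"
      using True by (auto simp: not_less)
    then show ?thesis by (simp add: strip_label_def)
  qed
  have p: "puncture N i = - ul i + ul (Suc i)" using True by (simp add: puncture_def el_def)
  have x: "puncture N i \<in> cyc (puncture N i)" "- puncture N i \<in> cyc (puncture N i)"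
    using cyc.intros(2) [OF cyc.intros(1)] cyc_closed(3) by (metis add_0)+
  have "near (end_nbhd N i 1) (\<lambda>x y z. - 0 + crossing N x y + 0 \<in> cyc (puncture N i))"
  proof (rule near_all)
    fix z w assume "z \<in> end_nbhd N i 1" "w \<in> end_nbhd N i 1"
    from lab [OF this(1)] lab [OF this(2)] have "- strip_label N z + strip_label N w \<in> {0, puncture N i, - puncture N i}"
      unfolding p by (auto simp: minus_add simp del: ul.simps)
    then show "- 0 + crossing N z w + 0 \<in> cyc (puncture N i)"
      using x cyc.intros(1) by (auto simp: crossing_def)
  qed
  then show ?thesis using that [of 1 "\<lambda>_. 0"] by simp
next
  case False
  then have i: "i = N" using assms by simp
  let ?C = "cyc (puncture N N)"
  have p: "puncture N N = - ul N" by (simp add: puncture_def el_def)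
  have x: "ul N \<in> ?C" "- ul N \<in> ?C"
    using cyc.intros(2) [OF cyc.intros(1), of "puncture N N"] cyc.intros(3) [OF cyc.intros(1), of "puncture N N"] by (simp_all add: p)
  define A where "A = (\<lambda>z. if Im z < 0 \<and> Re z < real N then - strip_label N z else 0)"
  have right: "strip_label N z = ul N" if "real N \<le> Re z" for z
  proof -
    have "{j. j < N \<and> real j < Re z} = {..<N}" using that by auto
    then show ?thesis by (simp add: strip_label_def)
  qed
  have left: "strip_label N z = 0" if "Re z < 0" for z
  proof -
    have "{j. j < N \<and> real j < Re z} = {}" using that by (auto simp: not_less)
    then show ?thesis by (simp only: strip_label_def card.empty ul.simps)
  qed
  let ?R = "\<lambda>z w v :: complex. - A z + crossing N z w + A w \<in> ?C"
  have "near ({z. Im z < 0} \<union> ({z. 0 < Im z} \<union> ({z. real N < Re z} \<union> {z. Re z < 0}))) ?R"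
  proof (intro near_open_Un open_Un)
    show "near {z. Im z < 0} ?R"
    proof (rule near_all)
      fix z w :: complex assume zw: "z \<in> {z. Im z < 0}" "w \<in> {z. Im z < 0}"
      show "- A z + crossing N z w + A w \<in> ?C"
        using zw x right [of z] right [of w] cyc.intros(1) [of "puncture N N"]
        by (cases "Re z < real N"; cases "Re w < real N"; simp add: A_def crossing_def grp_norm)
    qed
    show "near {z. 0 < Im z} ?R"
      by (rule near_all) (simp add: A_def crossing_def cyc.intros)
    show "near {z. real N < Re z} ?R"
      by (rule near_all) (simp add: A_def crossing_def right cyc.intros)
    show "near {z. Re z < 0} ?R"
      by (rule near_all) (simp add: A_def crossing_def left cyc.intros)
  qed (auto simp: open_halfspaces)
  moreover have "end_nbhd N i 1 \<subseteq> {z. Im z < 0} \<union> ({z. 0 < Im z} \<union> ({z. real N < Re z} \<union> {z. Re z < 0}))"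
  proof
    fix z assume "z \<in> end_nbhd N i 1"
    then have "real N < cmod z" by (simp add: end_nbhd_def i)
    moreover have "cmod z = \<bar>Re z\<bar>" if "Im z = 0" using that by (simp add: cmod_def)
    ultimately show "z \<in> {z. Im z < 0} \<union> ({z. 0 < Im z} \<union> ({z. real N < Re z} \<union> {z. Re z < 0}))"
      by (cases "Im z = 0"; auto)
  qed
  ultimately have "near (end_nbhd N i 1) ?R" by (rule near_subset)
  then show ?thesis using that [of 1 A] i by simp
qed

text \<open>Going once around a puncture through four convex regions, only the lower of which meets a slit.\<close>

lemma monodromy:
  assumes h: "additive_map h" "cobounds (plane N) A (\<lambda>x y. h (crossing N x y)) c"
    and Cs: "near E (\<lambda>x y z. - B x + c x y + B y \<in> C)"
    and C: "0 \<in> C" "\<And>a b. a \<in> C \<Longrightarrow> b \<in> C \<Longrightarrow> a + b \<in> C" "\<And>a. a \<in> C \<Longrightarrow> - a \<in> C"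
    and conv: "convex L" "convex R" "convex U" "convex V"
    and sub: "L \<subseteq> E \<inter> slit (-1) N" "R \<subseteq> E \<inter> slit 1 N" "U \<subseteq> E \<inter> slit 1 N" "V \<subseteq> E \<inter> slit 1 N"
    and pts: "p \<in> V \<inter> L" "q \<in> L \<inter> R" "r \<in> R \<inter> U" "s \<in> U \<inter> V"
    and lab: "strip_label N p = ul k" "strip_label N q = ul l"
  shows "\<exists>a. - a + h (- ul k + ul l) + a \<in> C"
proof -
  define c' where "c' = (\<lambda>x y. - B x + c x y + B y)"
  have C': "near Z (\<lambda>x y z. c' x y \<in> C)" if "Z \<subseteq> E" for Z
    unfolding c'_def by (rule near_subset [OF Cs that])
  have cob: "cobounds Z B c c'" for Z
    unfolding cobounds_def c'_def by (rule near_all) simp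
  have up: "- (A x + B x) + (A y + B y) \<in> C" if "convex Z" "Z \<subseteq> E \<inter> slit 1 N" "x \<in> Z" "y \<in> Z" for Z x y
  proof (rule subgroup_valued [OF C, of Z c' "\<lambda>x. A x + B x"])
    show "primitive Z c' (\<lambda>x. A x + B x)"
      using that by (intro primitive_cobounds [OF primitive_subset [OF cobounds_up [OF h]] cob]) auto
  qed (use that C' convex_connected in auto)
  have down: "- (h (strip_label N x) + A x + B x) + (h (strip_label N y) + A y + B y) \<in> C"
    if "x \<in> L" "y \<in> L" for x y
  proof (rule subgroup_valued [OF C, of L c' "\<lambda>x. h (strip_label N x) + A x + B x"])
    show "primitive L c' (\<lambda>x. h (strip_label N x) + A x + B x)"
      using sub by (intro primitive_cobounds [OF primitive_subset [OF cobounds_down [OF h]] cob]) auto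
  qed (use that C' convex_connected conv sub in auto)
  let ?P = "\<lambda>x. A x + B x"
  have 1: "- (h (ul k) + ?P p) + (h (ul l) + ?P q) \<in> C"
    using down [of p q] pts lab by (simp add: add.assoc)
  have 2: "- ?P q + ?P r \<in> C" using up [OF conv(2) sub(2), of q r] pts by blast
  have 3: "- ?P r + ?P s \<in> C" using up [OF conv(3) sub(3), of r s] pts by blast
  have 4: "- ?P s + ?P p \<in> C" using up [OF conv(4) sub(4), of s p] pts by blast
  have "(- (h (ul k) + ?P p) + (h (ul l) + ?P q)) + (- ?P q + ?P r) + (- ?P r + ?P s) + (- ?P s + ?P p) \<in> C"
    by (rule C(2) [OF C(2) [OF C(2) [OF 1 2] 3] 4])
  then have "- ?P p + h (- ul k + ul l) + ?P p \<in> C"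
    by (simp add: additive_mapD [OF h(1)] grp_norm)
  then show ?thesis by blast
qed

text \<open>The loop around end \<open>i\<close> goes to a loop within a neighbourhood of end
  \<open>j\<close>, which is a power of the loop around \<open>j\<close>. The four regions for
  \<open>monodromy\<close> are half-discs at a finite puncture and distant half-planes at
  infinity.\<close>

theorem acts_puncture:
  assumes f: "plane_map N f" "acts N f h" and i: "i \<le> N" and j: "j \<le> N"
    and ends: "\<And>r. 0 < r \<Longrightarrow> \<exists>r'>0. f ` end_nbhd N i r' \<subseteq> end_nbhd N j r"
  shows "\<exists>a. - a + h (puncture N i) + a \<in> cyc (puncture N j)"
proof -
  obtain A where A: "additive_map h" "cobounds (plane N) A (\<lambda>x y. h (crossing N x y)) (\<lambda>x y. crossing N (f x) (f y))"
    using f(2) by (auto simp: acts_def)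
  obtain B r where r: "0 < r" "near (end_nbhd N j r) (\<lambda>x y z. - B x + crossing N x y + B y \<in> cyc (puncture N j))"
    by (rule crossing_end [OF j])
  obtain r0 where r0: "0 < r0" "f ` end_nbhd N i r0 \<subseteq> end_nbhd N j r" using ends [OF r(1)] by blast
  define r' where "r' = min r0 1"
  have r': "0 < r'" "r' \<le> 1" and "r' \<le> r0" using r0(1) by (auto simp: r'_def)
  have "1 / r0 \<le> 1 / r'" using r'(1) \<open>r' \<le> r0\<close> by (intro divide_left_mono) auto
  then have r'3: "end_nbhd N i r' \<subseteq> end_nbhd N i r0"
    using \<open>r' \<le> r0\<close> by (auto simp: end_nbhd_def)
  note r' = r' r'3
  let ?E = "end_nbhd N i r' \<inter> plane N"
  have "near ?E (\<lambda>x y z. - B (f x) + crossing N (f x) (f y) + B (f y) \<in> cyc (puncture N j))"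
  proof (rule near_pull [OF r(2)])
    show "continuous_on ?E f" using f(1) continuous_on_subset unfolding plane_map_def by blast
    show "f x \<in> end_nbhd N j r" if "x \<in> ?E" for x using that r'(3) r0(2) by blast
  qed
  note mono = monodromy [OF A this cyc_closed]
  show ?thesis
  proof (cases "i < N")
    case True
    let ?B = "ball (of_nat i) r' :: complex set"
    have inB: "Complex (real i + a) b \<in> ?B" if "\<bar>a\<bar> = r' / 2" "\<bar>b\<bar> = r' / 2" for a b
    proof -
      have "cmod (Complex a b) < r'"
      proof -
        have "a\<^sup>2 = (r' / 2)\<^sup>2" "b\<^sup>2 = (r' / 2)\<^sup>2" using that by (metis power2_abs)+
        then have "(cmod (Complex a b))\<^sup>2 = r'\<^sup>2 / 2" by (simp add: cmod_def power_divide)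
        also have "\<dots> < r'\<^sup>2" using r'(1) by simp
        finally show ?thesis using r'(1) by (simp add: power_less_imp_less_base)
      qed
      moreover have "dist (of_nat i) (Complex (real i + a) b) = cmod (Complex a b)"
      proof -
        have "Complex (real i + a) b - of_nat i = Complex a b" by (simp add: complex_eq_iff)
        then show ?thesis by (metis dist_commute dist_norm)
      qed
      ultimately show ?thesis by simp
    qed
    have near_i: "\<bar>Re z - real i\<bar> < 1" if "z \<in> ?B" for z
      using that abs_Re_le_cmod [of "of_nat i - z"] r'(2) by (simp add: dist_norm abs_minus_commute)
    have E: "z \<in> ?E" if "z \<in> ?B" "z \<noteq> of_nat i" for z
    proof -
      have "z \<in> plane N"
      proof (rule ccontr)
        assume "z \<notin> plane N"
        then obtain j where "z = of_nat j" by (auto simp: plane_def)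
        then show False using that near_i [OF that(1)] by auto
      qed
      then show ?thesis using that True by (simp add: end_nbhd_def)
    qed
    have st: "z \<in> strip N (Suc i)" if "z \<in> ?B" "real i < Re z" for z
      using near_i [OF that(1)] that(2) by (force simp: strip_def)
    have st': "z \<in> strip N i" if "z \<in> ?B" "Re z < real i" for z
      using near_i [OF that(1)] that(2) by (force simp: strip_def)
    have "\<exists>a. - a + h (- ul i + ul (Suc i)) + a \<in> cyc (puncture N j)"
    proof (rule mono [of "?B \<inter> {z. Im z < 0}" "?B \<inter> {z. real i < Re z}" "?B \<inter> {z. 0 < Im z}" "?B \<inter> {z. Re z < real i}"
          "Complex (real i + - (r' / 2)) (- (r' / 2))" "Complex (real i + r' / 2) (- (r' / 2))"
          "Complex (real i + r' / 2) (r' / 2)" "Complex (real i + - (r' / 2)) (r' / 2)"])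
      show "?B \<inter> {z. Im z < 0} \<subseteq> ?E \<inter> slit (- 1) N" "?B \<inter> {z. 0 < Im z} \<subseteq> ?E \<inter> slit 1 N"
        using E by (fastforce simp: slit_def)+
      show "?B \<inter> {z. real i < Re z} \<subseteq> ?E \<inter> slit 1 N" "?B \<inter> {z. Re z < real i} \<subseteq> ?E \<inter> slit 1 N"
        using E st st' strip_subset strips_slit by fastforce+
      show "strip_label N (Complex (real i + - (r' / 2)) (- (r' / 2))) = ul i"
        using r' True by (intro strip_label_strip st' inB) auto
      show "strip_label N (Complex (real i + r' / 2) (- (r' / 2))) = ul (Suc i)"
        using r' True by (intro strip_label_strip st inB) auto
    qed (use r' inB [of "r' / 2" "r' / 2"] inB [of "- (r' / 2)" "r' / 2"] inB [of "r' / 2" "- (r' / 2)"]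
          inB [of "- (r' / 2)" "- (r' / 2)"] in \<open>auto intro: convex_Int\<close>)
    then show ?thesis using True by (simp add: puncture_def el_def del: ul.simps)
  next
    case False
    then have iN: "i = N" using i by simp
    define R where "R = real N + 1 / r'"
    have R: "real N < R" "0 < R" using r'(1) by (auto simp: R_def add_nonneg_pos)
    have E: "z \<in> ?E" if "R < \<bar>Re z\<bar> \<or> R < \<bar>Im z\<bar>" for z
    proof -
      have z: "R < cmod z" using that abs_Re_le_cmod [of z] abs_Im_le_cmod [of z] by linarith
      have "z \<in> plane N"
      proof (rule ccontr)
        assume "z \<notin> plane N"
        then obtain j where "z = of_nat j" "j < N" by (auto simp: plane_def)
        then show False using z R by simp
      qed
      then show ?thesis using z by (simp add: end_nbhd_def iN R_def)
    qed
    have st: "z \<in> strip N N" if "R < Re z" for z using that R by (auto simp: strip_def)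
    have st': "z \<in> strip N 0" if "Re z < - R" for z using that R by (auto simp: strip_def)
    have "\<exists>a. - a + h (- ul 0 + ul N) + a \<in> cyc (puncture N j)"
    proof (rule mono [of "{z. Im z < - R}" "{z. R < Re z}" "{z. R < Im z}" "{z. Re z < - R}"
          "Complex (- (R + 1)) (- (R + 1))" "Complex (R + 1) (- (R + 1))"
          "Complex (R + 1) (R + 1)" "Complex (- (R + 1)) (R + 1)"])
      show "{z. Im z < - R} \<subseteq> ?E \<inter> slit (- 1) N" "{z. R < Im z} \<subseteq> ?E \<inter> slit 1 N"
        using E R by (fastforce simp: slit_def)+
      show "{z. R < Re z} \<subseteq> ?E \<inter> slit 1 N" "{z. Re z < - R} \<subseteq> ?E \<inter> slit 1 N"
        using E R st st' strip_subset strips_slit by fastforce+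
      show "strip_label N (Complex (- (R + 1)) (- (R + 1))) = ul 0"
        by (intro strip_label_strip st') auto
      show "strip_label N (Complex (R + 1) (- (R + 1))) = ul N"
        by (intro strip_label_strip st) auto
    qed (use R in auto)
    then obtain a where "- a + h (ul N) + a \<in> cyc (puncture N j)" by auto
    then have "- (- a + h (ul N) + a) \<in> cyc (puncture N j)" by (rule cyc_closed(3))
    then have "- a + h (- ul N) + a \<in> cyc (puncture N j)"
      by (simp add: additive_mapD [OF A(1)] grp_norm)
    then show ?thesis by (auto simp: puncture_def el_def iN)
  qed
qed

section \<open>Automorphisms permuting the punctures\<close>

definition conjugate :: "'g::group_add \<Rightarrow> 'g \<Rightarrow> bool" where
  "conjugate a b \<longleftrightarrow> (\<exists>g. a = - g + b + g)"

lemma conjugateI: "a = - g + b + g \<Longrightarrow> conjugate a b"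
  by (auto simp: conjugate_def)

lemma conjugate_refl [simp]: "conjugate a a" by (rule conjugateI [of _ 0]) simp

lemma conjugate_trans: "conjugate a b \<Longrightarrow> conjugate b c \<Longrightarrow> conjugate a c"
proof -
  assume "conjugate a b" "conjugate b c"
  then obtain g h where "a = - g + b + g" "b = - h + c + h" by (auto simp: conjugate_def)
  then show ?thesis by (intro conjugateI [of _ "h + g"]) (simp add: grp_norm)
qed

lemma conjugate_hom: "additive_map h \<Longrightarrow> conjugate a b \<Longrightarrow> conjugate (h a) (h b)"
  unfolding conjugate_def by (metis additive_mapD(1,3))

lemma conjugate_uminus: "conjugate a b \<Longrightarrow> conjugate (- a) (- b)"
proof -
  assume "conjugate a b"
  then obtain g where "a = - g + b + g" by (auto simp: conjugate_def)
  then show ?thesis by (intro conjugateI [of _ g]) (simp add: grp_norm)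
qed

lemma conjugate_int: "additive_map (d :: 'g::group_add \<Rightarrow> int) \<Longrightarrow> conjugate a b \<Longrightarrow> d a = d b"
  unfolding conjugate_def by (auto simp: additive_mapD)

definition permutes_ends :: "nat \<Rightarrow> (fgroup \<Rightarrow> fgroup) \<Rightarrow> (nat \<Rightarrow> nat) \<Rightarrow> bool" where
  "permutes_ends N h \<pi> \<longleftrightarrow> additive_map h \<and> bij_betw \<pi> {..N} {..N} \<and>
     (\<forall>i\<le>N. conjugate (h (puncture N i)) (puncture N (\<pi> i)))"

lemma permutes_ends_comp:
  assumes "permutes_ends N h \<pi>" "permutes_ends N k \<rho>"
  shows "permutes_ends N (h \<circ> k) (\<pi> \<circ> \<rho>)"
proof -
  have "conjugate (h (k (puncture N i))) (puncture N (\<pi> (\<rho> i)))" if "i \<le> N" for i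
  proof -
    have "\<rho> i \<le> N" using assms(2) that unfolding permutes_ends_def bij_betw_def by blast
    then show ?thesis
      using assms that conjugate_trans [OF conjugate_hom] unfolding permutes_ends_def by blast
  qed
  then show ?thesis using assms
    unfolding permutes_ends_def by (auto intro: additive_map_comp bij_betw_trans)
qed

lemma puncture_gen: "i < N \<Longrightarrow> puncture N i = gen i"
  by (simp add: puncture_def gen_eq_e)

lemma puncture_last: "puncture N N = - ul N"
  by (simp add: puncture_def el_def)

lemma act_gen_puncture:
  assumes "i < N"
  shows "act N (gen i) (puncture N i) = puncture N (Suc i)"
  using assms by (simp add: puncture_def ev_hom ev_braid_gen_e grp_norm)

lemma permutes_ends_gen:
  assumes "i < N"
  shows "permutes_ends N (act N (gen i)) (Transposition.transpose i (Suc i))"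
    "permutes_ends N (act N (- gen i)) (Transposition.transpose i (Suc i))"
proof -
  have bij: "bij_betw (Transposition.transpose i (Suc i)) {..N} {..N}"
    by (rule bij_betw_byWitness [where f' = "Transposition.transpose i (Suc i)"])
      (use assms in \<open>auto simp: Transposition.transpose_def\<close>)
  have "conjugate (act N (gen i) (puncture N j)) (puncture N (Transposition.transpose i (Suc i) j))"
    "conjugate (act N (- gen i) (puncture N j)) (puncture N (Transposition.transpose i (Suc i) j))" for j
  proof -
    consider "j = i" | "j = Suc i" | "j \<noteq> i" "j \<noteq> Suc i" by blast
    then have "conjugate (act N (gen i) (puncture N j)) (puncture N (Transposition.transpose i (Suc i) j)) \<and>
      conjugate (act N (- gen i) (puncture N j)) (puncture N (Transposition.transpose i (Suc i) j))"
    proof cases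
      case 1
      then show ?thesis using assms act_gen_puncture [OF assms]
        by (auto simp: puncture_def ev_hom ev_braid_gen_inv_e grp_norm
            intro: conjugateI [of _ "- el N (Suc i) + el N i"])
    next
      case 2
      then show ?thesis using assms
        by (auto simp: puncture_def ev_hom ev_braid_gen_inv_e ev_braid_gen_e grp_norm
            intro: conjugateI [of _ "- el N i + el N (Suc (Suc i))"])
    next
      case 3
      then show ?thesis using assms
        by (simp add: puncture_def ev_hom ev_braid_gen_inv_e ev_braid_gen_e)
    qed
    then show "conjugate (act N (gen i) (puncture N j)) (puncture N (Transposition.transpose i (Suc i) j))"
      "conjugate (act N (- gen i) (puncture N j)) (puncture N (Transposition.transpose i (Suc i) j))" by auto
  qed
  then show "permutes_ends N (act N (gen i)) (Transposition.transpose i (Suc i))"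
    "permutes_ends N (act N (- gen i)) (Transposition.transpose i (Suc i))"
    using bij by (simp_all add: permutes_ends_def del: act_simps)
qed

lemma permutes_ends_act:
  assumes "z \<in> letters_below N"
  shows "\<exists>\<pi>. permutes_ends N (act N z) \<pi>"
  using assms
proof (induction rule: letters_below_induct)
  case zero
  have "permutes_ends N (act N 0) id" by (simp add: permutes_ends_def)
  then show ?case by blast
next
  case (gen i z)
  have "act N (gen i + z) = act N (gen i) \<circ> act N z" by (rule ext) (simp del: act_simps add: act_simps(2))
  then show ?case using gen permutes_ends_comp permutes_ends_gen(1) by metis
next
  case (minus_gen i z)
  have "act N (- gen i + z) = act N (- gen i) \<circ> act N z" by (rule ext) (simp del: act_simps add: act_simps(2))
  then show ?case using minus_gen permutes_ends_comp permutes_ends_gen(2) by metis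
qed

lemma act_shift_puncture: "l \<le> N \<Longrightarrow> act N (shift_word N l) (puncture N l) = puncture N N"
proof (induction "N - l" arbitrary: l)
  case (Suc d)
  then show ?case using act_gen_puncture [of l N] by (simp add: shift_word_simps)
qed (simp add: shift_word_simps)

lemma letters_below_ul: "k \<le> N \<Longrightarrow> ul k \<in> letters_below N"
  by (induction k) (simp_all add: letters_below_intros)

lemma letters_below_cong:
  assumes "additive_map f" "additive_map g" "\<And>j. j < N \<Longrightarrow> f (gen j) = g (gen j)" "x \<in> letters_below N"
  shows "f x = g x"
  using assms(4) by (induction rule: letters_below_induct)
    (simp_all add: additive_mapD [OF assms(1)] additive_mapD [OF assms(2)] assms(3))

lemma additive_map_conj: "additive_map h \<Longrightarrow> additive_map (\<lambda>x. a + h x - a)"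
  by (simp add: additive_map_def grp_norm)

lemma conjugate_conj_gen: "conjugate x (gen p) \<Longrightarrow> \<exists>w. x = conj_gen w p"
  unfolding conjugate_def by (metis wval_gen_word_of)

text \<open>A shift word \<open>c\<close> is chosen such that \<open>h \<circ> act N (- c)\<close>
  preserves the end at infinity; a conjugation then makes it fix \<open>ul N\<close>, and Artin's
  theorem applies.\<close>

theorem permutes_ends_braid:
  assumes "permutes_ends N h \<pi>"
  shows "\<exists>z\<in>letters_below N. \<exists>a. \<forall>x\<in>letters_below N. h x = a + act N z x - a"
proof -
  obtain l where l: "l \<le> N" "\<pi> l = N"
    using assms unfolding permutes_ends_def bij_betw_def by (metis (full_types) atMost_iff imageE order_refl)
  define c where "c = shift_word N l"
  have c: "c \<in> letters_below N" using l by (simp add: c_def shift_word_letters)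
  then have "- c \<in> letters_below N" by (rule letters_below_intros)
  then obtain \<rho> where "permutes_ends N (act N (- c)) \<rho>" using permutes_ends_act by blast
  then have pk: "permutes_ends N (h \<circ> act N (- c)) (\<pi> \<circ> \<rho>)" by (rule permutes_ends_comp [OF assms])
  define k where "k = h \<circ> act N (- c)"
  have k: "additive_map k" using pk by (simp add: permutes_ends_def k_def)
  have h: "additive_map h" using assms by (simp add: permutes_ends_def)
  have "act N (- c) (puncture N N) = puncture N l"
    using act_shift_puncture [OF l(1)] by (metis act_simps(3) c_def)
  then have kN: "conjugate (k (puncture N N)) (puncture N N)"
    using assms l unfolding k_def permutes_ends_def by force
  have kN': "conjugate (k (puncture N N)) (puncture N ((\<pi> \<circ> \<rho>) N))"
    using pk by (simp add: permutes_ends_def k_def)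
  obtain g where g: "k (puncture N N) = - g + puncture N N + g" using kN by (auto simp: conjugate_def)
  define k' where "k' = (\<lambda>x. g + k x - g)"
  have k': "additive_map k'" unfolding k'_def by (rule additive_map_conj [OF k])
  have "k (ul N) = - g + ul N + g"
    using arg_cong [OF g, of uminus] by (simp add: puncture_last additive_mapD [OF k] grp_norm)
  then have k'N: "k' (ul N) = ul N" by (simp add: k'_def grp_norm)
  have nondeg: "\<not> conjugate (puncture N N) (puncture N i)" if "i < N" for i
  proof
    define d :: "fgroup \<Rightarrow> int" where "d = ev (\<lambda>_. 1)"
    have d: "additive_map d" by (simp add: d_def)
    assume "conjugate (puncture N N) (puncture N i)"
    from conjugate_int [OF d this] have "d (ul N) = - 1"
      using that by (simp add: puncture_last puncture_gen additive_mapD [OF d]) (simp add: d_def)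
    moreover have "d (ul N) = int N" by (induction N) (simp_all add: d_def ev_add)
    ultimately show False by simp
  qed
  \<comment> \<open>\<open>\<rho>\<close> is only known to exist. The value at \<open>N\<close> is
    recovered from the group: the loops at infinity and at a finite puncture have the exponent sums
    \<open>- N\<close> and 1 and are not conjugate.\<close>
  have "(\<pi> \<circ> \<rho>) N = N"
  proof (rule ccontr)
    assume ne: "(\<pi> \<circ> \<rho>) N \<noteq> N"
    have "(\<pi> \<circ> \<rho>) N \<le> N" using pk unfolding permutes_ends_def bij_betw_def by blast
    then have lt: "(\<pi> \<circ> \<rho>) N < N" using ne by simp
    obtain g' where g': "k (puncture N N) = - g' + puncture N ((\<pi> \<circ> \<rho>) N) + g'" using kN' by (auto simp: conjugate_def)
    have "- g + puncture N N + g = - g' + puncture N ((\<pi> \<circ> \<rho>) N) + g'" using g g' by simp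
    then have "g + (- g + puncture N N + g) - g = g + (- g' + puncture N ((\<pi> \<circ> \<rho>) N) + g') - g" by simp
    then have "puncture N N = - (g' - g) + puncture N ((\<pi> \<circ> \<rho>) N) + (g' - g)"
      by (simp add: grp_norm)
    then show False using nondeg [OF lt] conjugateI by blast
  qed
  then have lt: "(\<pi> \<circ> \<rho>) i < N" if "i < N" for i
    using pk that unfolding permutes_ends_def bij_betw_def inj_on_def
    by (metis (no_types, lifting) atMost_iff imageI le_neq_implies_less less_imp_le less_irrefl order_refl)
  have "\<exists>w. k' (gen i) = conj_gen w ((\<pi> \<circ> \<rho>) i)" if i: "i < N" for i
  proof -
    have "conjugate (k' (gen i)) (k (gen i))" unfolding k'_def by (rule conjugateI [of _ "- g"]) (simp add: grp_norm)
    moreover have "conjugate (k (puncture N i)) (puncture N ((\<pi> \<circ> \<rho>) i))"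
      using pk i by (simp add: permutes_ends_def k_def)
    then have "conjugate (k (gen i)) (gen ((\<pi> \<circ> \<rho>) i))"
      using i lt [OF i] by (simp add: puncture_gen)
    ultimately show ?thesis using conjugate_conj_gen conjugate_trans by blast
  qed
  then obtain w where w: "\<And>i. i < N \<Longrightarrow> k' (gen i) = conj_gen (w i) ((\<pi> \<circ> \<rho>) i)" by metis
  have "ev (\<lambda>i. k' (gen i)) (ul N) = ul N"
    using additive_map_u_cong [OF additive_map_ev k', of N "\<lambda>i. k' (gen i)"] k'N by simp
  from artin [OF order_refl w this] obtain z where
    z: "z \<in> letters_below (N - 1)" "\<And>i. i < N \<Longrightarrow> k' (gen i) = act N z (gen i)" by blast
  have "h x = - g + act N (z + c) x - - g" if x: "x \<in> letters_below N" for x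
  proof -
    have "k' (act N c x) = act N z (act N c x)"
      by (rule letters_below_cong [OF k' additive_map_act z(2) act_letters [OF x]])
    moreover have "k (act N c x) = h x" by (simp add: k_def)
    ultimately have "g + h x - g = act N (z + c) x" by (simp add: k'_def)
    then have "- g + (g + h x - g) + g = - g + act N (z + c) x + g" by simp
    then show ?thesis by (simp add: grp_norm)
  qed
  moreover have "z + c \<in> letters_below N"
    using letters_below_mono [OF z(1), of N] c by (simp add: letters_below_intros)
  ultimately show ?thesis by blast
qed

text \<open>The action of complex conjugation.\<close>

definition mirror :: "nat \<Rightarrow> fgroup \<Rightarrow> fgroup" where
  "mirror N = ev (\<lambda>k. if k < N then ul k - ul (Suc k) else gen k)"

lemma additive_map_mirror [simp]: "additive_map (mirror N)" by (simp add: mirror_def)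

lemma mirror_ul: "k \<le> N \<Longrightarrow> mirror N (ul k) = - ul k"
  by (induction k) (simp_all add: mirror_def ev_add grp_norm)

lemma mirror_el: "mirror N (el N k) = - el N k"
  by (simp add: el_def mirror_ul) (simp add: mirror_def)

lemma mirror_ge: "N \<le> k \<Longrightarrow> mirror N (gen k) = gen k" by (simp add: mirror_def)

lemmas mirror_hom = additive_mapD [OF additive_map_mirror]

lemma mirror_mirror [simp]: "mirror N (mirror N x) = x"
proof -
  have "additive_map (\<lambda>x. mirror N (mirror N x))" by (simp add: additive_map_def mirror_hom)
  from additive_map_ext_e [OF this additive_map_id(2), of N x] show ?thesis
    by (simp add: mirror_el mirror_hom mirror_ge)
qed

definition flip_word :: "fgroup \<Rightarrow> fgroup" where
  "flip_word = ev (\<lambda>i. - gen i)"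

lemma flip_word_simps [simp]:
  "flip_word 0 = 0" "flip_word (a + b) = flip_word a + flip_word b" "flip_word (- a) = - flip_word a"
  "flip_word (a - b) = flip_word a - flip_word b" "flip_word (gen i) = - gen i"
  by (simp_all add: flip_word_def ev_hom)

lemma flip_flip_word [simp]: "flip_word (flip_word z) = z"
  by (induction z rule: fgroup_induct) simp_all

text \<open>Complex conjugation exchanges positive and negative crossings. For single generators
  this is checked in the coordinates \<open>el\<close>.\<close>

lemma mirror_act: "mirror N (act N z (mirror N x)) = act N (flip_word z) x"
proof -
  have gens: "mirror N (act N (gen i) (mirror N x)) = act N (- gen i) x \<and>
      mirror N (act N (- gen i) (mirror N x)) = act N (gen i) x" for i x
  proof (cases "i < N")
    case True
    have hom: "additive_map (\<lambda>x. mirror N (act N (gen i) (mirror N x)))"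
      "additive_map (\<lambda>x. mirror N (act N (- gen i) (mirror N x)))"
      by (simp_all add: additive_map_def mirror_hom ev_hom)
    show ?thesis
      using additive_map_ext_e [OF hom(1) additive_map_act [of N "- gen i"], of N x]
        additive_map_ext_e [OF hom(2) additive_map_act [of N "gen i"], of N x]
      by (simp add: mirror_el mirror_hom mirror_ge ev_braid_gen_e ev_braid_gen_inv_e ev_hom ev_braid_gen_ge True grp_norm)
  qed (simp add: braid_gen_trivial)
  show ?thesis
  proof (induction z arbitrary: x rule: fgroup_induct)
    case (gen i z)
    have "mirror N (act N (gen i + z) (mirror N x)) = mirror N (act N (gen i) (mirror N (mirror N (act N z (mirror N x)))))"
      by (simp del: act_simps(6,7))
    then show ?case using gens [of i] gen by (simp del: act_simps(6,7))
  next
    case (minus_gen i z)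
    have "mirror N (act N (- gen i + z) (mirror N x)) = mirror N (act N (- gen i) (mirror N (mirror N (act N z (mirror N x)))))"
      by (simp del: act_simps(6,7))
    then show ?case using gens [of i] minus_gen by (simp del: act_simps(6,7))
  qed simp
qed

lemma mirror_puncture: "conjugate (mirror N (puncture N i)) (- puncture N i)"
  by (rule conjugateI [of _ "- el N i"]) (simp add: puncture_def mirror_hom mirror_el grp_norm)

text \<open>The element is a multiple \<open>k\<close> of \<open>x\<close>. Kept are its images
  under homomorphisms to the integers, which determine \<open>k\<close> later, and the two values of
  \<open>k\<close> that will turn out to be possible.\<close>

lemma cyc_multiple:
  assumes "a \<in> cyc x"
  shows "\<exists>k::int. (k = 1 \<longrightarrow> a = x) \<and> (k = -1 \<longrightarrow> a = - x) \<and>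
    (\<forall>h :: fgroup \<Rightarrow> int. additive_map h \<longrightarrow> h a = k * h x)"
proof -
  define zp where "zp = (\<lambda>k::int. if 0 \<le> k then npow (nat k) x else npow (nat (- k)) (- x))"
  have up: "zp (k + 1) = x + zp k" for k
  proof (cases "0 \<le> k")
    case True
    then have "nat (k + 1) = Suc (nat k)" by simp
    then show ?thesis using True by (simp add: zp_def npow_simps)
  next
    case False
    then have "nat (- k) = Suc (nat (- (k + 1)))" by simp
    then have "zp k = - x + npow (nat (- (k + 1))) (- x)" using False by (simp add: zp_def npow_simps)
    moreover have "zp (k + 1) = npow (nat (- (k + 1))) (- x)"
      using False by (cases "k = - 1") (auto simp: zp_def npow_simps)
    ultimately show ?thesis by simp
  qed
  have comm: "zp k + x = x + zp k" for k
  proof -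
    have "npow n (- x) + x = x + npow n (- x)" for n
    proof -
      have "comm x (npow n (- x))"
        by (induction n) (simp_all add: npow_simps comm_add comm_uminus)
      then show ?thesis by (simp add: comm_def)
    qed
    then show ?thesis by (simp add: zp_def npow_commute)
  qed
  have "\<exists>k. a = zp k" using assms
  proof induction
    case cyc_zero
    have "zp 0 = 0" by (simp add: zp_def npow_simps)
    then show ?case by metis
  next
    case (cyc_add a)
    then show ?case using up comm by metis
  next
    case (cyc_diff a)
    then obtain k where "a = zp k" by blast
    then have "a = zp (k - 1) + x" using up [of "k - 1"] comm [of "k - 1"] by simp
    then show ?case by (metis add_diff_cancel)
  qed
  then obtain k where k: "a = zp k" by blast
  have hz: "h (zp k) = k * h x" if h: "additive_map h" for h :: "fgroup \<Rightarrow> int"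
  proof -
    have "npow n c = int n * c" for n and c :: int by (induction n) (simp_all add: npow_simps distrib_right)
    then show ?thesis using h by (simp add: zp_def additive_map_npow additive_mapD [OF h])
  qed
  show ?thesis
    by (rule exI [of _ k]) (auto simp: k hz, auto simp: zp_def npow_simps npow_def)
qed

lemma degree_at:
  assumes "j \<le> N" "0 < N"
  shows "\<exists>d :: fgroup \<Rightarrow> int. additive_map d \<and> d (puncture N j) \<noteq> 0"
proof (cases "j < N")
  case True
  then show ?thesis
    by (intro exI [of _ "ev (\<lambda>i. if i = j then 1 else 0)"]) (simp add: puncture_gen)
next
  case False
  then have [simp]: "j = N" using assms by simp
  have "ev (\<lambda>_. 1 :: int) (ul N) = int N" by (induction N) (simp_all add: ev_add)
  then show ?thesis using assms
    by (intro exI [of _ "ev (\<lambda>_. 1)"]) (simp add: puncture_last ev_uminus)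
qed

lemma degree_difference:
  assumes "p \<le> N" "q \<le> N" "p \<noteq> q"
  shows "\<exists>d :: fgroup \<Rightarrow> int. additive_map d \<and>
    (\<forall>j\<le>N. d (puncture N j) = (if j = p then 1 else if j = q then -1 else 0))"
proof -
  define d :: "fgroup \<Rightarrow> int" where "d = ev (\<lambda>j. if j = p then 1 else if j = q then -1 else 0)"
  have "d (ul k) = (if p < k then 1 else 0) - (if q < k then 1 else 0)" for k
    using assms(3) by (induction k) (auto simp: d_def ev_add less_Suc_eq)
  then have "d (puncture N N) = (if N = p then 1 else if N = q then -1 else 0)"
    using assms by (auto simp: puncture_last d_def ev_uminus)
  moreover have "d (puncture N j) = (if j = p then 1 else if j = q then -1 else 0)" if "j < N" for j
    using that by (simp add: puncture_gen d_def)
  ultimately show ?thesis by (intro exI [of _ d]) (auto simp: d_def le_less)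
qed

text \<open>The last puncture is minus the sum of the others, so all images carry the same sign.\<close>

lemma uniform_sign:
  assumes h: "additive_map h" and bij: "bij_betw \<pi> {..N} {..N}"
    and s: "\<And>i. i \<le> N \<Longrightarrow> conjugate (h (puncture N i)) (if s i then puncture N (\<pi> i) else - puncture N (\<pi> i))"
    and ab: "a \<le> N" "b \<le> N"
  shows "s a = s b"
proof (cases "a = b")
  case False
  have le: "\<pi> i \<le> N" if "i \<le> N" for i using bij that unfolding bij_betw_def by blast
  have inj: "\<pi> i = \<pi> j \<longleftrightarrow> i = j" if "i \<le> N" "j \<le> N" for i j
    using bij that unfolding bij_betw_def inj_on_def by auto
  obtain d :: "fgroup \<Rightarrow> int" where d: "additive_map d"
    "\<And>j. j \<le> N \<Longrightarrow> d (puncture N j) = (if j = \<pi> a then 1 else if j = \<pi> b then -1 else 0)"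
    using degree_difference [of "\<pi> a" N "\<pi> b"] le ab inj False by metis
  have dh: "d (h (puncture N i)) = (if i = a then (if s a then 1 else -1) else if i = b then (if s b then -1 else 1) else 0)"
    if "i \<le> N" for i
    using conjugate_int [OF d(1) s [OF that]] d(2) [OF le [OF that]] inj that ab
    by (auto simp: additive_mapD [OF d(1)] split: if_splits)
  have "d (h (ul k)) = (\<Sum>i<k. d (h (gen i)))" for k
    by (induction k) (simp_all add: additive_mapD [OF h] additive_mapD [OF d(1)])
  then have "d (h (puncture N N)) = - (\<Sum>i<N. d (h (puncture N i)))"
    by (simp add: puncture_last puncture_gen additive_mapD [OF h] additive_mapD [OF d(1)])
  then have "(\<Sum>i\<le>N. d (h (puncture N i))) = 0"
    by (simp add: lessThan_Suc_atMost [symmetric])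
  also have "(\<Sum>i\<le>N. d (h (puncture N i))) = (\<Sum>i\<in>{a, b}. d (h (puncture N i)))"
    using ab by (intro sum.mono_neutral_right) (auto simp: dh)
  finally show ?thesis using False ab by (simp add: dh split: if_splits)
qed simp

section \<open>Homeomorphisms act by braids\<close>

definition end_map :: "nat \<Rightarrow> (complex \<Rightarrow> complex) \<Rightarrow> (nat \<Rightarrow> nat) \<Rightarrow> bool" where
  "end_map N f \<pi> \<longleftrightarrow> plane_map N f \<and> (\<forall>i\<le>N. \<pi> i \<le> N \<and>
     (\<forall>r>0. \<exists>r'>0. f ` end_nbhd N i r' \<subseteq> end_nbhd N (\<pi> i) r))"

lemma acts_cong: 
  assumes "acts N f h" "\<And>x. x \<in> plane N \<Longrightarrow> g x = f x" shows "acts N g h"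
  using assms(1) unfolding acts_def cobounds_def
  by (elim conjE exE, intro conjI exI; (elim near_mono)?) (simp_all add: assms(2))

text \<open>The loop at an end goes to a multiple \<open>m\<close> of the loop at the image end, the
  inverse map yields \<open>m'\<close>, and an integer homomorphism that does not vanish on the loop
  shows \<open>m' * m = 1\<close>. The signs agree at all ends by \<open>uniform_sign\<close>; if
  they are negative, composition with \<open>mirror\<close> corrects them.\<close>

lemma acts_signs:
  assumes f: "end_map N f \<pi>" and g: "end_map N g \<rho>"
    and fg: "\<And>x. x \<in> plane N \<Longrightarrow> f (g x) = x" and \<pi>\<rho>: "\<And>i. i \<le> N \<Longrightarrow> \<pi> (\<rho> i) = i"
    and N: "0 < N" and h: "acts N f h"
  obtains s where "permutes_ends N (if s then h else h \<circ> mirror N) \<pi>"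
    "\<And>i. i \<le> N \<Longrightarrow> conjugate (h (puncture N i)) (if s then puncture N (\<pi> i) else - puncture N (\<pi> i))"
proof -
  obtain k where k: "acts N g k" using g acts_exists unfolding end_map_def by blast
  have hk: "additive_map h" "additive_map k" using h k by (auto simp: acts_def)
  have "acts N (f \<circ> g) (h \<circ> k)" using h k g by (intro acts_comp) (auto simp: end_map_def)
  moreover have "acts N (f \<circ> g) id" using acts_cong [OF acts_id] fg by auto
  ultimately obtain a where a: "\<And>i. i \<le> N \<Longrightarrow> h (k (ul i)) = a + ul i - a"
    using acts_unique [of N "f \<circ> g" id "h \<circ> k"] by auto
  have hkp: "h (k (puncture N i)) = a + puncture N i - a" for i
  proof -
    have "h (k (el N i)) = a + el N i - a" for i
      using a [of i] by (auto simp: el_def additive_mapD [OF hk(1)] additive_mapD [OF hk(2)])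
    then show ?thesis by (simp add: puncture_def additive_mapD [OF hk(1)] additive_mapD [OF hk(2)] grp_norm)
  qed
  have \<pi>le: "i \<le> N \<Longrightarrow> \<pi> i \<le> N" and \<rho>le: "i \<le> N \<Longrightarrow> \<rho> i \<le> N" for i using f g by (auto simp: end_map_def)
  have surj: "\<pi> ` {..N} = {..N}" using \<pi>le \<rho>le \<pi>\<rho> by (auto simp: image_iff) (metis atMost_iff)
  then have bij: "bij_betw \<pi> {..N} {..N}"
    unfolding bij_betw_def using eq_card_imp_inj_on [of "{..N}" \<pi>] by simp
  have \<rho>\<pi>: "\<rho> (\<pi> i) = i" if "i \<le> N" for i
    using bij \<pi>\<rho> [OF \<pi>le [OF that]] \<rho>le [OF \<pi>le [OF that]] that unfolding bij_betw_def inj_on_def by auto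
  have sgn: "\<exists>s. conjugate (h (puncture N i)) (if s then puncture N (\<pi> i) else - puncture N (\<pi> i))" if i: "i \<le> N" for i
  proof -
    let ?j = "\<pi> i"
    have j: "?j \<le> N" using \<pi>le i by blast
    obtain b where "- b + h (puncture N i) + b \<in> cyc (puncture N ?j)"
      using acts_puncture [of N f h i ?j] f h i by (auto simp: end_map_def)
    then obtain m where m: "m = 1 \<Longrightarrow> - b + h (puncture N i) + b = puncture N ?j"
      "m = -1 \<Longrightarrow> - b + h (puncture N i) + b = - puncture N ?j"
      "\<And>d :: fgroup \<Rightarrow> int. additive_map d \<Longrightarrow> d (- b + h (puncture N i) + b) = m * d (puncture N ?j)"
      using cyc_multiple by metis
    obtain b' where "- b' + k (puncture N ?j) + b' \<in> cyc (puncture N i)"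
      using acts_puncture [of N g k ?j i] g k i j \<rho>\<pi> [OF i] unfolding end_map_def by metis
    then obtain m' where m': 
      "\<And>d :: fgroup \<Rightarrow> int. additive_map d \<Longrightarrow> d (- b' + k (puncture N ?j) + b') = m' * d (puncture N i)"
      using cyc_multiple by metis
    obtain d :: "fgroup \<Rightarrow> int" where d: "additive_map d" "d (puncture N ?j) \<noteq> 0" using degree_at [OF j N] by blast
    have dh: "additive_map (d \<circ> h)" using d hk by (intro additive_map_comp)
    have "d (puncture N ?j) = d (h (k (puncture N ?j)))"
      by (simp add: hkp additive_mapD [OF d(1)])
    also have "\<dots> = m' * d (h (puncture N i))"
      using m' [OF dh] by (simp add: additive_mapD [OF d(1)] additive_mapD [OF hk(1)])
    also have "d (h (puncture N i)) = m * d (puncture N ?j)"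
      using m(3) [OF d(1)] by (simp add: additive_mapD [OF d(1)])
    finally have "m' * m = 1" using d(2) by (simp add: mult.assoc [symmetric])
    then have "m = 1 \<or> m = -1" using zmult_eq_1_iff [of m' m] by auto
    moreover have "conjugate (h (puncture N i)) (- b + h (puncture N i) + b)"
      by (rule conjugateI [of _ "- b"]) (simp add: grp_norm)
    ultimately show ?thesis using m(1,2) by metis
  qed
  then obtain s where s: "\<And>i. i \<le> N \<Longrightarrow> conjugate (h (puncture N i)) (if s i then puncture N (\<pi> i) else - puncture N (\<pi> i))"
    by metis
  have su: "s i = s 0" if "i \<le> N" for i
    using uniform_sign [OF hk(1) bij s that, of 0] by simp
  have all: "conjugate (h (puncture N i)) (if s 0 then puncture N (\<pi> i) else - puncture N (\<pi> i))" if "i \<le> N" for i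
    using s [OF that] su [OF that] by simp
  have "permutes_ends N (if s 0 then h else h \<circ> mirror N) \<pi>"
  proof (cases "s 0")
    case True
    then show ?thesis using all hk bij by (auto simp: permutes_ends_def)
  next
    case False
    have "conjugate (h (mirror N (puncture N i))) (puncture N (\<pi> i))" if "i \<le> N" for i
    proof -
      have "conjugate (h (mirror N (puncture N i))) (h (- puncture N i))"
        by (rule conjugate_hom [OF hk(1) mirror_puncture])
      moreover have "conjugate (h (- puncture N i)) (- (- puncture N (\<pi> i)))"
        using conjugate_uminus [OF all [OF that]] False by (simp add: additive_mapD [OF hk(1)])
      ultimately show ?thesis using conjugate_trans by fastforce
    qed
    then show ?thesis using False hk bij by (auto simp: permutes_ends_def intro: additive_map_comp)
  qed
  then show ?thesis using that all by blast
qed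

theorem acts_braid:
  assumes f: "end_map N f \<pi>" and g: "end_map N g \<rho>"
    and fg: "\<And>x. x \<in> plane N \<Longrightarrow> f (g x) = x" and \<pi>\<rho>: "\<And>i. i \<le> N \<Longrightarrow> \<pi> (\<rho> i) = i" and N: "0 < N"
  shows "\<exists>z\<in>letters_below N. acts N f (act N z) \<or> acts N f (act N z \<circ> mirror N)"
proof -
  obtain h where h: "acts N f h" using f acts_exists unfolding end_map_def by blast
  obtain s where "permutes_ends N (if s then h else h \<circ> mirror N) \<pi>"
    by (rule acts_signs [OF f g fg \<pi>\<rho> N h])
  from permutes_ends_braid [OF this] obtain z a where
    z: "z \<in> letters_below N" "\<And>x. x \<in> letters_below N \<Longrightarrow> (if s then h else h \<circ> mirror N) x = a + act N z x - a" by blast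
  show ?thesis
  proof (cases s)
    case True
    have "acts N f (act N z)"
    proof (rule acts_conj [OF h additive_map_act])
      fix k assume "k \<le> N"
      then have "h (ul k) = a + act N z (ul k) - a" using z(2) letters_below_ul True by fastforce
      then show "act N z (ul k) = - a + h (ul k) - - a" by (simp add: grp_norm)
    qed
    then show ?thesis using z(1) by blast
  next
    case False
    have "acts N f (act N z \<circ> mirror N)"
    proof (rule acts_conj [OF h additive_map_comp [OF additive_map_act additive_map_mirror]])
      fix k assume k: "k \<le> N"
      then have "h (mirror N (- ul k)) = a + act N z (- ul k) - a"
        using z(2) [OF letters_below_intros(4) [OF letters_below_ul]] False by fastforce
      then show "(act N z \<circ> mirror N) (ul k) = - a + h (ul k) - - a"
        using k by (simp add: mirror_ul mirror_hom grp_norm)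
    qed
    then show ?thesis using z(1) by blast
  qed
qed

section \<open>Maps supported in a disc around two punctures\<close>

definition mid :: "nat \<Rightarrow> complex" where "mid i = Complex (real i + 1 / 2) 0"

lemma primitive_zero: "(\<And>x y. x \<in> S \<Longrightarrow> y \<in> S \<Longrightarrow> c x y = 0) \<Longrightarrow> primitive S c (\<lambda>_. 0)"
  unfolding primitive_def by (rule near_all) simp

text \<open>Where \<open>f\<close> is the identity the crossing cocycle is its own pull-back. So the
  gauge \<open>A\<close> is constant above the disc, and below it constant up to strip labels. Every
  strip except \<open>Suc i\<close> joins these two regions outside the disc; this equates the
  constants and determines \<open>h (ul k)\<close> for \<open>k \<noteq> Suc i\<close>.\<close>

lemma supported_acts:
  assumes i: "Suc i < N"
    and id: "\<And>z. z \<in> plane N \<Longrightarrow> 3 / 4 \<le> cmod (z - mid i) \<Longrightarrow> f z = z"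
    and h: "additive_map h" "cobounds (plane N) A (\<lambda>x y. h (crossing N x y)) (\<lambda>x y. crossing N (f x) (f y))"
  obtains a where "\<And>z. 3 / 4 < Im z \<Longrightarrow> A z = a"
    "\<And>z. Im z < - (3 / 4) \<Longrightarrow> h (strip_label N z) + A z = a + strip_label N z"
    "\<And>k. k \<le> N \<Longrightarrow> k \<noteq> Suc i \<Longrightarrow> h (ul k) = a + ul k - a"
proof -
  let ?c = "\<lambda>x y. crossing N (f x) (f y)"
  have fz: "f z = z" if "z \<in> slit \<sigma> N" "\<sigma> \<in> {1, -1}" "3 / 4 < \<bar>Im z\<bar> \<or> 3 / 4 < \<bar>Re z - (real i + 1 / 2)\<bar>" for z \<sigma>
  proof (rule id)
    show "z \<in> plane N" using that(1,2) slit_Un by auto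
    show "3 / 4 \<le> cmod (z - mid i)"
      using that(3) abs_Re_le_cmod [of "z - mid i"] abs_Im_le_cmod [of "z - mid i"] by (auto simp: mid_def)
  qed
  define a where "a = A (Complex 0 1)"
  let ?U = "{z. 3 / 4 < Im z}" and ?D = "{z. Im z < - (3 / 4)}"
  have U: "?U \<subseteq> slit 1 N" and D: "?D \<subseteq> slit (-1) N" by (auto simp: slit_def)
  have up: "A z = a" if "3 / 4 < Im z" for z
  proof -
    have "primitive ?U ?c (\<lambda>_. 0)"
    proof (rule primitive_zero)
      fix x y assume "x \<in> ?U" "y \<in> ?U"
      moreover from this have "f x = x" using fz [of x 1] U by auto
      ultimately show "?c x y = 0" by (simp add: crossing_def)
    qed
    from primitive_subset [OF cobounds_up [OF h] U] this convex_connected [OF convex_halfspaces(3)]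
    have "A z - 0 = A (Complex 0 1) - 0" by (rule primitive_unique) (use that in simp_all)
    then show ?thesis by (simp add: a_def)
  qed
  define b where "b = h (strip_label N (Complex (- 1) (- 1))) + A (Complex (- 1) (- 1)) - strip_label N (Complex (- 1) (- 1))"
  have down: "h (strip_label N z) + A z - strip_label N z = b" if "Im z < - (3 / 4)" for z
  proof -
    have "primitive ?D ?c (strip_label N)"
      unfolding primitive_def
    proof (rule near_all)
      fix x y assume "x \<in> ?D" "y \<in> ?D"
      moreover from this have "f x = x" "f y = y" using fz [of x "-1"] fz [of y "-1"] D by auto
      ultimately show "?c x y = - strip_label N x + strip_label N y" by (simp add: crossing_def)
    qed
    from primitive_subset [OF cobounds_down [OF h] D] this convex_connected [OF convex_halfspaces(4)]
    show ?thesis unfolding b_def by (rule primitive_unique) (use that in simp_all)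
  qed
  have side: "A (Complex (real k - 1 / 2) (- 1)) = a" if k: "k \<le> N" "k \<noteq> Suc i" for k
  proof -
    let ?Z = "strip N k \<inter> (if k \<le> i then {z. Re z < real i - 1 / 4} else {z. real i + 5 / 4 < Re z})"
    have Z: "?Z \<subseteq> slit 1 N" using strip_subset strips_slit by blast
    have fZ: "f z = z" if "z \<in> ?Z" for z
      using fz [of z 1] Z that by (auto split: if_splits)
    have conv: "convex ?Z" by (intro convex_Int convex_strip) simp
    have "primitive ?Z ?c (\<lambda>_. 0)"
    proof (rule primitive_zero)
      fix x y assume xy: "x \<in> ?Z" "y \<in> ?Z"
      have "strip_label N x = ul k" "strip_label N y = ul k"
        by (rule strip_label_strip [OF IntD1 [OF xy(1)] k(1)] strip_label_strip [OF IntD1 [OF xy(2)] k(1)])+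
      then have "strip_label N x = strip_label N y" by simp
      then show "?c x y = 0" using fZ xy by (simp add: crossing_def)
    qed
    moreover have pts: "Complex (real k - 1 / 2) t \<in> ?Z" for t
    proof -
      have "Complex (real k - 1 / 2) t \<in> strip N k" by (auto simp: strip_def)
      moreover have "real k - 1 / 2 < real i - 1 / 4" if "k \<le> i" using that by simp
      moreover have "real i + 5 / 4 < real k - 1 / 2" if "\<not> k \<le> i"
      proof -
        have "Suc (Suc i) \<le> k" using that k(2) by simp
        then have "real (Suc (Suc i)) \<le> real k" by (simp only: of_nat_le_iff)
        then show ?thesis by simp
      qed
      ultimately show ?thesis by simp
    qed
    ultimately have "A (Complex (real k - 1 / 2) (- 1)) - 0 = A (Complex (real k - 1 / 2) 1) - 0"
      by (intro primitive_unique [OF primitive_subset [OF cobounds_up [OF h] Z] _ convex_connected [OF conv]])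
    then show ?thesis using up [of "Complex (real k - 1 / 2) 1"] by simp
  qed
  have lab: "strip_label N (Complex (real k - 1 / 2) (- 1)) = ul k" if "k \<le> N" for k
    using that by (intro strip_label_strip) (auto simp: strip_def)
  have "b = a"
    using down [of "Complex (real 0 - 1 / 2) (- 1)"] side [of 0] lab [of 0] additive_mapD(2) [OF h(1)] by simp
  then have down': "h (strip_label N z) + A z = a + strip_label N z" if "Im z < - (3 / 4)" for z
    using down [OF that] by (metis diff_add_cancel)
  have "h (ul k) = a + ul k - a" if k: "k \<le> N" "k \<noteq> Suc i" for k
  proof -
    have "h (ul k) + a = a + ul k"
      using down' [of "Complex (real k - 1 / 2) (- 1)"] side [OF k] lab [OF k(1)] by simp
    then show ?thesis by (metis add_diff_cancel)
  qed
  then show ?thesis using that up down' by blast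
qed

text \<open>Up to one conjugation the action fixes \<open>ul k\<close> for all
  \<open>k \<noteq> 1\<close>. For \<open>k = N\<close> this excludes the negative sign; for
  \<open>k = 2\<close> it is the hypothesis of Artin's theorem for two loops, which yields a word in
  \<open>gen 0\<close> alone; the larger \<open>k\<close> show that the word is right on the other
  generators.\<close>

theorem supported_acts_power:
  assumes N: "2 < N" and f: "end_map N f \<pi>" and g: "end_map N g \<rho>"
    and fg: "\<And>x. x \<in> plane N \<Longrightarrow> f (g x) = x" and \<pi>\<rho>: "\<And>i. i \<le> N \<Longrightarrow> \<pi> (\<rho> i) = i"
    and fixed: "\<And>j. 2 \<le> j \<Longrightarrow> j \<le> N \<Longrightarrow> \<pi> j = j"
    and id: "\<And>z. z \<in> plane N \<Longrightarrow> 3 / 4 \<le> cmod (z - mid 0) \<Longrightarrow> f z = z"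
  shows "\<exists>z\<in>letters_below 1. acts N f (act N z)"
proof -
  obtain h where h: "acts N f h" using f acts_exists unfolding end_map_def by blast
  then obtain A where A: "additive_map h" "cobounds (plane N) A (\<lambda>x y. h (crossing N x y)) (\<lambda>x y. crossing N (f x) (f y))"
    by (auto simp: acts_def)
  obtain a where a: "\<And>k. k \<le> N \<Longrightarrow> k \<noteq> Suc 0 \<Longrightarrow> h (ul k) = a + ul k - a"
    using supported_acts [of 0 N f, OF _ id A] N by (metis less_trans lessI numeral_2_eq_2)
  obtain s where s: "permutes_ends N (if s then h else h \<circ> mirror N) \<pi>"
    "\<And>i. i \<le> N \<Longrightarrow> conjugate (h (puncture N i)) (if s then puncture N (\<pi> i) else - puncture N (\<pi> i))"
    using acts_signs [OF f g fg \<pi>\<rho> _ h] N by (metis gr_implies_not0 neq0_conv)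
  have \<pi>N: "\<pi> N = N" using fixed N by simp
  have "conjugate (h (puncture N N)) (puncture N N)"
    using a [of N] N by (intro conjugateI [of _ "- a"]) (simp add: puncture_last additive_mapD [OF A(1)] grp_norm)
  obtain d :: "fgroup \<Rightarrow> int" where d: "additive_map d" "d (puncture N N) \<noteq> 0" using degree_at [of N N] N by auto
  have s_True: s
  proof (rule ccontr)
    assume "\<not> s"
    then have "d (h (puncture N N)) = d (- puncture N N)" using conjugate_int [OF d(1) s(2) [of N]] \<pi>N by simp
    moreover have "d (h (puncture N N)) = d (puncture N N)" using conjugate_int [OF d(1)] \<open>conjugate (h (puncture N N)) (puncture N N)\<close> by blast
    ultimately show False using d by (simp add: additive_mapD [OF d(1)])
  qed
  have low: "\<pi> i < 2" if "i < 2" for i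
  proof (rule ccontr)
    assume "\<not> \<pi> i < 2"
    moreover have "\<pi> i \<le> N" using f that N by (simp add: end_map_def)
    ultimately have "\<pi> (\<pi> i) = \<pi> i" using fixed by simp
    then have "\<pi> i = i"
      using s(1) that N \<open>\<pi> i \<le> N\<close> unfolding permutes_ends_def bij_betw_def inj_on_def by auto
    then show False using \<open>\<not> \<pi> i < 2\<close> that by simp
  qed
  define k where "k = (\<lambda>x. - a + h x - - a)"
  have k: "additive_map k" unfolding k_def by (rule additive_map_conj [OF A(1)])
  have kul: "k (ul j) = ul j" if "j \<le> N" "j \<noteq> Suc 0" for j
    using a [OF that] by (simp add: k_def grp_norm)
  have "\<exists>w. k (gen i) = conj_gen w (\<pi> i)" if "i < 2" for i
  proof -
    have "conjugate (k (gen i)) (h (gen i))" unfolding k_def by (rule conjugateI [of _ a]) (simp add: grp_norm)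
    moreover have "conjugate (h (gen i)) (gen (\<pi> i))"
      using s(2) [of i] s_True that low [OF that] N by (simp add: puncture_gen)
    ultimately show ?thesis using conjugate_conj_gen conjugate_trans by blast
  qed
  then obtain w where w: "\<And>i. i < 2 \<Longrightarrow> k (gen i) = conj_gen (w i) (\<pi> i)" by metis
  have "ev (\<lambda>i. k (gen i)) (ul 2) = ul 2"
    using additive_map_u_cong [OF additive_map_ev k, of 2 "\<lambda>i. k (gen i)"] kul [of 2] N by simp
  from artin [OF _ w this, of N] N obtain z where
    z: "z \<in> letters_below (2 - 1)" "\<And>i. i < 2 \<Longrightarrow> k (gen i) = act N z (gen i)" by (metis less_imp_le)
  have z1: "z \<in> letters_below 1" using z(1) by simp
  have "act N z (gen j) = gen j" if "2 \<le> j" for j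
    using z1
  proof (induction rule: letters_below_induct)
    case (gen i z)
    then show ?case using that N by (simp add: braid_gen_def)
  next
    case (minus_gen i z)
    then show ?case using that N by (simp add: braid_gen_inv_def)
  qed simp
  moreover have "k (gen j) = gen j" if "2 \<le> j" "j < N" for j
    using kul [of j] kul [of "Suc j"] that by (simp add: gen_eq_u additive_mapD [OF k] del: ul.simps)
  ultimately have kz: "k (gen j) = act N z (gen j)" if "j < N" for j
    using z(2) that by (cases "j < 2") auto
  have "acts N f (act N z)"
  proof (rule acts_conj [OF h additive_map_act])
    fix j assume "j \<le> N"
    then have "k (ul j) = act N z (ul j)"
      using letters_below_cong [OF k additive_map_act kz letters_below_ul] by blast
    then show "act N z (ul j) = - a + h (ul j) - - a" by (simp add: k_def)
  qed
  then show ?thesis using z1 by blast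
qed

section \<open>The standard half-twists of the plane\<close>

text \<open>\<open>pi\<close> up to radius 1/2, where the two punctures lie, and 0 from radius 3/4
  on, so that no other puncture is met.\<close>

definition twist_angle :: "real \<Rightarrow> real" where
  "twist_angle r = pi * max 0 (min 1 (3 - 4 * r))"

text \<open>The factor \<open>\<tau>\<close> makes the twists a one-parameter group, which provides
  inverses and square roots.\<close>

definition twist :: "nat \<Rightarrow> real \<Rightarrow> complex \<Rightarrow> complex" where
  "twist i \<tau> z = mid i + (z - mid i) * cis (\<tau> * twist_angle (cmod (z - mid i)))"

lemma twist_far: "3 / 4 \<le> cmod (z - mid i) \<Longrightarrow> twist i \<tau> z = z"
  by (simp add: twist_def twist_angle_def)

lemma cmod_twist: "cmod (twist i \<tau> z - mid i) = cmod (z - mid i)"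
  by (simp add: twist_def norm_mult)

lemma twist_twist: "twist i \<sigma> (twist i \<tau> z) = twist i (\<sigma> + \<tau>) z"
proof -
  have "twist i \<sigma> (twist i \<tau> z) = mid i + (twist i \<tau> z - mid i) * cis (\<sigma> * twist_angle (cmod (z - mid i)))"
    by (simp only: twist_def [of i \<sigma> "twist i \<tau> z"] cmod_twist)
  also have "\<dots> = mid i + (z - mid i) * (cis (\<tau> * twist_angle (cmod (z - mid i))) * cis (\<sigma> * twist_angle (cmod (z - mid i))))"
    by (simp add: twist_def mult.assoc)
  also have "\<dots> = twist i (\<sigma> + \<tau>) z"
    by (simp only: cis_mult twist_def) (simp add: algebra_simps)
  finally show ?thesis .
qed

lemma twist_0 [simp]: "twist i 0 z = z" by (simp add: twist_def)

lemma continuous_twist: "continuous_on S (twist i \<tau>)"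
  unfolding twist_def twist_angle_def cis_conv_exp by (intro continuous_intros)

lemma twist_near: "cmod (z - mid i) \<le> 1 / 2 \<Longrightarrow> twist i 1 z = 2 * mid i - z"
  by (simp add: twist_def twist_angle_def max_def min_def algebra_simps)

lemma mid_dist: "cmod (of_nat j - mid i) = \<bar>real j - real i - 1 / 2\<bar>"
proof -
  have "of_nat j - mid i = complex_of_real (real j - real i - 1 / 2)" by (simp add: mid_def complex_eq_iff)
  then show ?thesis by (metis norm_of_real)
qed

lemma twist_puncture: "twist i 1 (of_nat j) = of_nat (Transposition.transpose i (Suc i) j)"
proof -
  consider "j = i" | "j = Suc i" | "j < i" | "Suc (Suc i) \<le> j" by linarith
  then show ?thesis
  proof cases
    case 1
    then have "cmod (of_nat j - mid i) \<le> 1 / 2" using mid_dist [of j i] by simp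
    from twist_near [OF this] show ?thesis using 1 by (simp add: mid_def complex_eq_iff)
  next
    case 2
    then have "cmod (of_nat j - mid i) \<le> 1 / 2" using mid_dist [of j i] by simp
    from twist_near [OF this] show ?thesis using 2 by (simp add: mid_def complex_eq_iff)
  next
    case 3
    then have "real j + 1 \<le> real i" by linarith
    then show ?thesis using 3 by (subst twist_far) (auto simp: mid_dist)
  next
    case 4
    then have "real i + 2 \<le> real j" by linarith
    then show ?thesis using 4 by (subst twist_far) (auto simp: mid_dist)
  qed
qed

lemma twist_plane:
  assumes i: "Suc i < N"
  shows "twist i 1 z \<in> plane N \<longleftrightarrow> z \<in> plane N"
proof -
  have "z \<in> of_nat ` {..<N}" if z: "twist i 1 z = of_nat j" "j < N" for j
  proof -
    have "z = twist i (-1) (of_nat j)" using twist_twist [of i "-1" 1 z] z by simp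
    moreover have "twist i 1 (of_nat (Transposition.transpose i (Suc i) j)) = of_nat j" by (simp add: twist_puncture)
    ultimately have "z = of_nat (Transposition.transpose i (Suc i) j)"
      using twist_twist [of i "-1" 1 "of_nat (Transposition.transpose i (Suc i) j)"] by simp
    moreover have "Transposition.transpose i (Suc i) j < N" using z(2) i by (auto simp: Transposition.transpose_def)
    ultimately show ?thesis by blast
  qed
  moreover have "twist i 1 (of_nat j) \<in> of_nat ` {..<N}" if "j < N" for j
    using that i by (auto simp: twist_puncture Transposition.transpose_def)
  ultimately show ?thesis unfolding plane_def by auto
qed

lemma mid_vertical: "twist i 1 (Complex (real i + 1 / 2) y) =
   Complex (real i + 1 / 2 - y * sin (twist_angle \<bar>y\<bar>)) (y * cos (twist_angle \<bar>y\<bar>))"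
proof -
  have *: "Complex (real i + 1 / 2) y - mid i = Complex 0 y" by (simp add: mid_def complex_eq_iff)
  have "cmod (Complex 0 y) = \<bar>y\<bar>" by (simp add: cmod_def)
  then show ?thesis unfolding twist_def * by (simp add: complex_eq_iff mid_def)
qed

text \<open>A quarter turn happens at radius 5/8 only. There the image of the vertical line through
  \<open>mid i\<close> meets the real axis, already beyond the two punctures.\<close>

lemma twist_angle_half: "cos (twist_angle r) = 0 \<Longrightarrow> r = 5 / 8 \<and> sin (twist_angle r) = 1"
proof -
  assume c: "cos (twist_angle r) = 0"
  have "0 \<le> twist_angle r" "twist_angle r \<le> pi" by (auto simp: twist_angle_def max_def min_def)
  then have t: "twist_angle r = pi / 2"
    using c cos_inj_pi [of "twist_angle r" "pi / 2"] by simp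
  define M where "M = max 0 (min 1 (3 - 4 * r))"
  have "pi * M = pi / 2" using t by (simp only: twist_angle_def M_def)
  then have "M = 1 / 2" by simp
  then have m: "max 0 (min 1 (3 - 4 * r)) = 1 / 2" by (simp only: M_def)
  have "max 0 x = 1 / 2 \<Longrightarrow> x = 1 / 2" "min 1 x = 1 / 2 \<Longrightarrow> x = 1 / 2" for x :: real
    by (auto simp: max_def min_def split: if_splits)
  from this(2) [OF this(1) [OF m]] have "3 - 4 * r = 1 / 2" .
  then have "r = 5 / 8" by linarith
  moreover have "sin (twist_angle r) = 1" unfolding t by simp
  ultimately show ?thesis by simp
qed

text \<open>By \<open>supported_acts\<close> only \<open>h (ul (Suc i))\<close> is open. It is found
  by following the gauge \<open>A\<close> along the vertical line through \<open>mid i\<close>: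
  apart from the centre, the image of its upper half meets the real axis to the left of puncture
  \<open>i\<close>, and that of its lower half to the right of puncture
  \<open>i + 1\<close>.\<close>

theorem twist_acts:
  assumes i: "Suc i < N"
  shows "acts N (twist i 1) (act N (- gen i))"
proof -
  let ?f = "twist i 1"
  let ?c = "\<lambda>x y. crossing N (?f x) (?f y)"
  have pm: "plane_map N ?f" using twist_plane [OF i] continuous_twist by (auto simp: plane_map_def)
  then obtain h where h: "acts N ?f h" by (rule acts_exists)
  then obtain A where A: "additive_map h" "cobounds (plane N) A (\<lambda>x y. h (crossing N x y)) ?c"
    by (auto simp: acts_def)
  obtain a where a: "\<And>z. 3 / 4 < Im z \<Longrightarrow> A z = a"
    "\<And>z. Im z < - (3 / 4) \<Longrightarrow> h (strip_label N z) + A z = a + strip_label N z"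
    "\<And>k. k \<le> N \<Longrightarrow> k \<noteq> Suc i \<Longrightarrow> h (ul k) = a + ul k - a"
    by (rule supported_acts [OF i _ A]) (auto intro: twist_far)
  define v where "v = (\<lambda>y. Complex (real i + 1 / 2) y)"
  have vs: "v y \<in> strip N (Suc i)" for y by (auto simp: v_def strip_def)
  have lab: "strip_label N (v y) = ul (Suc i)" for y using i by (intro strip_label_strip [OF vs]) simp
  have seg: "convex (v ` I)" if "convex I" for I :: "real set"
  proof -
    have "v ` I = (\<lambda>x. mid i + x) ` ((\<lambda>y. y *\<^sub>R \<i>) ` I)"
      unfolding image_image by (rule image_cong) (auto simp: v_def mid_def complex_eq_iff)
    then show ?thesis using that by (simp only:) (intro convex_translation convex_linear_image, auto intro: bounded_linear.linear bounded_linear_scaleR_left)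
  qed
  have vslit: "v ` I \<subseteq> slit \<sigma> N" for I \<sigma> using vs strip_subset strips_slit by blast
  have fv: "?f (v y) = Complex (real i + 1 / 2 - y * sin (twist_angle \<bar>y\<bar>)) (y * cos (twist_angle \<bar>y\<bar>))" for y
    unfolding v_def by (rule mid_vertical)
  have quarter: "?f (v (1 / 4)) = v (- (1 / 4))" "?f (v (- (1 / 4))) = v (1 / 4)"
    by (simp_all add: fv, simp_all add: v_def twist_angle_def)
  have one: "?f (v 1) = v 1" "?f (v (- 1)) = v (- 1)"
    by (simp_all add: fv, simp_all add: v_def twist_angle_def)
  have "A (v (1 / 4)) = a + (- ul i + ul (Suc i))"
  proof -
    \<comment> \<open>A primitive of \<open>crossing\<close> on a region that contains the image of
      the upper part of the line. The two half-planes are joined in it through strip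
      \<open>i\<close> only, whence the term \<open>- ul i\<close>.\<close>
    define P where "P = (\<lambda>w. if Im w < 0 then - ul i + strip_label N w else 0)"
    have "primitive ({z. 0 < Im z} \<union> ({z. Im z < 0} \<union> strip N i)) (crossing N) P"
      unfolding primitive_def
    proof (intro near_open_Un open_Un)
      show "near (strip N i) (\<lambda>x y z. crossing N x y = - P x + P y)"
        using i strip_label_strip [of _ N i] by (intro near_all) (auto simp: crossing_def P_def)
    qed (auto simp: open_halfspaces open_strip P_def crossing_def grp_norm intro!: near_all)
    then have "primitive (v ` {1 / 4..}) ?c (\<lambda>x. P (?f x))"
    proof (rule primitive_pull [OF _ continuous_twist])
      fix x assume "x \<in> v ` {1 / 4..}"
      then obtain y where y: "x = v y" "1 / 4 \<le> y" by auto
      show "?f x \<in> {z. 0 < Im z} \<union> ({z. Im z < 0} \<union> strip N i)"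
      proof (cases "cos (twist_angle y) = 0")
        case True
        have "\<bar>y\<bar> = y" "y = 5 / 8" "sin (twist_angle y) = 1" using y twist_angle_half [OF True] by auto
        then have "?f x = Complex (real i + 1 / 2 - 5 / 8 * 1) (5 / 8 * 0)"
          using fv [of y] y(1) True by (simp only:)
        then have "?f x = Complex (real i - 1 / 8) 0" by simp
        then show ?thesis by (auto simp: strip_def)
      next
        case False
        then have "Im (?f x) \<noteq> 0" using y by (simp add: fv)
        then show ?thesis by auto
      qed
    qed
    then have "A (v (1 / 4)) - P (?f (v (1 / 4))) = A (v 1) - P (?f (v 1))"
      by (rule primitive_unique [OF primitive_subset [OF cobounds_up [OF A] vslit] _ convex_connected [OF seg]]) auto
    moreover have "P (?f (v (1 / 4))) = - ul i + ul (Suc i)" "P (?f (v 1)) = 0" "A (v 1) = a"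
      unfolding quarter one P_def by (simp_all only: lab) (simp_all add: v_def a(1))
    ultimately show ?thesis by (metis diff_0_right diff_add_cancel)
  qed
  moreover have "h (ul (Suc i)) + A (v (- (1 / 4))) = a + ul (Suc (Suc i))"
  proof -
    define P where "P = (\<lambda>w. if Im w < 0 then strip_label N w else ul (Suc (Suc i)))"
    have "primitive ({z. 0 < Im z} \<union> ({z. Im z < 0} \<union> strip N (Suc (Suc i)))) (crossing N) P"
      unfolding primitive_def
    proof (intro near_open_Un open_Un)
      show "near (strip N (Suc (Suc i))) (\<lambda>x y z. crossing N x y = - P x + P y)"
        using i strip_label_strip [of _ N "Suc (Suc i)"] by (intro near_all) (auto simp: crossing_def P_def simp del: ul.simps)
    qed (auto simp: open_halfspaces open_strip P_def crossing_def grp_norm intro!: near_all)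
    then have "primitive (v ` {..- (1 / 4)}) ?c (\<lambda>x. P (?f x))"
    proof (rule primitive_pull [OF _ continuous_twist])
      fix x assume "x \<in> v ` {..- (1 / 4)}"
      then obtain y where y: "x = v y" "y \<le> - (1 / 4)" by auto
      show "?f x \<in> {z. 0 < Im z} \<union> ({z. Im z < 0} \<union> strip N (Suc (Suc i)))"
      proof (cases "cos (twist_angle (- y)) = 0")
        case True
        have "\<bar>y\<bar> = - y" "- y = 5 / 8" and s: "sin (twist_angle (- y)) = 1" using y twist_angle_half [OF True] by auto
        then have "y = - (5 / 8)" by simp
        have "?f x = Complex (real i + 1 / 2 - y * 1) (y * 0)"
          using fv [of y] y(1) True s \<open>\<bar>y\<bar> = - y\<close> by (simp only:)
        then have "?f x = Complex (real i + 9 / 8) 0" by (simp add: \<open>y = - (5 / 8)\<close>)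
        then show ?thesis by (auto simp: strip_def)
      next
        case False
        then have "Im (?f x) \<noteq> 0" using y by (simp add: fv)
        then show ?thesis by auto
      qed
    qed
    then have "(h (strip_label N (v (- (1 / 4)))) + A (v (- (1 / 4)))) - P (?f (v (- (1 / 4)))) =
        (h (strip_label N (v (- 1))) + A (v (- 1))) - P (?f (v (- 1)))"
      by (rule primitive_unique [OF primitive_subset [OF cobounds_down [OF A] vslit] _ convex_connected [OF seg]]) auto
    moreover have "P (?f (v (- (1 / 4)))) = ul (Suc (Suc i))" "P (?f (v (- 1))) = ul (Suc i)"
      unfolding quarter one P_def by (simp_all only: lab) (simp_all add: v_def)
    moreover have "h (strip_label N (v (- 1))) + A (v (- 1)) = a + ul (Suc i)"
      using a(2) [of "v (- 1)"] lab [of "- 1"] by (simp add: v_def)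
    ultimately have "h (ul (Suc i)) + A (v (- (1 / 4))) - ul (Suc (Suc i)) = a + ul (Suc i) - ul (Suc i)"
      by (simp only: lab)
    then have "h (ul (Suc i)) + A (v (- (1 / 4))) - ul (Suc (Suc i)) = a" by (simp only: add_diff_cancel)
    then show ?thesis by (metis diff_add_cancel)
  qed
  moreover have "A (v (1 / 4)) - 0 = A (v (- (1 / 4))) - 0"
  proof (rule primitive_unique [OF primitive_subset [OF cobounds_up [OF A] vslit] _ convex_connected [OF seg]])
    show "primitive (v ` {- (1 / 4)..1 / 4}) ?c (\<lambda>_. 0)"
    proof (rule primitive_zero)
      have "?f (v y) = v (- y)" if "y \<in> {- (1 / 4)..1 / 4}" for y
      proof -
        have *: "v y - mid i = Complex 0 y" by (simp add: v_def mid_def complex_eq_iff)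
        have "cmod (Complex 0 y) = \<bar>y\<bar>" by (simp add: cmod_def)
        moreover have "\<bar>y\<bar> \<le> 1 / 2" using that by auto
        ultimately have "cmod (v y - mid i) \<le> 1 / 2" unfolding * by simp
        from twist_near [OF this] show ?thesis by (simp add: v_def mid_def complex_eq_iff)
      qed
      then show "?c x y = 0" if "x \<in> v ` {- (1 / 4)..1 / 4}" "y \<in> v ` {- (1 / 4)..1 / 4}" for x y
        using that by (auto simp: crossing_def lab simp del: ul.simps)
    qed
  qed auto
  ultimately have "h (ul (Suc i)) + (a + (- ul i + ul (Suc i))) = a + ul (Suc (Suc i))" by simp
  then have "h (ul (Suc i)) = a + ul (Suc (Suc i)) - (a + (- ul i + ul (Suc i)))" by (metis add_diff_cancel)
  then have mid: "h (ul (Suc i)) = a + (ul (Suc (Suc i)) - ul (Suc i) + ul i) - a"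
    by (simp add: grp_norm del: ul.simps)
  show ?thesis
  proof (rule acts_conj [OF h additive_map_act])
    fix k assume k: "k \<le> N"
    have "act N (- gen i) (ul k) = (if k = Suc i then ul (Suc (Suc i)) - ul (Suc i) + ul i else ul k)"
      using ev_braid_gen_inv_e [of i N k] i k by (auto simp: el_def simp del: ul.simps)
    then show "act N (- gen i) (ul k) = - a + h (ul k) - - a"
      using mid a(3) [OF k] by (auto simp: grp_norm simp del: ul.simps)
  qed
qed

section \<open>Charts of the punctured sphere\<close>

declare add_uminus_conv_diff [simp]

abbreviation sph :: "point set" where "sph \<equiv> topspace S2"

lemma S2_eq: "S2 = top_of_set sph"
  by (simp add: nsphere euclidean_product_topology)

lemma continuous_map_S2: "continuous_map S2 S2 f \<longleftrightarrow> continuous_on sph f \<and> f ` sph \<subseteq> sph"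
  by (subst (1 2) S2_eq) (auto simp: continuous_map_subtopology_eu)

lemma homeomorphic_mapE:
  assumes "homeomorphic_map S2 S2 f"
  obtains g where "homeomorphism sph sph f g" "homeomorphic_map S2 S2 g"
proof -
  obtain g where g: "homeomorphic_maps S2 S2 f g" using assms homeomorphic_map_maps by blast
  then have "homeomorphism sph sph f g"
    unfolding homeomorphic_maps_def continuous_map_S2 homeomorphism_def by force
  then show ?thesis using that g homeomorphic_maps_map by blast
qed

lemma homeomorphic_mapI: "homeomorphism sph sph f g \<Longrightarrow> homeomorphic_map S2 S2 f"
  unfolding homeomorphic_map_maps homeomorphic_maps_def continuous_map_S2 homeomorphism_def by force

text \<open>\<open>nsphere 2\<close> lies in a function space; the identification with the unit
  sphere of a Euclidean space gives access to its homeomorphism with a plane after one point is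
  removed.\<close>

definition to_sph :: "complex \<times> real \<Rightarrow> point" where
  "to_sph p = (\<lambda>i. if i = 0 then Re (fst p) else if i = 1 then Im (fst p) else if i = 2 then snd p else 0)"

definition of_sph :: "point \<Rightarrow> complex \<times> real" where
  "of_sph x = (Complex (x 0) (x 1), x 2)"

lemma mem_sph: "x \<in> sph \<longleftrightarrow> (x 0)\<^sup>2 + (x 1)\<^sup>2 + (x 2)\<^sup>2 = 1 \<and> (\<forall>i>2. x i = 0)"
proof -
  have "{..2 :: nat} = {0, 1, 2}" by auto
  then show ?thesis by (simp add: nsphere add.assoc)
qed

lemma to_sph_homeomorphism: "homeomorphism (sphere 0 1) sph to_sph of_sph"
proof (rule homeomorphismI)
  have "continuous_on (sphere 0 1) (\<lambda>p. to_sph p i)" for i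
    by (cases "i = 0"; cases "i = 1"; cases "i = 2"; simp add: to_sph_def; intro continuous_intros)
  then show "continuous_on (sphere 0 1) to_sph"
    by (rule continuous_on_coordinatewise_then_product)
  have c: "continuous_on sph (\<lambda>x. x i)" for i
    by (rule continuous_on_subset [OF continuous_on_product_coordinates]) simp
  show "continuous_on sph of_sph"
    unfolding of_sph_def Complex_eq by (intro continuous_intros c)
  show "to_sph ` sphere 0 1 \<subseteq> sph"
    by (auto simp: mem_sph to_sph_def norm_prod_def cmod_power2)
  show "of_sph ` sph \<subseteq> sphere 0 1"
    by (auto simp: mem_sph of_sph_def norm_prod_def cmod_power2)
  show "of_sph (to_sph p) = p" for p by (simp add: of_sph_def to_sph_def)
  show "to_sph (of_sph x) = x" if "x \<in> sph" for x
  proof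
    fix i show "to_sph (of_sph x) i = x i"
      using that by (cases "i = 0"; cases "i = 1"; cases "i = 2"; simp add: mem_sph of_sph_def to_sph_def)
  qed
qed

lemma compact_sph: "compact sph"
proof -
  have "compact (to_sph ` sphere 0 1)"
    using to_sph_homeomorphism by (intro compact_continuous_image compact_sphere) (auto simp: homeomorphism_def)
  then show ?thesis using to_sph_homeomorphism by (simp add: homeomorphism_def)
qed

lemma chart_exists:
  assumes "p \<in> sph"
  obtains \<kappa> \<psi> where "homeomorphism (sph - {p}) (UNIV :: complex set) \<kappa> \<psi>"
proof -
  have "of_sph p \<in> sphere 0 1" "to_sph (of_sph p) = p"
    using to_sph_homeomorphism assms by (auto simp: homeomorphism_def)
  then have "(sphere 0 1 - {of_sph p}) homeomorphic (UNIV :: complex set)"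
    by (intro homeomorphic_punctured_sphere_affine) auto
  moreover have "homeomorphism (sphere 0 1 - {of_sph p}) (sph - {p}) to_sph of_sph"
  proof -
    have "inj_on to_sph (sphere 0 1)" using to_sph_homeomorphism by (metis homeomorphism_def inj_on_inverseI)
    then have "to_sph ` (sphere 0 1 - {of_sph p}) = sph - {p}"
      using to_sph_homeomorphism \<open>of_sph p \<in> sphere 0 1\<close> \<open>to_sph (of_sph p) = p\<close>
      by (simp add: homeomorphism_def inj_on_image_set_diff [of to_sph "sphere 0 1"])
    then show ?thesis using homeomorphism_of_subsets [OF to_sph_homeomorphism, of "sphere 0 1 - {of_sph p}"] by auto
  qed
  ultimately have "(sph - {p}) homeomorphic (UNIV :: complex set)"
    using homeomorphic_trans homeomorphic_sym homeomorphic_def by metis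
  then show ?thesis using that by (auto simp: homeomorphic_def)
qed

locale sphere_chart =
  fixes P :: "point set" and N :: nat and p :: point and \<kappa> :: "point \<Rightarrow> complex" and \<psi> :: "complex \<Rightarrow> point"
  assumes chart: "homeomorphism (sph - {p}) UNIV \<kappa> \<psi>" and p: "p \<in> sph"
    and P: "P = insert p (\<psi> ` of_nat ` {..<N})"
begin

lemma chart_simps [simp]: "\<kappa> (\<psi> z) = z" "x \<in> sph \<Longrightarrow> x \<noteq> p \<Longrightarrow> \<psi> (\<kappa> x) = x" "\<psi> z \<in> sph" "\<psi> z \<noteq> p" "p \<noteq> \<psi> z"
  using chart unfolding homeomorphism_def by auto

lemma chart_cont: "continuous_on (sph - {p}) \<kappa>" "continuous_on A \<psi>"
  using chart continuous_on_subset unfolding homeomorphism_def by auto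

lemma psi_inj [simp]: "\<psi> z = \<psi> w \<longleftrightarrow> z = w" by (metis chart_simps(1))

lemma P_sph: "P \<subseteq> sph" using p by (auto simp: P)

definition pt_at :: "nat \<Rightarrow> point" where "pt_at j = (if j < N then \<psi> (of_nat j) else p)"

lemma P_eq: "P = pt_at ` {..N}"
proof -
  have "{..N} = insert N {..<N}" by auto
  then show ?thesis by (auto simp: P pt_at_def)
qed

lemma pt_at_inj: "i \<le> N \<Longrightarrow> j \<le> N \<Longrightarrow> pt_at i = pt_at j \<longleftrightarrow> i = j"
  by (auto simp: pt_at_def)

lemma plane_iff: "z \<in> plane N \<longleftrightarrow> \<psi> z \<notin> P"
  by (auto simp: plane_def P image_iff)

definition nbhd_at :: "nat \<Rightarrow> real \<Rightarrow> point set" where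
  "nbhd_at j r = insert (pt_at j) (\<psi> ` end_nbhd N j r)"

lemma open_minus: "openin (top_of_set sph) (sph - {p})"
  by (metis Diff_eq closed_singleton open_Compl openin_open_Int)

lemma nbhd_at_open:
  assumes "0 < r" shows "openin (top_of_set sph) (nbhd_at j r)"
proof (cases "j < N")
  case True
  then have "nbhd_at j r = \<psi> ` ball (of_nat j) r"
    using assms by (auto simp: nbhd_at_def pt_at_def end_nbhd_def)
  moreover have "openin (top_of_set (sph - {p})) (\<psi> ` ball (of_nat j) r)"
    using homeomorphism_imp_open_map [OF homeomorphism_symD [OF chart], of "ball (of_nat j) r"] by simp
  ultimately show ?thesis using openin_trans open_minus by metis
next
  case False
  let ?K = "\<psi> ` cball 0 (real N + 1 / r)"
  have "compact ?K" by (intro compact_continuous_image chart_cont compact_cball)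
  then have "openin (top_of_set sph) (sph \<inter> - ?K)"
    using compact_imp_closed by (intro openin_open_Int open_Compl)
  moreover have "sph \<inter> - ?K = nbhd_at j r"
  proof (rule Set.set_eqI)
    fix x
    show "x \<in> sph \<inter> - ?K \<longleftrightarrow> x \<in> nbhd_at j r"
    proof (cases "x = p")
      case False
      show ?thesis
      proof (cases "x \<in> sph")
        case True
        then obtain z where "x = \<psi> z" using False by (metis chart_simps(2))
        then show ?thesis using \<open>\<not> j < N\<close> by (auto simp: nbhd_at_def pt_at_def end_nbhd_def image_iff)
      next
        case F: False
        then have "x \<noteq> \<psi> z" for z by auto
        then show ?thesis using F False \<open>\<not> j < N\<close> by (auto simp: nbhd_at_def pt_at_def)
      qed
    next
      case True
      then show ?thesis using \<open>\<not> j < N\<close> p chart_simps(4) by (auto simp: nbhd_at_def pt_at_def)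
    qed
  qed
  ultimately show ?thesis by simp
qed

text \<open>At infinity: the complement of \<open>W\<close> is compact and misses \<open>p\<close>,
  so its image in the chart is bounded.\<close>

lemma nbhd_at_basis:
  assumes W: "openin (top_of_set sph) W" "pt_at j \<in> W"
  shows "\<exists>r>0. nbhd_at j r \<subseteq> W"
proof -
  obtain T where T: "open T" "W = sph \<inter> T" using W(1) by (auto simp: openin_open)
  show ?thesis
  proof (cases "j < N")
    case True
    have "open (\<psi> -` T)" using chart_cont(2) [of UNIV] T(1) by (simp add: continuous_on_open_vimage)
    moreover have "of_nat j \<in> \<psi> -` T" using W(2) T(2) True by (simp add: pt_at_def)
    ultimately obtain r where r: "0 < r" "ball (of_nat j) r \<subseteq> \<psi> -` T" by (metis open_contains_ball)
    then have "nbhd_at j r \<subseteq> W" using W(2) T(2) True by (auto simp: nbhd_at_def end_nbhd_def)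
    then show ?thesis using r(1) by blast
  next
    case False
    have pW: "p \<in> W" using W(2) False by (simp add: pt_at_def)
    have "sph - W = sph \<inter> - T" using T(2) by auto
    then have "compact (sph - W)" using compact_Int_closed [OF compact_sph closed_Compl [OF T(1)]] by metis
    moreover have "continuous_on (sph - W) \<kappa>" using pW by (intro continuous_on_subset [OF chart_cont(1)]) auto
    ultimately have "bounded (\<kappa> ` (sph - W))" by (intro compact_imp_bounded compact_continuous_image)
    then obtain B where B: "0 < B" "\<And>z. z \<in> \<kappa> ` (sph - W) \<Longrightarrow> cmod z \<le> B" by (auto simp: bounded_pos)
    have "nbhd_at j (1 / B) \<subseteq> W"
    proof
      fix x assume "x \<in> nbhd_at j (1 / B)"
      then consider "x = p" | z where "x = \<psi> z" "real N + B < cmod z"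
        using False B(1) by (auto simp: nbhd_at_def pt_at_def end_nbhd_def)
      then show "x \<in> W"
      proof cases
        case 2
        show ?thesis
        proof (rule ccontr)
          assume "x \<notin> W"
          then have "z \<in> \<kappa> ` (sph - W)" using 2 by (metis DiffI chart_simps(1,3) image_eqI)
          then show False using B(2) [of z] 2 by simp
        qed
      qed (use pW in simp)
    qed
    then show ?thesis using B(1) by (intro exI [of _ "1 / B"]) simp
  qed
qed

text \<open>The value is arbitrary where \<open>f (\<psi> z) = p\<close>. On \<open>plane N\<close>
  this does not occur for homeomorphisms that preserve \<open>P\<close>.\<close>

definition hat :: "(point \<Rightarrow> point) \<Rightarrow> complex \<Rightarrow> complex" where
  "hat f z = \<kappa> (f (\<psi> z))"

lemma hat_end_map:
  assumes f: "homeomorphism sph sph f g" and \<pi>: "\<And>j. j \<le> N \<Longrightarrow> \<pi> j \<le> N \<and> f (pt_at j) = pt_at (\<pi> j)"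
    and surj: "f ` P = P"
  shows "end_map N (hat f) \<pi>"
proof -
  have inj: "f x = f y \<longleftrightarrow> x = y" if "x \<in> sph" "y \<in> sph" for x y
    using f that unfolding homeomorphism_def by metis
  have fs: "f x \<in> sph" if "x \<in> sph" for x using f that unfolding homeomorphism_def by blast
  have fc: "continuous_on sph f" using f by (simp add: homeomorphism_def)
  have notP: "f (\<psi> z) \<notin> P" if "z \<in> plane N" for z
  proof
    assume "f (\<psi> z) \<in> P"
    then obtain y where "y \<in> P" "f y = f (\<psi> z)" using surj by (metis imageE)
    then show False using inj P_sph that plane_iff by (metis chart_simps(3) subsetD)
  qed
  have np: "f (\<psi> z) \<in> sph - {p}" if "z \<in> plane N" for z using notP [OF that] fs by (auto simp: P)
  have "hat f z \<in> plane N" if "z \<in> plane N" for z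
    using notP [OF that] np [OF that] by (simp add: plane_iff hat_def)
  moreover have "continuous_on (plane N) (hat f)"
  proof -
    have "continuous_on (plane N) (\<lambda>z. f (\<psi> z))"
      by (rule continuous_on_compose2 [OF fc chart_cont(2)]) auto
    then show ?thesis unfolding hat_def
      by (rule continuous_on_compose2 [OF chart_cont(1)]) (use np in auto)
  qed
  ultimately have pm: "plane_map N (hat f)" by (auto simp: plane_map_def)
  have "\<exists>r'>0. hat f ` end_nbhd N i r' \<subseteq> end_nbhd N (\<pi> i) r" if i: "i \<le> N" and r: "0 < r" for i r
  proof -
    let ?W = "sph \<inter> f -` nbhd_at (\<pi> i) r"
    have "openin (top_of_set sph) ?W"
    proof -
      have "nbhd_at (\<pi> i) r \<subseteq> sph" using openin_imp_subset nbhd_at_open [OF r] by blast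
      then show ?thesis
        using fc fs nbhd_at_open [OF r, of "\<pi> i"] continuous_on_open [of sph f] f unfolding homeomorphism_def by metis
    qed
    moreover have "pt_at i \<in> ?W" using \<pi> [OF i] P_sph i by (auto simp: nbhd_at_def P_eq)
    ultimately obtain r0 where r0: "0 < r0" "nbhd_at i r0 \<subseteq> ?W" using nbhd_at_basis by blast
    define r' where "r' = min r0 1"
    have r': "0 < r'" "r' \<le> 1" "r' \<le> r0" using r0(1) by (auto simp: r'_def)
    have "1 / r0 \<le> 1 / r'" using r' by (intro divide_left_mono) auto
    then have sub: "end_nbhd N i r' \<subseteq> end_nbhd N i r0" using r' by (auto simp: end_nbhd_def)
    have "hat f z \<in> end_nbhd N (\<pi> i) r" if z: "z \<in> end_nbhd N i r'" for z
    proof -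
      have "f (\<psi> z) \<in> nbhd_at (\<pi> i) r" using r0(2) sub z by (auto simp: nbhd_at_def)
      moreover have "\<psi> z \<noteq> pt_at i"
        using z i by (auto simp: pt_at_def end_nbhd_def split: if_splits)
      then have "f (\<psi> z) \<noteq> pt_at (\<pi> i)" using \<pi> [OF i] inj P_sph i by (metis P_eq atMost_iff chart_simps(3) image_eqI subsetD)
      ultimately show ?thesis by (auto simp: nbhd_at_def hat_def)
    qed
    then show ?thesis using r'(1) by blast
  qed
  then show ?thesis using pm \<pi> by (auto simp: end_map_def)
qed

lemma label_exists:
  assumes "f ` P = P"
  shows "\<exists>\<pi>. \<forall>j\<le>N. \<pi> j \<le> N \<and> f (pt_at j) = pt_at (\<pi> j)"
proof -
  have "\<forall>j. \<exists>i. j \<le> N \<longrightarrow> i \<le> N \<and> f (pt_at j) = pt_at i"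
  proof
    fix j
    show "\<exists>i. j \<le> N \<longrightarrow> i \<le> N \<and> f (pt_at j) = pt_at i"
    proof (cases "j \<le> N")
      case True
      then have "f (pt_at j) \<in> pt_at ` {..N}" using assms unfolding P_eq by blast
      then show ?thesis by auto
    qed simp
  qed
  from choice [OF this] show ?thesis by blast
qed

lemma hat_braid:
  assumes f: "homeomorphism sph sph f g" "f ` P = P" and N: "0 < N"
  obtains \<pi> \<rho> where "end_map N (hat f) \<pi>" "end_map N (hat g) \<rho>" "\<And>z. z \<in> plane N \<Longrightarrow> hat f (hat g z) = z"
    "\<And>i. i \<le> N \<Longrightarrow> \<pi> (\<rho> i) = i" "\<And>j. j \<le> N \<Longrightarrow> \<pi> j \<le> N \<and> f (pt_at j) = pt_at (\<pi> j)"
proof -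
  have g: "homeomorphism sph sph g f" using f(1) by (rule homeomorphism_symD)
  have gf: "g (f x) = x" "f (g x) = x" "f x \<in> sph" "g x \<in> sph" if "x \<in> sph" for x
    using f(1) that unfolding homeomorphism_def by auto
  have gP: "g ` P = P"
  proof -
    have "g ` f ` P = P" unfolding image_image using gf P_sph by (auto simp: subset_iff image_iff)
    then show ?thesis using f(2) by simp
  qed
  obtain \<pi> where \<pi>': "\<forall>j\<le>N. \<pi> j \<le> N \<and> f (pt_at j) = pt_at (\<pi> j)" using label_exists [OF f(2)] by (elim exE)
  then have \<pi>: "\<pi> j \<le> N \<and> f (pt_at j) = pt_at (\<pi> j)" if "j \<le> N" for j using that by blast
  obtain \<rho> where "\<forall>j\<le>N. \<rho> j \<le> N \<and> g (pt_at j) = pt_at (\<rho> j)" using label_exists [OF gP] by (elim exE)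
  then have \<rho>: "\<rho> j \<le> N \<and> g (pt_at j) = pt_at (\<rho> j)" if "j \<le> N" for j using that by blast
  have "\<pi> (\<rho> i) = i" if "i \<le> N" for i
  proof -
    have "pt_at i \<in> sph" using P_sph that by (auto simp: P_eq)
    then have "pt_at (\<pi> (\<rho> i)) = pt_at i" using \<pi> \<rho> gf(2) that by metis
    then show ?thesis using pt_at_inj \<pi> \<rho> that by blast
  qed
  moreover have "hat f (hat g z) = z" if "z \<in> plane N" for z
  proof -
    have "g (\<psi> z) \<noteq> p"
    proof
      assume "g (\<psi> z) = p"
      then have "\<psi> z \<in> f ` P" using gf(2) [of "\<psi> z"] by (metis P chart_simps(3) image_eqI insertI1)
      then show False using f(2) that plane_iff by simp
    qed
    then show ?thesis using gf by (simp add: hat_def)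
  qed
  ultimately show ?thesis
    using that [OF hat_end_map [OF f(1) \<pi> f(2)] hat_end_map [OF g \<rho> gP]] \<pi> by blast
qed

text \<open>Every stage of the isotopy is injective and agrees with \<open>f\<close> on
  \<open>P\<close>, hence maps the complement of \<open>P\<close> into itself. In the chart this is
  a homotopy of maps of the punctured plane.\<close>

lemma hat_isotopic:
  assumes f: "f ` P = P" and iso: "isotopic_rel P f g" and h: "acts N (hat f) h"
  shows "acts N (hat g) h"
proof -
  obtain H where H: "continuous_map (prod_topology (top_of_set {0..1::real}) S2) S2 H"
    "\<And>x. H (0, x) = f x" "\<And>x. H (1, x) = g x"
    "\<And>t. t \<in> {0..1} \<Longrightarrow> homeomorphic_map S2 S2 (\<lambda>x. H (t, x)) \<and> (\<forall>x\<in>P. H (t, x) = f x)"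
    using iso unfolding isotopic_rel_def homotopic_with_def by blast
  have Hc: "continuous_on ({0..1} \<times> sph) H"
    using H(1) by (subst (asm) (1 2) S2_eq) (auto simp: continuous_map_subtopology_eu)
  have ok: "H (s, \<psi> z) \<in> sph - P" if s: "s \<in> {0..1}" and z: "z \<in> plane N" for s z
  proof -
    obtain g' where g': "homeomorphism sph sph (\<lambda>x. H (s, x)) g'"
      using H(4) [OF s] homeomorphic_mapE by blast
    have "H (s, \<psi> z) \<in> sph" using g' unfolding homeomorphism_def by auto
    moreover have "H (s, \<psi> z) \<notin> P"
    proof
      assume "H (s, \<psi> z) \<in> P"
      then obtain y where y: "y \<in> P" "f y = H (s, \<psi> z)" using f by (metis imageE)
      then have "H (s, y) = H (s, \<psi> z)" using H(4) [OF s] by simp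
      then have "y = \<psi> z" using g' y(1) P_sph unfolding homeomorphism_def by (metis chart_simps(3) subsetD)
      then show False using y z plane_iff by simp
    qed
    ultimately show ?thesis by blast
  qed
  show ?thesis
  proof (rule acts_homotopic [OF h, of "\<lambda>q. \<kappa> (H (fst q, \<psi> (snd q)))"])
    have "continuous_on ({0..1} \<times> plane N) (\<lambda>q. H (fst q, \<psi> (snd q)))"
    proof (rule continuous_on_compose2 [OF Hc])
      show "continuous_on ({0..1::real} \<times> plane N) (\<lambda>q. (fst q, \<psi> (snd q)))"
        by (intro continuous_on_Pair continuous_on_fst continuous_on_id continuous_on_snd
              continuous_on_compose2 [OF chart_cont(2) [of UNIV]]) auto
    qed auto
    then show "continuous_on ({0..1} \<times> plane N) (\<lambda>q. \<kappa> (H (fst q, \<psi> (snd q))))"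
    proof (rule continuous_on_compose2 [OF chart_cont(1)])
      have "H (s, \<psi> z) \<in> sph - {p}" if "s \<in> {0..1}" "z \<in> plane N" for s z using ok [OF that] by (auto simp: P)
      then show "(\<lambda>q. H (fst q, \<psi> (snd q))) ` ({0..1} \<times> plane N) \<subseteq> sph - {p}"
        by (intro image_subsetI) (simp add: mem_Times_iff del: Diff_iff)
    qed
    show "\<kappa> (H (fst (s, y), \<psi> (snd (s, y)))) \<in> plane N" if "s \<in> {0..1}" "y \<in> plane N" for s y
      using ok [OF that] by (auto simp: plane_iff P)
  qed (auto simp: hat_def H(2,3))
qed

section \<open>Extending planar homeomorphisms to the sphere\<close>

definition lift :: "(complex \<Rightarrow> complex) \<Rightarrow> point \<Rightarrow> point" where
  "lift \<theta> x = (if x = p then p else \<psi> (\<theta> (\<kappa> x)))"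

lemma lift_cont:
  assumes "continuous_on UNIV \<theta>" "\<And>z. R < cmod z \<Longrightarrow> \<theta> z = z"
  shows "continuous_on sph (lift \<theta>)"
proof -
  define r where "r = 1 / (\<bar>R\<bar> + 1)"
  have r: "0 < r" "1 / r = \<bar>R\<bar> + 1" by (simp_all add: r_def)
  have sub: "nbhd_at N r \<subseteq> sph" using openin_imp_subset nbhd_at_open [OF r(1)] by blast
  then have U: "(sph - {p}) \<union> nbhd_at N r = sph" using p by (auto simp: nbhd_at_def pt_at_def)
  have "continuous_on (sph - {p}) (\<lambda>x. \<psi> (\<theta> (\<kappa> x)))"
    by (intro continuous_on_compose2 [OF chart_cont(2) [of UNIV]] continuous_on_compose2 [OF assms(1)] chart_cont) auto
  then have 1: "continuous_on (sph - {p}) (lift \<theta>)"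
    by (rule continuous_on_eq) (simp add: lift_def)
  have "lift \<theta> x = x" if xn: "x \<in> nbhd_at N r" for x
  proof (cases "x = p")
    case False
    then obtain z where "x = \<psi> z" "z \<in> end_nbhd N N r" using xn by (auto simp: nbhd_at_def pt_at_def)
    moreover from this have "real N + (\<bar>R\<bar> + 1) < cmod z" using r(2) by (simp add: end_nbhd_def)
    ultimately show ?thesis using assms(2) [of z] False by (simp add: lift_def)
  qed (simp add: lift_def)
  then have 2: "continuous_on (nbhd_at N r) (lift \<theta>)"
    by (intro continuous_on_eq [OF continuous_on_id]) simp
  show ?thesis
    using continuous_on_Un_local_open [of "sph - {p}" "nbhd_at N r" "lift \<theta>"] open_minus nbhd_at_open [OF r(1), of N] 1 2
    unfolding U by simp
qed

lemma lift_homeomorphism: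
  assumes "homeomorphism UNIV UNIV \<theta> \<theta>'" "\<And>z. R < cmod z \<Longrightarrow> \<theta> z = z"
  shows "homeomorphism sph sph (lift \<theta>) (lift \<theta>')"
proof -
  have inv: "\<theta> (\<theta>' z) = z" "\<theta>' (\<theta> z) = z" for z using assms(1) by (auto simp: homeomorphism_def)
  have "\<theta>' z = z" if "R < cmod z" for z using assms(2) [OF that] inv by metis
  then have "continuous_on sph (lift \<theta>)" "continuous_on sph (lift \<theta>')"
    using assms lift_cont by (auto simp: homeomorphism_def)
  then show ?thesis
    using p by (intro homeomorphismI) (auto simp: lift_def inv)
qed

lemma hat_lift [simp]: "hat (lift \<theta>) = \<theta>"
  by (rule ext) (simp add: hat_def lift_def)

lemma lift_P:
  assumes "\<theta> ` of_nat ` {..<N} = of_nat ` {..<N}"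
  shows "lift \<theta> ` P = P"
proof -
  have "lift \<theta> ` \<psi> ` of_nat ` {..<N} = \<psi> ` \<theta> ` of_nat ` {..<N}"
  proof -
    have "lift \<theta> (\<psi> z) = \<psi> (\<theta> z)" for z by (simp add: lift_def)
    then show ?thesis by (simp add: image_image)
  qed
  moreover have "lift \<theta> p = p" by (simp add: lift_def)
  ultimately show ?thesis using assms unfolding P image_insert by simp
qed

lemma lift_lift: "x \<in> sph \<Longrightarrow> lift \<theta> (lift \<theta>' x) = lift (\<theta> \<circ> \<theta>') x"
  by (simp add: lift_def)

lemma twist_homeomorphism: "homeomorphism UNIV UNIV (twist i s) (twist i (- s))"
  by (rule homeomorphismI) (auto simp: continuous_twist twist_twist)

lemma twist_outside: "cmod (mid i) + 1 < cmod z \<Longrightarrow> twist i s z = z"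
  using norm_triangle_sub [of z "mid i"] by (intro twist_far) simp

text \<open>A homeomorphism and its inverse have the same degree, so \<open>f \<circ> f\<close> has
  the degree of the identity. The half-twist is the square of the twist by half the angle, and so
  has degree 1.\<close>

lemma degree_square:
  assumes "homeomorphic_map S2 S2 f"
  shows "Brouwer_degree2 2 (f \<circ> f) = 1"
proof -
  obtain g where g: "homeomorphic_maps S2 S2 f g" using assms homeomorphic_map_maps by blast
  then have c: "continuous_map S2 S2 f" "continuous_map S2 S2 g" by (auto simp: homeomorphic_maps_def)
  have "Brouwer_degree2 2 f = Brouwer_degree2 2 g"
    using Brouwer_degree2_homeomorphic_maps [OF g] by metis
  then have "Brouwer_degree2 2 (f \<circ> f) = Brouwer_degree2 2 (g \<circ> f)"
    using c by (simp add: Brouwer_degree2_compose)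
  also have "\<dots> = Brouwer_degree2 2 id"
    using g by (intro Brouwer_degree2_eq) (auto simp: homeomorphic_maps_def)
  finally show ?thesis by simp
qed

lemma twist_marked:
  assumes i: "Suc i < N"
  shows "lift (twist i 1) \<in> marked_homeos P" "acts N (hat (lift (twist i 1))) (act N (- gen i))"
proof -
  have hom: "homeomorphism sph sph (lift (twist i s)) (lift (twist i (- s)))" for s
    using lift_homeomorphism [OF twist_homeomorphism twist_outside] .
  have "Brouwer_degree2 2 (lift (twist i 1)) = Brouwer_degree2 2 (lift (twist i (1 / 2)) \<circ> lift (twist i (1 / 2)))"
    by (rule Brouwer_degree2_eq) (simp add: lift_lift o_def twist_twist)
  then have "Brouwer_degree2 2 (lift (twist i 1)) = 1" using degree_square homeomorphic_mapI [OF hom] by simp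
  moreover have "lift (twist i 1) ` P = P"
  proof (rule lift_P)
    have "twist i 1 ` of_nat ` {..<N} = of_nat ` Transposition.transpose i (Suc i) ` {..<N}"
      by (simp add: image_image twist_puncture)
    moreover have "Transposition.transpose i (Suc i) ` {..<N} = {..<N}"
      using i by (subst Transposition.transpose_image_eq) auto
    ultimately show "twist i 1 ` of_nat ` {..<N} = of_nat ` {..<N}" by simp
  qed
  ultimately show "lift (twist i 1) \<in> marked_homeos P"
    using homeomorphic_mapI [OF hom] by (simp add: marked_homeos_def)
  show "acts N (hat (lift (twist i 1))) (act N (- gen i))" using twist_acts [OF i] by simp
qed

end

section \<open>A chart adapted to a half-twist\<close>

definition turn :: "(real \<Rightarrow> real) \<Rightarrow> complex \<Rightarrow> complex" where
  "turn \<alpha> w = w * cis (\<alpha> (cmod w))"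

lemma cmod_turn [simp]: "cmod (turn \<alpha> w) = cmod w" by (simp add: turn_def norm_mult)

lemma turn_uminus [simp]: "turn \<alpha> (turn (\<lambda>r. - \<alpha> r) w) = w"
  by (simp add: turn_def norm_mult mult.assoc cis_mult)

text \<open>Interpolates between the angle of \<open>twist\<close>, which is 0 beyond radius 3/4,
  and that of \<open>disc_half_twist\<close>, which becomes 0 only at the boundary. All stages turn
  radius 1/2 by \<open>pi\<close> and fix the boundary, so they permute the marked points in the
  same way.\<close>

definition twist_path :: "real \<Rightarrow> real \<Rightarrow> real" where
  "twist_path s r = (1 - s) * twist_angle r + s * (pi * min 1 (2 - 2 * r))"

lemma twist_path_values: "twist_path s (1 / 2) = pi" "twist_path s 1 = 0"
  by (simp_all add: twist_path_def twist_angle_def algebra_simps)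

lemma turn_half: "\<alpha> (1 / 2) = pi \<Longrightarrow> turn \<alpha> (1 / 2) = - 1 / 2" "\<alpha> (1 / 2) = pi \<Longrightarrow> turn \<alpha> (- 1 / 2) = 1 / 2"
  "\<alpha> (1 / 2) = - pi \<Longrightarrow> turn \<alpha> (1 / 2) = - 1 / 2" "\<alpha> (1 / 2) = - pi \<Longrightarrow> turn \<alpha> (- 1 / 2) = 1 / 2"
  by (simp_all add: turn_def norm_divide cis_pi cis_cnj [symmetric] flip: cis_inverse)

text \<open>In the coordinate \<open>r / (1 - r)\<close> this is the division of the radius by \<open>c\<close>.\<close>

definition squeeze :: "real \<Rightarrow> complex \<Rightarrow> complex" where
  "squeeze c w = w / of_real (cmod w + c * (1 - cmod w))"

lemma squeeze_pos: "0 < c \<Longrightarrow> cmod w \<le> 1 \<Longrightarrow> 0 < cmod w + c * (1 - cmod w)"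
  by (cases "cmod w = 1") (auto intro: add_nonneg_pos)

lemma cmod_squeeze:
  "0 < c \<Longrightarrow> cmod w \<le> 1 \<Longrightarrow> cmod (squeeze c w) = cmod w / (cmod w + c * (1 - cmod w))"
  using squeeze_pos [of c w] by (simp add: squeeze_def norm_divide del: of_real_add of_real_mult of_real_diff)

lemma squeeze_le: "0 < c \<Longrightarrow> cmod w \<le> 1 \<Longrightarrow> cmod (squeeze c w) \<le> 1"
  using squeeze_pos [of c w] by (simp add: cmod_squeeze)

lemma squeeze_small:
  assumes "0 < c" "cmod w \<le> 3 / 4"
  shows "cmod (squeeze c w) \<le> 3 / c"
proof -
  have "cmod w * c \<le> 3 * (c * (1 - cmod w))" using mult_right_mono [of "4 * cmod w" 3 c] assms by (simp add: algebra_simps)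
  then have "cmod w * c \<le> 3 * (cmod w + c * (1 - cmod w))" using norm_ge_zero [of w] unfolding distrib_left by linarith
  moreover have "0 < cmod w + c * (1 - cmod w)" using assms by (intro squeeze_pos) auto
  ultimately show ?thesis using assms by (simp add: cmod_squeeze field_simps)
qed

lemma squeeze_inverse:
  assumes c: "0 < c" "cmod w \<le> 1"
  shows "squeeze (1 / c) (squeeze c w) = w"
proof -
  define D where "D = cmod w + c * (1 - cmod w)"
  have D: "0 < D" using squeeze_pos [OF c] by (simp add: D_def)
  have 1: "cmod (squeeze c w) = cmod w / D" using cmod_squeeze [OF c] by (simp add: D_def)
  have "cmod w / D + 1 / c * (1 - cmod w / D) = (cmod w * c + (D - cmod w)) / (D * c)"
    using D c by (simp add: field_simps)
  also have "D - cmod w = c * (1 - cmod w)" by (simp add: D_def)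
  also have "(cmod w * c + c * (1 - cmod w)) / (D * c) = 1 / D" using c D by (simp add: field_simps)
  finally have 2: "squeeze (1 / c) (squeeze c w) = squeeze c w / of_real (1 / D)"
    unfolding squeeze_def [of "1 / c"] 1 by simp
  show ?thesis unfolding 2 using D by (simp add: squeeze_def flip: D_def)
qed

lemma continuous_squeeze: "0 < c \<Longrightarrow> continuous_on (cball 0 1) (squeeze c)"
  unfolding squeeze_def using squeeze_pos by (intro continuous_intros) (auto simp del: of_real_add of_real_mult of_real_diff simp: less_imp_neq [symmetric])

locale planar_disc =
  fixes \<Phi> :: "complex \<Rightarrow> complex"
  assumes cont: "continuous_on (cball 0 1) \<Phi>" and inj: "inj_on \<Phi> (cball 0 1)"
begin

definition ext :: "(complex \<Rightarrow> complex) \<Rightarrow> complex \<Rightarrow> complex" where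
  "ext e z = (if z \<in> \<Phi> ` cball 0 1 then \<Phi> (e (the_inv_into (cball 0 1) \<Phi> z)) else z)"

lemma ext_disc [simp]: "cmod w \<le> 1 \<Longrightarrow> ext e (\<Phi> w) = \<Phi> (e w)"
  using inj by (simp add: ext_def the_inv_into_f_f)

lemma ext_outside [simp]: "z \<notin> \<Phi> ` cball 0 1 \<Longrightarrow> ext e z = z" by (simp add: ext_def)

lemma ext_ext:
  assumes "\<And>w. cmod w \<le> 1 \<Longrightarrow> cmod (e' w) \<le> 1 \<and> e (e' w) = w"
  shows "ext e (ext e' z) = z"
  using assms by (cases "z \<in> \<Phi> ` cball 0 1") auto

text \<open>Gluing along two closed sets. The complement of the image of the open disc is closed by
  invariance of domain, and on the boundary \<open>e\<close> is the identity.\<close>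

lemma ext_cont_family:
  assumes E: "continuous_on ({0..1::real} \<times> cball 0 1) (\<lambda>q. e (fst q) (snd q))"
    and into: "\<And>s w. s \<in> {0..1} \<Longrightarrow> cmod w \<le> 1 \<Longrightarrow> cmod (e s w) \<le> 1"
    and boundary: "\<And>s w. s \<in> {0..1} \<Longrightarrow> cmod w = 1 \<Longrightarrow> e s w = w"
  shows "continuous_on ({0..1} \<times> UNIV) (\<lambda>q. ext (e (fst q)) (snd q))"
proof -
  let ?D = "\<Phi> ` cball 0 1" and ?i = "the_inv_into (cball 0 1) \<Phi>" and ?I = "{0..1::real}"
  have "compact ?D" by (intro compact_continuous_image cont compact_cball)
  then have cD: "closed (?I \<times> ?D)" by (intro closed_Times compact_imp_closed) auto
  have "open (\<Phi> ` ball 0 1)"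
    using cont inj by (intro invariance_of_domain) (auto intro: continuous_on_subset inj_on_subset)
  then have cO: "closed (?I \<times> - \<Phi> ` ball 0 1)" by (intro closed_Times closed_Compl) auto
  have ic: "continuous_on ?D ?i" by (intro continuous_on_inv_into cont inj compact_cball)
  have ii: "?i z \<in> cball 0 1" if "z \<in> ?D" for z using the_inv_into_into [OF inj that] by blast
  have "continuous_on (?I \<times> ?D) (\<lambda>q. (fst q, ?i (snd q)))"
    by (intro continuous_on_Pair continuous_on_fst continuous_on_snd continuous_on_id continuous_on_compose2 [OF ic]) auto
  then have "continuous_on (?I \<times> ?D) (\<lambda>q. e (fst (fst q, ?i (snd q))) (snd (fst q, ?i (snd q))))"
    by (rule continuous_on_compose2 [OF E]) (use ii in \<open>auto simp del: mem_cball\<close>)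
  then have "continuous_on (?I \<times> ?D) (\<lambda>q. e (fst q) (?i (snd q)))" by simp
  then have "continuous_on (?I \<times> ?D) (\<lambda>q. \<Phi> (e (fst q) (?i (snd q))))"
    by (rule continuous_on_compose2 [OF cont]) (use ii into in \<open>auto simp: mem_cball_0 image_subset_iff simp del: mem_cball\<close>)
  then have 1: "continuous_on (?I \<times> ?D) (\<lambda>q. ext (e (fst q)) (snd q))"
    by (rule continuous_on_eq) (auto simp: ext_def)
  have "ext (e s) z = z" if "s \<in> ?I" "z \<notin> \<Phi> ` ball 0 1" for s z
  proof (cases "z \<in> ?D")
    case True
    then obtain w where w: "cmod w \<le> 1" "z = \<Phi> w" by auto
    then have "cmod w = 1" using that(2) by (cases "cmod w < 1") auto
    then show ?thesis using w boundary that(1) by simp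
  qed simp
  then have 2: "continuous_on (?I \<times> - \<Phi> ` ball 0 1) (\<lambda>q. ext (e (fst q)) (snd q))"
    by (intro continuous_on_eq [OF continuous_on_snd [OF continuous_on_id]]) auto
  have "\<Phi> ` ball 0 1 \<subseteq> ?D" by (intro image_mono) auto
  then have "?I \<times> ?D \<union> ?I \<times> - \<Phi> ` ball 0 1 = ?I \<times> UNIV" by blast
  then show ?thesis using continuous_on_closed_Un [OF cD cO 1 2] by simp
qed

lemma ext_cont:
  assumes "continuous_on (cball 0 1) e" "\<And>w. cmod w \<le> 1 \<Longrightarrow> cmod (e w) \<le> 1" "\<And>w. cmod w = 1 \<Longrightarrow> e w = w"
  shows "continuous_on UNIV (ext e)"
proof -
  have "continuous_on ({0..1::real} \<times> UNIV) (\<lambda>q. ext ((\<lambda>_. e) (fst q)) (snd q))"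
    by (intro ext_cont_family continuous_on_compose2 [OF assms(1)] continuous_on_snd continuous_on_id) (use assms in auto)
  then have "continuous_on ({0..1::real} \<times> UNIV) (\<lambda>q. ext e (snd q))" by simp
  then have "continuous_on UNIV (\<lambda>z. ext e (snd (0::real, z)))"
    by (rule continuous_on_compose2) (auto intro!: continuous_intros)
  then show ?thesis by simp
qed

lemma ext_homeomorphism:
  assumes "continuous_on (cball 0 1) e" "\<And>w. cmod w \<le> 1 \<Longrightarrow> cmod (e w) \<le> 1" "\<And>w. cmod w = 1 \<Longrightarrow> e w = w"
    and "continuous_on (cball 0 1) e'" "\<And>w. cmod w \<le> 1 \<Longrightarrow> cmod (e' w) \<le> 1" "\<And>w. cmod w = 1 \<Longrightarrow> e' w = w"
    and "\<And>w. cmod w \<le> 1 \<Longrightarrow> e (e' w) = w" "\<And>w. cmod w \<le> 1 \<Longrightarrow> e' (e w) = w"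
  shows "homeomorphism UNIV UNIV (ext e) (ext e')"
proof (rule homeomorphismI)
  show "continuous_on UNIV (ext e)" using assms(1-3) by (rule ext_cont)
  show "continuous_on UNIV (ext e')" using assms(4-6) by (rule ext_cont)
qed (use assms in \<open>auto intro!: ext_ext\<close>)

text \<open>Only the part of the disc up to radius 3/4 has to be placed, so the boundary curve needs
  no straightening. That part is squeezed within the disc until it is nearer to
  \<open>\<Phi> 0\<close> than any puncture outside; the affine map \<open>L\<close> turns this into
  a separation by the circle of radius 3/4 about \<open>mid 0\<close>. Finally \<open>F\<close> and
  \<open>G\<close>, supported inside and outside this circle, move the punctures to their integer
  places.\<close>

lemma standard_position:
  assumes K: "finite K" "card K = N" "K \<inter> \<Phi> ` cball 0 1 = {\<Phi> (1 / 2), \<Phi> (- 1 / 2)}"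
  obtains k k' where "homeomorphism UNIV UNIV k k'" "k ` K = of_nat ` {..<N}"
    "k (\<Phi> (1 / 2)) = 0" "k (\<Phi> (- 1 / 2)) = 1"
    "\<forall>w. cmod w \<le> 3 / 4 \<longrightarrow> k (\<Phi> w) \<in> ball (mid 0) (3 / 4)"
proof -
  let ?a = "\<Phi> (1 / 2)" and ?b = "\<Phi> (- 1 / 2)"
  define O' where "O' = K - {?a, ?b}"
  have inD: "1 / 2 \<in> cball (0::complex) 1" "- 1 / 2 \<in> cball (0::complex) 1" by (simp_all add: norm_divide)
  have ab: "?a \<noteq> ?b" using inj_onD [OF inj _ inD] by auto
  have abK: "?a \<in> K" "?b \<in> K" using K(3) by auto
  have KO: "K = insert ?a (insert ?b O')" using abK by (auto simp: O'_def)
  have fO: "finite O'" and cO: "card O' = N - 2" and N2: "2 \<le> N"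
  proof -
    show "finite O'" using K(1) by (simp add: O'_def)
    then have "card K = Suc (Suc (card O'))" unfolding KO using ab by (simp add: O'_def)
    then show "card O' = N - 2" "2 \<le> N" using K(2) by auto
  qed
  have O_out: "q \<notin> \<Phi> ` cball 0 1" if "q \<in> O'" for q using that K(3) by (auto simp: O'_def)
  obtain \<epsilon> where \<epsilon>: "0 < \<epsilon>" "\<And>q. q \<in> O' \<Longrightarrow> \<epsilon> < cmod (q - \<Phi> 0)"
  proof -
    have "\<Phi> 0 \<in> \<Phi> ` cball 0 1" by (intro imageI) simp
    then have "\<Phi> 0 \<notin> O'" using O_out by blast
    then have "open (- O')" "\<Phi> 0 \<in> - O'" using fO by (auto intro: finite_imp_closed)
    then obtain e where e: "0 < e" "cball (\<Phi> 0) e \<subseteq> - O'" by (meson open_contains_cball)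
    have "e < cmod (q - \<Phi> 0)" if "q \<in> O'" for q
      using e(2) that by (force simp: dist_norm norm_minus_commute)
    then show ?thesis using that e(1) by blast
  qed
  obtain \<delta> where \<delta>: "0 < \<delta>" "\<And>w. cmod w \<le> 1 \<Longrightarrow> cmod w < \<delta> \<Longrightarrow> cmod (\<Phi> w - \<Phi> 0) < \<epsilon>"
    using cont [unfolded continuous_on_iff, rule_format, of 0 \<epsilon>] \<epsilon>(1) by (auto simp: dist_norm)
  \<comment> \<open>By \<open>squeeze_small\<close> radius 3/4 is squeezed to at most
    \<open>3 / c\<close>, which is half of \<open>\<delta>\<close>.\<close>
  define c where "c = 6 / \<delta>"
  have c: "0 < c" "0 < 1 / c" "3 / c < \<delta>" using \<delta>(1) by (simp_all add: c_def)
  define J where "J = ext (squeeze c)"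
  define J' where "J' = ext (squeeze (1 / c))"
  have sq1: "squeeze d w = w" if "cmod w = 1" for d w using that by (simp add: squeeze_def)
  have J: "homeomorphism UNIV UNIV J J'"
    unfolding J_def J'_def
    using squeeze_inverse [OF c(1)] squeeze_inverse [OF c(2)] squeeze_le c sq1
    by (intro ext_homeomorphism continuous_squeeze) auto
  define \<rho> where "\<rho> = complex_of_real (3 / 4 / \<epsilon>)"
  have \<rho>: "\<rho> \<noteq> 0" "cmod \<rho> = 3 / 4 / \<epsilon>" using \<epsilon>(1) by (auto simp: \<rho>_def norm_divide)
  define L where "L z = mid 0 + \<rho> * (z - \<Phi> 0)" for z
  define L' where "L' z = \<Phi> 0 + (z - mid 0) / \<rho>" for z
  have L: "homeomorphism UNIV UNIV L L'"
    unfolding L_def L'_def using \<rho>(1) by (intro homeomorphismI continuous_intros) auto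
  have LJ: "homeomorphism UNIV UNIV (L \<circ> J) (J' \<circ> L')" using homeomorphism_compose [OF J L] .
  have injLJ: "L (J x) = L (J y) \<longleftrightarrow> x = y" for x y using LJ unfolding homeomorphism_def by (metis UNIV_I comp_apply)
  have small: "L (J (\<Phi> w)) \<in> ball (mid 0) (3 / 4)" if w: "cmod w \<le> 3 / 4" for w
  proof -
    have "cmod (squeeze c w) < \<delta>" using squeeze_small [OF c(1) w] c(3) by linarith
    moreover have "cmod (squeeze c w) \<le> 1" using squeeze_le [OF c(1)] w by simp
    ultimately have "cmod (\<Phi> (squeeze c w) - \<Phi> 0) < \<epsilon>" using \<delta>(2) by blast
    then have "cmod \<rho> * cmod (\<Phi> (squeeze c w) - \<Phi> 0) < 3 / 4" unfolding \<rho>(2) using \<epsilon>(1) by (simp add: field_simps)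
    then show ?thesis using w by (simp add: L_def J_def dist_norm norm_mult norm_minus_commute)
  qed
  have large: "L (J q) \<in> - cball (mid 0) (3 / 4)" if q: "q \<in> O'" for q
  proof -
    have "J q = q" using O_out [OF q] by (simp add: J_def)
    moreover have "3 / 4 < cmod \<rho> * cmod (q - \<Phi> 0)" unfolding \<rho>(2) using \<epsilon>(2) [OF q] \<epsilon>(1) by (simp add: field_simps)
    ultimately show ?thesis by (simp add: L_def dist_norm norm_mult norm_minus_commute)
  qed
  let ?B = "ball (mid 0) (3 / 4)" and ?C = "- cball (mid 0) (3 / 4)"
  have a: "L (J ?a) \<in> ?B" "L (J ?b) \<in> ?B" using small by (simp_all add: norm_divide)
  have mB: "of_nat j \<in> ?B" if "j < 2" for j
    using that mid_dist [of j 0] by (auto simp: dist_norm norm_minus_commute less_2_cases_iff)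
  have mC: "of_nat j \<in> ?C" if "2 \<le> j" for j
    using that mid_dist [of j 0] by (auto simp: dist_norm norm_minus_commute)
  have hull: "UNIV \<subseteq> affine hull S" if "open S" "x \<in> S" for S and x :: complex
    using that affine_hull_open [of S] by auto
  let ?x = "\<lambda>j::nat. if j = 0 then L (J ?a) else L (J ?b)"
  obtain F F' where F: "homeomorphism UNIV UNIV F F'" "\<And>j. j \<in> {0, 1} \<Longrightarrow> F (?x j) = of_nat j"
    "{z. \<not> (F z = z \<and> F' z = z)} \<subseteq> ?B"
  proof (rule homeomorphism_moving_points_exists [of ?B UNIV "{0, 1::nat}" ?x of_nat])
    show "pairwise (\<lambda>i j. ?x i \<noteq> ?x j \<and> (of_nat i :: complex) \<noteq> of_nat j) {0, 1}"
      using ab injLJ by (auto simp: pairwise_def)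
    show "?x i \<in> ?B \<and> of_nat i \<in> ?B" if "i \<in> {0, 1}" for i using that a mB [of i] by auto
    show "UNIV \<subseteq> affine hull ?B" using hull [OF open_ball a(1)] .
  qed (auto simp: complex_eq_iff)
  obtain h where h: "bij_betw h {0..<N - 2} O'" using ex_bij_betw_nat_finite [OF fO] cO by auto
  have hO: "h i \<in> O'" if "i < N - 2" for i using h that by (auto simp: bij_betw_def)
  let ?y = "\<lambda>i. L (J (h i))"
  have ne: "?C \<noteq> {}" using mC [of 2] by auto
  obtain G G' where G: "homeomorphism UNIV UNIV G G'" "\<And>i. i \<in> {0..<N - 2} \<Longrightarrow> G (?y i) = of_nat (i + 2)"
    "{z. \<not> (G z = z \<and> G' z = z)} \<subseteq> ?C"
  proof (rule homeomorphism_moving_points_exists [of ?C UNIV "{0..<N - 2}" ?y "\<lambda>i. of_nat (i + 2)"])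
    show "pairwise (\<lambda>i j. ?y i \<noteq> ?y j \<and> (of_nat (i + 2) :: complex) \<noteq> of_nat (j + 2)) {0..<N - 2}"
      using h injLJ by (auto simp: pairwise_def bij_betw_def inj_on_def simp del: of_nat_add)
    show "?y i \<in> ?C \<and> of_nat (i + 2) \<in> ?C" if "i \<in> {0..<N - 2}" for i
      using that large [OF hO [of i]] mC [of "i + 2"] by (simp del: of_nat_add Compl_iff)
    show "connected ?C" by (intro connected_complement_bounded_convex) auto
    show "UNIV \<subseteq> affine hull ?C" using hull [of ?C "of_nat 2"] mC [of 2] by (simp add: open_Compl del: Compl_iff of_nat_numeral)
  qed (auto intro!: connected_complement_bounded_convex)
  have Fout: "F z = z" if "z \<notin> ?B" for z using F(3) that by blast
  have Gout: "G z = z" if "z \<notin> ?C" for z using G(3) that by blast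
  have FB: "F z \<in> ?B" if "z \<in> ?B" for z
  proof (rule ccontr)
    assume "F z \<notin> ?B"
    then have "F (F z) = F z" by (rule Fout)
    then have "F z = z" using F(1) unfolding homeomorphism_def by (metis UNIV_I)
    then show False using that \<open>F z \<notin> ?B\<close> by simp
  qed
  have GFB: "G (F z) \<in> ?B \<and> G (F z) = F z" if "z \<in> ?B" for z
  proof -
    have "F z \<in> ?B" by (rule FB [OF that])
    moreover then have "F z \<notin> ?C" by auto
    ultimately show ?thesis using Gout by simp
  qed
  define k where "k = G \<circ> (F \<circ> (L \<circ> J))"
  define k' where "k' = ((J' \<circ> L') \<circ> F') \<circ> G'"
  have k: "homeomorphism UNIV UNIV k k'"
    unfolding k_def k'_def using homeomorphism_compose [OF homeomorphism_compose [OF LJ F(1)] G(1)] .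
  have ka: "k ?a = 0" using GFB [OF a(1)] F(2) [of 0] by (simp add: k_def)
  have kb: "k ?b = 1" using GFB [OF a(2)] F(2) [of 1] by (simp add: k_def)
  have kh: "k (h i) = of_nat (i + 2)" if "i < N - 2" for i
  proof -
    have "F (?y i) = ?y i" using large [OF hO [OF that]] by (intro Fout) auto
    then show ?thesis using G(2) [of i] that by (simp add: k_def)
  qed
  have "O' = h ` {0..<N - 2}" using h by (simp add: bij_betw_def)
  then have "k ` O' = (\<lambda>i. of_nat (i + 2)) ` {0..<N - 2}" using kh by (auto simp: image_image)
  also have "\<dots> = of_nat ` (\<lambda>i. i + 2) ` {0..<N - 2}" by (simp add: image_image)
  also have "(\<lambda>i. i + 2) ` {0..<N - 2} = {2..<N}" using N2 by (simp only: image_add_atLeastLessThan' le_add_diff_inverse2 add_0)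
  finally have "k ` K = of_nat ` insert 0 (insert 1 {2..<N})" using ka kb by (subst KO) simp
  also have "insert 0 (insert 1 {2..<N}) = {..<N}" using N2 by auto
  finally have kK: "k ` K = of_nat ` {..<N}" .
  have kB: "\<forall>w. cmod w \<le> 3 / 4 \<longrightarrow> k (\<Phi> w) \<in> ?B"
    unfolding k_def o_apply using GFB small by blast
  show ?thesis by (rule that [OF k kK ka kb kB])
qed

lemma turn_boundary: "\<alpha> 1 = 0 \<Longrightarrow> cmod w = 1 \<Longrightarrow> turn \<alpha> w = w" by (simp add: turn_def)

lemma twist_path_cont: "continuous_on ({0..1::real} \<times> cball 0 1) (\<lambda>q. turn (twist_path (fst q)) (snd q))"
  unfolding turn_def twist_path_def twist_angle_def cis_conv_exp by (intro continuous_intros)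

lemma turn_cont:
  assumes "continuous_on UNIV \<alpha>" shows "continuous_on S (turn \<alpha>)"
  unfolding turn_def cis_conv_exp
  by (intro continuous_intros continuous_on_compose2 [OF assms]) auto

lemma ext_turn_half:
  assumes "\<alpha> (1 / 2) = pi \<or> \<alpha> (1 / 2) = - pi"
  shows "ext (turn \<alpha>) (\<Phi> (1 / 2)) = \<Phi> (- 1 / 2)" "ext (turn \<alpha>) (\<Phi> (- 1 / 2)) = \<Phi> (1 / 2)"
proof -
  have t: "turn \<alpha> (1 / 2) = - 1 / 2" "turn \<alpha> (- 1 / 2) = 1 / 2" using assms turn_half by blast+
  have n: "cmod (1 / 2) \<le> 1" "cmod (- 1 / 2) \<le> 1" by (simp_all add: norm_divide)
  show "ext (turn \<alpha>) (\<Phi> (1 / 2)) = \<Phi> (- 1 / 2)" "ext (turn \<alpha>) (\<Phi> (- 1 / 2)) = \<Phi> (1 / 2)"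
    using ext_disc [OF n(1), of "turn \<alpha>"] ext_disc [OF n(2), of "turn \<alpha>"] unfolding t by blast+
qed

lemma ext_turn_puncture:
  assumes K: "K \<inter> \<Phi> ` cball 0 1 = {\<Phi> (1 / 2), \<Phi> (- 1 / 2)}" and \<alpha>: "\<alpha> (1 / 2) = pi \<or> \<alpha> (1 / 2) = - pi" and q: "q \<in> K"
  shows "ext (turn \<alpha>) q \<in> K"
proof (cases "q \<in> \<Phi> ` cball 0 1")
  case True
  then have "q = \<Phi> (1 / 2) \<or> q = \<Phi> (- 1 / 2)" using K q by blast
  moreover have "\<Phi> (1 / 2) \<in> K" "\<Phi> (- 1 / 2) \<in> K" using K by auto
  ultimately show ?thesis using ext_turn_half [of \<alpha>] \<alpha> by auto
qed (use q in simp)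

end

lemma continuous_twist_angle: "continuous_on S twist_angle"
  unfolding twist_angle_def by (intro continuous_intros)

lemma twist_path_0: "twist_path 0 = twist_angle" by (rule ext) (simp add: twist_path_def)

context sphere_chart
begin

lemma supported_swap_acts:
  assumes N: "2 < N" and \<theta>: "homeomorphism UNIV UNIV \<theta> \<theta>'"
    and sw: "\<theta> 0 = 1" "\<theta> 1 = 0" and out: "\<And>z. 3 / 4 \<le> cmod (z - mid 0) \<Longrightarrow> \<theta> z = z"
  shows "\<exists>z\<in>letters_below 1. acts N \<theta> (act N z)"
proof -
  have N0: "0 < N" using N by simp
  have far: "\<theta> z = z" if "cmod (mid 0) + 1 < cmod z" for z
    using norm_triangle_sub [of z "mid 0"] that by (intro out) simp
  have nat: "\<theta> (of_nat j) = of_nat j" if "2 \<le> j" for j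
    using that by (intro out) (auto simp: mid_dist)
  have "\<theta> ` of_nat ` {..<N} = of_nat ` {..<N}"
  proof -
    have e: "{..<N} = insert 0 (insert 1 {2..<N})" using N by auto
    have "\<theta> ` of_nat ` {2..<N} = of_nat ` {2..<N}" using nat by (auto simp: image_image intro!: image_cong)
    then show ?thesis unfolding e image_insert by (simp add: sw insert_commute)
  qed
  then have lP: "lift \<theta> ` P = P" by (rule lift_P)
  have hom: "homeomorphism sph sph (lift \<theta>) (lift \<theta>')" using lift_homeomorphism [OF \<theta> far] .
  obtain \<pi> \<rho> where \<pi>: "end_map N (hat (lift \<theta>)) \<pi>" "end_map N (hat (lift \<theta>')) \<rho>"
    "\<And>z. z \<in> plane N \<Longrightarrow> hat (lift \<theta>) (hat (lift \<theta>') z) = z"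
    "\<And>i. i \<le> N \<Longrightarrow> \<pi> (\<rho> i) = i" "\<And>j. j \<le> N \<Longrightarrow> \<pi> j \<le> N \<and> lift \<theta> (pt_at j) = pt_at (\<pi> j)"
    using hat_braid [OF hom lP N0] by blast
  have fixed: "\<pi> j = j" if "2 \<le> j" "j \<le> N" for j
  proof -
    have "lift \<theta> (pt_at j) = pt_at j" using nat [OF that(1)] by (simp add: pt_at_def lift_def)
    then show ?thesis using \<pi>(5) [OF that(2)] pt_at_inj that(2) by metis
  qed
  show ?thesis
    by (rule supported_acts_power [OF N \<pi>(1,2) \<pi>(3) \<pi>(4) fixed, unfolded hat_lift]) (use out in auto)
qed

end

text \<open>The half-twist itself reaches up to the boundary of its disc, where the chart gives no
  control. Its deformation \<open>\<theta>\<close> along \<open>twist_path\<close> is supported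
  within radius 3/4 and is homotopic to it off the punctures, so both act alike, by a power of
  \<open>gen 0\<close>.\<close>

lemma half_twist_chart:
  assumes H: "half_twist P H" and P: "P \<subseteq> sph" "finite P" "card P = Suc N" and N: "2 < N"
  obtains p \<kappa> \<psi> f z where "sphere_chart P N p \<kappa> \<psi>" "f \<in> H" "z \<in> letters_below 1"
    "acts N (sphere_chart.hat \<kappa> \<psi> f) (act N z)"
proof -
  obtain \<phi> f where \<phi>: "embedding_map (top_of_set (cball (0::complex) 1)) S2 \<phi>"
    and \<phi>P: "\<phi> ` cball 0 1 \<inter> P = {\<phi> (1 / 2), \<phi> (- 1 / 2)}" and f: "f \<in> H"
    "\<And>z. z \<in> cball 0 1 \<Longrightarrow> f (\<phi> z) = \<phi> (disc_half_twist z)"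
    "\<And>x. x \<in> sph \<Longrightarrow> x \<notin> \<phi> ` cball 0 1 \<Longrightarrow> f x = x"
    using H unfolding half_twist_def by auto
  have \<phi>c: "continuous_on (cball 0 1) \<phi>" "\<phi> ` cball 0 1 \<subseteq> sph" "inj_on \<phi> (cball 0 1)"
  proof -
    have "continuous_map (top_of_set (cball 0 1)) S2 \<phi>" "inj_on \<phi> (cball 0 1)"
      using homeomorphic_imp_continuous_map [OF \<phi> [unfolded embedding_map_def]]
        homeomorphic_imp_injective_map [OF \<phi> [unfolded embedding_map_def]]
      by (simp_all add: continuous_map_in_subtopology)
    then show "continuous_on (cball 0 1) \<phi>" "\<phi> ` cball 0 1 \<subseteq> sph" "inj_on \<phi> (cball 0 1)"
      by (subst (asm) S2_eq, auto simp: continuous_map_subtopology_eu)+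
  qed
  have "\<not> P \<subseteq> {\<phi> (1 / 2), \<phi> (- 1 / 2)}"
  proof
    assume "P \<subseteq> {\<phi> (1 / 2), \<phi> (- 1 / 2)}"
    then have "card P \<le> card {\<phi> (1 / 2), \<phi> (- 1 / 2)}" by (rule card_mono [rotated]) simp
    also have "\<dots> \<le> 2" by (simp add: card_insert_if)
    finally show False using P(3) N by simp
  qed
  \<comment> \<open>A marked point outside the disc is put at infinity, so that the whole disc lies
    in the chart.\<close>
  then obtain p where p: "p \<in> P" "p \<notin> \<phi> ` cball 0 1" using \<phi>P by blast
  then have ps: "p \<in> sph" using P(1) by blast
  obtain \<kappa>1 \<psi>1 where chart: "homeomorphism (sph - {p}) (UNIV :: complex set) \<kappa>1 \<psi>1"
    using chart_exists [OF ps] .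
  have c1: "\<kappa>1 (\<psi>1 z) = z" "\<psi>1 z \<in> sph" "\<psi>1 z \<noteq> p" for z using chart unfolding homeomorphism_def by auto
  have c2: "\<psi>1 (\<kappa>1 x) = x" if "x \<in> sph" "x \<noteq> p" for x using chart that unfolding homeomorphism_def by auto
  have \<phi>p: "\<phi> w \<in> sph \<and> \<phi> w \<noteq> p" if "cmod w \<le> 1" for w using \<phi>c(2) p(2) that by auto
  define \<Phi> where "\<Phi> w = \<kappa>1 (\<phi> w)" for w
  have \<psi>\<Phi>: "\<psi>1 (\<Phi> w) = \<phi> w" if "cmod w \<le> 1" for w using c2 \<phi>p [OF that] by (simp add: \<Phi>_def)
  interpret D: planar_disc \<Phi>
  proof
    have "continuous_on (sph - {p}) \<kappa>1" using chart by (simp add: homeomorphism_def)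
    then show "continuous_on (cball 0 1) \<Phi>" unfolding \<Phi>_def
      by (rule continuous_on_compose2 [OF _ \<phi>c(1)]) (use \<phi>p in \<open>simp add: image_subset_iff\<close>)
    show "inj_on \<Phi> (cball 0 1)"
    proof (rule inj_onI)
      fix v w :: complex assume vw: "v \<in> cball 0 1" "w \<in> cball 0 1" "\<Phi> v = \<Phi> w"
      then have "\<phi> v = \<phi> w" using \<psi>\<Phi> by (metis mem_cball_0)
      then show "v = w" using inj_onD [OF \<phi>c(3)] vw by blast
    qed
  qed
  define K where "K = \<kappa>1 ` (P - {p})"
  have \<psi>K: "\<psi>1 z \<in> P \<longleftrightarrow> z \<in> K" for z
  proof
    assume "\<psi>1 z \<in> P" then show "z \<in> K" using c1 by (metis DiffI K_def image_eqI singletonD)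
  next
    assume "z \<in> K"
    then obtain x where "x \<in> P" "x \<noteq> p" "z = \<kappa>1 x" by (auto simp: K_def)
    then show "\<psi>1 z \<in> P" using c2 P(1) by auto
  qed
  have injK: "inj_on \<kappa>1 (P - {p})" using c2 P(1) by (intro inj_on_inverseI [of _ \<psi>1]) auto
  have finK: "finite K" and cardK: "card K = N"
    using P p(1) by (simp_all add: K_def card_image [OF injK])
  have KD: "K \<inter> \<Phi> ` cball 0 1 = {\<Phi> (1 / 2), \<Phi> (- 1 / 2)}"
  proof -
    have "z \<in> K \<longleftrightarrow> z = \<Phi> (1 / 2) \<or> z = \<Phi> (- 1 / 2)" if z: "z \<in> \<Phi> ` cball 0 1" for z
    proof -
      obtain w where w: "cmod w \<le> 1" "z = \<Phi> w" using z by auto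
      have "z \<in> K \<longleftrightarrow> \<phi> w \<in> P" using \<psi>K [of z] \<psi>\<Phi> w by simp
      also have "\<dots> \<longleftrightarrow> \<phi> w = \<phi> (1 / 2) \<or> \<phi> w = \<phi> (- 1 / 2)" using \<phi>P w(1) by (auto simp: set_eq_iff)
      also have "\<dots> \<longleftrightarrow> \<psi>1 (\<Phi> w) = \<psi>1 (\<Phi> (1 / 2)) \<or> \<psi>1 (\<Phi> w) = \<psi>1 (\<Phi> (- 1 / 2))"
        using w(1) by (simp add: \<psi>\<Phi> norm_divide)
      also have "\<dots> \<longleftrightarrow> \<Phi> w = \<Phi> (1 / 2) \<or> \<Phi> w = \<Phi> (- 1 / 2)" using c1(1) by metis
      finally show ?thesis using w(2) by simp
    qed
    moreover have "\<Phi> (1 / 2) \<in> \<Phi> ` cball 0 1" "\<Phi> (- 1 / 2) \<in> \<Phi> ` cball 0 1" by (simp_all add: norm_divide)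
    ultimately show ?thesis by blast
  qed
  obtain k k' where k: "homeomorphism UNIV UNIV k k'" "k ` K = of_nat ` {..<N}"
    "k (\<Phi> (1 / 2)) = 0" "k (\<Phi> (- 1 / 2)) = 1"
    "\<forall>w. cmod w \<le> 3 / 4 \<longrightarrow> k (\<Phi> w) \<in> ball (mid 0) (3 / 4)"
    by (rule D.standard_position [OF finK cardK KD])
  have kk: "k (k' z) = z" "k' (k z) = z" for z using k(1) by (auto simp: homeomorphism_def)
  have kcont: "continuous_on UNIV k" "continuous_on UNIV k'" using k(1) by (auto simp: homeomorphism_def)
  have chart': "homeomorphism (sph - {p}) UNIV (k \<circ> \<kappa>1) (\<psi>1 \<circ> k')" using homeomorphism_compose [OF chart k(1)] .
  have k'K: "k' ` of_nat ` {..<N} = K"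
    unfolding k(2) [symmetric] by (simp add: image_image kk)
  have "P = insert p ((\<psi>1 \<circ> k') ` of_nat ` {..<N})"
  proof -
    have "(\<psi>1 \<circ> k') ` of_nat ` {..<N} = \<psi>1 ` K" by (simp only: image_comp [symmetric] k'K)
    also have "\<dots> = (\<lambda>x. x) ` (P - {p})"
      unfolding K_def image_image by (rule image_cong [OF refl]) (use c2 P(1) in blast)
    finally show ?thesis using p(1) by auto
  qed
  then interpret C: sphere_chart P N p "k \<circ> \<kappa>1" "\<psi>1 \<circ> k'"
    using chart' ps by unfold_locales
  let ?T = "\<lambda>s. D.ext (turn (twist_path s))"
  have plane_k': "z \<in> plane N \<longleftrightarrow> k' z \<notin> K" for z using C.plane_iff [of z] \<psi>K by simp
  have hat_f: "C.hat f z = k (?T 1 (k' z))" for z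
  proof (cases "k' z \<in> \<Phi> ` cball 0 1")
    case True
    then obtain w where w: "cmod w \<le> 1" "k' z = \<Phi> w" by auto
    have "turn (twist_path 1) w = disc_half_twist w" by (simp add: turn_def twist_path_def disc_half_twist_def)
    moreover have "f (\<psi>1 (\<Phi> w)) = \<phi> (disc_half_twist w)" using f(2) w by (simp add: \<psi>\<Phi>)
    ultimately show ?thesis using w by (simp add: C.hat_def \<Phi>_def [of "disc_half_twist w"])
  next
    case False
    have "\<psi>1 (k' z) \<notin> \<phi> ` cball 0 1"
    proof
      assume "\<psi>1 (k' z) \<in> \<phi> ` cball 0 1"
      then obtain w where w: "w \<in> cball 0 1" "\<psi>1 (k' z) = \<phi> w" by blast
      then have "k' z = \<Phi> w" using c1(1) [of "k' z"] by (simp add: \<Phi>_def)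
      then show False using w(1) False by blast
    qed
    then show ?thesis using False f(3) c1 by (simp add: C.hat_def)
  qed
  define \<theta> where "\<theta> z = k (?T 0 (k' z))" for z
  define \<theta>' where "\<theta>' z = k (D.ext (turn (\<lambda>r. - twist_path 0 r)) (k' z))" for z
  have tp0: "continuous_on UNIV (twist_path 0)" unfolding twist_path_0 by (rule continuous_twist_angle)
  have "homeomorphism UNIV UNIV (?T 0) (D.ext (turn (\<lambda>r. - twist_path 0 r)))"
    using tp0 turn_uminus [of "twist_path 0"] turn_uminus [of "\<lambda>r. - twist_path 0 r"]
    by (intro D.ext_homeomorphism D.turn_cont continuous_on_minus) (auto simp: D.turn_boundary twist_path_values)
  from homeomorphism_compose [OF homeomorphism_compose [OF homeomorphism_symD [OF k(1)] this] k(1)]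
  have \<theta>: "homeomorphism UNIV UNIV \<theta> \<theta>'"
    by (simp add: \<theta>_def [abs_def] \<theta>'_def [abs_def] o_def)
  have "k' 0 = \<Phi> (1 / 2)" "k' 1 = \<Phi> (- 1 / 2)" using kk(2) k(3,4) by metis+
  then have sw: "\<theta> 0 = 1" "\<theta> 1 = 0"
    unfolding \<theta>_def using D.ext_turn_half [of "twist_path 0"] twist_path_values(1) k(3,4) by simp_all
  have out: "\<theta> z = z" if z: "3 / 4 \<le> cmod (z - mid 0)" for z
  proof -
    have "?T 0 (k' z) = k' z"
    proof (cases "k' z \<in> \<Phi> ` cball 0 1")
      case True
      then obtain w where w: "cmod w \<le> 1" "k' z = \<Phi> w" by auto
      have "\<not> cmod w \<le> 3 / 4"
      proof
        assume "cmod w \<le> 3 / 4"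
        then have "k (k' z) \<in> ball (mid 0) (3 / 4)" using k(5) w by simp
        then show False using z kk by (simp add: dist_norm norm_minus_commute)
      qed
      then have "turn (twist_path 0) w = w" by (simp add: turn_def twist_path_0 twist_angle_def)
      then show ?thesis using w by simp
    qed simp
    then show ?thesis by (simp add: \<theta>_def kk)
  qed
  obtain z where z: "z \<in> letters_below 1" "acts N \<theta> (act N z)"
    using C.supported_swap_acts [OF N \<theta> sw out] by blast
  have "acts N (C.hat f) (act N z)"
  proof (rule acts_homotopic [OF z(2), of "\<lambda>q. k (?T (fst q) (k' (snd q)))"])
    have E: "continuous_on ({0..1} \<times> UNIV) (\<lambda>q. ?T (fst q) (snd q))"
      by (rule D.ext_cont_family [OF D.twist_path_cont]) (auto simp: D.turn_boundary twist_path_values)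
    have "continuous_on ({0..1::real} \<times> plane N) (\<lambda>q. (fst q, k' (snd q)))"
      by (intro continuous_on_Pair continuous_on_fst continuous_on_snd continuous_on_id
          continuous_on_compose2 [OF kcont(2)]) auto
    from continuous_on_compose2 [OF E this]
    have "continuous_on ({0..1::real} \<times> plane N) (\<lambda>q. ?T (fst q) (k' (snd q)))" by force
    then show "continuous_on ({0..1} \<times> plane N) (\<lambda>q. k (?T (fst q) (k' (snd q))))"
      by (rule continuous_on_compose2 [OF kcont(1)]) auto
    show "k (?T (fst (s, y)) (k' (snd (s, y)))) \<in> plane N" if "s \<in> {0..1}" "y \<in> plane N" for s y
    proof -
      have "?T s (k' y) \<notin> K"
      proof
        assume "?T s (k' y) \<in> K"
        from D.ext_turn_puncture [OF KD _ this]
        have "D.ext (turn (\<lambda>r. - twist_path s r)) (?T s (k' y)) \<in> K"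
          by (simp add: twist_path_values)
        moreover have "D.ext (turn (\<lambda>r. - twist_path s r)) (?T s (k' y)) = k' y"
          using turn_uminus [of "\<lambda>r. - twist_path s r"] by (intro D.ext_ext) simp
        ultimately show False using that(2) plane_k' by simp
      qed
      then show ?thesis by (simp add: plane_k' kk)
    qed
  qed (simp_all add: \<theta>_def hat_f)
  then show ?thesis using that [OF C.sphere_chart_axioms f(1) z(1)] by blast
qed

section \<open>Free subgroups of quotients\<close>

lemma word_value_hom:
  assumes h: "group_hom G H h" and w: "fst ` set w \<subseteq> carrier G"
  shows "word_value G w \<in> carrier G \<and> h (word_value G w) = word_value H (map (\<lambda>(x, b). (h x, b)) w)"
  using w
proof (induction w)
  case Nil
  then show ?case using group_hom.hom_one [OF h] by (simp add: word_value_def group.is_monoid group_hom.axioms(1) [OF h] monoid.one_closed)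
next
  case (Cons a w)
  interpret group_hom G H h by (rule h)
  obtain x b where a: "a = (x, b)" by (cases a)
  have x: "x \<in> carrier G" using Cons.prems by (simp add: a)
  have IH: "word_value G w \<in> carrier G" "h (word_value G w) = word_value H (map (\<lambda>(x, b). (h x, b)) w)"
    using Cons by auto
  have "word_value G (a # w) = (if b then x else inv\<^bsub>G\<^esub> x) \<otimes>\<^bsub>G\<^esub> word_value G w"
    by (simp add: word_value_def a)
  moreover have "word_value H (map (\<lambda>(x, b). (h x, b)) (a # w)) =
      (if b then h x else inv\<^bsub>H\<^esub> h x) \<otimes>\<^bsub>H\<^esub> word_value H (map (\<lambda>(x, b). (h x, b)) w)"
    by (simp add: word_value_def a)
  ultimately show ?case using x IH by (cases b) simp_all
qed

text \<open>The hypothesis is about words in the indices 0 and 1. Applied to two short words it also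
  shows that the two elements are distinct and do not commute.\<close>

lemma free_nonabelian_subgroup:
  fixes c :: "nat \<Rightarrow> 'a" and Q (structure)
  assumes Q: "group Q" and ck: "\<And>k. k \<in> {0, 1} \<Longrightarrow> c k \<in> carrier Q"
    and nontrivial: "\<And>w. reduced_word w \<Longrightarrow> w \<noteq> [] \<Longrightarrow> set w \<subseteq> {0, 1} \<times> UNIV \<Longrightarrow>
      word_value Q (map (\<lambda>(k, b). (c k, b)) w) \<noteq> \<one>"
  shows "contains_free_nonabelian_subgroup Q"
proof -
  interpret Q: group Q by (rule Q)
  have c01: "c 0 \<noteq> c 1"
  proof
    assume "c 0 = c 1"
    then have "word_value Q (map (\<lambda>(k, b). (c k, b)) [(0, True), (1, False)]) = \<one>"
      using ck [of 1] by (simp add: word_value_def)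
    then show False using nontrivial [of "[(0, True), (1, False)]"] by (simp add: reduced_word_def)
  qed
  have comm01: "c 0 \<otimes> c 1 \<noteq> c 1 \<otimes> c 0"
  proof
    assume e: "c 0 \<otimes> c 1 = c 1 \<otimes> c 0"
    have c: "c 0 \<in> carrier Q" "c 1 \<in> carrier Q" using ck by auto
    have "word_value Q (map (\<lambda>(k, b). (c k, b)) [(0, True), (1, True), (0, False), (1, False)]) =
        c 0 \<otimes> (c 1 \<otimes> (inv c 0 \<otimes> inv c 1))"
      using c by (simp add: word_value_def)
    also have "\<dots> = (c 0 \<otimes> c 1) \<otimes> inv (c 1 \<otimes> c 0)"
      using c by (simp add: Q.inv_mult_group Q.m_assoc)
    also have "\<dots> = \<one>" unfolding e using c by simp
    finally show False using nontrivial [of "[(0, True), (1, True), (0, False), (1, False)]"] by (simp add: reduced_word_def)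
  qed
  let ?X = "c ` {0, 1}"
  have XQ: "?X \<subseteq> carrier Q" using ck by auto
  define K where "K = generate Q ?X"
  have K: "subgroup K Q" unfolding K_def by (rule Q.generate_is_subgroup [OF XQ])
  have XK: "?X \<subseteq> K" unfolding K_def by (auto intro: generate.incl)
  let ?K = "Q\<lparr>carrier := K\<rparr>"
  interpret K: group ?K by (rule subgroup.subgroup_is_group [OF K Q.group_axioms])
  have incl: "group_hom ?K Q id"
  proof (intro group_hom.intro group_hom_axioms.intro K.group_axioms Q.group_axioms)
    show "id \<in> hom ?K Q" using subgroup.subset [OF K] unfolding hom_def by auto
  qed
  have "freely_generates ?K ?X"
    unfolding freely_generates_def
  proof (intro conjI allI impI)
    show "?X \<subseteq> carrier ?K" using XK by simp
    show "generate ?K ?X = carrier ?K" using Q.generate_consistent [OF XK K] by (simp add: K_def)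
  next
    fix u assume u: "set u \<subseteq> ?X \<times> UNIV \<and> reduced_word u \<and> u \<noteq> []"
    define i where "i y = (if y = c 0 then 0 else 1 :: nat)" for y
    have i: "i y \<in> {0, 1}" "y \<in> ?X \<Longrightarrow> c (i y) = y" for y by (auto simp: i_def)
    let ?w = "map (\<lambda>(y, b). (i y, b)) u"
    have ii: "i y = i z \<longleftrightarrow> y = z" if "y \<in> ?X" "z \<in> ?X" for y z using i(2) that by metis
    have uX: "fst a \<in> ?X" if "a \<in> set u" for a using u that by auto
    have "successively (\<lambda>a a'. \<not> (i (fst a) = i (fst a') \<and> snd a \<noteq> snd a')) u"
    proof (rule successively_mono)
      show "successively (\<lambda>a a'. \<not> (fst a = fst a' \<and> snd a \<noteq> snd a')) u"
        using u by (simp add: reduced_word_def case_prod_unfold)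
      show "\<not> (i (fst a) = i (fst a') \<and> snd a \<noteq> snd a')"
        if "a \<in> set u" "a' \<in> set u" "\<not> (fst a = fst a' \<and> snd a \<noteq> snd a')" for a a'
        unfolding ii [OF uX [OF that(1)] uX [OF that(2)]] by (rule that(3))
    qed
    then have "reduced_word ?w" unfolding reduced_word_def successively_map by (simp add: case_prod_unfold)
    moreover have "set ?w \<subseteq> {0, 1} \<times> UNIV" by (auto simp: i_def)
    moreover have "map (\<lambda>(k, b). (c k, b)) ?w = u"
      using u i(2) by (auto simp: o_def case_prod_unfold intro!: map_idI)
    ultimately have "word_value Q u \<noteq> \<one>" using nontrivial [of ?w] u by simp
    moreover have "word_value ?K u = word_value Q u"
    proof -
      have "fst ` set u \<subseteq> carrier ?K" using u XK by auto
      from word_value_hom [OF incl this] show ?thesis by (simp add: case_prod_unfold)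
    qed
    ultimately show "word_value ?K u \<noteq> \<one>\<^bsub>?K\<^esub>" by simp
  qed
  then have "free_group ?K" using K.group_axioms by (auto simp: free_group_def)
  moreover have "\<not> comm_group ?K"
  proof
    assume "comm_group ?K"
    then have "c 0 \<otimes>\<^bsub>?K\<^esub> c 1 = c 1 \<otimes>\<^bsub>?K\<^esub> c 0"
      using XK by (intro comm_monoid.m_comm comm_group.axioms(1)) auto
    then show False using comm01 by simp
  qed
  ultimately show ?thesis using K by (auto simp: contains_free_nonabelian_subgroup_def)
qed

lemma free_quotient:
  fixes x :: "nat \<Rightarrow> 'a"
  assumes M: "M \<lhd> G" and x: "x 0 \<in> carrier G" "x 1 \<in> carrier G"
    and free: "\<And>w. reduced_word w \<Longrightarrow> w \<noteq> [] \<Longrightarrow> set w \<subseteq> {0, 1} \<times> UNIV \<Longrightarrow>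
      word_value G (map (\<lambda>(k, b). (x k, b)) w) \<notin> M"
  shows "contains_free_nonabelian_subgroup (G Mod M)"
proof -
  interpret M: normal M G by (rule M)
  have Q: "group (G Mod M)" by (rule M.factorgroup_is_group)
  have hom: "group_hom G (G Mod M) (\<lambda>a. M #>\<^bsub>G\<^esub> a)"
    using M.r_coset_hom_Mod by (simp add: group_hom_def group_hom_axioms_def Q M.group_axioms)
  have xk: "x k \<in> carrier G" if "k \<in> {0, 1}" for k using x that by auto
  show ?thesis
  proof (rule free_nonabelian_subgroup [OF Q])
    show "M #>\<^bsub>G\<^esub> x k \<in> carrier (G Mod M)" if "k \<in> {0, 1}" for k
      using group_hom.hom_closed [OF hom xk [OF that]] .
    fix w :: "(nat \<times> bool) list" assume w: "reduced_word w" "w \<noteq> []" "set w \<subseteq> {0, 1} \<times> UNIV"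
    show "word_value (G Mod M) (map (\<lambda>(k, b). (M #>\<^bsub>G\<^esub> x k, b)) w) \<noteq> \<one>\<^bsub>G Mod M\<^esub>"
    proof
      assume 1: "word_value (G Mod M) (map (\<lambda>(k, b). (M #>\<^bsub>G\<^esub> x k, b)) w) = \<one>\<^bsub>G Mod M\<^esub>"
      let ?v = "map (\<lambda>(k, b). (x k, b)) w"
      have "fst ` set ?v \<subseteq> carrier G" using w(3) xk by auto
      from word_value_hom [OF hom this]
      have v: "word_value G ?v \<in> carrier G"
        "M #>\<^bsub>G\<^esub> word_value G ?v = word_value (G Mod M) (map (\<lambda>(k, b). (M #>\<^bsub>G\<^esub> x k, b)) w)"
        by (auto simp: o_def case_prod_unfold)
      then have "M #>\<^bsub>G\<^esub> word_value G ?v = M" using 1 by (simp add: FactGroup_def)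
      then have "word_value G ?v \<in> M" using M.coset_join1 v(1) M.subgroup_axioms by blast
      then show False using free [OF w] by simp
    qed
  qed
qed

section \<open>Braid words coding mapping classes\<close>

lemma flip_word_letters: "z \<in> letters_below k \<Longrightarrow> flip_word z \<in> letters_below k"
  by (induction rule: letters_below_induct) (simp_all add: letters_below_intros)

context sphere_chart
begin

abbreviation M where "M \<equiv> mapping_class_group P"

lemma marked_inj:
  assumes "f \<in> marked_homeos P" "x \<in> sph" "y \<in> sph" "f x = f y" shows "x = y"
proof -
  obtain g where "homeomorphism sph sph f g" using assms(1) marked_homeosD(1) homeomorphic_mapE by blast
  then show ?thesis using assms(2-4) unfolding homeomorphism_def by metis
qed

lemma marked_not_P:
  assumes f: "f \<in> marked_homeos P" and z: "z \<in> plane N" shows "f (\<psi> z) \<in> sph - P"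
proof -
  have "f (\<psi> z) \<in> sph" using marked_homeosD(2) [OF f] by (auto simp: continuous_map_S2)
  moreover have "f (\<psi> z) \<notin> P"
  proof
    assume "f (\<psi> z) \<in> P"
    then obtain y where "y \<in> P" "f y = f (\<psi> z)" using marked_homeosD(4) [OF f] by (metis imageE)
    then show False using marked_inj [OF f] P_sph z plane_iff by (metis chart_simps(3) subsetD)
  qed
  ultimately show ?thesis by blast
qed

lemma marked_plane_map:
  assumes "f \<in> marked_homeos P" shows "plane_map N (hat f)"
proof -
  obtain g where g: "homeomorphism sph sph f g" using assms marked_homeosD(1) homeomorphic_mapE by blast
  obtain \<pi> where "\<forall>j\<le>N. \<pi> j \<le> N \<and> f (pt_at j) = pt_at (\<pi> j)" using label_exists marked_homeosD(4) [OF assms] by blast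
  then have "end_map N (hat f) \<pi>" using marked_homeosD(4) [OF assms] by (intro hat_end_map [OF g]) auto
  then show ?thesis by (simp add: end_map_def)
qed

lemma hat_comp:
  assumes "g \<in> marked_homeos P" "z \<in> plane N" shows "hat (f \<circ> g) z = hat f (hat g z)"
  using marked_not_P [OF assms] by (simp add: hat_def P)

lemma acts_hat_comp:
  assumes "g \<in> marked_homeos P" "acts N (hat f) h" "acts N (hat g) k"
  shows "acts N (hat (f \<circ> g)) (h \<circ> k)"
  using acts_comp [OF assms(2,3) marked_plane_map [OF assms(1)]]
  by (rule acts_cong) (simp add: hat_comp [OF assms(1)])

text \<open>\<open>g\<close> acts by some \<open>k0\<close>, and \<open>h \<circ> k0\<close> is
  inner by uniqueness. Applying \<open>k\<close> identifies \<open>k0\<close> with \<open>k\<close>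
  up to conjugation.\<close>

lemma acts_hat_inverse:
  assumes f: "f \<in> marked_homeos P" and g: "g \<in> marked_homeos P" and gf: "\<And>x. x \<in> sph \<Longrightarrow> g (f x) = x"
    and h: "acts N (hat f) h" and k: "additive_map k" "\<And>x. k (h x) = x"
  shows "acts N (hat g) k"
proof -
  obtain k0 where k0: "acts N (hat g) k0" using acts_exists [OF marked_plane_map [OF g]] .
  have fg: "f (g x) = x" if "x \<in> sph" for x
  proof -
    have "g x \<in> sph" using marked_homeosD(2) [OF g] that by (auto simp: continuous_map_S2)
    then have "f (g x) \<in> sph" using marked_homeosD(2) [OF f] by (auto simp: continuous_map_S2)
    then show ?thesis using marked_inj [OF g _ that] gf [OF \<open>g x \<in> sph\<close>] by blast
  qed
  have "acts N (hat (f \<circ> g)) id" by (rule acts_cong [OF acts_id]) (simp add: hat_def fg)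
  then obtain a where a: "\<And>j. j \<le> N \<Longrightarrow> (h \<circ> k0) (ul j) = a + id (ul j) - a"
    using acts_unique acts_hat_comp [OF g h k0] by metis
  have "k (ul j) = - k a + k0 (ul j) - - k a" if "j \<le> N" for j
  proof -
    have "k (h (k0 (ul j))) = k (a + ul j - a)" using a [OF that] by simp
    then have "k0 (ul j) = k a + k (ul j) - k a" by (simp add: k(2) additive_mapD [OF k(1)])
    then show ?thesis by (simp add: grp_norm del: add_uminus_conv_diff)
  qed
  then show ?thesis by (rule acts_conj [OF k0 k(1)])
qed

text \<open>A relation and not a function: a class may have many words, and
  \<open>codes_unique\<close> describes the ambiguity.\<close>

definition codes :: "(point \<Rightarrow> point) set \<Rightarrow> fgroup \<Rightarrow> bool" where
  "codes A z \<longleftrightarrow> z \<in> letters_below N \<and>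
     (\<exists>f\<in>marked_homeos P. A = mapping_class P f \<and> acts N (hat f) (act N z))"

lemma codesI: "f \<in> marked_homeos P \<Longrightarrow> acts N (hat f) (act N z) \<Longrightarrow> z \<in> letters_below N \<Longrightarrow> codes (mapping_class P f) z"
  by (auto simp: codes_def)

lemma codes_carrier: "codes A z \<Longrightarrow> A \<in> carrier M"
  by (auto simp: codes_def mapping_class_group_def)

lemma codes_letters: "codes A z \<Longrightarrow> z \<in> letters_below N" by (simp add: codes_def)

lemma act_comp: "act N a \<circ> act N b = act N (a + b)" by (rule ext) simp

lemma codes_mult:
  assumes "codes A a" "codes B b" shows "codes (A \<otimes>\<^bsub>M\<^esub> B) (a + b)"
proof -
  obtain f g where f: "f \<in> marked_homeos P" "A = mapping_class P f" "acts N (hat f) (act N a)"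
    and g: "g \<in> marked_homeos P" "B = mapping_class P g" "acts N (hat g) (act N b)"
    using assms unfolding codes_def by blast
  have "acts N (hat (f \<circ> g)) (act N (a + b))" using acts_hat_comp [OF g(1) f(3) g(3)] by (simp add: act_comp)
  moreover have "A \<otimes>\<^bsub>M\<^esub> B = mapping_class P (f \<circ> g)" using f g mapping_class_mult by simp
  ultimately show ?thesis
    using assms comp_marked_homeos [OF f(1) g(1)] unfolding codes_def by (auto intro: letters_below_intros)
qed

lemma codes_one: "codes \<one>\<^bsub>M\<^esub> 0"
proof -
  have "hat id = id" "act N 0 = id" by (simp_all add: hat_def fun_eq_iff)
  then have "acts N (hat id) (act N 0)" using acts_id by simp
  then show ?thesis unfolding codes_def
    by (auto simp: letters_below_intros mapping_class_group_def intro!: bexI [of _ id])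
qed

lemma inverse_class:
  assumes f: "f \<in> marked_homeos P"
  obtains g where "g \<in> marked_homeos P" "\<forall>x\<in>sph. g (f x) = x" "inv\<^bsub>M\<^esub> (mapping_class P f) = mapping_class P g"
proof -
  interpret M: group M by (rule group_mapping_class_group [OF P_sph])
  obtain g where g: "g \<in> marked_homeos P" "\<And>x. x \<in> sph \<Longrightarrow> g (f x) = x"
    using inverse_marked_homeos [OF P_sph f] by blast
  have "isotopic_rel P (g \<circ> f) id"
    using g comp_marked_homeos [OF g(1) f] by (intro isotopic_rel_cong [OF P_sph]) auto
  then have "mapping_class P g \<otimes>\<^bsub>M\<^esub> mapping_class P f = \<one>\<^bsub>M\<^esub>"
    using mapping_class_mult [OF g(1) f] mapping_class_eqI by (simp add: mapping_class_group_def)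
  then have "inv\<^bsub>M\<^esub> (mapping_class P f) = mapping_class P g"
    by (rule M.inv_equality) (use f g(1) in \<open>auto simp: mapping_class_group_def\<close>)
  then show ?thesis using that g by blast
qed

lemma codes_inv:
  assumes "codes A a" shows "codes (inv\<^bsub>M\<^esub> A) (- a)"
proof -
  obtain f where f: "f \<in> marked_homeos P" "A = mapping_class P f" "acts N (hat f) (act N a)"
    using assms unfolding codes_def by blast
  obtain g where g: "g \<in> marked_homeos P" "\<forall>x\<in>sph. g (f x) = x" "inv\<^bsub>M\<^esub> A = mapping_class P g"
    unfolding f(2) by (rule inverse_class [OF f(1)])
  have "acts N (hat g) (act N (- a))" using g(2) by (intro acts_hat_inverse [OF f(1) g(1) _ f(3)]) auto
  then show ?thesis using assms g unfolding codes_def by (auto intro: letters_below_intros)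
qed

lemma codes_pow: "codes A a \<Longrightarrow> codes (A [^]\<^bsub>M\<^esub> (k :: nat)) (npow k a)"
proof (induction k)
  case 0
  then show ?case using codes_one by (simp add: npow_simps)
next
  case (Suc k)
  have "codes (A [^]\<^bsub>M\<^esub> k \<otimes>\<^bsub>M\<^esub> A) (npow k a + a)" using Suc by (intro codes_mult) auto
  then show ?case by (simp add: npow_simps npow_commute)
qed

lemma codes_word:
  assumes "\<And>k. k \<in> {0, 1} \<Longrightarrow> codes (x k) (z k)" "set w \<subseteq> {0, 1} \<times> UNIV"
  shows "codes (word_value M (map (\<lambda>(k, b). (x k, b)) w)) (wval z w)"
  using assms(2)
proof (induction w)
  case Nil
  then show ?case using codes_one by (simp add: word_value_def)
next
  case (Cons a w)
  obtain k b where a: "a = (k, b)" by (cases a)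
  have "codes (if b then x k else inv\<^bsub>M\<^esub> x k) (letter z a)"
    using Cons.prems assms(1) codes_inv by (auto simp: a)
  from codes_mult [OF this] Cons show ?case by (simp add: word_value_def a)
qed

lemma marked_acts_braid:
  assumes f: "f \<in> marked_homeos P" and N: "0 < N"
  shows "\<exists>v\<in>letters_below N. acts N (hat f) (act N v) \<or> acts N (hat f) (act N v \<circ> mirror N)"
proof -
  obtain g where g: "homeomorphism sph sph f g" using f marked_homeosD(1) homeomorphic_mapE by blast
  show ?thesis
  proof (rule hat_braid [OF g marked_homeosD(4) [OF f] N])
    fix \<pi> \<rho> assume 1: "end_map N (hat f) \<pi>" "end_map N (hat g) \<rho>"
      and 2: "\<And>z. z \<in> plane N \<Longrightarrow> hat f (hat g z) = z" and 3: "\<And>i. i \<le> N \<Longrightarrow> \<pi> (\<rho> i) = i"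
    show ?thesis using 1 2 3 N by (rule acts_braid)
  qed
qed

text \<open>The conjugating map acts by a braid word \<open>v\<close>, possibly composed with
  \<open>mirror\<close>. In the second case the mirrors on both sides of \<open>b\<close> combine to
  \<open>flip_word b\<close> by \<open>mirror_act\<close>.\<close>

lemma codes_conj:
  assumes A: "A \<in> carrier M" and B: "codes B b" and N: "0 < N"
  shows "\<exists>v\<in>letters_below N. codes (A \<otimes>\<^bsub>M\<^esub> B \<otimes>\<^bsub>M\<^esub> inv\<^bsub>M\<^esub> A) (v + b - v) \<or>
    codes (A \<otimes>\<^bsub>M\<^esub> B \<otimes>\<^bsub>M\<^esub> inv\<^bsub>M\<^esub> A) (v + flip_word b - v)"
proof -
  obtain f where f: "f \<in> marked_homeos P" "A = mapping_class P f" using A by (auto simp: mapping_class_group_def)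
  obtain e where e: "e \<in> marked_homeos P" "B = mapping_class P e" "acts N (hat e) (act N b)"
    using B unfolding codes_def by blast
  obtain g where g: "g \<in> marked_homeos P" "\<forall>x\<in>sph. g (f x) = x" "inv\<^bsub>M\<^esub> A = mapping_class P g"
    unfolding f(2) by (rule inverse_class [OF f(1)])
  have gf: "g (f x) = x" if "x \<in> sph" for x using g(2) that by blast
  have b: "b \<in> letters_below N" using codes_letters [OF B] .
  have cls: "A \<otimes>\<^bsub>M\<^esub> B \<otimes>\<^bsub>M\<^esub> inv\<^bsub>M\<^esub> A = mapping_class P ((f \<circ> e) \<circ> g)"
    unfolding g(3) unfolding f(2) e(2) by (simp only: mapping_class_mult comp_marked_homeos f(1) e(1) g(1))
  have mem: "(f \<circ> e) \<circ> g \<in> marked_homeos P" by (intro comp_marked_homeos f(1) e(1) g(1))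
  have comp: "acts N (hat ((f \<circ> e) \<circ> g)) ((h \<circ> act N b) \<circ> k)"
    if "acts N (hat f) h" "acts N (hat g) k" for h k
    by (intro acts_hat_comp g(1) e that)
  note marked_acts_braid [OF f(1) N]
  then obtain v where v: "v \<in> letters_below N" and
    "acts N (hat f) (act N v) \<or> acts N (hat f) (act N v \<circ> mirror N)" by blast
  then consider "acts N (hat f) (act N v)" | "acts N (hat f) (act N v \<circ> mirror N)" by blast
  then show ?thesis
  proof cases
    case 1
    have "acts N (hat g) (act N (- v))" by (rule acts_hat_inverse [OF f(1) g(1) gf 1]) auto
    from comp [OF 1 this] have "acts N (hat ((f \<circ> e) \<circ> g)) (act N (v + b - v))"
      by (simp only: act_comp diff_conv_add_uminus)
    from codesI [OF mem this letters_below_intros(5) [OF letters_below_intros(3) [OF v b] v]]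
    have "codes (A \<otimes>\<^bsub>M\<^esub> B \<otimes>\<^bsub>M\<^esub> inv\<^bsub>M\<^esub> A) (v + b - v)" unfolding cls .
    then show ?thesis using v by blast
  next
    case 2
    have "acts N (hat g) (mirror N \<circ> act N (- v))"
      by (rule acts_hat_inverse [OF f(1) g(1) gf 2]) (auto intro: additive_map_comp)
    from comp [OF 2 this]
    have "acts N (hat ((f \<circ> e) \<circ> g)) ((act N v \<circ> mirror N \<circ> act N b) \<circ> (mirror N \<circ> act N (- v)))" .
    also have "(act N v \<circ> mirror N \<circ> act N b) \<circ> (mirror N \<circ> act N (- v)) = act N (v + flip_word b - v)"
      by (rule ext) (simp add: mirror_act)
    finally have "acts N (hat ((f \<circ> e) \<circ> g)) (act N (v + flip_word b - v))" .
    from codesI [OF mem this letters_below_intros(5) [OF letters_below_intros(3) [OF v flip_word_letters [OF b]] v]]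
    have "codes (A \<otimes>\<^bsub>M\<^esub> B \<otimes>\<^bsub>M\<^esub> inv\<^bsub>M\<^esub> A) (v + flip_word b - v)" unfolding cls .
    then show ?thesis using v by blast
  qed
qed

text \<open>Two representatives of a class are isotopic, so what one of them induces is also induced
  by the other, and the induced homomorphism is unique up to conjugation.\<close>

lemma codes_unique:
  assumes "codes A a" "codes A b" shows "acts_inner N (a - b)"
proof -
  obtain f g where f: "f \<in> marked_homeos P" "A = mapping_class P f" "acts N (hat f) (act N a)"
    and g: "g \<in> marked_homeos P" "A = mapping_class P g" "acts N (hat g) (act N b)"
    using assms unfolding codes_def by blast
  have "f \<in> mapping_class P g" using f(2) g(2) mapping_class_self [OF f(1)] by simp
  then have "isotopic_rel P g f" by (simp add: mapping_class_def)
  then have "acts N (hat f) (act N b)" by (rule hat_isotopic [OF marked_homeosD(4) [OF g(1)] _ g(3)])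
  then obtain c where c: "\<And>j. j \<le> N \<Longrightarrow> act N a (ul j) = c + act N b (ul j) - c"
    using acts_unique f(3) by metis
  have "act N a x = c + act N b x - c" if "x \<in> letters_below N" for x
  proof (rule letters_below_cong [OF additive_map_act additive_map_conj [OF additive_map_act] _ that])
    show "act N a (gen j) = c + act N b (gen j) - c" if "j < N" for j
      using c [of j] c [of "Suc j"] that
      by (simp add: gen_eq_u act_hom grp_norm del: add_uminus_conv_diff ul.simps)
  qed
  then have "act N (a - b) x = c + x - c" if "x \<in> letters_below N" for x
    using act_letters [OF that, of "- b"] by simp
  then show ?thesis unfolding acts_inner_def by blast
qed

text \<open>The closure of \<open>R\<close> under \<open>flip_word\<close> answers the second
  alternative of \<open>codes_conj\<close>.\<close>

lemma coded_normal:
  assumes N: "0 < N" and R: "0 \<in> R" "\<And>a b. a \<in> R \<Longrightarrow> b \<in> R \<Longrightarrow> a + b \<in> R" "\<And>a. a \<in> R \<Longrightarrow> - a \<in> R"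
    "\<And>a v. a \<in> R \<Longrightarrow> v \<in> letters_below N \<Longrightarrow> v + a - v \<in> R" "\<And>a. a \<in> R \<Longrightarrow> flip_word a \<in> R"
  shows "{A. \<exists>w\<in>R. codes A w} \<lhd> M"
proof -
  interpret M: group M by (rule group_mapping_class_group [OF P_sph])
  let ?S = "{A. \<exists>w\<in>R. codes A w}"
  show ?thesis
    unfolding M.normal_inv_iff
  proof (intro conjI ballI M.subgroupI)
    show "?S \<subseteq> carrier M" using codes_carrier by auto
    show "?S \<noteq> {}" using codes_one R(1) by auto
  next
    fix A assume "A \<in> ?S"
    then obtain a where a: "a \<in> R" "codes A a" by auto
    show "inv\<^bsub>M\<^esub> A \<in> ?S" using R(3) [OF a(1)] codes_inv [OF a(2)] by auto
    fix B assume "B \<in> ?S"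
    then obtain b where b: "b \<in> R" "codes B b" by auto
    show "A \<otimes>\<^bsub>M\<^esub> B \<in> ?S" using R(2) [OF a(1) b(1)] codes_mult [OF a(2) b(2)] by auto
  next
    fix A B assume A: "A \<in> carrier M" and "B \<in> ?S"
    then obtain b where b: "b \<in> R" "codes B b" by auto
    from codes_conj [OF A b(2) N] obtain v where v: "v \<in> letters_below N" and
      "codes (A \<otimes>\<^bsub>M\<^esub> B \<otimes>\<^bsub>M\<^esub> inv\<^bsub>M\<^esub> A) (v + b - v) \<or>
       codes (A \<otimes>\<^bsub>M\<^esub> B \<otimes>\<^bsub>M\<^esub> inv\<^bsub>M\<^esub> A) (v + flip_word b - v)" by auto
    moreover have "v + b - v \<in> R" "v + flip_word b - v \<in> R" using R(4) [OF _ v] R(5) b(1) by simp_all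
    ultimately show "A \<otimes>\<^bsub>M\<^esub> B \<otimes>\<^bsub>M\<^esub> inv\<^bsub>M\<^esub> A \<in> ?S" by auto
  qed
qed

end

lemma letters_below_1_power:
  assumes "z \<in> letters_below 1"
  shows "\<exists>j. z = npow j (gen 0) \<or> z = npow j (- gen 0)"
  using assms
proof (induction rule: letters_below_induct)
  case zero
  then show ?case using npow_simps(1) by metis
next
  case (gen i z)
  then have i: "i = 0" by simp
  from gen.IH obtain j where "z = npow j (gen 0) \<or> z = npow j (- gen 0)" by blast
  then show ?case
  proof
    assume "z = npow j (gen 0)" then show ?thesis using i npow_simps(2) by metis
  next
    assume z: "z = npow j (- gen 0)"
    show ?thesis
    proof (cases j)
      case 0 then show ?thesis using z i by (intro exI [of _ 1]) (simp add: npow_simps)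
    next
      case (Suc k) then show ?thesis using z i by (intro exI [of _ k]) (simp add: npow_simps)
    qed
  qed
next
  case (minus_gen i z)
  then have i: "i = 0" by simp
  from minus_gen.IH obtain j where "z = npow j (gen 0) \<or> z = npow j (- gen 0)" by blast
  then show ?case
  proof
    assume "z = npow j (- gen 0)" then show ?thesis using i npow_simps(2) by metis
  next
    assume z: "z = npow j (gen 0)"
    show ?thesis
    proof (cases j)
      case 0 then show ?thesis using z i by (intro exI [of _ 1]) (simp add: npow_simps)
    next
      case (Suc k) then show ?thesis using z i by (intro exI [of _ k]) (simp add: npow_simps)
    qed
  qed
qed

lemma npow_zero [simp]: "npow k 0 = 0"
  by (induction k) (simp_all add: npow_simps)

lemma npow_add: "npow (j + k) a = npow j a + npow k a"
  by (induction j) (simp_all add: npow_simps add.assoc)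

lemma npow_npow: "npow j (npow k a) = npow (j * k) a"
  by (induction j) (simp_all add: npow_simps npow_add)

context spin_chain_hyperbolic
begin

lemma rep_letters_below_1:
  assumes "z \<in> letters_below 1"
  shows "rep (npow m z) = 0" "rep (flip_word (npow m z)) = 0"
proof -
  have plus: "rep (npow m (npow j (gen 0))) = 0" for j
  proof -
    have "npow m (npow j (gen 0)) = npow j (npow m (gen 0))" by (simp add: npow_npow mult.commute)
    then have "rep (npow m (npow j (gen 0))) = npow j (rep (npow m (gen 0)))"
      by (simp only: additive_map_npow [OF additive_map_ev])
    then show ?thesis by (simp only: rep_gen_power npow_zero)
  qed
  have "npow m (npow j (- gen 0)) = - npow m (npow j (gen 0))" for j by (simp add: npow_npow uminus_npow)
  then have minus: "rep (npow m (npow j (- gen 0))) = 0" for j using plus by (simp add: ev_hom)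
  have fl: "flip_word (npow m x) = npow m (flip_word x)" for m x
    unfolding flip_word_def by (simp add: additive_map_npow)
  obtain j where "z = npow j (gen 0) \<or> z = npow j (- gen 0)" using letters_below_1_power [OF assms] by blast
  then show "rep (npow m z) = 0" "rep (flip_word (npow m z)) = 0" using plus minus by (auto simp: fl)
qed

end

theorem theoremB:
  fixes n m :: nat and P :: "point set" and H :: "(point \<Rightarrow> point) set"
  assumes "n \<ge> 6" and "even n"
    and "m > 0"
    and "even m \<Longrightarrow> m \<notin> {2, 4, 6, 10}"
    and "odd m \<Longrightarrow> m \<notin> {1, 3, 5}"
    and "P \<subseteq> topspace S2" and "finite P" and "card P = n"
    and "H \<in> carrier (mapping_class_group P)" and "half_twist P H"
  shows "contains_free_nonabelian_subgroup
           (mapping_class_group P Mod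
              normal_closure (mapping_class_group P) {H [^]\<^bsub>mapping_class_group P\<^esub> m})"
proof -
  \<comment> \<open>One marked point goes to infinity, so the free group has rank
    \<open>n - 1\<close>; the chain has one site for each marked point, and \<open>n = 2 * h\<close>
    lets the cups pair them all.\<close>
  define N where "N = n - 1"
  define h where "h = n div 2"
  have Nh: "Suc N = 2 * h" "2 \<le> h" "1 < h" and N: "5 \<le> N" "card P = Suc N"
    using assms(1,2,8) by (auto simp: N_def h_def)
  have m: "7 \<le> m"
  proof (rule ccontr)
    assume "\<not> 7 \<le> m"
    then have "m = 1 \<or> m = 2 \<or> m = 3 \<or> m = 4 \<or> m = 5 \<or> m = 6" using assms(3) by linarith
    then show False using assms(4,5) by auto
  qed
  interpret spin_chain_hyperbolic m "- cis (2 * pi / m)" by unfold_locales (use m in auto)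
  have N2: "2 < N" using N(1) by simp
  obtain p \<kappa> \<psi> f z where chart: "sphere_chart P N p \<kappa> \<psi>" and f: "f \<in> H" and z: "z \<in> letters_below 1"
    and fz: "acts N (sphere_chart.hat \<kappa> \<psi> f) (act N z)"
    by (rule half_twist_chart [OF assms(10,6,7) N(2) N2])
  interpret sphere_chart P N p \<kappa> \<psi> by (rule chart)
  interpret M: group M by (rule group_mapping_class_group [OF assms(6)])
  obtain f0 where f0: "f0 \<in> marked_homeos P" "H = mapping_class P f0"
    using assms(9) by (auto simp: mapping_class_group_def)
  have fm: "f \<in> marked_homeos P" and "isotopic_rel P f0 f" using f f0(2) by (auto simp: mapping_class_def)
  then have Hf: "H = mapping_class P f" using f0(2) mapping_class_eqI by simp
  have "z \<in> letters_below N" by (rule letters_below_mono [OF z]) (use N2 in simp)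
  then have H: "codes H z" unfolding Hf by (rule codesI [OF fm fz])
  \<comment> \<open>Words that act trivially on the spin chain together with their mirror images.
    They code a normal subgroup that contains the \<open>m\<close>-th power of
    \<open>H\<close>.\<close>
  define R where "R = {w \<in> letters_below N. rep w = 0 \<and> rep (flip_word w) = 0}"
  have nR: "{A. \<exists>w\<in>R. codes A w} \<lhd> M"
    by (rule coded_normal) (use N2 in \<open>auto simp: R_def ev_hom flip_word_letters letters_below_intros\<close>)
  have zR: "npow m z \<in> R"
    using codes_letters [OF codes_pow [OF H, of m]] rep_letters_below_1 [OF z] by (simp add: R_def)
  have HR: "H [^]\<^bsub>M\<^esub> m \<in> {A. \<exists>w\<in>R. codes A w}" using bexI [of "codes _", OF codes_pow [OF H] zR] by simp
  have closure: "normal_closure M {H [^]\<^bsub>M\<^esub> m} \<subseteq> {A. \<exists>w\<in>R. codes A w}"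
    unfolding normal_closure_def using nR HR by (intro Inter_lower) simp
  define A where "A = mapping_class P (lift (twist 0 1))"
  define B where "B = mapping_class P (lift (twist 1 1))"
  have i: "Suc 0 < N" "Suc 1 < N" using N2 by auto
  have A: "codes A (- gen 0)" and B: "codes B (- gen 1)"
    unfolding A_def B_def using N2
    by (intro codesI twist_marked i letters_below_intros; simp)+
  have A': "codes (inv\<^bsub>M\<^esub> A) (gen 0)" using codes_inv [OF A] by simp
  obtain K where K: "\<And>w s. reduced_word w \<Longrightarrow> w \<noteq> [] \<Longrightarrow> set w \<subseteq> {0, 1} \<times> UNIV \<Longrightarrow>
    app (rep (wval (free_gens K) w)) (cup h) \<noteq> (\<lambda>a. s * cup h a)"
    using free_gens_not_scalar [OF Nh(3)] by blast
  \<comment> \<open>\<open>A\<close> codes \<open>- gen 0\<close> and \<open>B\<close> codes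
    \<open>- gen 1\<close>, so the two products code \<open>gen 0 - gen 1\<close> and
    \<open>- gen 1 + gen 0\<close>, the hyperbolic elements behind \<open>free_gens\<close>.\<close>
  define x where "x k = (if k = 0 then (inv\<^bsub>M\<^esub> A \<otimes>\<^bsub>M\<^esub> B) [^]\<^bsub>M\<^esub> K else (B \<otimes>\<^bsub>M\<^esub> inv\<^bsub>M\<^esub> A) [^]\<^bsub>M\<^esub> K)" for k :: nat
  have x: "codes (x k) (free_gens K k)" for k
    using codes_pow [OF codes_mult [OF A' B], of K] codes_pow [OF codes_mult [OF B A'], of K]
    by (simp add: x_def free_gens_def)
  show ?thesis
  proof (rule free_quotient)
    show "normal_closure M {H [^]\<^bsub>M\<^esub> m} \<lhd> M"
      using assms(9) by (intro normal_closure_normal M.group_axioms) auto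
    show "x 0 \<in> carrier M" "x 1 \<in> carrier M" using codes_carrier [OF x] by auto
  next
    fix w :: "(nat \<times> bool) list" assume w: "reduced_word w" "w \<noteq> []" "set w \<subseteq> {0, 1} \<times> UNIV"
    have c: "codes (word_value M (map (\<lambda>(k, b). (x k, b)) w)) (wval (free_gens K) w)"
      by (rule codes_word [OF x w(3)])
    show "word_value M (map (\<lambda>(k, b). (x k, b)) w) \<notin> normal_closure M {H [^]\<^bsub>M\<^esub> m}"
    proof
      assume "word_value M (map (\<lambda>(k, b). (x k, b)) w) \<in> normal_closure M {H [^]\<^bsub>M\<^esub> m}"
      then obtain r where r: "r \<in> R" "codes (word_value M (map (\<lambda>(k, b). (x k, b)) w)) r"
        using subsetD [OF closure] by auto
      \<comment> \<open>Both words code the same class, so their difference acts by an inner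
        automorphism and multiplies \<open>cup h\<close> by a scalar. As \<open>r\<close> acts
        trivially on the chain, the same holds for the free word, against the choice of
        \<open>K\<close>.\<close>
      have "wval (free_gens K) w - r \<in> letters_below N"
        using codes_letters [OF c] codes_letters [OF r(2)] by (rule letters_below_intros)
      from inner_imp_scalar [OF this codes_unique [OF c r(2)] Nh(1,2)]
      obtain s where "app (rep (wval (free_gens K) w - r)) (cup h) = (\<lambda>a. s * cup h a)" by (elim exE conjE)
      then show False using K [OF w, of s] r(1) by (simp add: R_def ev_hom)
    qed
  qed
qed

end
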